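(* Let $X$ and $X'$ be definable sets and let $f\colon X\to X'$ be a definable homotopy equivalence. Let $\mathcal B'=(B',X',p,F)$ be a definable fibre bundle with base $X'$ and locally definably compact fibre $F$. Then the induced bundle $f^{-1}(\mathcal B')$ is homotopy equivalent to $\mathcal B'$ as definable fibre bundles.
   Context: Fix an o-minimal expansion $\mathcal M$ of a real closed field $R$; "definable" means definable in $\mathcal M$ with parameters, with order/product/subspace topologies. A definable map is a continuous definable function; $I=[0,1]$. A definable homotopy equivalence $f\colon X\to X'$ is a definable map for which there is a definable map $g\colon X'\to X$ with $g\circ f$ and $f\circ g$ definably homotopic (via definable maps on $(\cdot)\times I$) to the identities. $F$ is locally definably compact if each point has a definably compact definable neighbourhood in $F$. A definable fibre bundle $(B,X,p,F)$ consists of definable sets $B,X,F$ and a surjective definable map $p\colon B\to X$ such that there is a finite covering of $X$ by open definable sets $U_i$ with definable homeomorphisms $\phi_i\colon U_i\times F\to p^{-1}(U_i)$. A definable bundle map $u\colon(B,X,p,F)\to(B_1,X_1,p_1,F)$ is a definable map $u\colon B\to B_1$ for which there is a definable map $\bar u\colon X\to X_1$ with $p_1\circ u=\bar u\circ p$ and with $u|_{p^{-1}(x)}$ a homeomorphism onto $p_1^{-1}(\bar u(x))$ for every $x$. A homotopy of definable bundle maps is a definable map $h\colon B\times I\to B_1$ with every $h(-,t)$ a definable bundle map. Two definable fibre bundles $\mathcal B,\mathcal B_1$ are homotopy equivalent if there are definable bundle maps $u\colon\mathcal B\to\mathcal B_1$, $v\colon\mathcal B_1\to\mathcal B$ such that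 $u\circ v$ and $v\circ u$ are each connected to the identity by a homotopy of definable bundle maps. For a definable map $f\colon X\to X'$, the induced bundle $f^{-1}(\mathcal B')$ is $(A,X,q,F)$ with $A=\{(b,x)\in B'\times X: p(b)=f(x)\}$ and $q(b,x)=x$.
   Formalization: The local trivialisations φ_i of a definable fibre bundle are required to satisfy p(φ_i(x,y)) = x; without this the claim fails, e.g. for p(x,y)=xy on R² with base and fibre R and f the inclusion of the point 0. *)

theory Defs
  imports "HOL-Analysis.Analysis"
begin

text \<open>
  The order topology is part of the class, so that \<open>euclidean :: 'a topology\<close> is the order
  topology on the field.
\<close>

class real_closed_field = linordered_field + linorder_topology +
  assumes nonneg_has_sqrt: "0 \<le> x \<Longrightarrow> \<exists>y. y * y = x"
    and odd_degree_has_root: "odd n \<Longrightarrow> c n \<noteq> 0 \<Longrightarrow> \<exists>x. (\<Sum>i\<le>n. c i * x ^ i) = 0"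

section \<open>Expansions of a real closed field and definable sets\<close>

text \<open>
  First-order formulas (de Bruijn indices, parameters from the field) over the language of ordered
  rings extended by function symbols \<open>'f\<close> and relation symbols \<open>'r\<close>. A symbol applied to argument
  lists of different lengths plays the role of one symbol for each arity.
\<close>

datatype ('f, 'a) fo_term =
    Var nat
  | Param 'a
  | Plus "('f, 'a) fo_term" "('f, 'a) fo_term"
  | Times "('f, 'a) fo_term" "('f, 'a) fo_term"
  | Fun 'f "('f, 'a) fo_term list"

datatype ('f, 'r, 'a) fo_formula =
    Equal "('f, 'a) fo_term" "('f, 'a) fo_term"
  | Less "('f, 'a) fo_term" "('f, 'a) fo_term"
  | Rel 'r "('f, 'a) fo_term list"
  | Neg "('f, 'r, 'a) fo_formula"
  | Conj "('f, 'r, 'a) fo_formula" "('f, 'r, 'a) fo_formula"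
  | Exist "('f, 'r, 'a) fo_formula"

text \<open>
  The field operations and the order are interpreted by those of \<open>'a\<close>; an expansion only has to
  interpret the additional symbols.
\<close>

record ('f, 'r, 'a) expansion =
  fun_interp :: "'f \<Rightarrow> 'a list \<Rightarrow> 'a"
  rel_interp :: "'r \<Rightarrow> 'a list \<Rightarrow> bool"

primrec fo_eval ::
    "('f, 'r, 'a::linordered_field) expansion \<Rightarrow> (nat \<Rightarrow> 'a) \<Rightarrow> ('f, 'a) fo_term \<Rightarrow> 'a" where
  "fo_eval M e (Var i) = e i"
| "fo_eval M e (Param a) = a"
| "fo_eval M e (Plus s t) = fo_eval M e s + fo_eval M e t"
| "fo_eval M e (Times s t) = fo_eval M e s * fo_eval M e t"
| "fo_eval M e (Fun k ts) = fun_interp M k (map (fo_eval M e) ts)"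

primrec fo_sat ::
    "('f, 'r, 'a::linordered_field) expansion \<Rightarrow> (nat \<Rightarrow> 'a) \<Rightarrow> ('f, 'r, 'a) fo_formula \<Rightarrow> bool"
where
  "fo_sat M e (Equal s t) \<longleftrightarrow> fo_eval M e s = fo_eval M e t"
| "fo_sat M e (Less s t) \<longleftrightarrow> fo_eval M e s < fo_eval M e t"
| "fo_sat M e (Rel k ts) \<longleftrightarrow> rel_interp M k (map (fo_eval M e) ts)"
| "fo_sat M e (Neg \<phi>) \<longleftrightarrow> \<not> fo_sat M e \<phi>"
| "fo_sat M e (Conj \<phi> \<psi>) \<longleftrightarrow> fo_sat M e \<phi> \<and> fo_sat M e \<psi>"
| "fo_sat M e (Exist \<phi>) \<longleftrightarrow> (\<exists>a. fo_sat M (case_nat a e) \<phi>)"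

text \<open>
  Points of the \<open>n\<close>-th power of the field are lists of length \<open>n\<close>. Variables \<open>i \<ge> n\<close> are read as
  the parameter 0.
\<close>

definition definable_in ::
    "('f, 'r, 'a::linordered_field) expansion \<Rightarrow> nat \<Rightarrow> 'a list set \<Rightarrow> bool" where
  "definable_in M n S \<longleftrightarrow>
     (\<exists>\<phi>. S = {x. length x = n \<and> fo_sat M (\<lambda>i. if i < n then x ! i else 0) \<phi>})"

definition definable :: "('f, 'r, 'a::linordered_field) expansion \<Rightarrow> 'a list set \<Rightarrow> bool" where
  "definable M S \<longleftrightarrow> (\<exists>n. definable_in M n S)"

definition points_and_open_intervals :: "'a::linorder set set" where
  "points_and_open_intervals =
     range (\<lambda>a. {a}) \<union> {{a<..<b} |a b. a < b} \<union> range lessThan \<union> range greaterThan \<union> {UNIV}"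

definition o_minimal :: "('f, 'r, 'a::linordered_field) expansion \<Rightarrow> bool" where
  "o_minimal M \<longleftrightarrow>
     (\<forall>S. definable_in M 1 S \<longrightarrow>
        (\<exists>\<J>. finite \<J> \<and> \<J> \<subseteq> points_and_open_intervals \<and> {a. [a] \<in> S} = \<Union>\<J>))"

section \<open>Topology\<close>

definition power_topology :: "nat \<Rightarrow> 'a::topological_space list topology" where
  "power_topology n =
     pullback_topology {x. length x = n} (\<lambda>x. \<lambda>i\<in>{..<n}. x ! i)
       (product_topology (\<lambda>_. euclidean) {..<n})"

text \<open>
  The disjoint union of all the finite powers. It lets the subspace topology of a definable set be
  written without reference to the dimension of the ambient space: see
  \<open>subtopology_list_topology\<close>.
\<close>

definition list_topology :: "'a::topological_space list topology" where
  "list_topology = topology (\<lambda>U. \<forall>n. openin (power_topology n) (U \<inter> {x. length x = n}))"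

abbreviation space_of :: "'a::topological_space list set \<Rightarrow> 'a list topology" where
  "space_of S \<equiv> subtopology list_topology S"

lemma topspace_power_topology: "topspace (power_topology n) = {x. length x = n}"
  by (auto simp: power_topology_def topspace_pullback_topology)

lemma openin_list_topology:
  "openin list_topology U \<longleftrightarrow> (\<forall>n. openin (power_topology n) (U \<inter> {x. length x = n}))"
proof -
  have "istopology (\<lambda>U::'a list set. \<forall>n. openin (power_topology n) (U \<inter> {x. length x = n}))"
    unfolding istopology_def
  proof (intro conjI allI impI)
    fix S T :: "'a list set" and n
    assume "\<forall>n. openin (power_topology n) (S \<inter> {x. length x = n})"
      and "\<forall>n. openin (power_topology n) (T \<inter> {x. length x = n})"
    then have "openin (power_topology n) ((S \<inter> {x. length x = n}) \<inter> (T \<inter> {x. length x = n}))"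
      using openin_Int by blast
    moreover have "(S \<inter> {x. length x = n}) \<inter> (T \<inter> {x. length x = n}) = S \<inter> T \<inter> {x. length x = n}"
      by blast
    ultimately show "openin (power_topology n) (S \<inter> T \<inter> {x. length x = n})"
      by (simp only:)
  next
    fix \<K> :: "'a list set set" and n
    assume *: "\<forall>K\<in>\<K>. \<forall>n. openin (power_topology n) (K \<inter> {x. length x = n})"
    have "openin (power_topology n) (\<Union>K\<in>\<K>. K \<inter> {x. length x = n})"
      by (rule openin_Union) (use * in blast)
    moreover have "(\<Union>K\<in>\<K>. K \<inter> {x. length x = n}) = \<Union>\<K> \<inter> {x. length x = n}"
      by blast
    ultimately show "openin (power_topology n) (\<Union>\<K> \<inter> {x. length x = n})"
      by (simp only:)
  qed
  then show ?thesis
    unfolding list_topology_def by (simp only: topology_inverse')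
qed

lemma subtopology_list_topology:
  assumes "S \<subseteq> {x. length x = n}"
  shows "subtopology list_topology S = subtopology (power_topology n) S"
proof (rule topology_eq[THEN iffD2], intro allI iffI)
  fix U
  assume "openin (subtopology list_topology S) U"
  then obtain V where V: "openin list_topology V" "U = V \<inter> S"
    by (auto simp: openin_subtopology)
  then have "openin (power_topology n) (V \<inter> {x. length x = n})"
    by (simp add: openin_list_topology)
  moreover have "U = (V \<inter> {x. length x = n}) \<inter> S"
    using V assms by auto
  ultimately show "openin (subtopology (power_topology n) S) U"
    by (auto simp: openin_subtopology)
next
  fix U
  assume "openin (subtopology (power_topology n) S) U"
  then obtain V where V: "openin (power_topology n) V" "U = V \<inter> S"
    by (auto simp: openin_subtopology)
  have sub: "V \<subseteq> {x. length x = n}"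
    using openin_subset[OF V(1)] by (simp add: topspace_power_topology)
  have "openin (power_topology k) (V \<inter> {x. length x = k})" for k
  proof (cases "k = n")
    case True
    then show ?thesis using V(1) sub by (simp add: Int_absorb2)
  next
    case False
    then have "V \<inter> {x. length x = k} = {}" using sub by auto
    then show ?thesis by simp
  qed
  then show "openin (subtopology list_topology S) U"
    using V(2) by (auto simp: openin_subtopology openin_list_topology)
qed

section \<open>Definable maps\<close>

definition set_product :: "'a list set \<Rightarrow> 'a list set \<Rightarrow> 'a list set" (infixr "\<otimes>" 75) where
  "S \<otimes> T = {x @ y | x y. x \<in> S \<and> y \<in> T}"

definition unit_interval :: "'a::linordered_field list set" where
  "unit_interval = {[t] |t. 0 \<le> t \<and> t \<le> 1}"

text \<open>Only the values of \<open>f\<close> on \<open>X\<close> matter.\<close>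

definition definable_map ::
    "('f, 'r, 'a::real_closed_field) expansion \<Rightarrow> 'a list set \<Rightarrow> 'a list set
       \<Rightarrow> ('a list \<Rightarrow> 'a list) \<Rightarrow> bool" where
  "definable_map M X Y f \<longleftrightarrow>
     definable M X \<and> definable M Y \<and> f \<in> X \<rightarrow> Y \<and>
     definable M {x @ f x |x. x \<in> X} \<and>
     continuous_map (space_of X) (space_of Y) f"

definition definable_homeomorphism ::
    "('f, 'r, 'a::real_closed_field) expansion \<Rightarrow> 'a list set \<Rightarrow> 'a list set
       \<Rightarrow> ('a list \<Rightarrow> 'a list) \<Rightarrow> bool" where
  "definable_homeomorphism M X Y f \<longleftrightarrow>
     definable_map M X Y f \<and> homeomorphic_map (space_of X) (space_of Y) f"

definition definably_homotopic ::
    "('f, 'r, 'a::real_closed_field) expansion \<Rightarrow> 'a list set \<Rightarrow> 'a list set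
       \<Rightarrow> ('a list \<Rightarrow> 'a list) \<Rightarrow> ('a list \<Rightarrow> 'a list) \<Rightarrow> bool" where
  "definably_homotopic M X Y f g \<longleftrightarrow>
     (\<exists>h. definable_map M (X \<otimes> unit_interval) Y h \<and>
        (\<forall>x\<in>X. h (x @ [0]) = f x \<and> h (x @ [1]) = g x))"

definition definable_homotopy_equivalence ::
    "('f, 'r, 'a::real_closed_field) expansion \<Rightarrow> 'a list set \<Rightarrow> 'a list set
       \<Rightarrow> ('a list \<Rightarrow> 'a list) \<Rightarrow> bool" where
  "definable_homotopy_equivalence M X X' f \<longleftrightarrow>
     definable_map M X X' f \<and>
     (\<exists>g. definable_map M X' X g \<and>
        definably_homotopic M X X (g \<circ> f) id \<and>
        definably_homotopic M X' X' (f \<circ> g) id)"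

text \<open>
  Definable compactness in the sense of Peterzil and Steinhorn: every definable curve
  in \<open>K\<close> has limits in \<open>K\<close> at both ends.
\<close>

definition definably_compact ::
    "('f, 'r, 'a::real_closed_field) expansion \<Rightarrow> 'a list set \<Rightarrow> bool" where
  "definably_compact M K \<longleftrightarrow>
     definable M K \<and>
     (\<forall>a b \<sigma>. a < b \<and> definable_map M {[t] |t. a < t \<and> t < b} K \<sigma> \<longrightarrow>
        (\<exists>l. limitin (space_of K) (\<lambda>t. \<sigma> [t]) l (at_right a)) \<and>
        (\<exists>l. limitin (space_of K) (\<lambda>t. \<sigma> [t]) l (at_left b)))"

definition locally_definably_compact ::
    "('f, 'r, 'a::real_closed_field) expansion \<Rightarrow> 'a list set \<Rightarrow> bool" where
  "locally_definably_compact M F \<longleftrightarrow>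
     (\<forall>x\<in>F. \<exists>N U. definable M N \<and> definably_compact M N \<and>
        openin (space_of F) U \<and> x \<in> U \<and> U \<subseteq> N \<and> N \<subseteq> F)"

section \<open>Definable fibre bundles\<close>

text \<open>A bundle is a tuple \<open>(B, X, p, F)\<close>: total space, base, projection, fibre.\<close>

type_synonym 'a fibre_data = "'a list set \<times> 'a list set \<times> ('a list \<Rightarrow> 'a list) \<times> 'a list set"

fun definable_fibre_bundle ::
    "('f, 'r, 'a::real_closed_field) expansion \<Rightarrow> 'a fibre_data \<Rightarrow> bool" where
  "definable_fibre_bundle M (B, X, p, F) \<longleftrightarrow>
     definable M B \<and> definable M X \<and> definable M F \<and>
     definable_map M B X p \<and> p ` B = X \<and>
     (\<exists>\<U>. finite \<U> \<and> \<Union>\<U> = X \<and>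
        (\<forall>U\<in>\<U>. definable M U \<and> openin (space_of X) U \<and>
           (\<exists>\<phi>. definable_homeomorphism M (U \<otimes> F) {b \<in> B. p b \<in> U} \<phi> \<and>
              (\<forall>x\<in>U. \<forall>y\<in>F. p (\<phi> (x @ y)) = x))))"

fun definable_bundle_map ::
    "('f, 'r, 'a::real_closed_field) expansion \<Rightarrow> 'a fibre_data \<Rightarrow> 'a fibre_data
       \<Rightarrow> ('a list \<Rightarrow> 'a list) \<Rightarrow> bool" where
  "definable_bundle_map M (B, X, p, F) (B\<^sub>1, X\<^sub>1, p\<^sub>1, F\<^sub>1) u \<longleftrightarrow>
     F = F\<^sub>1 \<and> definable_map M B B\<^sub>1 u \<and>
     (\<exists>v. definable_map M X X\<^sub>1 v \<and>
        (\<forall>b\<in>B. p\<^sub>1 (u b) = v (p b)) \<and>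
        (\<forall>x\<in>X. homeomorphic_map (space_of {b \<in> B. p b = x}) (space_of {b \<in> B\<^sub>1. p\<^sub>1 b = v x}) u))"

fun bundle_map_homotopic ::
    "('f, 'r, 'a::real_closed_field) expansion \<Rightarrow> 'a fibre_data \<Rightarrow> 'a fibre_data
       \<Rightarrow> ('a list \<Rightarrow> 'a list) \<Rightarrow> ('a list \<Rightarrow> 'a list) \<Rightarrow> bool" where
  "bundle_map_homotopic M (B, X, p, F) (B\<^sub>1, X\<^sub>1, p\<^sub>1, F\<^sub>1) u\<^sub>0 u\<^sub>1 \<longleftrightarrow>
     (\<exists>h. definable_map M (B \<otimes> unit_interval) B\<^sub>1 h \<and>
        (\<forall>t. 0 \<le> t \<and> t \<le> 1 \<longrightarrow>
           definable_bundle_map M (B, X, p, F) (B\<^sub>1, X\<^sub>1, p\<^sub>1, F\<^sub>1) (\<lambda>b. h (b @ [t]))) \<and>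
        (\<forall>b\<in>B. h (b @ [0]) = u\<^sub>0 b \<and> h (b @ [1]) = u\<^sub>1 b))"

definition bundle_homotopy_equivalent ::
    "('f, 'r, 'a::real_closed_field) expansion \<Rightarrow> 'a fibre_data \<Rightarrow> 'a fibre_data \<Rightarrow> bool" where
  "bundle_homotopy_equivalent M \<B> \<B>\<^sub>1 \<longleftrightarrow>
     definable_fibre_bundle M \<B> \<and> definable_fibre_bundle M \<B>\<^sub>1 \<and>
     (\<exists>u v. definable_bundle_map M \<B> \<B>\<^sub>1 u \<and> definable_bundle_map M \<B>\<^sub>1 \<B> v \<and>
        bundle_map_homotopic M \<B>\<^sub>1 \<B>\<^sub>1 (u \<circ> v) id \<and>
        bundle_map_homotopic M \<B> \<B> (v \<circ> u) id)"

text \<open>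
  The second projection of a product. When all elements of \<open>S\<close> have the same length, as in a
  definable set, the decomposition of \<open>z\<close> is unique: see \<open>product_snd_append\<close>.
\<close>

definition product_snd :: "'a list set \<Rightarrow> 'a list set \<Rightarrow> 'a list \<Rightarrow> 'a list" where
  "product_snd S T z = (THE y. y \<in> T \<and> (\<exists>x\<in>S. z = x @ y))"

lemma product_snd_append:
  assumes "definable M S" "x \<in> S" "y \<in> T"
  shows "product_snd S T (x @ y) = y"
proof -
  obtain n where n: "S \<subseteq> {x. length x = n}"
    using assms(1) unfolding definable_def definable_in_def by blast
  show ?thesis
    unfolding product_snd_def
  proof (rule the_equality)
    show "y \<in> T \<and> (\<exists>x'\<in>S. x @ y = x' @ y)"
      using assms(2,3) by blast
  next
    fix y'
    assume "y' \<in> T \<and> (\<exists>x'\<in>S. x @ y = x' @ y')"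
    then obtain x' where "x' \<in> S" "x @ y = x' @ y'"
      by blast
    moreover have "length x = length x'"
      using n assms(2) \<open>x' \<in> S\<close> by blast
    ultimately show "y' = y"
      by simp
  qed
qed

fun induced_bundle ::
    "('a list \<Rightarrow> 'a list) \<Rightarrow> 'a list set \<Rightarrow> 'a fibre_data \<Rightarrow> 'a fibre_data" where
  "induced_bundle f X (B', X', p, F) =
     ({b @ x |b x. b \<in> B' \<and> x \<in> X \<and> p b = f x}, X, product_snd B' X, F)"

end

theory Submission
  imports Defs
begin

text \<open>
  The heart of the proof is a definable transport along a homotopy \<open>H\<close> of maps from \<open>Y\<close> to the base:
  it carries the fibre over \<open>H (y, 0)\<close> homeomorphically to the fibre over \<open>H (y, t)\<close>, continuously in
  \<open>(y, t)\<close>. For fixed \<open>y\<close> one moves along the path \<open>H (y, -)\<close> in steps, each inside one chart and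
  keeping the fibre coordinate fixed. The length of a step depends continuously on \<open>y\<close>, and uniform
  finiteness bounds the number of steps independently of \<open>y\<close>; this replaces the Lebesgue number of a
  compact base.

  Let \<open>K\<close> and \<open>L\<close> be homotopies from \<open>g f\<close> and \<open>f g\<close> to the identities. Let \<open>u\<close> be the projection of
  the induced bundle to \<open>B'\<close>, let \<open>v\<close> be transport along the reverse of \<open>L\<close>, and let \<open>u'\<close> be transport
  along \<open>f K\<close> reversed, followed by transport along \<open>L\<close>. Following the paths only part of the way
  shows that \<open>u v\<close> and \<open>v u'\<close> are homotopic to the identity through bundle maps, whence
  \<open>v u \<simeq> v u v u' \<simeq> v u' \<simeq> id\<close>.
\<close>

subsection \<open>Definable predicates, functions and tuples\<close>

text \<open>The field need not be archimedean, so the number \<open>1 / \<lambda>\<close> of equal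
  steps that a Lebesgue number \<open>\<lambda>\<close> would ask for may exceed every natural
  number. Steps are therefore taken as long as the chart allows, and they are counted by the places
  where a chart is left. They are pasted along relatively closed sets, which is why their lengths
  have to be continuous; a chart that does not help at a given place contributes a step of length
  zero.

  The map \<open>u'\<close> is there because \<open>f K\<close> and \<open>L f\<close> are two
  homotopies from \<open>f g f\<close> to \<open>f\<close> that need not be deformable into each
  other. Going back along \<open>L\<close>, as \<open>v\<close> does, may differ from going back
  along \<open>f K\<close> by a nontrivial monodromy of the fibres, so \<open>v u\<close> is not
  visibly homotopic to the identity. The transport along \<open>L\<close> in \<open>u'\<close> can
  be contracted against the one in \<open>v\<close>, as both follow the same path; what remains is
  transport along \<open>f K\<close>, and \<open>K\<close> itself carries it over to the induced
  bundle.\<close>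

definition dpred :: "('f, 'r, 'a::linordered_field) expansion \<Rightarrow> ((nat \<Rightarrow> 'a) \<Rightarrow> bool) \<Rightarrow> bool" where
  "dpred M P \<longleftrightarrow> (\<exists>\<phi>. \<forall>e. P e = fo_sat M e \<phi>)"

text \<open>Like \<open>dpred\<close>, this speaks of functions of the whole environment, so that
  closure rules can follow the shape of a HOL expression and no formula has to be written down. The
  graph carries the value in variable 0, with the arguments shifted by one.\<close>

definition dfun :: "('f, 'r, 'a::linordered_field) expansion \<Rightarrow> ((nat \<Rightarrow> 'a) \<Rightarrow> 'a) \<Rightarrow> bool" where
  "dfun M v \<longleftrightarrow> dpred M (\<lambda>e. e 0 = v (\<lambda>i. e (Suc i)))"

definition dlist ::
    "('f, 'r, 'a::linordered_field) expansion \<Rightarrow> nat \<Rightarrow> ((nat \<Rightarrow> 'a) \<Rightarrow> 'a list) \<Rightarrow> bool" where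
  "dlist M n v \<longleftrightarrow> (\<forall>e. length (v e) = n) \<and> (\<forall>i<n. dfun M (\<lambda>e. v e ! i))"

section \<open>Renaming of variables and finite support of formulas\<close>

lemma fo_eval_rename: "\<exists>t'. \<forall>e. fo_eval M e t' = fo_eval M (\<lambda>i. e (\<sigma> i)) t"
proof (induction t)
  case (Var i)
  show ?case by (rule exI[of _ "Var (\<sigma> i)"]) simp
next
  case (Param a)
  show ?case by (rule exI[of _ "Param a"]) simp
next
  case (Plus s t)
  then obtain s' t' where "\<forall>e. fo_eval M e s' = fo_eval M (\<lambda>i. e (\<sigma> i)) s"
    "\<forall>e. fo_eval M e t' = fo_eval M (\<lambda>i. e (\<sigma> i)) t" by blast
  then show ?case by (intro exI[of _ "Plus s' t'"]) simp
next
  case (Times s t)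
  then obtain s' t' where "\<forall>e. fo_eval M e s' = fo_eval M (\<lambda>i. e (\<sigma> i)) s"
    "\<forall>e. fo_eval M e t' = fo_eval M (\<lambda>i. e (\<sigma> i)) t" by blast
  then show ?case by (intro exI[of _ "Times s' t'"]) simp
next
  case (Fun k ts)
  then have "\<forall>t\<in>set ts. \<exists>t'. \<forall>e. fo_eval M e t' = fo_eval M (\<lambda>i. e (\<sigma> i)) t" by blast
  then obtain r where "\<forall>t\<in>set ts. \<forall>e. fo_eval M e (r t) = fo_eval M (\<lambda>i. e (\<sigma> i)) t"
    by (rule bchoice[THEN exE])
  then show ?case by (intro exI[of _ "Fun k (map r ts)"]) (simp add: comp_def cong: map_cong)
qed

lemma fo_sat_rename:
  fixes M :: "('f, 'r, 'a::linordered_field) expansion"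
  shows "\<exists>\<phi>'. \<forall>e. fo_sat M e \<phi>' = fo_sat M (\<lambda>i. e (\<sigma> i)) \<phi>"
proof (induction \<phi> arbitrary: \<sigma>)
  case (Equal s t)
  obtain s' where "\<forall>e. fo_eval M e s' = fo_eval M (\<lambda>i. e (\<sigma> i)) s"
    using fo_eval_rename[of M \<sigma> s] by blast
  moreover obtain t' where "\<forall>e. fo_eval M e t' = fo_eval M (\<lambda>i. e (\<sigma> i)) t"
    using fo_eval_rename[of M \<sigma> t] by blast
  ultimately show ?case by (intro exI[of _ "Equal s' t'"]) simp
next
  case (Less s t)
  obtain s' where "\<forall>e. fo_eval M e s' = fo_eval M (\<lambda>i. e (\<sigma> i)) s"
    using fo_eval_rename[of M \<sigma> s] by blast
  moreover obtain t' where "\<forall>e. fo_eval M e t' = fo_eval M (\<lambda>i. e (\<sigma> i)) t"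
    using fo_eval_rename[of M \<sigma> t] by blast
  ultimately show ?case by (intro exI[of _ "Less s' t'"]) simp
next
  case (Rel k ts)
  have "\<forall>t. \<exists>t'. \<forall>e. fo_eval M e t' = fo_eval M (\<lambda>i. e (\<sigma> i)) t"
    using fo_eval_rename by blast
  then obtain r where "\<forall>t. \<forall>e. fo_eval M e (r t) = fo_eval M (\<lambda>i. e (\<sigma> i)) t"
    by (rule choice[THEN exE])
  then show ?case by (intro exI[of _ "Rel k (map r ts)"]) (simp add: comp_def)
next
  case (Neg \<phi>)
  then obtain \<phi>' where "\<forall>e. fo_sat M e \<phi>' = fo_sat M (\<lambda>i. e (\<sigma> i)) \<phi>" by blast
  then show ?case by (intro exI[of _ "Neg \<phi>'"]) simp
next
  case (Conj \<phi> \<psi>)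
  obtain \<phi>' where "\<forall>e. fo_sat M e \<phi>' = fo_sat M (\<lambda>i. e (\<sigma> i)) \<phi>"
    using Conj(1)[of \<sigma>] by blast
  moreover obtain \<psi>' where "\<forall>e. fo_sat M e \<psi>' = fo_sat M (\<lambda>i. e (\<sigma> i)) \<psi>"
    using Conj(2)[of \<sigma>] by blast
  ultimately show ?case by (intro exI[of _ "Conj \<phi>' \<psi>'"]) simp
next
  case (Exist \<phi>)
  \<comment> \<open>Under the quantifier the renaming must fix the bound variable 0 and act on the
    others one place higher.\<close>
  obtain \<phi>' where *: "\<forall>e. fo_sat M e \<phi>' = fo_sat M (\<lambda>i. e (case_nat 0 (\<lambda>i. Suc (\<sigma> i)) i)) \<phi>"
    using Exist[of "case_nat 0 (\<lambda>i. Suc (\<sigma> i))"] by blast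
  have "(\<lambda>i. case_nat a e (case_nat 0 (\<lambda>i. Suc (\<sigma> i)) i)) = case_nat a (\<lambda>i. e (\<sigma> i))" for a and e :: "nat \<Rightarrow> 'a"
    by (auto split: nat.split)
  with * show ?case by (intro exI[of _ "Exist \<phi>'"]) simp
qed

lemma dpred_rename: "dpred M P \<Longrightarrow> dpred M (\<lambda>e. P (\<lambda>i. e (\<sigma> i)))"
proof -
  assume "dpred M P"
  then obtain \<phi> where "\<forall>e. P e = fo_sat M e \<phi>" unfolding dpred_def by blast
  moreover obtain \<phi>' where "\<forall>e. fo_sat M e \<phi>' = fo_sat M (\<lambda>i. e (\<sigma> i)) \<phi>"
    using fo_sat_rename[of M \<sigma> \<phi>] by blast
  ultimately show ?thesis unfolding dpred_def by (intro exI[of _ \<phi>']) simp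
qed

lemma finite_support_both:
  fixes F :: "(nat \<Rightarrow> 'a) \<Rightarrow> 'b" and G :: "(nat \<Rightarrow> 'a) \<Rightarrow> 'c"
  assumes "\<forall>e e'. (\<forall>i<k. e i = e' i) \<longrightarrow> F e = F e'" "\<forall>e e'. (\<forall>i<l. e i = e' i) \<longrightarrow> G e = G e'"
  shows "\<exists>m. \<forall>e e'. (\<forall>i<m. e i = e' i) \<longrightarrow> H (F e) (G e) = H (F e') (G e')"
proof (intro exI[of _ "max k l"] allI impI)
  fix e e' :: "nat \<Rightarrow> 'a"
  assume "\<forall>i<max k l. e i = e' i"
  then have "\<forall>i<k. e i = e' i" "\<forall>i<l. e i = e' i" by auto
  then have "F e = F e'" "G e = G e'" using assms by blast+
  then show "H (F e) (G e) = H (F e') (G e')" by simp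
qed

lemma finite_support_map:
  fixes F :: "'t \<Rightarrow> (nat \<Rightarrow> 'a) \<Rightarrow> 'b"
  assumes "\<forall>t\<in>set ts. \<exists>k. \<forall>e e'. (\<forall>i<k. e i = e' i) \<longrightarrow> F t e = F t e'"
  shows "\<exists>m. \<forall>e e'. (\<forall>i<m. e i = e' i) \<longrightarrow> map (\<lambda>t. F t e) ts = map (\<lambda>t. F t e') ts"
  using assms
proof (induction ts)
  case (Cons t ts)
  then obtain k l where "\<forall>e e'. (\<forall>i<k. e i = e' i) \<longrightarrow> F t e = F t e'"
    "\<forall>e e'. (\<forall>i<l. e i = e' i) \<longrightarrow> map (\<lambda>t. F t e) ts = map (\<lambda>t. F t e') ts" by auto
  then show ?case
    using finite_support_both[of k "F t" l "\<lambda>e. map (\<lambda>t. F t e) ts" "(#)"] by simp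
qed simp

lemma fo_eval_finite_support:
  "\<exists>k. \<forall>e e'. (\<forall>i<k. e i = e' i) \<longrightarrow> fo_eval M e t = fo_eval M e' t"
proof (induction t)
  case (Var i)
  show ?case by (rule exI[of _ "Suc i"]) simp
next
  case (Plus s t)
  then obtain k l where "\<forall>e e'. (\<forall>i<k. e i = e' i) \<longrightarrow> fo_eval M e s = fo_eval M e' s"
    "\<forall>e e'. (\<forall>i<l. e i = e' i) \<longrightarrow> fo_eval M e t = fo_eval M e' t" by blast
  then show ?case using finite_support_both[of k "\<lambda>e. fo_eval M e s" l "\<lambda>e. fo_eval M e t" "\<lambda>x y. x + y"] by simp
next
  case (Times s t)
  then obtain k l where "\<forall>e e'. (\<forall>i<k. e i = e' i) \<longrightarrow> fo_eval M e s = fo_eval M e' s"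
    "\<forall>e e'. (\<forall>i<l. e i = e' i) \<longrightarrow> fo_eval M e t = fo_eval M e' t" by blast
  then show ?case using finite_support_both[of k "\<lambda>e. fo_eval M e s" l "\<lambda>e. fo_eval M e t" "\<lambda>x y. x * y"] by simp
next
  case (Fun f ts)
  then have "\<forall>t\<in>set ts. \<exists>k. \<forall>e e'. (\<forall>i<k. e i = e' i) \<longrightarrow> fo_eval M e t = fo_eval M e' t" by blast
  from finite_support_map[of ts "\<lambda>t e. fo_eval M e t", OF this] show ?case
    by (elim ex_forward all_forward imp_forward) (simp_all del: map_eq_conv)
qed auto

text \<open>A formula mentions finitely many variables. This is what lets \<open>dpred_subst\<close>
  express a substitution into all variables by a finite block of quantifiers.\<close>

lemma fo_sat_finite_support:
  "\<exists>k. \<forall>e e'. (\<forall>i<k. e i = e' i) \<longrightarrow> fo_sat M e \<phi> = fo_sat M e' \<phi>"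
proof (induction \<phi>)
  case (Equal s t)
  obtain k where "\<forall>e e'. (\<forall>i<k. e i = e' i) \<longrightarrow> fo_eval M e s = fo_eval M e' s"
    using fo_eval_finite_support[of M s] by blast
  moreover obtain l where "\<forall>e e'. (\<forall>i<l. e i = e' i) \<longrightarrow> fo_eval M e t = fo_eval M e' t"
    using fo_eval_finite_support[of M t] by blast
  ultimately show ?case
    using finite_support_both[of k "\<lambda>e. fo_eval M e s" l "\<lambda>e. fo_eval M e t" "\<lambda>x y. x = y"] by simp
next
  case (Less s t)
  obtain k where "\<forall>e e'. (\<forall>i<k. e i = e' i) \<longrightarrow> fo_eval M e s = fo_eval M e' s"
    using fo_eval_finite_support[of M s] by blast
  moreover obtain l where "\<forall>e e'. (\<forall>i<l. e i = e' i) \<longrightarrow> fo_eval M e t = fo_eval M e' t"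
    using fo_eval_finite_support[of M t] by blast
  ultimately show ?case
    using finite_support_both[of k "\<lambda>e. fo_eval M e s" l "\<lambda>e. fo_eval M e t" "\<lambda>x y. x < y"] by simp
next
  case (Rel k ts)
  have "\<forall>t\<in>set ts. \<exists>k. \<forall>e e'. (\<forall>i<k. e i = e' i) \<longrightarrow> fo_eval M e t = fo_eval M e' t"
    using fo_eval_finite_support[of M] by blast
  from finite_support_map[of ts "\<lambda>t e. fo_eval M e t", OF this] show ?case
    by (elim ex_forward all_forward imp_forward) (simp_all del: map_eq_conv)
next
  case (Conj \<phi> \<psi>)
  then obtain k l where "\<forall>e e'. (\<forall>i<k. e i = e' i) \<longrightarrow> fo_sat M e \<phi> = fo_sat M e' \<phi>"
    "\<forall>e e'. (\<forall>i<l. e i = e' i) \<longrightarrow> fo_sat M e \<psi> = fo_sat M e' \<psi>" by blast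
  then show ?case using finite_support_both[of k "\<lambda>e. fo_sat M e \<phi>" l "\<lambda>e. fo_sat M e \<psi>" "\<lambda>x y. x \<and> y"] by simp
next
  case (Exist \<phi>)
  then obtain k where k: "\<forall>e e'. (\<forall>i<k. e i = e' i) \<longrightarrow> fo_sat M e \<phi> = fo_sat M e' \<phi>" by blast
  have *: "fo_sat M (case_nat a e) \<phi> = fo_sat M (case_nat a e') \<phi>" if "\<forall>i<k. e i = e' i" for a e e'
    using k[rule_format, of "case_nat a e" "case_nat a e'"] that by (auto split: nat.split)
  show ?case unfolding fo_sat.simps
    by (intro exI[of _ k] allI impI ex_cong1) (rule *)
qed auto

lemma dpred_finite_support:
  assumes "dpred M P"
  shows "\<exists>k. \<forall>e e'. (\<forall>i<k. e i = e' i) \<longrightarrow> P e = P e'"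
proof -
  obtain \<phi> where "\<forall>e. P e = fo_sat M e \<phi>" using assms unfolding dpred_def by blast
  then have "P = (\<lambda>e. fo_sat M e \<phi>)" by blast
  then show ?thesis using fo_sat_finite_support[of M \<phi>] by simp
qed

section \<open>Closure of definable predicates under connectives and quantifiers\<close>

lemma dpred_not:
  assumes "dpred M P" shows "dpred M (\<lambda>e. \<not> P e)"
proof -
  obtain \<phi> where "\<forall>e. P e = fo_sat M e \<phi>" using assms unfolding dpred_def by blast
  then show ?thesis unfolding dpred_def by (intro exI[of _ "Neg \<phi>"]) simp
qed

lemma dpred_conj:
  assumes "dpred M P" "dpred M Q" shows "dpred M (\<lambda>e. P e \<and> Q e)"
proof -
  obtain \<phi> \<psi> where "\<forall>e. P e = fo_sat M e \<phi>" "\<forall>e. Q e = fo_sat M e \<psi>"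
    using assms unfolding dpred_def by blast
  then show ?thesis unfolding dpred_def by (intro exI[of _ "Conj \<phi> \<psi>"]) simp
qed

lemma dpred_disj:
  assumes "dpred M P" "dpred M Q" shows "dpred M (\<lambda>e. P e \<or> Q e)"
  using dpred_not[OF dpred_conj[OF dpred_not[OF assms(1)] dpred_not[OF assms(2)]]] by simp

lemma dpred_imp:
  assumes "dpred M P" "dpred M Q" shows "dpred M (\<lambda>e. P e \<longrightarrow> Q e)"
  using dpred_disj[OF dpred_not[OF assms(1)] assms(2)] by (simp only: imp_conv_disj)

lemma dpred_iff:
  assumes "dpred M P" "dpred M Q" shows "dpred M (\<lambda>e. P e \<longleftrightarrow> Q e)"
  using dpred_conj[OF dpred_imp[OF assms] dpred_imp[OF assms(2,1)]] by (simp only: iff_conv_conj_imp)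

lemma dpred_const: "dpred M (\<lambda>e. c)"
proof (cases c)
  case True
  then show ?thesis unfolding dpred_def by (intro exI[of _ "Equal (Param 0) (Param 0)"]) simp
next
  case False
  then show ?thesis unfolding dpred_def by (intro exI[of _ "Less (Param 0) (Param 0)"]) simp
qed

lemma dpred_ex:
  assumes "dpred M (\<lambda>e. Q (e 0) (\<lambda>i. e (Suc i)))"
  shows "dpred M (\<lambda>e. \<exists>a. Q a e)"
proof -
  obtain \<phi> where "\<forall>e. Q (e 0) (\<lambda>i. e (Suc i)) = fo_sat M e \<phi>" using assms unfolding dpred_def by blast
  then have "Q (case_nat a e 0) (\<lambda>i. case_nat a e (Suc i)) = fo_sat M (case_nat a e) \<phi>" for a e by blast
  then have "Q a e = fo_sat M (case_nat a e) \<phi>" for a e by simp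
  then show ?thesis unfolding dpred_def by (intro exI[of _ "Exist \<phi>"]) simp
qed

lemma dpred_all:
  assumes "dpred M (\<lambda>e. Q (e 0) (\<lambda>i. e (Suc i)))"
  shows "dpred M (\<lambda>e. \<forall>a. Q a e)"
  using dpred_not[OF dpred_ex[where Q="\<lambda>a e. \<not> Q a e", OF dpred_not[OF assms]]] by simp

lemma dpred_ball_lessThan:
  fixes n :: nat
  assumes "\<And>i. i < n \<Longrightarrow> dpred M (P i)" shows "dpred M (\<lambda>e. \<forall>i<n. P i e)"
  using assms
proof (induction n)
  case 0
  show ?case by (simp add: dpred_const)
next
  case (Suc n)
  have "dpred M (\<lambda>e. (\<forall>i<n. P i e) \<and> P n e)" using Suc by (intro dpred_conj) auto
  then show ?case by (simp only: All_less_Suc conj_commute)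
qed

lemma dpred_ex_list:
  fixes M :: "('f, 'r, 'a::linordered_field) expansion"
  assumes "dpred M (\<lambda>e. Q (map e [0..<n]) (\<lambda>i. e (n + i)))"
  shows "dpred M (\<lambda>e. \<exists>x. length x = n \<and> Q x e)"
  using assms
proof (induction n arbitrary: Q)
  case 0
  then show ?case by simp
next
  case (Suc n)
  \<comment> \<open>A cyclic shift of the first \<open>Suc n\<close> variables: the last entry of
    the tuple moves to variable 0, where \<open>dpred_ex\<close> can bind it, and the other
    \<open>n\<close> entries follow as a block for the induction hypothesis.\<close>
  define \<sigma> where "\<sigma> i = (if i < n then Suc i else if i = n then 0 else i)" for i
  have m: "map (\<lambda>i. e (\<sigma> i)) [0..<Suc n] = map (\<lambda>i. e (Suc i)) [0..<n] @ [e 0]" for e :: "nat \<Rightarrow> 'a"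
    by (auto simp: \<sigma>_def)
  have s: "(\<lambda>i. e (\<sigma> (Suc n + i))) = (\<lambda>i. e (Suc (n + i)))" for e :: "nat \<Rightarrow> 'a"
    by (auto simp: \<sigma>_def)
  have "dpred M (\<lambda>e. Q (map (\<lambda>i. e (Suc i)) [0..<n] @ [e 0]) (\<lambda>i. e (Suc (n + i))))"
    using dpred_rename[OF Suc.prems, of \<sigma>] unfolding m s .
  then have "dpred M (\<lambda>e. \<exists>a. Q (map e [0..<n] @ [a]) (\<lambda>i. e (n + i)))"
    by (rule dpred_ex[where Q="\<lambda>a e. Q (map e [0..<n] @ [a]) (\<lambda>i. e (n + i))"])
  then have "dpred M (\<lambda>e. \<exists>x. length x = n \<and> (\<exists>a. Q (x @ [a]) e))"
    by (rule Suc.IH[where Q="\<lambda>x e. \<exists>a. Q (x @ [a]) e"])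
  moreover have "(\<exists>x. length x = Suc n \<and> Q x e) = (\<exists>x. length x = n \<and> (\<exists>a. Q (x @ [a]) e))" for e
    by (metis length_Suc_conv_rev length_append_singleton)
  ultimately show ?case by simp
qed

section \<open>Substitution of definable functions\<close>

lemma dpred_var_eq: "dpred M (\<lambda>e. e i = e j)"
  unfolding dpred_def by (intro exI[of _ "Equal (Var i) (Var j)"]) simp

text \<open>\<open>P\<close> only sees the first \<open>k\<close> variables, so \<open>P\<close> at
  the values \<open>w i e\<close> says that some tuple \<open>y\<close> of length \<open>k\<close>
  has the entries \<open>w i e\<close> and satisfies \<open>P\<close>. The entries
  \<open>y ! i\<close> with \<open>i \<ge> k\<close> are unspecified, which the finite support makes
  harmless.\<close>

lemma dpred_subst:
  assumes "dpred M P" and w: "\<And>i. dfun M (w i)"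
  shows "dpred M (\<lambda>e. P (\<lambda>i. w i e))"
proof -
  obtain k where k: "\<And>e e'. (\<forall>i<k. e i = e' i) \<Longrightarrow> P e = P e'"
    using dpred_finite_support[OF assms(1)] by blast
  define Q where "Q y e \<longleftrightarrow> (\<forall>i<k. y ! i = w i e) \<and> P (\<lambda>i. y ! i)" for y e
  have v: "dpred M (\<lambda>e. e i = w i (\<lambda>j. e (k + j)))" for i
    using dpred_rename[OF w[of i, unfolded dfun_def], of "case_nat i (\<lambda>j. k + j)"] by simp
  have "dpred M (\<lambda>e. \<forall>i<k. e i = w i (\<lambda>j. e (k + j)))"
    by (rule dpred_ball_lessThan) (rule v)
  from dpred_conj[OF this assms(1)]
  have "dpred M (\<lambda>e. (\<forall>i<k. e i = w i (\<lambda>j. e (k + j))) \<and> P e)" .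
  moreover have "P (\<lambda>i. map e [0..<k] ! i) = P e" for e
    by (rule k) simp
  ultimately have "dpred M (\<lambda>e. Q (map e [0..<k]) (\<lambda>i. e (k + i)))"
    unfolding Q_def by simp
  then have "dpred M (\<lambda>e. \<exists>y. length y = k \<and> Q y e)" by (rule dpred_ex_list[where Q=Q and n=k])
  moreover have "(\<exists>y. length y = k \<and> Q y e) = P (\<lambda>i. w i e)" for e
  proof
    assume "\<exists>y. length y = k \<and> Q y e"
    then obtain y where "\<forall>i<k. y ! i = w i e" "P (\<lambda>i. y ! i)" by (auto simp: Q_def)
    then show "P (\<lambda>i. w i e)" using k[of "\<lambda>i. y ! i" "\<lambda>i. w i e"] by simp
  next
    assume P: "P (\<lambda>i. w i e)"
    have "P (\<lambda>i. map (\<lambda>i. w i e) [0..<k] ! i) = P (\<lambda>i. w i e)" by (rule k) simp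
    with P show "\<exists>y. length y = k \<and> Q y e"
      by (intro exI[of _ "map (\<lambda>i. w i e) [0..<k]"]) (simp add: Q_def)
  qed
  ultimately show ?thesis by (simp only:)
qed

lemma dfun_rename: "dfun M v \<Longrightarrow> dfun M (\<lambda>e. v (\<lambda>i. e (\<sigma> i)))"
  unfolding dfun_def using dpred_rename[of M "\<lambda>e. e 0 = v (\<lambda>i. e (Suc i))" "case_nat 0 (\<lambda>i. Suc (\<sigma> i))"]
  by simp

lemma dfun_var: "dfun M (\<lambda>e. e k)"
  unfolding dfun_def by (rule dpred_var_eq)

lemma dfun_const: "dfun M (\<lambda>e. c)"
  unfolding dfun_def dpred_def by (intro exI[of _ "Equal (Var 0) (Param c)"]) simp

lemma dpred_subst2:
  assumes "dpred M (\<lambda>e. P (e 0) (e 1))" "dfun M f" "dfun M g"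
  shows "dpred M (\<lambda>e. P (f e) (g e))"
  using dpred_subst[OF assms(1), of "\<lambda>i. if i = 0 then f else g"] assms(2,3) by simp

lemma dfun_subst:
  assumes v: "dfun M v" and w: "\<And>i. dfun M (w i)"
  shows "dfun M (\<lambda>e. v (\<lambda>i. w i e))"
proof -
  let ?w = "case_nat (\<lambda>e. e 0) (\<lambda>i e. w i (\<lambda>i. e (Suc i)))"
  have "dfun M (?w i)" for i
    using w by (auto split: nat.split intro: dfun_var dfun_rename)
  from dpred_subst[where w="?w", OF v[unfolded dfun_def] this] show ?thesis
    unfolding dfun_def by simp
qed

lemma dfun_subst2:
  assumes "dfun M (\<lambda>e. F (e 0) (e 1))" "dfun M f" "dfun M g"
  shows "dfun M (\<lambda>e. F (f e) (g e))"
  using dfun_subst[OF assms(1), of "\<lambda>i. if i = 0 then f else g"] assms(2,3) by simp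

section \<open>Order and arithmetic\<close>

lemma dpred_eq: "dfun M f \<Longrightarrow> dfun M g \<Longrightarrow> dpred M (\<lambda>e. f e = g e)"
  using dpred_subst2[of M "\<lambda>x y. x = y"] dpred_var_eq by blast

lemma dpred_less: "dfun M f \<Longrightarrow> dfun M g \<Longrightarrow> dpred M (\<lambda>e. f e < g e)"
  by (rule dpred_subst2)
    (unfold dpred_def, intro exI[of _ "Less (Var 0) (Var 1)"], simp)

lemma dpred_le: "dfun M f \<Longrightarrow> dfun M g \<Longrightarrow> dpred M (\<lambda>e. f e \<le> g e)"
  using dpred_not[OF dpred_less[of M g f]] by (simp add: not_less)

lemma dfun_add: "dfun M f \<Longrightarrow> dfun M g \<Longrightarrow> dfun M (\<lambda>e. f e + g e)"
  by (rule dfun_subst2)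
    (unfold dfun_def dpred_def, intro exI[of _ "Equal (Var 0) (Plus (Var 1) (Var 2))"],
     simp add: numeral_2_eq_2)

lemma dfun_mult: "dfun M f \<Longrightarrow> dfun M g \<Longrightarrow> dfun M (\<lambda>e. f e * g e)"
  by (rule dfun_subst2)
    (unfold dfun_def dpred_def, intro exI[of _ "Equal (Var 0) (Times (Var 1) (Var 2))"],
     simp add: numeral_2_eq_2)

text \<open>The language has only addition and multiplication; negation is multiplication by the
  parameter \<open>-1\<close>.\<close>

lemma dfun_uminus: "dfun M f \<Longrightarrow> dfun M (\<lambda>e. - f e)"
  using dfun_mult[OF dfun_const[of M "-1"]] by simp

lemma dfun_diff: "dfun M f \<Longrightarrow> dfun M g \<Longrightarrow> dfun M (\<lambda>e. f e - g e)"
  using dfun_add[OF _ dfun_uminus[of M g], of f] by simp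

lemma dfun_divide_const: "dfun M f \<Longrightarrow> dfun M (\<lambda>e. f e / c)"
  using dfun_mult[OF _ dfun_const[of M "inverse c"]] by (simp add: divide_inverse)

lemma dfun_if:
  assumes "dpred M P" "dfun M f" "dfun M g"
  shows "dfun M (\<lambda>e. if P e then f e else g e)"
proof -
  have "dpred M (\<lambda>e. P (\<lambda>i. e (Suc i)) \<and> e 0 = f (\<lambda>i. e (Suc i)) \<or>
      \<not> P (\<lambda>i. e (Suc i)) \<and> e 0 = g (\<lambda>i. e (Suc i)))"
    using assms by (intro dpred_disj dpred_conj dpred_not dpred_rename[of M P Suc]) (auto simp: dfun_def)
  then show ?thesis unfolding dfun_def by (rule back_subst) (auto intro!: arg_cong[of _ _ "dpred M"])
qed

lemma dfun_min: "dfun M f \<Longrightarrow> dfun M g \<Longrightarrow> dfun M (\<lambda>e. min (f e) (g e))"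
  unfolding min_def by (intro dfun_if dpred_le)

lemma dfun_max: "dfun M f \<Longrightarrow> dfun M g \<Longrightarrow> dfun M (\<lambda>e. max (f e) (g e))"
  unfolding max_def by (intro dfun_if dpred_le)

lemma dfun_abs: "dfun M f \<Longrightarrow> dfun M (\<lambda>e. \<bar>f e\<bar>)"
  unfolding abs_if by (intro dfun_if dpred_less dfun_uminus dfun_const)

section \<open>Tuples of definable functions\<close>

lemma dlist_vars: "dlist M n (\<lambda>e. map (\<lambda>i. e (\<sigma> i)) [0..<n])"
  unfolding dlist_def by (auto intro: dfun_var)

lemma dlist_map_vars: "dlist M n (\<lambda>e. map e [0..<n])"
  unfolding dlist_def by (auto intro: dfun_var)

lemma dlist_append:
  assumes "dlist M m v" "dlist M n w" "k = m + n"
  shows "dlist M k (\<lambda>e. v e @ w e)"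
proof -
  have "dfun M (\<lambda>e. (v e @ w e) ! i)" if "i < k" for i
  proof (cases "i < m")
    case True
    then show ?thesis using assms by (simp add: dlist_def nth_append)
  next
    case False
    then have "i - m < n" using that assms by simp
    then show ?thesis using assms False by (simp add: dlist_def nth_append)
  qed
  then show ?thesis using assms by (auto simp: dlist_def)
qed

lemma dlist_singleton: "dfun M f \<Longrightarrow> dlist M (Suc 0) (\<lambda>e. [f e])"
  by (simp add: dlist_def)

lemma dlist_snoc: "dlist M n v \<Longrightarrow> dfun M f \<Longrightarrow> dlist M (Suc n) (\<lambda>e. v e @ [f e])"
  by (rule dlist_append[OF _ dlist_singleton]) simp_all

lemma dlist_const: "length c = n \<Longrightarrow> dlist M n (\<lambda>e. c)"
  by (simp add: dlist_def dfun_const)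

lemma dlist_take: "dlist M n v \<Longrightarrow> k \<le> n \<Longrightarrow> dlist M k (\<lambda>e. take k (v e))"
  by (simp add: dlist_def)

lemma dlist_drop:
  assumes "dlist M n v" "m + k = n" shows "dlist M k (\<lambda>e. drop m (v e))"
proof -
  have "dfun M (\<lambda>e. drop m (v e) ! i)" if "i < k" for i
    using assms that by (auto simp: dlist_def)
  then show ?thesis using assms by (auto simp: dlist_def)
qed

lemma dfun_nth: "dlist M n v \<Longrightarrow> i < n \<Longrightarrow> dfun M (\<lambda>e. v e ! i)"
  by (simp add: dlist_def)

lemma dlist_if:
  assumes "dpred M P" "dlist M n v" "dlist M n w"
  shows "dlist M n (\<lambda>e. if P e then v e else w e)"
  using assms dfun_if[OF assms(1)] by (simp add: dlist_def if_distrib[of "\<lambda>x. x ! _"])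

lemma dpred_list_eq:
  assumes "dlist M n v" "dlist M n w"
  shows "dpred M (\<lambda>e. v e = w e)"
proof -
  have "dpred M (\<lambda>e. \<forall>i<n. v e ! i = w e ! i)"
    using assms by (intro dpred_ball_lessThan dpred_eq) (auto simp: dlist_def)
  moreover have "(v e = w e) = (\<forall>i<n. v e ! i = w e ! i)" for e
    using assms by (auto simp: dlist_def intro: nth_equalityI)
  ultimately show ?thesis by simp
qed

text \<open>It is enough to treat the generic tuple \<open>map e [0..<n]\<close>; every other
  definable tuple is substituted into it.\<close>

lemma dpred_subst_list:
  assumes "dpred M (\<lambda>e. P (map e [0..<n]))" "dlist M n v"
  shows "dpred M (\<lambda>e. P (v e))"
proof -
  have *: "dfun M (\<lambda>e. if i < n then v e ! i else 0)" for i
    using assms(2) by (cases "i < n") (simp_all add: dlist_def dfun_const)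
  have "dpred M (\<lambda>e. P (map (\<lambda>i. if i < n then v e ! i else 0) [0..<n]))"
    by (rule dpred_subst[OF assms(1), of "\<lambda>i e. if i < n then v e ! i else 0"]) (rule *)
  moreover have "map (\<lambda>i. if i < n then v e ! i else 0) [0..<n] = v e" for e
    using assms(2) by (auto simp: dlist_def intro: nth_equalityI)
  ultimately show ?thesis by simp
qed

lemma dfun_subst_list:
  assumes "dfun M (\<lambda>e. g (map e [0..<n]))" "dlist M n v"
  shows "dfun M (\<lambda>e. g (v e))"
proof -
  have *: "dfun M (\<lambda>e. if i < n then v e ! i else 0)" for i
    using assms(2) by (cases "i < n") (simp_all add: dlist_def dfun_const)
  have "dfun M (\<lambda>e. g (map (\<lambda>i. if i < n then v e ! i else 0) [0..<n]))"
    by (rule dfun_subst[OF assms(1), of "\<lambda>i e. if i < n then v e ! i else 0"]) (rule *)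
  moreover have "map (\<lambda>i. if i < n then v e ! i else 0) [0..<n] = v e" for e
    using assms(2) by (auto simp: dlist_def intro: nth_equalityI)
  ultimately show ?thesis by simp
qed

section \<open>Definable sets as definable predicates\<close>

lemma definable_in_length: "definable_in M n S \<Longrightarrow> x \<in> S \<Longrightarrow> length x = n"
  by (auto simp: definable_in_def)

text \<open>\<open>definable_in\<close> reads the variables beyond \<open>n\<close> as 0, a
  \<open>dpred\<close> may read them freely. Truncating an environment to its first \<open>n\<close>
  entries is itself a definable substitution, and this passes from one to the other.\<close>

lemma definable_in_iff:
  fixes M :: "('f, 'r, 'a::linordered_field) expansion"
  shows   "definable_in M n S \<longleftrightarrow> S \<subseteq> {x. length x = n} \<and> dpred M (\<lambda>e. map e [0..<n] \<in> S)"
proof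
  assume "definable_in M n S"
  then obtain \<phi> where S: "S = {x. length x = n \<and> fo_sat M (\<lambda>i. if i < n then x ! i else 0) \<phi>}"
    unfolding definable_in_def by blast
  have "dfun M (\<lambda>e. if i < n then e i else 0)" for i
    by (cases "i < n") (simp_all add: dfun_var dfun_const)
  moreover have "dpred M (\<lambda>e. fo_sat M e \<phi>)" by (auto simp: dpred_def)
  ultimately have "dpred M (\<lambda>e. fo_sat M (\<lambda>i. if i < n then e i else 0) \<phi>)"
    using dpred_subst[where w="\<lambda>i e. if i < n then e i else 0"] by blast
  moreover have "(\<lambda>i. if i < n then map e [0..<n] ! i else 0) = (\<lambda>i. if i < n then e i else 0)" for e :: "nat \<Rightarrow> 'a"
    by auto
  ultimately show "S \<subseteq> {x. length x = n} \<and> dpred M (\<lambda>e. map e [0..<n] \<in> S)"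
    by (auto simp: S)
next
  assume *: "S \<subseteq> {x. length x = n} \<and> dpred M (\<lambda>e. map e [0..<n] \<in> S)"
  then obtain \<phi> where \<phi>: "\<forall>e. (map e [0..<n] \<in> S) = fo_sat M e \<phi>" unfolding dpred_def by blast
  have "(x \<in> S) = fo_sat M (\<lambda>i. if i < n then x ! i else 0) \<phi>" if "length x = n" for x :: "'a list"
  proof -
    have "map (\<lambda>i. if i < n then x ! i else 0) [0..<n] = x"
      using that by (auto intro: nth_equalityI)
    with \<phi>[rule_format, of "\<lambda>i. if i < n then x ! i else 0"] show ?thesis by simp
  qed
  with * have "S = {x. length x = n \<and> fo_sat M (\<lambda>i. if i < n then x ! i else 0) \<phi>}" by auto
  then show "definable_in M n S" unfolding definable_in_def by blast
qed

text \<open>A nonempty definable set determines its dimension, whereas the empty set is definable in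
  every dimension; hence the explicit condition on the lengths.\<close>

lemma definable_iff: "definable M S \<and> S \<subseteq> {x. length x = n} \<longleftrightarrow> definable_in M n S"
proof
  assume S: "definable M S \<and> S \<subseteq> {x. length x = n}"
  show "definable_in M n S"
  proof (cases "S = {}")
    case True
    then show ?thesis by (simp add: definable_in_iff dpred_const)
  next
    case False
    then obtain x where "x \<in> S" by blast
    moreover obtain m where m: "definable_in M m S" using S by (auto simp: definable_def)
    ultimately have "m = n" using S by (auto simp: definable_in_def)
    with m show ?thesis by simp
  qed
next
  assume "definable_in M n S"
  then show "definable M S \<and> S \<subseteq> {x. length x = n}"
    by (auto simp: definable_in_def definable_def)
qed

lemma dpred_mem:
  assumes "definable_in M n S" "dlist M n v"
  shows "dpred M (\<lambda>e. v e \<in> S)"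
  using assms dpred_subst_list[of M "\<lambda>x. x \<in> S" n v] by (simp add: definable_in_iff)

lemma dpred_bex:
  assumes "definable_in M n S" "dpred M (\<lambda>e. Q (map e [0..<n]) (\<lambda>i. e (n + i)))"
  shows "dpred M (\<lambda>e. \<exists>x\<in>S. Q x e)"
proof -
  have "dpred M (\<lambda>e. map e [0..<n] \<in> S \<and> Q (map e [0..<n]) (\<lambda>i. e (n + i)))"
    using assms by (intro dpred_conj) (auto simp: definable_in_iff)
  then have "dpred M (\<lambda>e. \<exists>x. length x = n \<and> x \<in> S \<and> Q x e)"
    by (rule dpred_ex_list[where Q="\<lambda>x e. x \<in> S \<and> Q x e"])
  moreover have "(\<exists>x. length x = n \<and> x \<in> S \<and> Q x e) = (\<exists>x\<in>S. Q x e)" for e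
    using definable_in_length[OF assms(1)] by blast
  ultimately show ?thesis by simp
qed

lemma dpred_ball:
  assumes "definable_in M n S" "dpred M (\<lambda>e. Q (map e [0..<n]) (\<lambda>i. e (n + i)))"
  shows "dpred M (\<lambda>e. \<forall>x\<in>S. Q x e)"
  using dpred_not[OF dpred_bex[OF assms(1), where Q="\<lambda>a e. \<not> Q a e", OF dpred_not[OF assms(2)]]] by simp

text \<open>The index may range over things that are not field elements, for instance over the
  charts of a finite cover, because the quantifier unfolds into a finite disjunction.\<close>

lemma dpred_bex_finite:
  assumes "finite I" "\<And>i. i \<in> I \<Longrightarrow> dpred M (P i)"
  shows "dpred M (\<lambda>e. \<exists>i\<in>I. P i e)"
  using assms by (induction I) (simp_all add: dpred_const dpred_disj)

lemma dpred_ex1: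
  assumes "dpred M (\<lambda>e. Q (e 0) (\<lambda>i. e (Suc i)))"
  shows "dpred M (\<lambda>e. \<exists>!a. Q a e)"
proof -
  have "dpred M (\<lambda>e. \<exists>a. \<forall>b. Q b e = (b = a))"
    by (intro dpred_ex dpred_all dpred_iff dpred_eq dfun_var)
      (use dpred_rename[OF assms, of "case_nat 0 (\<lambda>i. Suc (Suc i))"] in simp)
  then show ?thesis unfolding Ex1_def by (rule back_subst) (auto intro!: arg_cong[of _ _ "dpred M"])
qed

lemmas dintros = dpred_not dpred_conj dpred_disj dpred_imp dpred_iff dpred_const dpred_ex1 dpred_ex dpred_all
  dpred_eq dpred_less dpred_le dfun_add dfun_mult dfun_diff dfun_uminus dfun_divide_const
  dfun_if dfun_min dfun_max dfun_abs dfun_var dfun_const dlist_vars dlist_map_vars dlist_snoc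

subsection \<open>One-variable consequences of o-minimality\<close>

text \<open>The field need not be Dedekind complete, so being a supremum is a relation first;
  \<open>lub\<close> is meaningful only where existence has been proved, which for definable sets is
  \<open>is_lub_exists\<close>.\<close>

definition is_lub :: "'a::linorder \<Rightarrow> 'a set \<Rightarrow> bool" where
  "is_lub s S \<longleftrightarrow> (\<forall>x\<in>S. x \<le> s) \<and> (\<forall>u. (\<forall>x\<in>S. x \<le> u) \<longrightarrow> s \<le> u)"

definition lub :: "'a::linorder set \<Rightarrow> 'a" where
  "lub S = (THE s. is_lub s S)"

definition dset :: "('f, 'r, 'a::linordered_field) expansion \<Rightarrow> 'a set \<Rightarrow> bool" where
  "dset M S \<longleftrightarrow> dpred M (\<lambda>e. e 0 \<in> S)"

lemma is_lub_unique: "is_lub s S \<Longrightarrow> is_lub t S \<Longrightarrow> s = t"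
  unfolding is_lub_def by (meson order_antisym)

lemma lub_eq: "is_lub s S \<Longrightarrow> lub S = s"
  unfolding lub_def using is_lub_unique by (blast intro: the_equality)

text \<open>Through this the largest or smallest point of a finite fibre becomes a definable
  function by \<open>dfun_lub\<close>.\<close>

lemma is_lub_Max: "finite S \<Longrightarrow> S \<noteq> {} \<Longrightarrow> is_lub (Max S) S"
  by (auto simp: is_lub_def)

lemma is_lub_less: "is_lub s S \<Longrightarrow> u < s \<Longrightarrow> \<exists>x\<in>S. u < x"
  unfolding is_lub_def by (meson not_le)

lemma is_lub_upper: "is_lub s S \<Longrightarrow> x \<in> S \<Longrightarrow> x \<le> s"
  unfolding is_lub_def by blast

lemma is_lub_least: "is_lub s S \<Longrightarrow> (\<And>x. x \<in> S \<Longrightarrow> x \<le> u) \<Longrightarrow> s \<le> u"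
  unfolding is_lub_def by blast

text \<open>Freezing all variables but the first turns their values into parameters. So o-minimality
  applies to each single member of a definable family of sets.\<close>

lemma dpred_params:
  fixes e :: "nat \<Rightarrow> 'a::linordered_field"
  assumes "dpred M (\<lambda>e. Q (e 0) (\<lambda>i. e (Suc i)))"
  shows "dset M {a. Q a e}"
proof -
  have "dfun M (case_nat (\<lambda>e. e 0) (\<lambda>i _. e i) i)" for i
    by (auto split: nat.split simp: dfun_var dfun_const)
  from dpred_subst[OF assms, of "case_nat (\<lambda>e. e 0) (\<lambda>i _. e i)", OF this]
  show ?thesis unfolding dset_def by simp
qed

text \<open>Being the least upper bound is a first-order condition. A supremum must exist for every
  environment, since otherwise \<open>lub\<close> is an arbitrary value; this is why many of the
  sets used later carry a default element such as \<open>0\<close> or \<open>-1\<close>.\<close>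

lemma dfun_lub:
  assumes "dpred M (\<lambda>e. Q (e 0) (\<lambda>i. e (Suc i)))"
    and "\<And>e. \<exists>s. is_lub s {a. Q a e}"
  shows "dfun M (\<lambda>e. lub {a. Q a e})"
proof -
  have eq: "e 0 = lub {a. Q a (\<lambda>i. e (Suc i))} \<longleftrightarrow>
      (\<forall>x. Q x (\<lambda>i. e (Suc i)) \<longrightarrow> x \<le> e 0) \<and>
      (\<forall>u. (\<forall>x. Q x (\<lambda>i. e (Suc i)) \<longrightarrow> x \<le> u) \<longrightarrow> e 0 \<le> u)" for e
  proof -
    obtain s where s: "is_lub s {a. Q a (\<lambda>i. e (Suc i))}" using assms(2) by blast
    have "e 0 = lub {a. Q a (\<lambda>i. e (Suc i))} \<longleftrightarrow> is_lub (e 0) {a. Q a (\<lambda>i. e (Suc i))}"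
      unfolding lub_eq[OF s] using s is_lub_unique[OF s, of "e 0"] by blast
    then show ?thesis by (simp add: is_lub_def)
  qed
  have Q1: "dpred M (\<lambda>e. Q (e 0) (\<lambda>i. e (Suc (Suc i))))"
    using dpred_rename[OF assms(1), of "case_nat 0 (\<lambda>i. Suc (Suc i))"] by simp
  have Q2: "dpred M (\<lambda>e. Q (e 0) (\<lambda>i. e (Suc (Suc (Suc i)))))"
    using dpred_rename[OF assms(1), of "case_nat 0 (\<lambda>i. Suc (Suc (Suc i)))"] by simp
  have A1: "dpred M (\<lambda>e. \<forall>x. Q x (\<lambda>i. e (Suc i)) \<longrightarrow> x \<le> e 0)"
    by (rule dpred_all, rule dpred_imp, rule Q1) (intro dpred_le dfun_var)
  have A2: "dpred M (\<lambda>e. \<forall>x. Q x (\<lambda>i. e (Suc (Suc i))) \<longrightarrow> x \<le> e 0)"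
    by (rule dpred_all, rule dpred_imp, rule Q2) (intro dpred_le dfun_var)
  have A3: "dpred M (\<lambda>e. \<forall>u. (\<forall>x. Q x (\<lambda>i. e (Suc i)) \<longrightarrow> x \<le> u) \<longrightarrow> e 0 \<le> u)"
    by (rule dpred_all, rule dpred_imp, rule A2) (intro dpred_le dfun_var)
  show ?thesis unfolding dfun_def eq by (rule dpred_conj[OF A1 A3])
qed

lemma o_minimal_dset:
  assumes "o_minimal M" "dset M S"
  obtains \<J> where "finite \<J>" "\<J> \<subseteq> points_and_open_intervals" "S = \<Union>\<J>"
proof -
  have "definable_in M 1 {[a] |a. a \<in> S}"
    using assms(2) by (auto simp: definable_in_iff dset_def)
  from assms(1)[unfolded o_minimal_def, rule_format, OF this] obtain \<J> where "finite \<J>" "\<J> \<subseteq> points_and_open_intervals" "{a. [a] \<in> {[a] |a. a \<in> S}} = \<Union>\<J>"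
    by (elim exE conjE)
  with that show ?thesis by simp
qed

lemma interval_germ_right:
  fixes a :: "'a::linordered_field"
  assumes "J \<in> points_and_open_intervals"
  shows "\<exists>\<epsilon>>0. (\<forall>t. a < t \<and> t < a + \<epsilon> \<longrightarrow> t \<in> J) \<or> (\<forall>t. a < t \<and> t < a + \<epsilon> \<longrightarrow> t \<notin> J)"
proof -
  consider c where "J = {c}" | b c where "J = {b<..<c}" | c where "J = {..<c}" | c where "J = {c<..}"
    | "J = UNIV" using assms unfolding points_and_open_intervals_def by blast
  then show ?thesis
  proof cases
    case (1 c)
    then show ?thesis by (intro exI[of _ "if a < c then c - a else 1"]) auto
  next
    case (2 b c)
    then show ?thesis by (intro exI[of _ "if a < b then b - a else if a < c then c - a else 1"]) auto
  next
    case (3 c)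
    then show ?thesis by (intro exI[of _ "if a < c then c - a else 1"]) auto
  next
    case (4 c)
    then show ?thesis by (intro exI[of _ "if a < c then c - a else 1"]) auto
  next
    case 5
    then show ?thesis by (intro exI[of _ 1]) auto
  qed
qed

text \<open>Each of the finitely many intervals and points is decided just to the right of
  \<open>a\<close>, and the least of their radii works for the union. The use is to turn "not
  eventually true" into "eventually false".\<close>

lemma germ_right:
  assumes "o_minimal M" "dset M S"
  shows "\<exists>\<epsilon>>0. (\<forall>t. a < t \<and> t < a + \<epsilon> \<longrightarrow> t \<in> S) \<or> (\<forall>t. a < t \<and> t < a + \<epsilon> \<longrightarrow> t \<notin> S)"
proof -
  obtain \<J> where J: "finite \<J>" "\<J> \<subseteq> points_and_open_intervals" "S = \<Union>\<J>"
    using o_minimal_dset[OF assms] .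
  have "\<exists>\<epsilon>>0. (\<forall>t. a < t \<and> t < a + \<epsilon> \<longrightarrow> t \<in> \<Union>\<J>) \<or> (\<forall>t. a < t \<and> t < a + \<epsilon> \<longrightarrow> t \<notin> \<Union>\<J>)"
    using J(1,2)
  proof (induction \<J>)
    case empty
    show ?case by (intro exI[of _ 1]) simp
  next
    case (insert J \<J>)
    obtain \<epsilon> where \<epsilon>: "\<epsilon> > 0"
      "(\<forall>t. a < t \<and> t < a + \<epsilon> \<longrightarrow> t \<in> J) \<or> (\<forall>t. a < t \<and> t < a + \<epsilon> \<longrightarrow> t \<notin> J)"
      using interval_germ_right[of J a] insert.prems by auto
    obtain \<delta> where \<delta>: "\<delta> > 0"
      "(\<forall>t. a < t \<and> t < a + \<delta> \<longrightarrow> t \<in> \<Union>\<J>) \<or> (\<forall>t. a < t \<and> t < a + \<delta> \<longrightarrow> t \<notin> \<Union>\<J>)"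
      using insert by auto
    have "t < a + \<epsilon> \<and> t < a + \<delta>" if "t < a + min \<epsilon> \<delta>" for t using that by auto
    then show ?case using \<epsilon> \<delta> by (intro exI[of _ "min \<epsilon> \<delta>"]) auto
  qed
  with J show ?thesis by simp
qed

lemma interval_lub:
  fixes J :: "'a::linordered_field set"
  assumes "J \<in> points_and_open_intervals" "J \<noteq> {}" "\<forall>x\<in>J. x \<le> u"
  shows "\<exists>s. is_lub s J"
proof -
  consider c where "J = {c}" | b c where "J = {b<..<c}" "b < c" | c where "J = {..<c}" | c where "J = {c<..}"
    | "J = UNIV" using assms(1) unfolding points_and_open_intervals_def by blast
  then show ?thesis
  proof cases
    case (1 c)
    then show ?thesis by (intro exI[of _ c]) (auto simp: is_lub_def)
  next
    case (2 b c)
    have *: "c \<le> v" if v: "\<forall>x\<in>{b<..<c}. x \<le> v" for v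
      by (rule dense_le_bounded[OF 2(2)]) (use v in auto)
    have "is_lub c J" unfolding 2(1) is_lub_def by (intro conjI allI impI, simp, rule *)
    then show ?thesis by blast
  next
    case (3 c)
    have *: "c \<le> v" if v: "\<forall>x\<in>{..<c}. x \<le> v" for v
      by (rule dense_le) (use v in auto)
    have "is_lub c J" unfolding 3 is_lub_def by (intro conjI allI impI, simp, rule *)
    then show ?thesis by blast
  next
    case (4 c)
    have "c < max c u + 1" by (rule le_less_trans[OF max.cobounded1 less_add_one])
    with 4 have "max c u + 1 \<le> u" using assms(3) by simp
    moreover have "u < max c u + 1" by (rule le_less_trans[OF max.cobounded2 less_add_one])
    ultimately show ?thesis by simp
  next
    case 5
    then have "u + 1 \<le> u" using assms(3) by blast
    then show ?thesis by simp
  qed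
qed

text \<open>Definable completeness, the substitute for completeness of the reals: the supremum of a
  finite union is the largest of the suprema of its nonempty members.\<close>

lemma is_lub_exists:
  assumes "o_minimal M" "dset M S" "S \<noteq> {}" "\<And>x. x \<in> S \<Longrightarrow> x \<le> u"
  shows "\<exists>s. is_lub s S"
proof -
  obtain \<J> where J: "finite \<J>" "\<J> \<subseteq> points_and_open_intervals" "S = \<Union>\<J>"
    using o_minimal_dset[OF assms(1,2)] .
  have "\<Union>\<J> = {} \<or> (\<exists>s. is_lub s (\<Union>\<J>))" if "\<forall>x\<in>\<Union>\<J>. x \<le> u"
    using J(1,2) that
  proof (induction \<J>)
    case (insert J \<J>)
    consider "\<Union>\<J> = {}" | "J = {}" | "J \<noteq> {}" "\<Union>\<J> \<noteq> {}" by blast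
    then show ?case
    proof cases
      case 1
      then have "\<Union>(insert J \<J>) = J" by auto
      then show ?thesis using interval_lub[of J u] insert.prems by auto
    next
      case 2
      then show ?thesis using insert by auto
    next
      case 3
      obtain s where s: "is_lub s J" using interval_lub[of J u] insert.prems 3 by auto
      obtain t where t: "is_lub t (\<Union>\<J>)" using insert 3 by auto
      have "is_lub (max s t) (J \<union> \<Union>\<J>)"
        unfolding is_lub_def
      proof (intro conjI ballI allI impI)
        show "x \<le> max s t" if "x \<in> J \<union> \<Union>\<J>" for x
          using that is_lub_upper[OF s] is_lub_upper[OF t] by (auto simp: le_max_iff_disj)
        show "max s t \<le> v" if "\<forall>x\<in>J \<union> \<Union>\<J>. x \<le> v" for v
          using that is_lub_least[OF s, of v] is_lub_least[OF t, of v] by auto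
      qed
      then show ?thesis by auto
    qed
  qed simp
  with J assms(3,4) show ?thesis by auto
qed

text \<open>The form in which o-minimality is mostly used below: a definable exceptional set is
  finite unless it fills an interval, and on that interval a contradiction can be sought.\<close>

lemma infinite_contains_interval:
  assumes "o_minimal M" "dset M S" "infinite S"
  obtains a b where "a < b" "{a<..<b} \<subseteq> S"
proof -
  obtain \<J> where J: "finite \<J>" "\<J> \<subseteq> points_and_open_intervals" "S = \<Union>\<J>"
    using o_minimal_dset[OF assms(1,2)] .
  then obtain J where "J \<in> \<J>" "infinite J" using assms(3) by blast
  then have "J \<in> points_and_open_intervals" "J \<subseteq> S" using J by auto
  then consider c where "J = {c}" | b c where "J = {b<..<c}" "b < c" | c where "J = {..<c}" | c where "J = {c<..}"
    | "J = UNIV" unfolding points_and_open_intervals_def by blast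
  then have "\<exists>a b. a < b \<and> {a<..<b} \<subseteq> J"
  proof cases
    case (1 c)
    then show ?thesis using \<open>infinite J\<close> by simp
  next
    case (2 b c)
    then show ?thesis by blast
  next
    case (3 c)
    then show ?thesis by (intro exI[of _ "c - 1"] exI[of _ c]) auto
  next
    case (4 c)
    then show ?thesis by (intro exI[of _ "c"] exI[of _ "c + 1"]) auto
  next
    case 5
    then show ?thesis by (intro exI[of _ 0] exI[of _ 1]) auto
  qed
  with \<open>J \<subseteq> S\<close> that show ?thesis by blast
qed

text \<open>The limit is the supremum \<open>c\<close> of the numbers that lie strictly below
  \<open>f\<close> just to the right of \<open>x\<close>. A number above \<open>c\<close> is not
  such a lower bound, so by \<open>germ_right\<close> it is eventually an upper bound; it is only a
  weak one, whence \<open>\<epsilon> / 2\<close> in place of \<open>\<epsilon>\<close>.\<close>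

lemma right_limit:
  fixes M :: "('f, 'r, 'a::linordered_field) expansion"
  assumes "o_minimal M" "dfun M (\<lambda>e. f (e 0))" and bd: "\<And>x. l \<le> f x \<and> f x \<le> u"
  shows "\<exists>c. \<forall>\<epsilon>>0. \<exists>\<delta>>0. \<forall>y. x < y \<and> y < x + \<delta> \<longrightarrow> \<bar>f y - c\<bar> < \<epsilon>"
proof -
  define C where "C = {c. \<exists>\<delta>>0. \<forall>y. x < y \<and> y < x + \<delta> \<longrightarrow> c < f y}"
  have fd: "dfun M (\<lambda>e. f (e k))" for k
    using dfun_rename[OF assms(2), of "\<lambda>_. k"] by simp
  have "dset M C"
    unfolding dset_def C_def mem_Collect_eq
    by (intro dintros fd)
  moreover have "l - 1 \<in> C"
  proof -
    have "l - 1 < f y" for y using bd[of y] by linarith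
    then show ?thesis unfolding C_def using zero_less_one by blast
  qed
  moreover have "c \<le> u" if "c \<in> C" for c
  proof -
    from that obtain \<delta> where \<delta>: "\<delta> > 0" "\<forall>y. x < y \<and> y < x + \<delta> \<longrightarrow> c < f y" by (auto simp: C_def)
    have "c < f (x + \<delta> / 2)" by (rule \<delta>(2)[rule_format]) (use \<delta>(1) in \<open>simp add: field_simps\<close>)
    then show ?thesis using bd[of "x + \<delta> / 2"] by linarith
  qed
  ultimately obtain c where c: "is_lub c C" using is_lub_exists[OF assms(1)] by (metis empty_iff)
  show ?thesis
  proof (rule exI[of _ c], intro allI impI)
    fix \<epsilon> :: 'a assume "\<epsilon> > 0"
    then obtain c1 where c1: "c1 \<in> C" "c - \<epsilon> < c1" using is_lub_less[OF c, of "c - \<epsilon>"] by auto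
    then obtain \<delta> where \<delta>: "\<delta> > 0" "\<forall>y. x < y \<and> y < x + \<delta> \<longrightarrow> c1 < f y" by (auto simp: C_def)
    have "c + \<epsilon> / 2 \<notin> C" using is_lub_upper[OF c, of "c + \<epsilon> / 2"] \<open>\<epsilon> > 0\<close> by auto
    moreover have "dset M {y. c + \<epsilon> / 2 < f y}"
      unfolding dset_def mem_Collect_eq by (intro dintros fd)
    ultimately obtain \<eta> where \<eta>: "\<eta> > 0" "\<forall>y. x < y \<and> y < x + \<eta> \<longrightarrow> \<not> c + \<epsilon> / 2 < f y"
      using germ_right[OF assms(1), of "{y. c + \<epsilon> / 2 < f y}" x] by (auto simp: C_def)
    have "\<bar>f y - c\<bar> < \<epsilon>" if "x < y" "y < x + min \<delta> \<eta>" for y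
    proof -
      have "c1 < f y" "\<not> c + \<epsilon> / 2 < f y" using \<delta> \<eta> that by auto
      moreover have "\<epsilon> / 2 < \<epsilon>" using \<open>\<epsilon> > 0\<close> by simp
      ultimately show ?thesis using c1(2) unfolding abs_less_iff by linarith
    qed
    then show "\<exists>\<delta>>0. \<forall>y. x < y \<and> y < x + \<delta> \<longrightarrow> \<bar>f y - c\<bar> < \<epsilon>"
      using \<delta>(1) \<eta>(1) by (intro exI[of _ "min \<delta> \<eta>"]) auto
  qed
qed

definition cont_at :: "('a::linordered_field \<Rightarrow> 'a) \<Rightarrow> 'a \<Rightarrow> bool" where
  "cont_at f x \<longleftrightarrow> (\<forall>\<epsilon>>0. \<exists>\<delta>>0. \<forall>y. \<bar>y - x\<bar> < \<delta> \<longrightarrow> \<bar>f y - f x\<bar> < \<epsilon>)"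

text \<open>
  If \<open>f\<close> were discontinuous throughout an interval, its oscillation \<open>g\<close> would be positive there,
  while \<open>{g \<ge> \<epsilon>}\<close> is finite for every \<open>\<epsilon> > 0\<close> because \<open>f\<close> has one-sided limits. So the range of
  \<open>g\<close>, which is definable, has only finitely many points above every \<open>\<epsilon> > 0\<close>; it is therefore
  finite, which makes the interval finite.
\<close>

lemma continuous_on_subinterval:
  fixes M :: "('f, 'r, 'a::linordered_field) expansion"
  assumes "o_minimal M" and df: "dfun M (\<lambda>e. f (e 0))" and bd: "\<And>x. l \<le> f x \<and> f x \<le> u" and "a < b"
  obtains c d where "c < d" "{c<..<d} \<subseteq> {a<..<b}" "\<And>x. c < x \<Longrightarrow> x < d \<Longrightarrow> cont_at f x"
proof -
  have fd: "dfun M (\<lambda>e. f (e k))" for k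
    using dfun_rename[OF df, of "\<lambda>_. k"] by simp
  define D where "D = {x. a < x \<and> x < b \<and> \<not> cont_at f x}"
  have D: "dset M D"
    unfolding dset_def D_def mem_Collect_eq cont_at_def by (intro dintros fd)
  have "finite D"
  proof (rule ccontr)
    assume "infinite D"
    then obtain c d where cd: "c < d" "{c<..<d} \<subseteq> D" using infinite_contains_interval[OF assms(1) D] by blast
    \<comment> \<open>\<open>O' x \<epsilon>\<close>: \<open>f\<close> oscillates by at least
      \<open>\<epsilon>\<close> in every neighbourhood of \<open>x\<close>. The oscillation
      \<open>g\<close> below is the supremum of these \<open>\<epsilon>\<close>, with 0 added so
      that it exists at points of continuity too.\<close>
    define O' where "O' x \<epsilon> \<longleftrightarrow> (\<forall>\<delta>>0. \<exists>y z. \<bar>y - x\<bar> < \<delta> \<and> \<bar>z - x\<bar> < \<delta> \<and> \<epsilon> \<le> \<bar>f y - f z\<bar>)" for x \<epsilon>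
    have O': "dpred M (\<lambda>e. O' (e i) (e j))" for i j
      unfolding O'_def by (intro dintros fd)
    have O'_mono: "O' x \<epsilon> \<Longrightarrow> \<eta> \<le> \<epsilon> \<Longrightarrow> O' x \<eta>" for x \<epsilon> \<eta>
      unfolding O'_def by (meson order_trans)
    define g where "g x = lub {\<epsilon>. \<epsilon> = 0 \<or> 0 < \<epsilon> \<and> O' x \<epsilon>}" for x
    have O'_bd: "\<epsilon> \<le> u - l" if *: "O' x \<epsilon>" for x \<epsilon>
    proof -
      obtain y z where "\<epsilon> \<le> \<bar>f y - f z\<bar>" using *[unfolded O'_def, rule_format, OF zero_less_one] by blast
      then show ?thesis using bd[of y] bd[of z] by linarith
    qed
    have lub: "\<exists>s. is_lub s {\<epsilon>. \<epsilon> = 0 \<or> 0 < \<epsilon> \<and> O' x \<epsilon>}" for x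
    proof (rule is_lub_exists[OF assms(1)])
      show "dset M {\<epsilon>. \<epsilon> = 0 \<or> 0 < \<epsilon> \<and> O' x \<epsilon>}"
        by (rule dpred_params[where Q="\<lambda>\<epsilon> e. \<epsilon> = 0 \<or> 0 < \<epsilon> \<and> O' (e 0) \<epsilon>" and e="\<lambda>_. x"])
          (intro dintros O')
      have "l \<le> u" using bd order_trans by blast
      then show "\<epsilon> \<le> u - l" if "\<epsilon> \<in> {\<epsilon>. \<epsilon> = 0 \<or> 0 < \<epsilon> \<and> O' x \<epsilon>}" for \<epsilon>
        using that O'_bd by auto
    qed auto
    have gd: "dfun M (\<lambda>e. g (e k))" for k
      unfolding g_def by (rule dfun_lub[where Q="\<lambda>\<epsilon> e. \<epsilon> = 0 \<or> 0 < \<epsilon> \<and> O' (e k) \<epsilon>"]) (intro dintros O', rule lub)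
    have g: "is_lub (g x) {\<epsilon>. \<epsilon> = 0 \<or> 0 < \<epsilon> \<and> O' x \<epsilon>}" for x
      using lub[of x] lub_eq unfolding g_def by metis
    have g_pos: "0 < g x" if "c < x" "x < d" for x
    proof -
      have "\<not> cont_at f x" using that cd(2) by (auto simp: D_def)
      then obtain \<epsilon> where \<epsilon>: "\<epsilon> > 0" "\<forall>\<delta>>0. \<exists>y. \<bar>y - x\<bar> < \<delta> \<and> \<epsilon> \<le> \<bar>f y - f x\<bar>"
        unfolding cont_at_def not_less[symmetric] by blast
      have "O' x \<epsilon>" unfolding O'_def
      proof (intro allI impI)
        fix \<delta> :: 'a assume "\<delta> > 0"
        with \<epsilon>(2) obtain y where "\<bar>y - x\<bar> < \<delta>" "\<epsilon> \<le> \<bar>f y - f x\<bar>" by blast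
        then show "\<exists>y z. \<bar>y - x\<bar> < \<delta> \<and> \<bar>z - x\<bar> < \<delta> \<and> \<epsilon> \<le> \<bar>f y - f z\<bar>"
          using \<open>\<delta> > 0\<close> by (intro exI[of _ y] exI[of _ x]) simp
      qed
      then show ?thesis using is_lub_upper[OF g, of \<epsilon>] \<epsilon>(1) by fastforce
    qed
    have fin: "finite {x. c < x \<and> x < d \<and> O' x \<epsilon>}" if "\<epsilon> > 0" for \<epsilon>
    proof (rule ccontr)
      assume inf: "infinite {x. c < x \<and> x < d \<and> O' x \<epsilon>}"
      have O'c: "dpred M (\<lambda>e. O' (e 0) \<epsilon>)"
        by (rule dpred_subst2[where P=O' and f="\<lambda>e. e 0" and g="\<lambda>e. \<epsilon>"]) (rule O' dfun_var dfun_const)+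
      have "dset M {x. c < x \<and> x < d \<and> O' x \<epsilon>}"
        unfolding dset_def mem_Collect_eq by (intro dintros O'c)
      then obtain p q where pq: "p < q" "{p<..<q} \<subseteq> {x. c < x \<and> x < d \<and> O' x \<epsilon>}"
        using infinite_contains_interval[OF assms(1) _ inf] by metis
      \<comment> \<open>Close to the right of \<open>p\<close> all values of \<open>f\<close> lie
        within \<open>\<epsilon> / 2\<close> of the one-sided limit \<open>k\<close>, so
        \<open>f\<close> cannot oscillate by \<open>\<epsilon>\<close> at a point there.\<close>
      obtain k where "\<forall>\<epsilon>>0. \<exists>\<delta>>0. \<forall>y. p < y \<and> y < p + \<delta> \<longrightarrow> \<bar>f y - k\<bar> < \<epsilon>"
        using right_limit[OF assms(1) df bd] by blast
      moreover have "\<epsilon> / 2 > 0" using that by simp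
      ultimately obtain \<delta> where \<delta>: "\<delta> > 0" "\<forall>y. p < y \<and> y < p + \<delta> \<longrightarrow> \<bar>f y - k\<bar> < \<epsilon> / 2"
        by meson
      obtain x where x: "p < x" "x < min q (p + \<delta>)" using dense[of p "min q (p + \<delta>)"] pq(1) \<delta>(1) by auto
      have "O' x \<epsilon>" using pq(2) x by auto
      moreover have "0 < min (x - p) (p + \<delta> - x)" using x by auto
      ultimately obtain y z where yz: "\<bar>y - x\<bar> < min (x - p) (p + \<delta> - x)" "\<bar>z - x\<bar> < min (x - p) (p + \<delta> - x)"
        "\<epsilon> \<le> \<bar>f y - f z\<bar>" unfolding O'_def by blast
      have "p < y" "y < p + \<delta>" "p < z" "z < p + \<delta>" using yz(1,2) by (simp_all add: abs_less_iff)
      then have "\<bar>f y - k\<bar> < \<epsilon> / 2" "\<bar>f z - k\<bar> < \<epsilon> / 2" using \<delta>(2) by auto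
      then show False using yz(3) by (simp add: abs_less_iff abs_if split: if_splits)
    qed
    \<comment> \<open>The supremum \<open>g x\<close> need not be attained by an oscillation; only
      smaller values are sure to occur, hence \<open>\<epsilon> / 2\<close>.\<close>
    have fin_g: "finite {x. c < x \<and> x < d \<and> \<epsilon> \<le> g x}" if "\<epsilon> > 0" for \<epsilon>
    proof (rule finite_subset[OF _ fin])
      show "\<epsilon> / 2 > 0" using that by simp
      show "{x. c < x \<and> x < d \<and> \<epsilon> \<le> g x} \<subseteq> {x. c < x \<and> x < d \<and> O' x (\<epsilon> / 2)}"
      proof clarify
        fix x assume "\<epsilon> \<le> g x"
        then have "\<epsilon> / 2 < g x" using that by (simp add: field_simps)
        then obtain \<eta> where "\<eta> \<in> {\<epsilon>. \<epsilon> = 0 \<or> 0 < \<epsilon> \<and> O' x \<epsilon>}" "\<epsilon> / 2 < \<eta>" using is_lub_less[OF g] by blast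
        then show "O' x (\<epsilon> / 2)" using that O'_mono[of x \<eta> "\<epsilon> / 2"] by auto
      qed
    qed
    have "dset M (g ` {c<..<d})"
    proof -
      have "dpred M (\<lambda>e. \<exists>x. c < x \<and> x < d \<and> e 0 = g x)" by (intro dintros gd)
      then show ?thesis unfolding dset_def by (rule back_subst) (intro arg_cong[of _ _ "dpred M"] ext, auto)
    qed
    show False
    proof (cases "finite (g ` {c<..<d})")
      case True
      moreover have "g ` {c<..<d} \<noteq> {}" using cd(1) by simp
      ultimately have "Min (g ` {c<..<d}) \<in> g ` {c<..<d}" by (rule Min_in)
      then have "Min (g ` {c<..<d}) > 0" using g_pos by auto
      then have "finite {x. c < x \<and> x < d \<and> Min (g ` {c<..<d}) \<le> g x}" by (rule fin_g)
      moreover have "{x. c < x \<and> x < d \<and> Min (g ` {c<..<d}) \<le> g x} = {c<..<d}" using True by auto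
      ultimately show False using infinite_Ioo[OF cd(1)] by simp
    next
      case False
      then obtain p q where pq: "p < q" "{p<..<q} \<subseteq> g ` {c<..<d}"
        using infinite_contains_interval[OF assms(1) \<open>dset M (g ` {c<..<d})\<close>] by blast
      obtain m where m: "p < m" "m < q" using dense pq(1) by blast
      then have "m > 0" using pq(2) g_pos by auto
      then have "finite (g ` {x. c < x \<and> x < d \<and> m \<le> g x})" using fin_g by blast
      moreover have "{m<..<q} \<subseteq> g ` {x. c < x \<and> x < d \<and> m \<le> g x}"
      proof
        fix y assume "y \<in> {m<..<q}"
        then have "y \<in> g ` {c<..<d}" "m \<le> y" using pq(2) m by auto
        then show "y \<in> g ` {x. c < x \<and> x < d \<and> m \<le> g x}" by auto
      qed
      ultimately show False using infinite_Ioo[OF m(2)] finite_subset by blast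
    qed
  qed
  define C where "C = {x. a < x \<and> x < b \<and> x \<notin> D}"
  have "dset M C"
    using D unfolding dset_def C_def mem_Collect_eq by (intro dintros)
  moreover have "C = {a<..<b} - D" by (auto simp: C_def)
  then have "infinite C" using \<open>finite D\<close> infinite_Ioo[OF \<open>a < b\<close>] by simp
  ultimately obtain c d where cd: "c < d" "{c<..<d} \<subseteq> C"
    using infinite_contains_interval[OF assms(1)] by blast
  show ?thesis
  proof (rule that[OF cd(1)])
    show "{c<..<d} \<subseteq> {a<..<b}" using cd(2) by (auto simp: C_def)
    show "cont_at f x" if "c < x" "x < d" for x
      using that cd(2) by (auto simp: C_def D_def)
  qed
qed

subsection \<open>Uniform finiteness\<close>

text \<open>
  A fibred family \<open>R\<close> of finite sets is regular at \<open>(a, b)\<close> if near that point it is either empty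
  or consists of one continuous branch through \<open>(a, b)\<close>.
\<close>

definition regular_at :: "('a::linordered_field \<Rightarrow> 'a \<Rightarrow> bool) \<Rightarrow> 'a \<Rightarrow> 'a \<Rightarrow> bool" where
  "regular_at R a b \<longleftrightarrow>
     (\<exists>\<epsilon>>0. \<forall>x t. \<bar>x - a\<bar> < \<epsilon> \<longrightarrow> \<bar>t - b\<bar> < \<epsilon> \<longrightarrow> \<not> R x t) \<or>
     R a b \<and> (\<forall>\<eta>>0. \<exists>\<delta>>0. \<forall>x. \<bar>x - a\<bar> < \<delta> \<longrightarrow> (\<exists>t. R x t \<and> \<bar>t - b\<bar> < \<eta>)) \<and>
     (\<exists>\<epsilon>>0. \<forall>x s t. \<bar>x - a\<bar> < \<epsilon> \<longrightarrow> R x s \<longrightarrow> R x t \<longrightarrow> \<bar>s - b\<bar> < \<epsilon> \<longrightarrow> \<bar>t - b\<bar> < \<epsilon> \<longrightarrow> s = t)"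

definition irregular :: "('a::linordered_field \<Rightarrow> 'a \<Rightarrow> bool) \<Rightarrow> 'a \<Rightarrow> bool" where
  "irregular R a \<longleftrightarrow> (\<exists>b. 0 \<le> b \<and> b \<le> 1 \<and> \<not> regular_at R a b)"

lemma lub_finite:
  assumes "finite S" "S \<noteq> {}" shows "lub S \<in> S" and "x \<in> S \<Longrightarrow> x \<le> lub S"
  using assms by (simp_all add: lub_eq[OF is_lub_Max[OF assms]])

lemma dpred_subst1:
  assumes "dpred M (\<lambda>e. P (e 0))" "dfun M f" shows "dpred M (\<lambda>e. P (f e))"
  using dpred_subst2[of M "\<lambda>x y. P x" f f] assms by simp

lemma dfun_subst1:
  assumes "dfun M (\<lambda>e. F (e 0))" "dfun M f" shows "dfun M (\<lambda>e. F (f e))"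
  using dfun_subst2[of M "\<lambda>x y. F x" f f] assms by simp

lemma dpred_regular_at:
  assumes R: "dpred M (\<lambda>e. R (e 0) (e 1))" and "dfun M f" "dfun M g"
  shows "dpred M (\<lambda>e. regular_at R (f e) (g e))"
proof (rule dpred_subst2[where P="regular_at R", OF _ assms(2,3)])
  show "dpred M (\<lambda>e. regular_at R (e 0) (e 1))"
    unfolding regular_at_def by (intro dintros dpred_subst2[where P=R, OF R])
qed

lemma dpred_irregular:
  assumes R: "dpred M (\<lambda>e. R (e 0) (e 1))" and "dfun M f"
  shows "dpred M (\<lambda>e. irregular R (f e))"
proof (rule dpred_subst1[where P="irregular R", OF _ assms(2)])
  show "dpred M (\<lambda>e. irregular R (e 0))"
    unfolding irregular_def by (intro dintros dpred_regular_at R)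
qed

text \<open>
  On an interval of irregular points the infimum \<open>\<beta>\<close> of the irregular heights and the nearest
  branches \<open>u > \<beta>\<close>, \<open>v < \<beta>\<close> would be continuous somewhere. There the family near the graph of
  \<open>\<beta>\<close> is empty or equal to that graph, so that all heights close to \<open>\<beta>\<close> are regular.
\<close>

lemma finite_irregular:
  fixes M :: "('f, 'r, 'a::linordered_field) expansion"
  assumes om: "o_minimal M" and R: "dpred M (\<lambda>e. R (e 0) (e 1))"
    and bd': "\<forall>x t. R x t \<longrightarrow> 0 \<le> t \<and> t \<le> 1" and fin: "\<And>x. finite {t. R x t}"
  shows "finite {a. irregular R a}"
proof (rule ccontr)
  assume inf: "infinite {a. irregular R a}"
  note R' = dpred_subst2[where P=R, OF R] and bd = bd'[rule_format]
  have "dset M {a. irregular R a}"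
    unfolding dset_def mem_Collect_eq by (intro dpred_irregular R dfun_var)
  then obtain a0 b0 where ab0: "a0 < b0" "{a0<..<b0} \<subseteq> {a. irregular R a}"
    using infinite_contains_interval[OF om _ inf] by blast
  \<comment> \<open>Heights are negated so that their infimum becomes a supremum. The default
    \<open>-1\<close> stands for height 1, the upper end of the range, and keeps the set nonempty
    for every \<open>a\<close>.\<close>
  define B where "B a = {s. s = -1 \<or> -1 \<le> s \<and> s \<le> 0 \<and> \<not> regular_at R a (- s)}" for a
  define \<beta> where "\<beta> a = - lub (B a)" for a
  have lubB: "\<exists>s. is_lub s (B a)" for a
  proof (rule is_lub_exists[OF om, where u=0])
    show "dset M (B a)" unfolding B_def
      by (rule dpred_params[where e="\<lambda>_. a" and
            Q="\<lambda>s e. s = -1 \<or> -1 \<le> s \<and> s \<le> 0 \<and> \<not> regular_at R (e 0) (- s)"])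
        (intro dintros dpred_regular_at R)
  qed (auto simp: B_def)
  then have B: "is_lub (- \<beta> a) (B a)" for a using lub_eq unfolding \<beta>_def minus_minus by metis
  have \<beta>0: "dfun M (\<lambda>e. \<beta> (e 0))"
    unfolding \<beta>_def B_def
    by (intro dfun_uminus dfun_lub[where Q="\<lambda>s e. s = -1 \<or> -1 \<le> s \<and> s \<le> 0 \<and> \<not> regular_at R (e 0) (- s)"]
        dintros dpred_regular_at R lubB[unfolded B_def])
  note \<beta>' = dfun_subst1[where F=\<beta>, OF \<beta>0]
  have \<beta>_bd: "0 \<le> \<beta> a \<and> \<beta> a \<le> 1" for a
  proof -
    have "- \<beta> a \<le> 0" by (rule is_lub_least[OF B]) (auto simp: B_def)
    moreover have "-1 \<le> - \<beta> a" by (rule is_lub_upper[OF B]) (simp add: B_def)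
    ultimately show ?thesis by simp
  qed
  \<comment> \<open>Negated like \<open>B\<close>. The default \<open>-2\<close> puts
    \<open>u a\<close> at height 2, above the whole range, so that \<open>\<beta> a < u a\<close>
    always holds; the default \<open>-1\<close> in \<open>V\<close> below does the same for
    \<open>v a < \<beta> a\<close>.\<close>
  define U where "U a = {s. s = -2 \<or> R a (- s) \<and> \<beta> a < - s}" for a
  define u where "u a = - lub (U a)" for a
  have finU: "finite (U a)" for a
  proof -
    have "U a \<subseteq> insert (-2) (uminus ` {t. R a t})" unfolding U_def by (auto simp: image_iff) (metis minus_minus)
    then show ?thesis using fin finite_subset by blast
  qed
  have "U a \<noteq> {}" for a by (auto simp: U_def)
  note U = lub_finite[OF finU this]
  have u0: "dfun M (\<lambda>e. u (e 0))"
    unfolding u_def U_def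
  proof (rule dfun_uminus, rule dfun_lub[where Q="\<lambda>s e. s = -2 \<or> R (e 0) (- s) \<and> \<beta> (e 0) < - s"])
    show "dpred M (\<lambda>e. e 0 = -2 \<or> R (e (Suc 0)) (- e 0) \<and> \<beta> (e (Suc 0)) < - e 0)"
      by (intro dintros R' \<beta>')
    show "\<exists>s. is_lub s {a. a = - 2 \<or> R (e 0) (- a) \<and> \<beta> (e 0) < - a}" for e
      using is_lub_Max[of "U (e 0)"] finU by (auto simp: U_def)
  qed
  have u: "u a = 2 \<or> R a (u a) \<and> \<beta> a < u a" for a using U(1)[of a] by (auto simp: U_def u_def)
  have u_le: "u a \<le> t" if "R a t" "\<beta> a < t" for a t
    using U(2)[of "- t" a] that by (simp add: U_def u_def)
  have u_bd: "0 \<le> u a \<and> u a \<le> 2" for a using u[of a] bd[of a "u a"] by auto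
  define V where "V a = {s. s = -1 \<or> R a s \<and> s < \<beta> a}" for a
  define v where "v a = lub (V a)" for a
  have finV: "finite (V a)" for a
  proof -
    have "V a \<subseteq> insert (-1) {t. R a t}" unfolding V_def by auto
    then show ?thesis using fin finite_subset by blast
  qed
  have "V a \<noteq> {}" for a by (auto simp: V_def)
  note V = lub_finite[OF finV this]
  have v0: "dfun M (\<lambda>e. v (e 0))"
    unfolding v_def V_def
  proof (rule dfun_lub[where Q="\<lambda>s e. s = -1 \<or> R (e 0) s \<and> s < \<beta> (e 0)"])
    show "dpred M (\<lambda>e. e 0 = -1 \<or> R (e (Suc 0)) (e 0) \<and> e 0 < \<beta> (e (Suc 0)))"
      by (intro dintros R' \<beta>')
    show "\<exists>s. is_lub s {a. a = - 1 \<or> R (e 0) a \<and> a < \<beta> (e 0)}" for e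
      using is_lub_Max[of "V (e 0)"] finV by (auto simp: V_def)
  qed
  have v: "v a = -1 \<or> R a (v a) \<and> v a < \<beta> a" for a using V(1)[of a] by (auto simp: V_def v_def)
  have v_ge: "t \<le> v a" if "R a t" "t < \<beta> a" for a t
    using V(2)[of t a] that by (simp add: V_def v_def)
  have v_bd: "-1 \<le> v a \<and> v a \<le> 1" for a using v[of a] bd[of a "v a"] by auto
  obtain a1 b1 where ab1: "a1 < b1" "{a1<..<b1} \<subseteq> {a0<..<b0}" "\<And>x. a1 < x \<Longrightarrow> x < b1 \<Longrightarrow> cont_at \<beta> x"
    using continuous_on_subinterval[OF om \<beta>0 \<beta>_bd ab0(1)] by blast
  obtain a2 b2 where ab2: "a2 < b2" "{a2<..<b2} \<subseteq> {a1<..<b1}" "\<And>x. a2 < x \<Longrightarrow> x < b2 \<Longrightarrow> cont_at u x"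
    using continuous_on_subinterval[OF om u0 u_bd ab1(1)] by blast
  obtain a3 b3 where ab3: "a3 < b3" "{a3<..<b3} \<subseteq> {a2<..<b2}" "\<And>x. a3 < x \<Longrightarrow> x < b3 \<Longrightarrow> cont_at v x"
    using continuous_on_subinterval[OF om v0 v_bd ab2(1)] by blast
  \<comment> \<open>The graph of \<open>\<beta>\<close> lies inside the family over \<open>P\<close>
    and outside over \<open>Q\<close>. One of the two contains an interval, on which the family has
    a uniform shape near the graph.\<close>
  define P where "P = {x. a3 < x \<and> x < b3 \<and> R x (\<beta> x)}"
  define Q where "Q = {x. a3 < x \<and> x < b3 \<and> \<not> R x (\<beta> x)}"
  have PQ: "dset M P" "dset M Q"
    unfolding P_def Q_def dset_def mem_Collect_eq by (intro dintros R' \<beta>')+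
  have "P \<union> Q = {a3<..<b3}" by (auto simp: P_def Q_def)
  then have "infinite P \<or> infinite Q" using infinite_Ioo[OF ab3(1)] finite_UnI by metis
  then obtain a4 b4 where ab4: "a4 < b4" "{a4<..<b4} \<subseteq> P \<or> {a4<..<b4} \<subseteq> Q"
    using infinite_contains_interval[OF om PQ(1)] infinite_contains_interval[OF om PQ(2)] by metis
  obtain a where a: "a4 < a" "a < b4" using dense[OF ab4(1)] by blast
  have sub: "{a4<..<b4} \<subseteq> {a3<..<b3}" using ab4(2) by (auto simp: P_def Q_def)
  have "cont_at \<beta> a" "cont_at u a" "cont_at v a" and irr: "irregular R a"
    using a sub ab3 ab2 ab1 ab0 by (auto simp: subset_iff)
  have "v a < \<beta> a" "\<beta> a < u a" using v[of a] u[of a] \<beta>_bd[of a] by auto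
  \<comment> \<open>With a quarter of the gap, \<open>u\<close> and \<open>v\<close> may each move
    by \<open>\<epsilon>\<close> and still stay away from the heights within
    \<open>\<epsilon>\<close> of \<open>\<beta> a\<close>.\<close>
  define \<epsilon> where "\<epsilon> = min (\<beta> a - v a) (u a - \<beta> a) / 4"
  have \<epsilon>: "\<epsilon> > 0" "v a + 4 * \<epsilon> \<le> \<beta> a" "\<beta> a + 4 * \<epsilon> \<le> u a"
    using \<open>v a < \<beta> a\<close> \<open>\<beta> a < u a\<close> by (auto simp: \<epsilon>_def min_def field_simps)
  obtain d1 where d1: "d1 > 0" "\<And>y. \<bar>y - a\<bar> < d1 \<Longrightarrow> \<bar>\<beta> y - \<beta> a\<bar> < \<epsilon>"
    using \<open>cont_at \<beta> a\<close> \<epsilon>(1) unfolding cont_at_def by blast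
  obtain d2 where d2: "d2 > 0" "\<And>y. \<bar>y - a\<bar> < d2 \<Longrightarrow> \<bar>u y - u a\<bar> < \<epsilon>"
    using \<open>cont_at u a\<close> \<epsilon>(1) unfolding cont_at_def by blast
  obtain d3 where d3: "d3 > 0" "\<And>y. \<bar>y - a\<bar> < d3 \<Longrightarrow> \<bar>v y - v a\<bar> < \<epsilon>"
    using \<open>cont_at v a\<close> \<epsilon>(1) unfolding cont_at_def by blast
  define \<delta> where "\<delta> = min (min d1 d2) (min d3 (min (a - a4) (b4 - a)))"
  have \<delta>: "\<delta> > 0" using d1 d2 d3 a by (simp add: \<delta>_def)
  have in_ab4: "y \<in> {a4<..<b4}" if "\<bar>y - a\<bar> < \<delta>" for y
    using that by (auto simp: \<delta>_def abs_less_iff)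
  have only_\<beta>: "t = \<beta> y" if "R y t" "\<bar>y - a\<bar> < \<delta>" "\<bar>t - \<beta> a\<bar> < \<epsilon>" for y t
  proof -
    have c: "\<bar>\<beta> y - \<beta> a\<bar> < \<epsilon>" "\<bar>u y - u a\<bar> < \<epsilon>" "\<bar>v y - v a\<bar> < \<epsilon>"
      using d1(2)[of y] d2(2)[of y] d3(2)[of y] that(2) by (auto simp: \<delta>_def)
    have "\<not> t < \<beta> y"
    proof
      assume "t < \<beta> y"
      then have "t \<le> v y" using v_ge that(1) by blast
      then show False using c(3) that(3) \<epsilon> unfolding abs_less_iff by linarith
    qed
    moreover have "\<not> \<beta> y < t"
    proof
      assume "\<beta> y < t"
      then have "u y \<le> t" using u_le that(1) by blast
      then show False using c(2) that(3) \<epsilon> unfolding abs_less_iff by linarith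
    qed
    ultimately show ?thesis by simp
  qed
  define \<kappa> where "\<kappa> = min \<epsilon> \<delta>"
  have \<kappa>: "\<kappa> > 0" "\<kappa> \<le> \<epsilon>" "\<kappa> \<le> \<delta>" using \<epsilon>(1) \<delta> by (auto simp: \<kappa>_def)
  have reg: "regular_at R a b" if b: "\<bar>b - \<beta> a\<bar> < \<kappa>" for b
  proof (cases "{a4<..<b4} \<subseteq> Q")
    case True
    have "\<not> R x t" if "\<bar>x - a\<bar> < \<kappa> - \<bar>b - \<beta> a\<bar>" "\<bar>t - b\<bar> < \<kappa> - \<bar>b - \<beta> a\<bar>" for x t
    proof
      assume "R x t"
      have "\<bar>t - \<beta> a\<bar> \<le> \<bar>t - b\<bar> + \<bar>b - \<beta> a\<bar>" using abs_triangle_ineq[of "t - b" "b - \<beta> a"] by simp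
      then have "\<bar>t - \<beta> a\<bar> < \<epsilon>" using that(2) \<kappa>(2) by linarith
      moreover have x: "\<bar>x - a\<bar> < \<delta>" using that(1) \<kappa>(3) by (smt (verit) abs_ge_zero diff_le_eq le_add_same_cancel1 order_less_le_trans)
      ultimately have "t = \<beta> x" using only_\<beta> \<open>R x t\<close> by blast
      then show False using \<open>R x t\<close> in_ab4[OF x] True by (auto simp: Q_def)
    qed
    then show ?thesis unfolding regular_at_def using b by (intro disjI1 exI[of _ "\<kappa> - \<bar>b - \<beta> a\<bar>"]) auto
  next
    case False
    then have sP: "{a4<..<b4} \<subseteq> P" using ab4(2) by blast
    show ?thesis
    proof (cases "b = \<beta> a")
      case True
      have "R a b" using sP a True by (auto simp: P_def)
      moreover have "\<exists>\<delta>>0. \<forall>x. \<bar>x - a\<bar> < \<delta> \<longrightarrow> (\<exists>t. R x t \<and> \<bar>t - b\<bar> < \<eta>)" if \<eta>: "\<eta> > 0" for \<eta>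
      proof -
        obtain d where d: "d > 0" "\<And>y. \<bar>y - a\<bar> < d \<Longrightarrow> \<bar>\<beta> y - \<beta> a\<bar> < \<eta>"
          using \<open>cont_at \<beta> a\<close> \<eta> unfolding cont_at_def by blast
        have "R x (\<beta> x) \<and> \<bar>\<beta> x - b\<bar> < \<eta>" if "\<bar>x - a\<bar> < min d \<delta>" for x
          using d(2)[of x] in_ab4[of x] sP that True by (auto simp: P_def)
        then show ?thesis using d(1) \<delta> by (intro exI[of _ "min d \<delta>"]) auto
      qed
      moreover have "s = t" if "\<bar>x - a\<bar> < \<kappa>" "R x s" "R x t" "\<bar>s - b\<bar> < \<kappa>" "\<bar>t - b\<bar> < \<kappa>" for x s t
        using only_\<beta>[of x s] only_\<beta>[of x t] that \<kappa> True by auto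
      ultimately show ?thesis unfolding regular_at_def using \<kappa>(1) by blast
    next
      case bn: False
      \<comment> \<open>Half the distance from \<open>b\<close> to the graph at \<open>a\<close>: a
        box around \<open>b\<close> of this size and the part of the graph over it stay disjoint,
        once \<open>\<beta>\<close> varies by less than \<open>h\<close>.\<close>
      define h where "h = \<bar>b - \<beta> a\<bar> / 2"
      have h: "h > 0" "\<bar>b - \<beta> a\<bar> = h + h" using bn by (auto simp: h_def field_simps)
      obtain d where d: "d > 0" "\<And>y. \<bar>y - a\<bar> < d \<Longrightarrow> \<bar>\<beta> y - \<beta> a\<bar> < h"
        using \<open>cont_at \<beta> a\<close> h(1) unfolding cont_at_def by blast
      define r where "r = min (min d h) (\<kappa> - \<bar>b - \<beta> a\<bar>)"
      have r: "r > 0" "r \<le> d" "r \<le> h" "r \<le> \<kappa> - \<bar>b - \<beta> a\<bar>" using d(1) h(1) b by (auto simp: r_def)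
      have "\<not> R x t" if "\<bar>x - a\<bar> < r" "\<bar>t - b\<bar> < r" for x t
      proof
        assume "R x t"
        have "\<bar>t - \<beta> a\<bar> \<le> \<bar>t - b\<bar> + \<bar>b - \<beta> a\<bar>" using abs_triangle_ineq[of "t - b" "b - \<beta> a"] by simp
        then have "\<bar>t - \<beta> a\<bar> < \<epsilon>" using that(2) r(4) \<kappa>(2) by linarith
        moreover have "\<bar>x - a\<bar> < \<delta>" using that(1) r(4) \<kappa>(3) h by linarith
        ultimately have "t = \<beta> x" using only_\<beta> \<open>R x t\<close> by blast
        then have "\<bar>t - \<beta> a\<bar> < h" using d(2)[of x] that(1) r(2) by simp
        moreover have "\<bar>b - \<beta> a\<bar> \<le> \<bar>t - b\<bar> + \<bar>t - \<beta> a\<bar>"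
          using abs_triangle_ineq[of "b - t" "t - \<beta> a"] by (simp add: abs_minus_commute)
        ultimately show False using that(2) r(3) h(2) by linarith
      qed
      then show ?thesis unfolding regular_at_def using r(1) by blast
    qed
  qed
  obtain b where b: "0 \<le> b" "b \<le> 1" "\<not> regular_at R a b" using irr by (auto simp: irregular_def)
  obtain s where s: "s \<in> B a" "- \<beta> a - \<kappa> < s" using is_lub_less[OF B[of a], of "- \<beta> a - \<kappa>"] \<kappa>(1) by auto
  have "\<exists>b. \<not> regular_at R a b \<and> \<bar>b - \<beta> a\<bar> < \<kappa>"
  proof (cases "s = -1")
    \<comment> \<open>Here \<open>s\<close> is only the default, so \<open>\<beta> a\<close> exceeds
      \<open>1 - \<kappa>\<close>; any irregular height lies between \<open>\<beta> a\<close> and 1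
      and is therefore close enough.\<close>
    case True
    have "- b \<in> B a" using b by (simp add: B_def)
    then have "- b \<le> - \<beta> a" by (rule is_lub_upper[OF B])
    then have "\<bar>b - \<beta> a\<bar> < \<kappa>" using s(2) True b(2) \<kappa>(1) by (simp add: abs_less_iff)
    then show ?thesis using b(3) by blast
  next
    case False
    have "s \<le> - \<beta> a" using is_lub_upper[OF B s(1)] .
    then have "\<bar>- s - \<beta> a\<bar> < \<kappa>" using s(2) \<kappa>(1) by (simp add: abs_less_iff)
    then show ?thesis using s(1) False by (auto simp: B_def)
  qed
  then show False using reg by blast
qed

text \<open>
  Points of nearby fibres that are far from the fibre over \<open>a\<close> would accumulate, from the right, at
  a point over \<open>a\<close> that is not regular.
\<close>

lemma no_far_points_right:
  fixes M :: "('f, 'r, 'a::linordered_field) expansion"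
  assumes om: "o_minimal M" and R: "dpred M (\<lambda>e. R (e 0) (e 1))"
    and bd': "\<forall>x t. R x t \<longrightarrow> 0 \<le> t \<and> t \<le> 1" and fin: "\<And>x. finite {t. R x t}"
    and "\<not> irregular R a" "\<epsilon> > 0"
  shows "\<exists>\<delta>>0. \<forall>x t. a < x \<and> x < a + \<delta> \<and> R x t \<longrightarrow> (\<exists>b. R a b \<and> \<bar>t - b\<bar> < \<epsilon>)"
proof -
  define far where "far t \<longleftrightarrow> (\<forall>b. R a b \<longrightarrow> \<epsilon> \<le> \<bar>t - b\<bar>)" for t
  note R' = dpred_subst2[where P=R, OF R] and bd = bd'[rule_format]
  have far0: "dpred M (\<lambda>e. far (e 0))"
    unfolding far_def by (intro dintros R')
  note far' = dpred_subst1[where P=far, OF far0]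
  \<comment> \<open>The default \<open>-1\<close> lies outside the range of heights, so
    \<open>lub (S x)\<close> is a far point of the fibre over \<open>x\<close> exactly if there is
    one.\<close>
  define S where "S x = {t. t = -1 \<or> R x t \<and> far t}" for x
  have finS: "finite (S x)" for x
    using finite_subset[of "S x" "insert (-1) {t. R x t}"] fin by (auto simp: S_def)
  have "S x \<noteq> {}" for x by (auto simp: S_def)
  note S = lub_finite[OF finS this]
  have h0: "dfun M (\<lambda>e. lub (S (e 0)))"
    unfolding S_def
  proof (rule dfun_lub[where Q="\<lambda>s e. s = -1 \<or> R (e 0) s \<and> far s"])
    show "dpred M (\<lambda>e. e 0 = -1 \<or> R (e (Suc 0)) (e 0) \<and> far (e 0))"
      by (intro dintros R' far')
    show "\<exists>s. is_lub s {a. a = - 1 \<or> R (e 0) a \<and> far a}" for e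
      using is_lub_Max[of "S (e 0)"] finS by (auto simp: S_def)
  qed
  have "-1 \<le> lub (S x) \<and> lub (S x) \<le> 1" for x
    using S(1)[of x] S(2)[of "-1" x] bd[of x "lub (S x)"] by (auto simp: S_def)
  from right_limit[OF om h0 this, of a] obtain c where
    c: "\<And>\<epsilon>. \<epsilon> > 0 \<Longrightarrow> \<exists>\<delta>>0. \<forall>y. a < y \<and> y < a + \<delta> \<longrightarrow> \<bar>lub (S y) - c\<bar> < \<epsilon>" by blast
  have "dset M {x. \<exists>t. R x t \<and> far t}"
    unfolding dset_def mem_Collect_eq by (intro dintros R' far')
  from germ_right[OF om this, of a] obtain \<kappa> where \<kappa>: "\<kappa> > 0" and
    "(\<forall>x. a < x \<and> x < a + \<kappa> \<longrightarrow> (\<exists>t. R x t \<and> far t)) \<or> (\<forall>x. a < x \<and> x < a + \<kappa> \<longrightarrow> \<not> (\<exists>t. R x t \<and> far t))"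
    by auto
  then show ?thesis
  proof (elim disjE)
    assume "\<forall>x. a < x \<and> x < a + \<kappa> \<longrightarrow> \<not> (\<exists>t. R x t \<and> far t)"
    then show ?thesis using \<kappa> unfolding far_def not_less[symmetric] by (intro exI[of _ \<kappa>]) auto
  next
    assume ex: "\<forall>x. a < x \<and> x < a + \<kappa> \<longrightarrow> (\<exists>t. R x t \<and> far t)"
    have h: "R x (lub (S x))" "far (lub (S x))" if x: "a < x" "x < a + \<kappa>" for x
    proof -
      obtain t where t: "R x t" "far t" using ex x by blast
      then have "0 \<le> lub (S x)" using S(2)[of t x] bd[of x t] by (auto simp: S_def)
      then have "lub (S x) \<noteq> -1" by auto
      then show "R x (lub (S x))" "far (lub (S x))" using S(1)[of x] by (auto simp: S_def)
    qed
    have near: "\<exists>x. a < x \<and> x < a + \<eta> \<and> x < a + \<kappa> \<and> \<bar>lub (S x) - c\<bar> < \<eta>" if \<eta>: "\<eta> > 0" for \<eta>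
    proof -
      obtain \<delta> where \<delta>: "\<delta> > 0" "\<forall>y. a < y \<and> y < a + \<delta> \<longrightarrow> \<bar>lub (S y) - c\<bar> < \<eta>" using c[OF \<eta>] by blast
      obtain x where "a < x" "x < a + min \<eta> (min \<delta> \<kappa>)"
        using dense[of a "a + min \<eta> (min \<delta> \<kappa>)"] \<eta> \<delta>(1) \<kappa> by auto
      then show ?thesis using \<delta>(2) by (intro exI[of _ x]) auto
    qed
    have "0 \<le> c"
    proof (rule ccontr)
      assume "\<not> 0 \<le> c"
      then obtain x where "a < x" "x < a + \<kappa>" "\<bar>lub (S x) - c\<bar> < - c" using near[of "- c"] by auto
      then show False using bd[OF h(1)[of x]] by (auto simp: abs_less_iff)
    qed
    moreover have "c \<le> 1"
    proof (rule ccontr)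
      assume "\<not> c \<le> 1"
      then obtain x where "a < x" "x < a + \<kappa>" "\<bar>lub (S x) - c\<bar> < c - 1" using near[of "c - 1"] by auto
      then show False using bd[OF h(1)[of x]] by (auto simp: abs_less_iff)
    qed
    ultimately have reg: "regular_at R a c" using assms(5) by (auto simp: irregular_def)
    \<comment> \<open>As a limit of heights at distance at least \<open>\<epsilon>\<close> from the
      fibre over \<open>a\<close>, \<open>c\<close> is not in that fibre. Regularity then leaves
      only the alternative that the family is empty near \<open>(a, c)\<close>, where the far points
      accumulate.\<close>
    have "\<not> R a c"
    proof
      assume "R a c"
      obtain x where "a < x" "x < a + \<kappa>" "\<bar>lub (S x) - c\<bar> < \<epsilon>" using near[OF assms(6)] by auto
      then show False using h(2)[of x] \<open>R a c\<close> unfolding far_def by (meson not_le)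
    qed
    with reg obtain r where r: "r > 0" "\<forall>x t. \<bar>x - a\<bar> < r \<longrightarrow> \<bar>t - c\<bar> < r \<longrightarrow> \<not> R x t"
      unfolding regular_at_def by blast
    obtain x where x: "a < x" "x < a + r" "x < a + \<kappa>" "\<bar>lub (S x) - c\<bar> < r" using near[OF r(1)] by auto
    then have "\<bar>x - a\<bar> < r" by (simp add: abs_less_iff)
    then show ?thesis using r(2) x h(1)[of x] by blast
  qed
qed

text \<open>Transfers the result on points to the right of \<open>a\<close> to those on the left.
  One implication, proved for all \<open>R\<close> and \<open>a\<close>, gives both because the
  reflection is an involution.\<close>

lemma regular_at_reflect: "regular_at (\<lambda>x. R (- x)) (- a) b \<longleftrightarrow> regular_at R a b"
proof -
  have imp: "regular_at (\<lambda>x. R (- x)) (- a) b" if reg: "regular_at R a b" for R a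
  proof -
    have m: "\<bar>- x - a\<bar> = \<bar>x - - a\<bar>" for x using abs_minus_cancel[of "x + a"] by simp
    from reg[unfolded regular_at_def] show ?thesis
    proof (elim disjE conjE)
      assume "\<exists>\<epsilon>>0. \<forall>x t. \<bar>x - a\<bar> < \<epsilon> \<longrightarrow> \<bar>t - b\<bar> < \<epsilon> \<longrightarrow> \<not> R x t"
      then obtain \<epsilon> where \<epsilon>: "\<epsilon> > 0" "\<And>x t. \<bar>x - a\<bar> < \<epsilon> \<Longrightarrow> \<bar>t - b\<bar> < \<epsilon> \<Longrightarrow> \<not> R x t" by blast
      show ?thesis
        unfolding regular_at_def using \<epsilon>(1) \<epsilon>(2)[of "- _"] by (intro disjI1 exI[of _ \<epsilon>]) (auto simp: m)
    next
      assume 1: "R a b" and 2: "\<forall>\<eta>>0. \<exists>\<delta>>0. \<forall>x. \<bar>x - a\<bar> < \<delta> \<longrightarrow> (\<exists>t. R x t \<and> \<bar>t - b\<bar> < \<eta>)"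
        and "\<exists>\<epsilon>>0. \<forall>x s t. \<bar>x - a\<bar> < \<epsilon> \<longrightarrow> R x s \<longrightarrow> R x t \<longrightarrow> \<bar>s - b\<bar> < \<epsilon> \<longrightarrow> \<bar>t - b\<bar> < \<epsilon> \<longrightarrow> s = t"
      then obtain \<epsilon> where \<epsilon>: "\<epsilon> > 0"
        "\<And>x s t. \<bar>x - a\<bar> < \<epsilon> \<Longrightarrow> R x s \<Longrightarrow> R x t \<Longrightarrow> \<bar>s - b\<bar> < \<epsilon> \<Longrightarrow> \<bar>t - b\<bar> < \<epsilon> \<Longrightarrow> s = t" by blast
      have "\<exists>\<delta>>0. \<forall>x. \<bar>x - - a\<bar> < \<delta> \<longrightarrow> (\<exists>t. R (- x) t \<and> \<bar>t - b\<bar> < \<eta>)" if "\<eta> > 0" for \<eta>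
      proof -
        obtain \<delta> where "\<delta> > 0" "\<And>x. \<bar>x - a\<bar> < \<delta> \<Longrightarrow> \<exists>t. R x t \<and> \<bar>t - b\<bar> < \<eta>" using 2 \<open>\<eta> > 0\<close> by blast
        then show ?thesis using m by (intro exI[of _ \<delta>]) (metis (no_types))
      qed
      moreover have "s = t" if "\<bar>x - - a\<bar> < \<epsilon>" "R (- x) s" "R (- x) t" "\<bar>s - b\<bar> < \<epsilon>" "\<bar>t - b\<bar> < \<epsilon>" for x s t
        using \<epsilon>(2)[of "- x" s t] that m[of x] by simp
      ultimately show ?thesis
        unfolding regular_at_def using 1 \<epsilon>(1) by (intro disjI2) auto
    qed
  qed
  show ?thesis using imp[of R a] imp[of "\<lambda>x. R (- x)" "- a"] by auto
qed

lemma no_far_points: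
  fixes M :: "('f, 'r, 'a::linordered_field) expansion"
  assumes om: "o_minimal M" and R: "dpred M (\<lambda>e. R (e 0) (e 1))"
    and bd': "\<forall>x t. R x t \<longrightarrow> 0 \<le> t \<and> t \<le> 1" and fin: "\<And>x. finite {t. R x t}"
    and "\<not> irregular R a" "\<epsilon> > 0"
  shows "\<exists>\<delta>>0. \<forall>x t. \<bar>x - a\<bar> < \<delta> \<and> R x t \<longrightarrow> (\<exists>b. R a b \<and> \<bar>t - b\<bar> < \<epsilon>)"
proof -
  obtain \<delta>1 where 1: "\<delta>1 > 0" "\<And>x t. a < x \<Longrightarrow> x < a + \<delta>1 \<Longrightarrow> R x t \<Longrightarrow> \<exists>b. R a b \<and> \<bar>t - b\<bar> < \<epsilon>"
    using no_far_points_right[where R=R, OF om R bd' fin assms(5,6)] by blast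
  have R': "dpred M (\<lambda>e. R (- e 0) (e 1))"
    by (intro dpred_subst2[where P=R, OF R] dfun_uminus dfun_var)
  have "\<not> irregular (\<lambda>x. R (- x)) (- a)" using assms(5) by (simp add: irregular_def regular_at_reflect)
  then obtain \<delta>2 where 2: "\<delta>2 > 0"
    "\<And>x t. - a < x \<Longrightarrow> x < - a + \<delta>2 \<Longrightarrow> R (- x) t \<Longrightarrow> \<exists>b. R a b \<and> \<bar>t - b\<bar> < \<epsilon>"
    using no_far_points_right[where R="\<lambda>x. R (- x)", OF om R' _ fin, of "- a" \<epsilon>] assms(6) bd' by auto
  show ?thesis
  proof (rule exI[of _ "min \<delta>1 \<delta>2"], intro conjI allI impI)
    show "0 < min \<delta>1 \<delta>2" using 1 2 by simp
    fix x t assume x: "\<bar>x - a\<bar> < min \<delta>1 \<delta>2 \<and> R x t"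
    consider "x = a" | "a < x" | "x < a" by force
    then show "\<exists>b. R a b \<and> \<bar>t - b\<bar> < \<epsilon>"
    proof cases
      case 1
      then show ?thesis using x \<open>\<epsilon> > 0\<close> by (intro exI[of _ t]) simp
    next
      case 2
      then show ?thesis using x 1(2)[of x t] by (simp add: abs_less_iff algebra_simps)
    next
      case 3
      then show ?thesis using x 2(2)[of "- x" t] by (simp add: abs_less_iff algebra_simps)
    qed
  qed
qed

section \<open>The number of points in the fibres of a family of finite sets\<close>

lemma dlist_pair: "dfun M f \<Longrightarrow> dfun M g \<Longrightarrow> dlist M (Suc (Suc 0)) (\<lambda>e. [f e, g e])"
  by (auto simp: dlist_def less_Suc_eq)

text \<open>Over \<open>x\<close> near \<open>a\<close>, each \<open>b\<close> in the fibre over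
  \<open>a\<close> has a point of the fibre close to it by continuity of the branch, exactly one by
  its uniqueness, and every point is close to some \<open>b\<close> by \<open>no_far_points\<close>.
  This is a bijection of the two fibres.\<close>

lemma card_locally_constant:
  fixes M :: "('f, 'r, 'a::linordered_field) expansion"
  assumes om: "o_minimal M" and R: "dpred M (\<lambda>e. R (e 0) (e 1))"
    and bd': "\<forall>x t. R x t \<longrightarrow> 0 \<le> t \<and> t \<le> 1" and fin: "\<And>x. finite {t. R x t}"
    and reg: "\<not> irregular R a"
  shows "\<exists>\<delta>>0. \<forall>x. \<bar>x - a\<bar> < \<delta> \<longrightarrow> card {t. R x t} = card {t. R a t}"
proof -
  define B where "B = {b. R a b}"
  have B: "finite B" using fin by (simp add: B_def)
  have *: "\<exists>\<epsilon>>0. \<forall>x s t. \<bar>x - a\<bar> < \<epsilon> \<longrightarrow> R x s \<longrightarrow> R x t \<longrightarrow> \<bar>s - b\<bar> < \<epsilon> \<longrightarrow> \<bar>t - b\<bar> < \<epsilon> \<longrightarrow> s = t"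
    and **: "\<forall>\<eta>>0. \<exists>\<delta>>0. \<forall>x. \<bar>x - a\<bar> < \<delta> \<longrightarrow> (\<exists>t. R x t \<and> \<bar>t - b\<bar> < \<eta>)"
    if "b \<in> B" for b
  proof -
    have b: "R a b" using that by (simp add: B_def)
    then have rb: "regular_at R a b" using reg bd' by (auto simp: irregular_def)
    have "\<not> (\<exists>\<epsilon>>0. \<forall>x t. \<bar>x - a\<bar> < \<epsilon> \<longrightarrow> \<bar>t - b\<bar> < \<epsilon> \<longrightarrow> \<not> R x t)"
    proof
      assume "\<exists>\<epsilon>>0. \<forall>x t. \<bar>x - a\<bar> < \<epsilon> \<longrightarrow> \<bar>t - b\<bar> < \<epsilon> \<longrightarrow> \<not> R x t"
      then obtain \<epsilon> where "\<epsilon> > 0" "\<forall>x t. \<bar>x - a\<bar> < \<epsilon> \<longrightarrow> \<bar>t - b\<bar> < \<epsilon> \<longrightarrow> \<not> R x t" by blast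
      from this(2)[rule_format, of a b] this(1) b show False by simp
    qed
    with rb[unfolded regular_at_def] have c: "R a b \<and>
      (\<forall>\<eta>>0. \<exists>\<delta>>0. \<forall>x. \<bar>x - a\<bar> < \<delta> \<longrightarrow> (\<exists>t. R x t \<and> \<bar>t - b\<bar> < \<eta>)) \<and>
      (\<exists>\<epsilon>>0. \<forall>x s t. \<bar>x - a\<bar> < \<epsilon> \<longrightarrow> R x s \<longrightarrow> R x t \<longrightarrow> \<bar>s - b\<bar> < \<epsilon> \<longrightarrow> \<bar>t - b\<bar> < \<epsilon> \<longrightarrow> s = t)"
      by - (erule disjE, erule (1) notE, assumption)
    from c[THEN conjunct2, THEN conjunct2]
    show "\<exists>\<epsilon>>0. \<forall>x s t. \<bar>x - a\<bar> < \<epsilon> \<longrightarrow> R x s \<longrightarrow> R x t \<longrightarrow> \<bar>s - b\<bar> < \<epsilon> \<longrightarrow> \<bar>t - b\<bar> < \<epsilon> \<longrightarrow> s = t" .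
    from c[THEN conjunct2, THEN conjunct1]
    show "\<forall>\<eta>>0. \<exists>\<delta>>0. \<forall>x. \<bar>x - a\<bar> < \<delta> \<longrightarrow> (\<exists>t. R x t \<and> \<bar>t - b\<bar> < \<eta>)" .
  qed
  have "\<forall>b\<in>B. \<exists>\<epsilon>>0. \<forall>x s t. \<bar>x - a\<bar> < \<epsilon> \<longrightarrow> R x s \<longrightarrow> R x t \<longrightarrow> \<bar>s - b\<bar> < \<epsilon> \<longrightarrow> \<bar>t - b\<bar> < \<epsilon> \<longrightarrow> s = t"
    by (intro ballI) (rule *)
  then obtain r where r0: "\<forall>b\<in>B. r b > 0 \<and>
      (\<forall>x s t. \<bar>x - a\<bar> < r b \<longrightarrow> R x s \<longrightarrow> R x t \<longrightarrow> \<bar>s - b\<bar> < r b \<longrightarrow> \<bar>t - b\<bar> < r b \<longrightarrow> s = t)"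
    by (rule bchoice[THEN exE])
  note r = r0[THEN bspec, THEN conjunct1] r0[THEN bspec, THEN conjunct2, rule_format]
  \<comment> \<open>\<open>\<epsilon>\<close> has to respect the uniqueness radius of every branch
    and half of every gap between two branches, which makes the balls around them disjoint. The
    element 1 covers an empty fibre.\<close>
  define G where "G = insert 1 (r ` B \<union> (\<lambda>(b, c). \<bar>b - c\<bar> / 2) ` {(b, c) \<in> B \<times> B. b \<noteq> c})"
  have "finite {(b, c) \<in> B \<times> B. b \<noteq> c}"
    by (rule finite_subset[of _ "B \<times> B"]) (use B in auto)
  then have G: "finite G" "G \<noteq> {}" "\<And>y. y \<in> G \<Longrightarrow> y > 0" using B r(1) by (auto simp: G_def)
  define \<epsilon> where "\<epsilon> = Min G"
  have \<epsilon>: "\<epsilon> > 0" using G(3)[OF Min_in[OF G(1,2)]] by (simp add: \<epsilon>_def)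
  have \<epsilon>_r: "\<epsilon> \<le> r b" if "b \<in> B" for b
    unfolding \<epsilon>_def by (rule Min_le[OF G(1)]) (use that in \<open>simp add: G_def\<close>)
  have \<epsilon>_gap: "b = c" if bc: "b \<in> B" "c \<in> B" "\<bar>t - b\<bar> < \<epsilon>" "\<bar>t - c\<bar> < \<epsilon>" for b c t
  proof (rule ccontr)
    assume "b \<noteq> c"
    have "\<epsilon> \<le> \<bar>b - c\<bar> / 2"
      unfolding \<epsilon>_def by (rule Min_le[OF G(1)]) (use bc(1,2) \<open>b \<noteq> c\<close> in \<open>force simp: G_def\<close>)
    moreover have "\<bar>b - c\<bar> \<le> \<bar>t - b\<bar> + \<bar>t - c\<bar>"
      using abs_triangle_ineq[of "b - t" "t - c"] by (simp add: abs_minus_commute)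
    moreover have "\<bar>b - c\<bar> / 2 + \<bar>b - c\<bar> / 2 = \<bar>b - c\<bar>" by simp
    ultimately show False using bc(3,4) by linarith
  qed
  have "\<forall>b\<in>B. \<exists>\<delta>>0. \<forall>x. \<bar>x - a\<bar> < \<delta> \<longrightarrow> (\<exists>t. R x t \<and> \<bar>t - b\<bar> < \<epsilon>)"
    by (intro ballI) (rule **[rule_format, OF _ \<epsilon>])
  then obtain d where d0: "\<forall>b\<in>B. d b > 0 \<and> (\<forall>x. \<bar>x - a\<bar> < d b \<longrightarrow> (\<exists>t. R x t \<and> \<bar>t - b\<bar> < \<epsilon>))"
    by (rule bchoice[THEN exE])
  note d = d0[THEN bspec, THEN conjunct1] d0[THEN bspec, THEN conjunct2, rule_format]
  obtain \<delta>0 where \<delta>0: "\<delta>0 > 0" "\<And>x t. \<bar>x - a\<bar> < \<delta>0 \<Longrightarrow> R x t \<Longrightarrow> \<exists>b. R a b \<and> \<bar>t - b\<bar> < \<epsilon>"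
    using no_far_points[where R=R, OF om R bd' fin reg \<epsilon>] by blast
  define D where "D = {\<delta>0, \<epsilon>} \<union> d ` B"
  have D: "finite D" "D \<noteq> {}" "\<And>y. y \<in> D \<Longrightarrow> y > 0" using B d(1) \<delta>0(1) \<epsilon> by (auto simp: D_def)
  define \<delta> where "\<delta> = Min D"
  have \<delta>: "\<delta> > 0" "\<delta> \<le> \<delta>0" "\<delta> \<le> \<epsilon>" "\<And>b. b \<in> B \<Longrightarrow> \<delta> \<le> d b"
    using D(3)[OF Min_in[OF D(1,2)]] Min_le[OF D(1)] unfolding \<delta>_def by (auto simp: D_def)
  have "card {t. R x t} = card {t. R a t}" if x: "\<bar>x - a\<bar> < \<delta>" for x
  proof -
    have "\<forall>b\<in>B. \<exists>t. R x t \<and> \<bar>t - b\<bar> < \<epsilon>" by (intro ballI d(2) less_le_trans[OF x \<delta>(4)])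
    then obtain h where h0: "\<forall>b\<in>B. R x (h b) \<and> \<bar>h b - b\<bar> < \<epsilon>" by (rule bchoice[THEN exE])
    note h = h0[THEN bspec, THEN conjunct1] h0[THEN bspec, THEN conjunct2]
    have "bij_betw h B {t. R x t}"
    proof (rule bij_betwI')
      show "(h b = h c) = (b = c)" if "b \<in> B" "c \<in> B" for b c
        using \<epsilon>_gap[OF that h(2)[OF that(1)]] h(2)[OF that(2)] by auto
      show "h b \<in> {t. R x t}" if "b \<in> B" for b using h(1) that by simp
      fix t assume "t \<in> {t. R x t}"
      then have t: "R x t" by simp
      obtain b where b: "b \<in> B" "\<bar>t - b\<bar> < \<epsilon>"
        using \<delta>0(2)[of x t] t x \<delta>(2) by (auto simp: B_def)
      have "\<bar>x - a\<bar> < r b" "\<bar>t - b\<bar> < r b" "\<bar>h b - b\<bar> < r b"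
        using \<epsilon>_r[OF b(1)] \<delta>(3) x b(2) h(2)[OF b(1)] by auto
      then have "t = h b" using r(2)[OF b(1) _ t h(1)[OF b(1)]] by blast
      with b(1) show "\<exists>b\<in>B. t = h b" by blast
    qed
    then show ?thesis by (simp add: bij_betw_same_card B_def)
  qed
  with \<delta>(1) show ?thesis by blast
qed

text \<open>For a fixed \<open>k\<close>, cardinality \<open>k\<close> is first-order: some
  \<open>k\<close> pairwise distinct elements exhaust the set.\<close>

lemma dpred_card_eq:
  fixes M :: "('f, 'r, 'a::linordered_field) expansion"
  assumes R: "dpred M (\<lambda>e. R (e 0) (e 1))" and fin: "\<And>x. finite {t. R x t}"
  shows "dpred M (\<lambda>e. card {t. R (e 0) t} = k)"
proof -
  let ?Q = "\<lambda>ts e. (\<forall>i<k. \<forall>j<k. i = j \<or> ts ! i \<noteq> ts ! j) \<and> (\<forall>t. R (e 0) t \<longleftrightarrow> \<not> (\<forall>i<k. t \<noteq> ts ! i))"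
  have "dpred M (\<lambda>e. \<forall>i<k. \<forall>j<k. i = j \<or> map e [0..<k] ! i \<noteq> map e [0..<k] ! j)"
    by (intro dpred_ball_lessThan) (simp, intro dintros)
  moreover have "dpred M (\<lambda>e. \<forall>t. R (e (k + 0)) t \<longleftrightarrow> \<not> (\<forall>i<k. t \<noteq> map e [0..<k] ! i))"
    by (rule dpred_all, rule dpred_iff, intro dpred_subst2[where P=R, OF R] dfun_var,
        rule dpred_not, rule dpred_ball_lessThan) (simp, intro dintros)
  ultimately have "dpred M (\<lambda>e. ?Q (map e [0..<k]) (\<lambda>i. e (k + i)))" by (rule dpred_conj)
  then have "dpred M (\<lambda>e. \<exists>ts. length ts = k \<and> ?Q ts e)" by (rule dpred_ex_list[where Q="?Q"])
  moreover have "(\<exists>ts. length ts = k \<and> ?Q ts e) = (card {t. R (e 0) t} = k)" for e :: "nat \<Rightarrow> 'a"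
  proof
    assume "\<exists>ts. length ts = k \<and> ?Q ts e"
    then obtain ts where ts: "length ts = k" "\<forall>i<k. \<forall>j<k. i = j \<or> ts ! i \<noteq> ts ! j"
      "\<forall>t. R (e 0) t \<longleftrightarrow> \<not> (\<forall>i<k. t \<noteq> ts ! i)" by (elim exE conjE)
    have "distinct ts" using ts(1,2) unfolding distinct_conv_nth by blast
    moreover have "{t. R (e 0) t} = set ts" using ts(1,3) unfolding set_conv_nth by blast
    ultimately show "card {t. R (e 0) t} = k" using ts(1) by (simp add: distinct_card)
  next
    assume k: "card {t. R (e 0) t} = k"
    obtain ts where ts: "set ts = {t. R (e 0) t}" "distinct ts"
      using finite_distinct_list[OF fin] by blast
    then have "length ts = k" using k distinct_card by metis
    moreover have "R (e 0) t \<longleftrightarrow> (\<exists>i<k. t = ts ! i)" for t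
    proof -
      have "R (e 0) t \<longleftrightarrow> t \<in> set ts" using ts(1) by simp
      then show ?thesis using \<open>length ts = k\<close> unfolding set_conv_nth by blast
    qed
    moreover have "\<forall>i<k. \<forall>j<k. i = j \<or> ts ! i \<noteq> ts ! j"
      using ts(2) \<open>length ts = k\<close> unfolding distinct_conv_nth by blast
    ultimately show "\<exists>ts. length ts = k \<and> ?Q ts e"
      by (intro exI[of _ ts]) simp
  qed
  ultimately show ?thesis by simp
qed

text \<open>Definable connectedness of the interval. \<open>S\<close> consists of the
  \<open>s\<close> up to which the cardinality has not changed; local constancy at its supremum
  reaches beyond the supremum, so \<open>y\<close> is not left out.\<close>

lemma card_constant:
  fixes M :: "('f, 'r, 'a::linordered_field) expansion"
  assumes om: "o_minimal M" and R: "dpred M (\<lambda>e. R (e 0) (e 1))"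
    and bd': "\<forall>x t. R x t \<longrightarrow> 0 \<le> t \<and> t \<le> 1" and fin: "\<And>x. finite {t. R x t}"
    and reg: "\<And>z. x \<le> z \<Longrightarrow> z \<le> y \<Longrightarrow> \<not> irregular R z" and "x \<le> y"
  shows "card {t. R x t} = card {t. R y t}"
proof -
  define k where "k = card {t. R x t}"
  define S where "S = {s. x \<le> s \<and> s \<le> y \<and> (\<forall>z. x \<le> z \<and> z \<le> s \<longrightarrow> card {t. R z t} = k)}"
  note dk = dpred_subst1[where P="\<lambda>z. card {t. R z t} = k", OF dpred_card_eq[where R=R, OF R fin]]
  have "dset M S"
    unfolding dset_def S_def mem_Collect_eq by (intro dpred_conj dpred_all dpred_imp dpred_le dfun_var dfun_const dk)
  moreover have xS: "x \<in> S" using assms(6) by (auto simp: S_def k_def)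
  moreover have "s \<le> y" if "s \<in> S" for s using that by (simp add: S_def)
  ultimately obtain s where s: "is_lub s S" using is_lub_exists[OF om] by (metis empty_iff)
  have "x \<le> s" "s \<le> y" using is_lub_upper[OF s xS] is_lub_least[OF s, of y] by (auto simp: S_def)
  then obtain \<delta> where \<delta>: "\<delta> > 0" "\<And>z. \<bar>z - s\<bar> < \<delta> \<Longrightarrow> card {t. R z t} = card {t. R s t}"
    using card_locally_constant[where R=R, OF om R bd' fin reg] by blast
  obtain s' where s': "s' \<in> S" "s - \<delta> < s'" using is_lub_less[OF s, of "s - \<delta>"] \<delta>(1) by auto
  have "s' \<le> s" using is_lub_upper[OF s s'(1)] .
  then have "\<bar>s' - s\<bar> < \<delta>" using s'(2) \<delta>(1) by (simp add: abs_less_iff)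
  then have ks: "card {t. R s t} = k" using \<delta>(2)[of s'] s'(1) by (auto simp: S_def)
  have all: "card {t. R z t} = k" if "x \<le> z" "z < s + \<delta>" for z
  proof (cases "z \<le> s'")
    case True
    then show ?thesis using s'(1) that(1) by (auto simp: S_def)
  next
    case False
    then have "\<bar>z - s\<bar> < \<delta>" using s'(2) that(2) by (simp add: abs_less_iff algebra_simps)
    then show ?thesis using \<delta>(2) ks by simp
  qed
  have "y < s + \<delta>"
  proof (rule ccontr)
    assume *: "\<not> y < s + \<delta>"
    have h: "\<delta> / 2 > 0" "s + \<delta> / 2 < s + \<delta>" using \<delta>(1) by (auto simp: field_simps)
    then have "s + \<delta> / 2 \<in> S" using * \<open>x \<le> s\<close> all by (auto simp: S_def)
    then show False using is_lub_upper[OF s, of "s + \<delta> / 2"] h by simp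
  qed
  then show ?thesis using all[of y] assms(6) by (simp add: k_def)
qed

text \<open>Sample points for the complement of the irregular points: midpoints for the gaps between
  two of them, a shift by 1 for the two unbounded pieces, and 0 in case there are none. The
  irregular points represent themselves. The choice is first-order in \<open>R\<close>, so it stays
  definable when \<open>R\<close> varies in a family.\<close>

definition critical :: "('a::linordered_field \<Rightarrow> 'a \<Rightarrow> bool) \<Rightarrow> 'a \<Rightarrow> bool" where
  "critical R c \<longleftrightarrow> c = 0 \<or> (\<exists>a b. irregular R a \<and> irregular R b \<and>
     (c = a \<or> c = a + 1 \<or> c = a - 1 \<or> c = (a + b) / 2))"

lemma finite_critical:
  assumes "finite {a. irregular R a}" shows "finite {c. critical R c}"
proof -
  let ?I = "{a. irregular R a}"
  have "{c. critical R c} \<subseteq> insert 0 (?I \<union> (\<lambda>a. a + 1) ` ?I \<union> (\<lambda>a. a - 1) ` ?I \<union> (\<Union>a\<in>?I. (\<lambda>b. (a + b) / 2) ` ?I))"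
    unfolding critical_def by blast
  then show ?thesis by (rule finite_subset) (use assms in auto)
qed

text \<open>A point \<open>y\<close> that is not irregular lies in a component of the complement of
  the finite set of irregular points. The cardinality is constant there, and each component contains
  a critical point.\<close>

lemma card_critical:
  fixes M :: "('f, 'r, 'a::linordered_field) expansion"
  assumes om: "o_minimal M" and R: "dpred M (\<lambda>e. R (e 0) (e 1))"
    and bd': "\<forall>x t. R x t \<longrightarrow> 0 \<le> t \<and> t \<le> 1" and fin: "\<And>x. finite {t. R x t}"
  shows "\<exists>c. critical R c \<and> card {t. R y t} = card {t. R c t}"
proof (cases "irregular R y")
  case True
  then show ?thesis by (auto simp: critical_def)
next
  case False
  define L where "L = {a. irregular R a \<and> a < y}"
  define U where "U = {a. irregular R a \<and> y < a}"
  have LU: "finite L" "finite U"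
    using finite_irregular[where R=R, OF om R bd' fin] by (auto simp: L_def U_def)
  have eq: "card {t. R y t} = card {t. R c t}"
    if "\<And>z. min y c \<le> z \<Longrightarrow> z \<le> max y c \<Longrightarrow> z \<notin> L \<and> z \<notin> U" for c
  proof -
    have "\<not> irregular R z" if "min y c \<le> z" "z \<le> max y c" for z
      using \<open>\<And>z. min y c \<le> z \<Longrightarrow> z \<le> max y c \<Longrightarrow> z \<notin> L \<and> z \<notin> U\<close>[OF that] False
      by (cases z y rule: linorder_cases) (auto simp: L_def U_def)
    then have "card {t. R (min y c) t} = card {t. R (max y c) t}"
      by (intro card_constant[where R=R, OF om R bd' fin]) auto
    then show ?thesis by (auto simp: min_def max_def split: if_splits)
  qed
  have Lm: "Max L \<in> L" "\<And>a. a \<in> L \<Longrightarrow> a \<le> Max L" if "L \<noteq> {}" using LU(1) that by auto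
  have Um: "Min U \<in> U" "\<And>a. a \<in> U \<Longrightarrow> Min U \<le> a" if "U \<noteq> {}" using LU(2) that by auto
  have L_lt: "a < y" "irregular R a" if "a \<in> L" for a using that by (auto simp: L_def)
  have U_gt: "y < a" "irregular R a" if "a \<in> U" for a using that by (auto simp: U_def)
  consider "L = {}" "U = {}" | "L \<noteq> {}" "U = {}" | "L = {}" "U \<noteq> {}" | "L \<noteq> {}" "U \<noteq> {}" by blast
  then show ?thesis
  proof cases
    case 1
    then show ?thesis using eq[of 0] by (auto simp: critical_def)
  next
    case 2
    have "critical R (Max L + 1)" using L_lt(2)[OF Lm(1)[OF 2(1)]] unfolding critical_def by blast
    moreover have lt: "Max L < min y (Max L + 1)" using L_lt(1)[OF Lm(1)[OF 2(1)]] by simp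
    have "card {t. R y t} = card {t. R (Max L + 1) t}"
    proof (rule eq)
      fix z assume "min y (Max L + 1) \<le> z"
      then show "z \<notin> L \<and> z \<notin> U" using Lm(2)[OF 2(1), of z] less_le_trans[OF lt] 2(2) by fastforce
    qed
    ultimately show ?thesis by blast
  next
    case 3
    have "critical R (Min U - 1)" using U_gt(2)[OF Um(1)[OF 3(2)]] unfolding critical_def by blast
    moreover have lt: "max y (Min U - 1) < Min U" using U_gt(1)[OF Um(1)[OF 3(2)]] by simp
    have "card {t. R y t} = card {t. R (Min U - 1) t}"
    proof (rule eq)
      fix z assume "z \<le> max y (Min U - 1)"
      then show "z \<notin> L \<and> z \<notin> U" using Um(2)[OF 3(2), of z] le_less_trans[OF _ lt] 3(1) by fastforce
    qed
    ultimately show ?thesis by blast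
  next
    case 4
    let ?c = "(Max L + Min U) / 2"
    have lu: "Max L < y" "y < Min U" using L_lt(1)[OF Lm(1)] U_gt(1)[OF Um(1)] 4 by auto
    then have "Max L < ?c" "?c < Min U" by (auto simp: field_simps)
    then have lt: "Max L < min y ?c" "max y ?c < Min U" using lu by auto
    have "critical R ?c"
      using L_lt(2)[OF Lm(1)[OF 4(1)]] U_gt(2)[OF Um(1)[OF 4(2)]] unfolding critical_def by blast
    moreover have "card {t. R y t} = card {t. R ?c t}"
    proof (rule eq)
      fix z assume "min y ?c \<le> z" "z \<le> max y ?c"
      then have "Max L < z" "z < Min U" using less_le_trans[OF lt(1)] le_less_trans[OF _ lt(2)] by auto
      then show "z \<notin> L \<and> z \<notin> U" using Lm(2)[OF 4(1), of z] Um(2)[OF 4(2), of z] by fastforce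
    qed
    ultimately show ?thesis by blast
  qed
qed

text \<open>
  Over a fixed \<open>x\<close> the cardinality of the fibres over \<open>(x, y)\<close> only depends on which of finitely
  many critical \<open>c\<close> represents \<open>y\<close>, so it suffices to bound the union of the fibres over \<open>(x, c)\<close>,
  a family with one parameter less.
\<close>

theorem uniform_finiteness:
  fixes M :: "('f, 'r, 'a::linordered_field) expansion"
  assumes om: "o_minimal M"
    and "definable_in M (Suc n) A" and "\<And>x t. x @ [t] \<in> A \<Longrightarrow> 0 \<le> t \<and> t \<le> 1"
    and "\<And>x. finite {t. x @ [t] \<in> A}"
  shows "\<exists>N. \<forall>x. card {t. x @ [t] \<in> A} \<le> N"
  using assms(2-)
proof (induction n arbitrary: A)
  case 0
  have "card {t. x @ [t] \<in> A} \<le> card {t. [t] \<in> A}" for x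
  proof (cases x)
    case (Cons y ys)
    then have "{t. x @ [t] \<in> A} = {}" using definable_in_length[OF 0(1)] by fastforce
    then show ?thesis by (simp only: card.empty)
  qed simp
  then show ?case by blast
next
  case (Suc n)
  note A = Suc.prems
  define R where "R x y t \<longleftrightarrow> x @ [y, t] \<in> A" for x y t
  have R: "dpred M (\<lambda>e. R x (e 0) (e 1))" if "length x = n" for x
    unfolding R_def by (rule dpred_mem[OF A(1)], rule dlist_append[OF dlist_const dlist_pair]) (use that in \<open>auto intro: dfun_var\<close>)
  have bd: "\<forall>y t. R x y t \<longrightarrow> 0 \<le> t \<and> t \<le> 1" for x
    using A(2)[of "x @ [y]" for y] by (auto simp: R_def)
  have fin: "finite {t. R x y t}" for x y
    using A(3)[of "x @ [y]"] by (simp add: R_def)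
  \<comment> \<open>The quantifier over \<open>c\<close> removes the last base variable:
    \<open>critical\<close> only speaks of the family \<open>R x\<close>, so \<open>D\<close> is
    definable, and it has finite fibres because there are finitely many critical points.\<close>
  define D where "D = {x @ [t] |x t. length x = n \<and> (\<exists>c. critical (R x) c \<and> R x c t)}"
  have D_iff: "x @ [t] \<in> D \<longleftrightarrow> length x = n \<and> (\<exists>c. critical (R x) c \<and> R x c t)" for x t
    by (auto simp: D_def)
  have "definable_in M (Suc n) D"
    unfolding definable_in_iff
  proof
    show "D \<subseteq> {x. length x = Suc n}" by (auto simp: D_def)
    have leaf: "dpred M (\<lambda>e. map (\<lambda>i. e (\<sigma> i)) [0..<n] @ [f e, g e] \<in> A)" if "dfun M f" "dfun M g" for \<sigma> f g
      by (rule dpred_mem[OF A(1)], rule dlist_append[OF dlist_vars dlist_pair[OF that]]) simp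
    have leaf0: "dpred M (\<lambda>e. map e [0..<n] @ [f e, g e] \<in> A)" if "dfun M f" "dfun M g" for f g
      using leaf[OF that, of "\<lambda>i. i"] by simp
    have "dpred M (\<lambda>e. \<exists>c. critical (R (map e [0..<n])) c \<and> R (map e [0..<n]) c (e n))"
      unfolding critical_def irregular_def regular_at_def R_def by (intro dintros leaf leaf0)
    then show "dpred M (\<lambda>e. map e [0..<Suc n] \<in> D)" by (simp add: D_iff)
  qed
  moreover have "0 \<le> t \<and> t \<le> 1" if "x @ [t] \<in> D" for x t
    using that bd by (auto simp: D_iff)
  moreover have "finite {t. x @ [t] \<in> D}" for x
  proof (cases "length x = n")
    case True
    have "{t. x @ [t] \<in> D} = (\<Union>c\<in>{c. critical (R x) c}. {t. R x c t})"
      using True by (auto simp: D_iff)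
    then show ?thesis
      using finite_critical[OF finite_irregular[where R="R x", OF om R[OF True] bd fin]] fin by simp
  qed (simp add: D_iff)
  ultimately obtain N where N: "\<And>x. card {t. x @ [t] \<in> D} \<le> N" and finD: "\<And>x. finite {t. x @ [t] \<in> D}"
    using Suc.IH[of D] by blast
  have "card {t. x @ [t] \<in> A} \<le> N" for x
  proof (cases "length x = Suc n")
    case True
    then obtain x' y where x: "x = x' @ [y]" "length x' = n" by (metis length_Suc_conv_rev)
    obtain c where c: "critical (R x') c" "card {t. R x' y t} = card {t. R x' c t}"
      using card_critical[where R="R x'", OF om R[OF x(2)] bd fin] by blast
    have "card {t. R x' c t} \<le> card {t. x' @ [t] \<in> D}"
      by (rule card_mono[OF finD]) (use c x(2) in \<open>auto simp: D_iff\<close>)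
    also have "\<dots> \<le> N" by (rule N)
    finally show ?thesis using c(2) x(1) by (simp add: R_def)
  next
    case False
    then have "{t. x @ [t] \<in> A} = {}" using definable_in_length[OF A(1)] by fastforce
    then show ?thesis by (simp only: card.empty)
  qed
  then show ?case by blast
qed

subsection \<open>Continuity and definable maps\<close>

text \<open>Radii have to be field elements, as there is no real-valued metric at hand. Lists of
  different lengths are never near each other, in accordance with \<open>list_topology\<close> being
  a disjoint union.\<close>

definition near :: "'a::linordered_field \<Rightarrow> 'a list \<Rightarrow> 'a list \<Rightarrow> bool" where
  "near \<delta> x y \<longleftrightarrow> length x = length y \<and> (\<forall>i<length x. \<bar>x ! i - y ! i\<bar> < \<delta>)"

lemma near_refl: "\<delta> > 0 \<Longrightarrow> near \<delta> x x"
  by (simp add: near_def)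

lemma near_sym: "near \<delta> x y \<Longrightarrow> near \<delta> y x"
  by (simp add: near_def abs_minus_commute)

lemma near_mono: "near \<delta> x y \<Longrightarrow> \<delta> \<le> \<epsilon> \<Longrightarrow> near \<epsilon> x y"
  by (auto simp: near_def intro: less_le_trans)

lemma near_length: "near \<delta> x y \<Longrightarrow> length x = length y"
  by (simp add: near_def)

lemma near_trans:
  assumes "near \<delta> x y" "near \<epsilon> y z" shows "near (\<delta> + \<epsilon>) x z"
  unfolding near_def
proof (intro conjI allI impI)
  show "length x = length z" using assms by (simp add: near_def)
  fix i assume "i < length x"
  then have "\<bar>x ! i - y ! i\<bar> < \<delta>" "\<bar>y ! i - z ! i\<bar> < \<epsilon>" using assms by (simp_all add: near_def)
  then show "\<bar>x ! i - z ! i\<bar> < \<delta> + \<epsilon>"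
    using abs_triangle_ineq[of "x ! i - y ! i" "y ! i - z ! i"] by simp
qed

lemma near_append:
  assumes "length x = length x'"
  shows "near \<delta> (x @ y) (x' @ y') \<longleftrightarrow> near \<delta> x x' \<and> near \<delta> y y'"
proof
  assume n: "near \<delta> (x @ y) (x' @ y')"
  have "\<bar>x ! i - x' ! i\<bar> < \<delta>" if "i < length x" for i
    using n that assms by (auto simp: near_def nth_append dest: spec[of _ i])
  moreover have "\<bar>y ! i - y' ! i\<bar> < \<delta>" if "i < length y" for i
    using n that assms by (auto simp: near_def nth_append dest: spec[of _ "length x + i"])
  ultimately show "near \<delta> x x' \<and> near \<delta> y y'" using n assms by (auto simp: near_def)
next
  assume "near \<delta> x x' \<and> near \<delta> y y'"
  then show "near \<delta> (x @ y) (x' @ y')" by (auto simp: near_def nth_append)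
qed

lemma near_singleton: "near \<delta> [s] [t] \<longleftrightarrow> \<bar>s - t\<bar> < \<delta>"
  by (simp add: near_def)

section \<open>The topology of lists in terms of \<open>near\<close>\<close>

lemma finite_min_pos:
  fixes r :: "'b \<Rightarrow> 'a::linordered_field"
  assumes "finite S" "\<And>i. i \<in> S \<Longrightarrow> r i > 0"
  shows "\<exists>\<delta>>0. \<forall>i\<in>S. \<delta> \<le> r i"
proof -
  have "\<And>y. y \<in> insert 1 (r ` S) \<Longrightarrow> y > 0" using assms(2) by auto
  then show ?thesis using assms(1) by (intro exI[of _ "Min (insert 1 (r ` S))"]) auto
qed

lemma open_iff_abs:
  fixes U :: "'a::real_closed_field set"
  shows "open U \<longleftrightarrow> (\<forall>x\<in>U. \<exists>\<epsilon>>0. \<forall>y. \<bar>x - y\<bar> < \<epsilon> \<longrightarrow> y \<in> U)"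
proof
  assume U: "open U"
  show "\<forall>x\<in>U. \<exists>\<epsilon>>0. \<forall>y. \<bar>x - y\<bar> < \<epsilon> \<longrightarrow> y \<in> U"
  proof
    fix x assume "x \<in> U"
    obtain b where b: "x < b" "{x..<b} \<subseteq> U" using open_right[OF U \<open>x \<in> U\<close>, of "x + 1"] by auto
    obtain a where a: "a < x" "{a<..x} \<subseteq> U" using open_left[OF U \<open>x \<in> U\<close>, of "x - 1"] by auto
    have "y \<in> U" if "\<bar>x - y\<bar> < min (b - x) (x - a)" for y
    proof (cases "x \<le> y")
      case True
      then have "y \<in> {x..<b}" using that by (simp add: abs_less_iff)
      then show ?thesis using b(2) by blast
    next
      case False
      then have "y \<in> {a<..x}" using that by (simp add: abs_less_iff)
      then show ?thesis using a(2) by blast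
    qed
    then show "\<exists>\<epsilon>>0. \<forall>y. \<bar>x - y\<bar> < \<epsilon> \<longrightarrow> y \<in> U"
      using a(1) b(1) by (intro exI[of _ "min (b - x) (x - a)"]) simp
  qed
next
  assume *: "\<forall>x\<in>U. \<exists>\<epsilon>>0. \<forall>y. \<bar>x - y\<bar> < \<epsilon> \<longrightarrow> y \<in> U"
  show "open U"
  proof (subst open_subopen, rule ballI)
    fix x assume "x \<in> U"
    then obtain \<epsilon> where \<epsilon>: "\<epsilon> > 0" "\<And>y. \<bar>x - y\<bar> < \<epsilon> \<Longrightarrow> y \<in> U" using * by blast
    have "y \<in> U" if "x - \<epsilon> < y" "y < x + \<epsilon>" for y
      by (rule \<epsilon>(2)) (use that in \<open>simp add: abs_less_iff algebra_simps\<close>)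
    then show "\<exists>T. open T \<and> x \<in> T \<and> T \<subseteq> U"
      using \<epsilon>(1) by (intro exI[of _ "{x - \<epsilon><..<x + \<epsilon>}"]) auto
  qed
qed

text \<open>A basic open box has finitely many sides, so the least of their radii gives a ball
  inside it; conversely a ball is a box.\<close>

lemma openin_power_topology:
  fixes V :: "'a::real_closed_field list set"
  shows "openin (power_topology n) V \<longleftrightarrow>
    V \<subseteq> {x. length x = n} \<and> (\<forall>x\<in>V. \<exists>\<delta>>0. \<forall>y. near \<delta> x y \<longrightarrow> y \<in> V)"
proof -
  define f :: "'a list \<Rightarrow> nat \<Rightarrow> 'a" where "f x = (\<lambda>i\<in>{..<n}. x ! i)" for x
  let ?T = "product_topology (\<lambda>_. euclidean) {..<n} :: (nat \<Rightarrow> 'a) topology"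
  have pt: "openin (power_topology n) V \<longleftrightarrow> (\<exists>U. openin ?T U \<and> V = f -` U \<inter> {x. length x = n})"
    unfolding power_topology_def openin_pullback_topology f_def by simp
  show ?thesis
  proof
    assume "openin (power_topology n) V"
    then obtain U where U: "openin ?T U" "V = f -` U \<inter> {x. length x = n}" using pt by blast
    have "\<exists>\<delta>>0. \<forall>y. near \<delta> x y \<longrightarrow> y \<in> V" if "x \<in> V" for x
    proof -
      have "f x \<in> U" "length x = n" using that U(2) by auto
      from U(1)[unfolded openin_product_topology_alt, rule_format, OF this(1)]
      obtain W where W0: "\<forall>i\<in>{..<n}. openin euclidean (W i)" "f x \<in> Pi\<^sub>E {..<n} W" "Pi\<^sub>E {..<n} W \<subseteq> U"
        by (elim exE conjE)
      then have W: "\<And>i. i < n \<Longrightarrow> open (W i)" "f x \<in> Pi\<^sub>E {..<n} W" "Pi\<^sub>E {..<n} W \<subseteq> U"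
        by auto
      have "\<forall>i\<in>{..<n}. \<exists>\<epsilon>>0. \<forall>y. \<bar>x ! i - y\<bar> < \<epsilon> \<longrightarrow> y \<in> W i"
      proof
        fix i assume i: "i \<in> {..<n}"
        then have "x ! i \<in> W i" using PiE_mem[OF W(2) i] by (simp add: f_def)
        then show "\<exists>\<epsilon>>0. \<forall>y. \<bar>x ! i - y\<bar> < \<epsilon> \<longrightarrow> y \<in> W i" using W(1)[of i] i open_iff_abs by auto
      qed
      then obtain r where r: "\<forall>i\<in>{..<n}. r i > 0 \<and> (\<forall>y. \<bar>x ! i - y\<bar> < r i \<longrightarrow> y \<in> W i)"
        by (rule bchoice[THEN exE])
      then obtain \<delta> where \<delta>: "\<delta> > 0" "\<forall>i\<in>{..<n}. \<delta> \<le> r i"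
        using finite_min_pos[of "{..<n}" r] by auto
      have "y \<in> V" if y: "near \<delta> x y" for y
      proof -
        have "y ! i \<in> W i" if "i < n" for i
        proof -
          have "\<bar>x ! i - y ! i\<bar> < \<delta>" using y that \<open>length x = n\<close> by (simp add: near_def)
          then show ?thesis using r \<delta>(2) that by (meson lessThan_iff order_less_le_trans)
        qed
        then have "f y \<in> Pi\<^sub>E {..<n} W" by (auto simp: f_def)
        then have "f y \<in> U" using W(3) by blast
        then show ?thesis using U(2) near_length[OF y] \<open>length x = n\<close> by simp
      qed
      then show ?thesis using \<delta>(1) by blast
    qed
    then show "V \<subseteq> {x. length x = n} \<and> (\<forall>x\<in>V. \<exists>\<delta>>0. \<forall>y. near \<delta> x y \<longrightarrow> y \<in> V)" using U(2) by blast
  next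
    assume V: "V \<subseteq> {x. length x = n} \<and> (\<forall>x\<in>V. \<exists>\<delta>>0. \<forall>y. near \<delta> x y \<longrightarrow> y \<in> V)"
    have inj: "x = y" if "f x = f y" "length x = n" "length y = n" for x y
    proof (rule nth_equalityI)
      show "length x = length y" using that by simp
      fix i assume "i < length x"
      then show "x ! i = y ! i" using fun_cong[OF that(1), of i] that(2) by (simp add: f_def)
    qed
    have "openin ?T (f ` V)"
      unfolding openin_product_topology_alt
    proof
      fix g assume "g \<in> f ` V"
      then obtain x where x: "x \<in> V" "g = f x" by blast
      then have lx: "length x = n" using V by blast
      obtain \<delta> where \<delta>: "\<delta> > 0" "\<And>y. near \<delta> x y \<Longrightarrow> y \<in> V" using V x(1) by blast
      define W where "W i = {t. \<bar>x ! i - t\<bar> < \<delta>}" for i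
      have "open (W i)" for i
        unfolding open_iff_abs
      proof
        fix t assume t: "t \<in> W i"
        have "s \<in> W i" if "\<bar>t - s\<bar> < \<delta> - \<bar>x ! i - t\<bar>" for s
          using abs_triangle_ineq[of "x ! i - t" "t - s"] that by (simp add: W_def)
        then show "\<exists>\<epsilon>>0. \<forall>s. \<bar>t - s\<bar> < \<epsilon> \<longrightarrow> s \<in> W i"
          using t by (intro exI[of _ "\<delta> - \<bar>x ! i - t\<bar>"]) (simp add: W_def)
      qed
      moreover have "g \<in> Pi\<^sub>E {..<n} W" using \<delta>(1) by (auto simp: x(2) f_def W_def)
      moreover have "Pi\<^sub>E {..<n} W \<subseteq> f ` V"
      proof
        fix k assume k: "k \<in> Pi\<^sub>E {..<n} W"
        have "near \<delta> x (map k [0..<n])"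
          using k lx by (auto simp: near_def W_def PiE_iff)
        then have "map k [0..<n] \<in> V" by (rule \<delta>(2))
        moreover have "f (map k [0..<n]) = k"
          using k by (auto simp: f_def PiE_iff extensional_def)
        ultimately show "k \<in> f ` V" by (metis image_eqI)
      qed
      ultimately show "\<exists>U. finite {i \<in> {..<n}. U i \<noteq> topspace euclidean} \<and>
          (\<forall>i\<in>{..<n}. openin euclidean (U i)) \<and> g \<in> Pi\<^sub>E {..<n} U \<and> Pi\<^sub>E {..<n} U \<subseteq> f ` V"
        by (intro exI[of _ W]) auto
    qed
    moreover have "V = f -` (f ` V) \<inter> {x. length x = n}" using V inj by auto
    ultimately show "openin (power_topology n) V" using pt by blast
  qed
qed

lemma openin_list_topology_near:
  fixes U :: "'a::real_closed_field list set"
  shows "openin list_topology U \<longleftrightarrow> (\<forall>x\<in>U. \<exists>\<delta>>0. \<forall>y. near \<delta> x y \<longrightarrow> y \<in> U)"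
proof
  assume *: "openin list_topology U"
  show "\<forall>x\<in>U. \<exists>\<delta>>0. \<forall>y. near \<delta> x y \<longrightarrow> y \<in> U"
  proof
    fix x assume "x \<in> U"
    then have "x \<in> U \<inter> {y. length y = length x}" by simp
    then show "\<exists>\<delta>>0. \<forall>y. near \<delta> x y \<longrightarrow> y \<in> U"
      using * unfolding openin_list_topology openin_power_topology by blast
  qed
next
  assume *: "\<forall>x\<in>U. \<exists>\<delta>>0. \<forall>y. near \<delta> x y \<longrightarrow> y \<in> U"
  show "openin list_topology U"
    unfolding openin_list_topology openin_power_topology
  proof (intro allI conjI ballI)
    fix n x assume x: "x \<in> U \<inter> {x. length x = n}"
    then obtain \<delta> where "\<delta> > 0" "\<And>y. near \<delta> x y \<Longrightarrow> y \<in> U" using * by blast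
    then show "\<exists>\<delta>>0. \<forall>y. near \<delta> x y \<longrightarrow> y \<in> U \<inter> {x. length x = n}"
      using x near_length[of _ x] by (intro exI[of _ \<delta>]) fastforce
  qed simp
qed

lemma topspace_list_topology: "topspace (list_topology :: 'a::real_closed_field list topology) = UNIV"
proof -
  have "openin list_topology (UNIV :: 'a list set)"
    unfolding openin_list_topology_near using zero_less_one by blast
  then show ?thesis using openin_subset by blast
qed

lemma openin_space_of:
  fixes U :: "'a::real_closed_field list set"
  shows "openin (space_of S) U \<longleftrightarrow> U \<subseteq> S \<and> (\<forall>x\<in>U. \<exists>\<delta>>0. \<forall>y\<in>S. near \<delta> x y \<longrightarrow> y \<in> U)"
proof
  assume "openin (space_of S) U"
  then show "U \<subseteq> S \<and> (\<forall>x\<in>U. \<exists>\<delta>>0. \<forall>y\<in>S. near \<delta> x y \<longrightarrow> y \<in> U)"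
    unfolding openin_subtopology openin_list_topology_near by blast
next
  assume U: "U \<subseteq> S \<and> (\<forall>x\<in>U. \<exists>\<delta>>0. \<forall>y\<in>S. near \<delta> x y \<longrightarrow> y \<in> U)"
  \<comment> \<open>\<open>T\<close> is the interior of the union of \<open>U\<close> and the
    complement of \<open>S\<close>, the largest open set that meets \<open>S\<close> in
    \<open>U\<close>; this avoids choosing a radius for each point of \<open>U\<close>.\<close>
  define T where "T = {z. \<exists>\<delta>>0. \<forall>y\<in>S. near \<delta> z y \<longrightarrow> y \<in> U}"
  have "\<exists>\<eta>>0. \<forall>w. near \<eta> z w \<longrightarrow> w \<in> T" if z: "z \<in> T" for z
  proof -
    obtain \<delta> where \<delta>: "\<delta> > 0" "\<And>y. y \<in> S \<Longrightarrow> near \<delta> z y \<Longrightarrow> y \<in> U" using z T_def by blast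
    have "w \<in> T" if w: "near (\<delta> / 2) z w" for w
    proof -
      have "y \<in> U" if "y \<in> S" "near (\<delta> / 2) w y" for y
        using \<delta>(2)[OF that(1)] near_trans[OF w that(2)] by simp
      then show ?thesis using half_gt_zero[OF \<delta>(1)] unfolding T_def by blast
    qed
    then show ?thesis using half_gt_zero[OF \<delta>(1)] by blast
  qed
  then have "openin list_topology T" unfolding openin_list_topology_near by blast
  moreover have "U = T \<inter> S"
    using U near_refl unfolding T_def by blast
  ultimately show "openin (space_of S) U" unfolding openin_subtopology by blast
qed

definition cont :: "'a::linordered_field list set \<Rightarrow> ('a list \<Rightarrow> 'a list) \<Rightarrow> bool" where
  "cont X f \<longleftrightarrow> (\<forall>x\<in>X. \<forall>\<epsilon>>0. \<exists>\<delta>>0. \<forall>y\<in>X. near \<delta> x y \<longrightarrow> near \<epsilon> (f x) (f y))"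

lemma contD:
  assumes "cont X f" "x \<in> X" "\<epsilon> > 0"
  obtains \<delta> where "\<delta> > 0" "\<And>y. y \<in> X \<Longrightarrow> near \<delta> x y \<Longrightarrow> near \<epsilon> (f x) (f y)"
  using assms unfolding cont_def by blast

lemma topspace_space_of: "topspace (space_of S) = (S :: 'a::real_closed_field list set)"
  by (simp add: topspace_list_topology)

lemma near_ball_open:
  fixes x :: "'a::real_closed_field list"
  shows "openin list_topology {z. near \<epsilon> x z}"
  unfolding openin_list_topology_near
proof
  fix z assume "z \<in> {z. near \<epsilon> x z}"
  then have z: "near \<epsilon> x z" by simp
  then obtain \<delta> where \<delta>: "\<delta> > 0" "\<forall>i\<in>{..<length x}. \<delta> \<le> \<epsilon> - \<bar>x ! i - z ! i\<bar>"
    using finite_min_pos[of "{..<length x}" "\<lambda>i. \<epsilon> - \<bar>x ! i - z ! i\<bar>"] by (auto simp: near_def)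
  have "near \<epsilon> x y" if y: "near \<delta> z y" for y
    unfolding near_def
  proof (intro conjI allI impI)
    show "length x = length y" using z y by (simp add: near_def)
    fix i assume i: "i < length x"
    then have "\<bar>z ! i - y ! i\<bar> < \<delta>" using z y by (simp add: near_def)
    moreover have "\<delta> \<le> \<epsilon> - \<bar>x ! i - z ! i\<bar>" using \<delta>(2) i by simp
    ultimately show "\<bar>x ! i - y ! i\<bar> < \<epsilon>"
      using abs_triangle_ineq[of "x ! i - z ! i" "z ! i - y ! i"] by simp
  qed
  then show "\<exists>\<delta>>0. \<forall>y. near \<delta> z y \<longrightarrow> y \<in> {z. near \<epsilon> x z}" using \<delta>(1) by blast
qed

lemma continuous_map_space_of:
  fixes f :: "'a::real_closed_field list \<Rightarrow> 'a list"
  shows "continuous_map (space_of X) (space_of Y) f \<longleftrightarrow> f \<in> X \<rightarrow> Y \<and> cont X f"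
proof
  assume c: "continuous_map (space_of X) (space_of Y) f"
  have sub: "f \<in> X \<rightarrow> Y" using c unfolding continuous_map_def topspace_space_of by blast
  have "\<exists>\<delta>>0. \<forall>y\<in>X. near \<delta> x y \<longrightarrow> near \<epsilon> (f x) (f y)" if x: "x \<in> X" "\<epsilon> > 0" for x \<epsilon>
  proof -
    have "openin (space_of Y) ({z. near \<epsilon> (f x) z} \<inter> Y)"
      unfolding openin_subtopology using near_ball_open by blast
    then have "openin (space_of X) {y \<in> X. f y \<in> {z. near \<epsilon> (f x) z} \<inter> Y}"
      using c unfolding continuous_map_def topspace_space_of by blast
    moreover have "x \<in> {y \<in> X. f y \<in> {z. near \<epsilon> (f x) z} \<inter> Y}"
      using x sub near_refl[OF x(2)] by blast
    ultimately show ?thesis unfolding openin_space_of by blast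
  qed
  then show "f \<in> X \<rightarrow> Y \<and> cont X f" using sub unfolding cont_def by blast
next
  assume c: "f \<in> X \<rightarrow> Y \<and> cont X f"
  have "openin (space_of X) {x \<in> X. f x \<in> U}" if U: "openin (space_of Y) U" for U
    unfolding openin_space_of
  proof (intro conjI ballI)
    fix x assume x: "x \<in> {x \<in> X. f x \<in> U}"
    then obtain \<epsilon> where \<epsilon>: "\<epsilon> > 0" "\<And>z. z \<in> Y \<Longrightarrow> near \<epsilon> (f x) z \<Longrightarrow> z \<in> U"
      using U unfolding openin_space_of by blast
    obtain \<delta> where "\<delta> > 0" "\<And>y. y \<in> X \<Longrightarrow> near \<delta> x y \<Longrightarrow> near \<epsilon> (f x) (f y)"
      using contD[of X f x \<epsilon>] c x \<epsilon>(1) by blast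
    then show "\<exists>\<delta>>0. \<forall>y\<in>X. near \<delta> x y \<longrightarrow> y \<in> {x \<in> X. f x \<in> U}" using \<epsilon>(2) c by blast
  qed blast
  then show "continuous_map (space_of X) (space_of Y) f"
    using c unfolding continuous_map_def topspace_space_of by blast
qed

section \<open>Composition and pasting of continuous maps\<close>

lemma cont_compose:
  assumes "cont X f" "cont Y g" "f \<in> X \<rightarrow> Y" shows "cont X (\<lambda>x. g (f x))"
  unfolding cont_def
proof (intro ballI allI impI)
  fix x and \<epsilon> :: 'a assume x: "x \<in> X" "\<epsilon> > 0"
  then have "f x \<in> Y" using assms(3) by blast
  then obtain \<eta> where \<eta>: "\<eta> > 0" "\<And>z. z \<in> Y \<Longrightarrow> near \<eta> (f x) z \<Longrightarrow> near \<epsilon> (g (f x)) (g z)"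
    using contD[OF assms(2) _ x(2)] by blast
  obtain \<delta> where "\<delta> > 0" "\<And>y. y \<in> X \<Longrightarrow> near \<delta> x y \<Longrightarrow> near \<eta> (f x) (f y)"
    using contD[OF assms(1) x(1) \<eta>(1)] by blast
  then show "\<exists>\<delta>>0. \<forall>y\<in>X. near \<delta> x y \<longrightarrow> near \<epsilon> (g (f x)) (g (f y))" using \<eta>(2) assms(3) by blast
qed

lemma cont_append:
  assumes "cont X f" "cont X g" shows "cont X (\<lambda>x. f x @ g x)"
  unfolding cont_def
proof (intro ballI allI impI)
  fix x and \<epsilon> :: 'a assume x: "x \<in> X" "\<epsilon> > 0"
  obtain \<delta> where \<delta>: "\<delta> > 0" "\<And>y. y \<in> X \<Longrightarrow> near \<delta> x y \<Longrightarrow> near \<epsilon> (f x) (f y)"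
    using contD[OF assms(1) x] by blast
  obtain \<eta> where \<eta>: "\<eta> > 0" "\<And>y. y \<in> X \<Longrightarrow> near \<eta> x y \<Longrightarrow> near \<epsilon> (g x) (g y)"
    using contD[OF assms(2) x] by blast
  have "near \<epsilon> (f x @ g x) (f y @ g y)" if "y \<in> X" "near (min \<delta> \<eta>) x y" for y
    using \<delta>(2)[OF that(1) near_mono[OF that(2)]] \<eta>(2)[OF that(1) near_mono[OF that(2)]]
    by (simp add: near_append near_length)
  then show "\<exists>\<delta>>0. \<forall>y\<in>X. near \<delta> x y \<longrightarrow> near \<epsilon> (f x @ g x) (f y @ g y)"
    using \<delta>(1) \<eta>(1) by (intro exI[of _ "min \<delta> \<eta>"]) simp
qed

lemma cont_subset: "cont X f \<Longrightarrow> Z \<subseteq> X \<Longrightarrow> cont Z f"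
  unfolding cont_def by blast

lemma cont_cong: "(\<And>x. x \<in> X \<Longrightarrow> f x = g x) \<Longrightarrow> cont X f \<longleftrightarrow> cont X g"
  unfolding cont_def by simp

lemma cont_contraction:
  assumes "\<And>x y \<delta>. x \<in> X \<Longrightarrow> y \<in> X \<Longrightarrow> \<delta> > 0 \<Longrightarrow> near \<delta> x y \<Longrightarrow> near \<delta> (f x) (f y)"
  shows "cont X f"
  unfolding cont_def using assms by blast

lemma cont_const: "cont X (\<lambda>x. c)"
  by (rule cont_contraction) (simp add: near_refl)

lemma near_take: "near \<delta> x y \<Longrightarrow> near \<delta> (take k x) (take k y)"
  by (simp add: near_def)

lemma near_drop: "near \<delta> x y \<Longrightarrow> near \<delta> (drop k x) (drop k y)"
  by (auto simp: near_def)

text \<open>The pasting lemma for two relatively closed sets, closedness being stated as a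
  neighbourhood free of the set around each outside point. At a point \<open>x\<close> the nearby
  points in \<open>C\<close> and those in \<open>D\<close> are controlled separately; a set that
  does not contain \<open>x\<close> has no nearby points.\<close>

lemma cont_paste:
  assumes "\<And>x. x \<in> X \<Longrightarrow> x \<in> C \<or> x \<in> D"
    and C: "\<And>x. x \<in> X \<Longrightarrow> x \<notin> C \<Longrightarrow> \<exists>\<delta>>0. \<forall>y\<in>X. near \<delta> x y \<longrightarrow> y \<notin> C"
    and D: "\<And>x. x \<in> X \<Longrightarrow> x \<notin> D \<Longrightarrow> \<exists>\<delta>>0. \<forall>y\<in>X. near \<delta> x y \<longrightarrow> y \<notin> D"
    and f: "cont (X \<inter> C) f" and g: "cont (X \<inter> D) g"
    and eq: "\<And>x. x \<in> X \<Longrightarrow> x \<in> C \<Longrightarrow> x \<in> D \<Longrightarrow> f x = g x"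
  shows "cont X (\<lambda>x. if x \<in> C then f x else g x)"
  unfolding cont_def
proof (intro ballI allI impI)
  fix x and \<epsilon> :: 'a assume x: "x \<in> X" "\<epsilon> > 0"
  let ?h = "\<lambda>x. if x \<in> C then f x else g x"
  have h_g: "?h y = g y" if "y \<in> X" "y \<in> D" for y using eq[OF that(1)] that(2) by auto
  have 1: "\<exists>\<delta>>0. \<forall>y\<in>X. y \<in> C \<longrightarrow> near \<delta> x y \<longrightarrow> near \<epsilon> (?h x) (?h y)"
  proof (cases "x \<in> C")
    case True
    then obtain \<delta> where "\<delta> > 0" "\<And>y. y \<in> X \<inter> C \<Longrightarrow> near \<delta> x y \<Longrightarrow> near \<epsilon> (f x) (f y)"
      using contD[OF f _ x(2)] x(1) by blast
    then show ?thesis using True by (intro exI[of _ \<delta>]) simp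
  next
    case False
    then show ?thesis using C[OF x(1)] by blast
  qed
  have 2: "\<exists>\<delta>>0. \<forall>y\<in>X. y \<in> D \<longrightarrow> near \<delta> x y \<longrightarrow> near \<epsilon> (?h x) (?h y)"
  proof (cases "x \<in> D")
    case True
    then obtain \<delta> where "\<delta> > 0" "\<And>y. y \<in> X \<inter> D \<Longrightarrow> near \<delta> x y \<Longrightarrow> near \<epsilon> (g x) (g y)"
      using contD[OF g _ x(2)] x(1) by blast
    then show ?thesis using h_g[OF x(1) True] h_g by (intro exI[of _ \<delta>]) (simp del: if_split)
  next
    case False
    then show ?thesis using D[OF x(1)] by blast
  qed
  obtain d1 where d1: "d1 > 0" "\<forall>y\<in>X. y \<in> C \<longrightarrow> near d1 x y \<longrightarrow> near \<epsilon> (?h x) (?h y)" using 1 by blast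
  obtain d2 where d2: "d2 > 0" "\<forall>y\<in>X. y \<in> D \<longrightarrow> near d2 x y \<longrightarrow> near \<epsilon> (?h x) (?h y)" using 2 by blast
  have "near \<epsilon> (?h x) (?h y)" if y: "y \<in> X" "near (min d1 d2) x y" for y
    using assms(1)[OF y(1)] d1(2)[rule_format, OF y(1) _ near_mono[OF y(2)]]
      d2(2)[rule_format, OF y(1) _ near_mono[OF y(2)]] by fastforce
  then show "\<exists>\<delta>>0. \<forall>y\<in>X. near \<delta> x y \<longrightarrow> near \<epsilon> (?h x) (?h y)"
    using d1(1) d2(1) by (intro exI[of _ "min d1 d2"]) (simp del: if_split)
qed

text \<open>\<open>dlist\<close> asks for definability at every environment, while only the values
  of \<open>f\<close> on \<open>X\<close> matter; hence the extension by zeros. The dimensions are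
  explicit because coordinates of concatenated lists are extracted with \<open>take\<close> and
  \<open>drop\<close>.\<close>

definition dmap ::
    "('f, 'r, 'a::real_closed_field) expansion \<Rightarrow> nat \<Rightarrow> nat \<Rightarrow> 'a list set \<Rightarrow> ('a list \<Rightarrow> 'a list) \<Rightarrow> bool" where
  "dmap M n m X f \<longleftrightarrow> definable_in M n X \<and> (\<forall>x\<in>X. length (f x) = m) \<and>
     dlist M m (\<lambda>e. if map e [0..<n] \<in> X then f (map e [0..<n]) else replicate m 0) \<and> cont X f"

lemma dlist_subst_list:
  assumes "dlist M m (\<lambda>e. g (map e [0..<n]))" "dlist M n v"
  shows "dlist M m (\<lambda>e. g (v e))"
proof -
  have "length (g (v e)) = m" for e
  proof -
    have "map (\<lambda>i. v e ! i) [0..<n] = v e" using assms(2) by (auto simp: dlist_def intro: nth_equalityI)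
    moreover have "length (g (map (\<lambda>i. v e ! i) [0..<n])) = m" using assms(1) by (auto simp: dlist_def)
    ultimately show ?thesis by simp
  qed
  moreover have "dfun M (\<lambda>e. g (v e) ! i)" if "i < m" for i
    by (rule dfun_subst_list[where g="\<lambda>x. g x ! i", OF _ assms(2)]) (use assms(1) that in \<open>simp add: dlist_def\<close>)
  ultimately show ?thesis by (simp add: dlist_def)
qed

lemma dmap_dlist:
  assumes "dmap M n m X f" "dlist M n v"
  shows "dlist M m (\<lambda>e. if v e \<in> X then f (v e) else replicate m 0)"
  by (rule dlist_subst_list[where g="\<lambda>x. if x \<in> X then f x else replicate m 0", OF _ assms(2)])
    (use assms(1) in \<open>simp add: dmap_def\<close>)

lemma dmap_definable: "dmap M n m X f \<Longrightarrow> definable_in M n X"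
  by (simp add: dmap_def)

lemma dmap_length: "dmap M n m X f \<Longrightarrow> x \<in> X \<Longrightarrow> length (f x) = m"
  by (simp add: dmap_def)

lemma dmap_cont: "dmap M n m X f \<Longrightarrow> cont X f"
  by (simp add: dmap_def)

lemma dmap_cong:
  assumes "\<And>x. x \<in> X \<Longrightarrow> f x = g x" "dmap M n m X f" shows "dmap M n m X g"
proof -
  have "(\<lambda>e. if map e [0..<n] \<in> X then f (map e [0..<n]) else replicate m 0) =
      (\<lambda>e. if map e [0..<n] \<in> X then g (map e [0..<n]) else replicate m 0)"
    using assms(1) by auto
  then show ?thesis using assms(2) cont_cong[OF assms(1)] assms(1) by (simp add: dmap_def)
qed

lemma dmapI:
  assumes X: "definable_in M n X" and v: "dlist M m (\<lambda>e. f (map e [0..<n]))" and "cont X f"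
  shows "dmap M n m X f"
proof -
  have "length (f x) = m" if "length x = n" for x
  proof -
    have "map (\<lambda>i. x ! i) [0..<n] = x" using that by (auto intro: nth_equalityI)
    moreover have "length (f (map (\<lambda>i. x ! i) [0..<n])) = m" using v by (auto simp: dlist_def)
    ultimately show ?thesis by simp
  qed
  moreover have "dlist M m (\<lambda>e. if map e [0..<n] \<in> X then f (map e [0..<n]) else replicate m 0)"
    by (intro dlist_if dpred_mem[OF X] dlist_map_vars v dlist_const) simp
  ultimately show ?thesis using assms definable_in_length[OF X] by (simp add: dmap_def)
qed

lemma dmap_id: "definable_in M n X \<Longrightarrow> dmap M n n X (\<lambda>x. x)"
  by (rule dmapI) (auto simp: dlist_map_vars intro: cont_contraction)

lemma dmap_const: "definable_in M n X \<Longrightarrow> length c = m \<Longrightarrow> dmap M n m X (\<lambda>x. c)"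
  by (rule dmapI) (auto simp: dlist_const cont_const)

lemma dmap_subset:
  assumes "dmap M n m X f" "definable_in M n Z" "Z \<subseteq> X" shows "dmap M n m Z f"
proof -
  have "dlist M m (\<lambda>e. if map e [0..<n] \<in> Z then
      (if map e [0..<n] \<in> X then f (map e [0..<n]) else replicate m 0) else replicate m 0)"
    by (intro dlist_if dpred_mem[OF assms(2)] dlist_map_vars dmap_dlist[OF assms(1)] dlist_const) simp
  moreover have "(\<lambda>e. if map e [0..<n] \<in> Z then
      (if map e [0..<n] \<in> X then f (map e [0..<n]) else replicate m 0) else replicate m 0) =
      (\<lambda>e. if map e [0..<n] \<in> Z then f (map e [0..<n]) else replicate m 0)"
    by (rule ext) (use assms(3) in auto)
  ultimately show ?thesis
    using assms cont_subset by (auto simp: dmap_def)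
qed

lemma dmap_compose:
  assumes f: "dmap M n m X f" and g: "dmap M m k Y g" and "f \<in> X \<rightarrow> Y"
  shows "dmap M n k X (\<lambda>x. g (f x))"
proof -
  let ?f = "\<lambda>x. if x \<in> X then f x else replicate m 0"
  have "dlist M k (\<lambda>e. if map e [0..<n] \<in> X then
      (if ?f (map e [0..<n]) \<in> Y then g (?f (map e [0..<n])) else replicate k 0) else replicate k 0)"
    by (intro dlist_if dpred_mem[OF dmap_definable[OF f]] dlist_map_vars dmap_dlist[OF g] dmap_dlist[OF f] dlist_const) simp
  moreover have "(\<lambda>e. if map e [0..<n] \<in> X then
      (if ?f (map e [0..<n]) \<in> Y then g (?f (map e [0..<n])) else replicate k 0) else replicate k 0) =
      (\<lambda>e. if map e [0..<n] \<in> X then g (f (map e [0..<n])) else replicate k 0)"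
    by (rule ext) (use assms(3) in auto)
  ultimately show ?thesis
    using assms cont_compose[OF dmap_cont[OF f] dmap_cont[OF g]] dmap_length[OF g] by (auto simp: dmap_def)
qed

lemma dmap_append:
  assumes f: "dmap M n m X f" and g: "dmap M n k X g" and l: "l = m + k"
  shows "dmap M n l X (\<lambda>x. f x @ g x)"
proof -
  have "dlist M l (\<lambda>e. (if map e [0..<n] \<in> X then f (map e [0..<n]) else replicate m 0) @
      (if map e [0..<n] \<in> X then g (map e [0..<n]) else replicate k 0))"
    by (intro dlist_append[OF _ _ l] dlist_map_vars dmap_dlist[OF f] dmap_dlist[OF g])
  moreover have "(\<lambda>e. (if map e [0..<n] \<in> X then f (map e [0..<n]) else replicate m 0) @
      (if map e [0..<n] \<in> X then g (map e [0..<n]) else replicate k 0)) =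
      (\<lambda>e. if map e [0..<n] \<in> X then f (map e [0..<n]) @ g (map e [0..<n]) else replicate l 0)"
    using l by (auto simp: replicate_add)
  ultimately show ?thesis
    using assms cont_append[OF dmap_cont[OF f] dmap_cont[OF g]] by (auto simp: dmap_def)
qed

lemma dmap_take: "definable_in M n X \<Longrightarrow> k \<le> n \<Longrightarrow> dmap M n k X (take k)"
  by (rule dmapI) (auto intro!: dlist_take dlist_map_vars cont_contraction near_take)

lemma dmap_drop: "definable_in M n X \<Longrightarrow> k + m = n \<Longrightarrow> dmap M n m X (drop k)"
  by (rule dmapI) (auto intro!: dlist_drop dlist_map_vars cont_contraction near_drop)

lemma dpred_comp_mem:
  assumes f: "dmap M n m X f" and T: "definable_in M m T" and v: "dlist M n v"
  shows "dpred M (\<lambda>e. v e \<in> X \<and> f (v e) \<in> T)"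
proof -
  have "dpred M (\<lambda>e. v e \<in> X \<and> (if v e \<in> X then f (v e) else replicate m 0) \<in> T)"
    by (intro dpred_conj dpred_mem[OF dmap_definable[OF f]] dpred_mem[OF T] dmap_dlist[OF f] v)
  then show ?thesis by (rule back_subst) (intro arg_cong[of _ _ "dpred M"] ext, auto)
qed

lemma definable_preimage:
  assumes f: "dmap M n m X f" and T: "definable_in M m T"
  shows "definable_in M n {x \<in> X. f x \<in> T}"
  unfolding definable_in_iff
  using dpred_comp_mem[OF assms dlist_map_vars] definable_in_length[OF dmap_definable[OF f]] by auto

lemma definable_equalizer:
  assumes f: "dmap M n m X f" and g: "dmap M n m X g"
  shows "definable_in M n {x \<in> X. f x = g x}"
proof -
  have "dpred M (\<lambda>e. map e [0..<n] \<in> X \<and> (if map e [0..<n] \<in> X then f (map e [0..<n]) else replicate m 0) =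
      (if map e [0..<n] \<in> X then g (map e [0..<n]) else replicate m 0))"
    by (intro dpred_conj dpred_mem[OF dmap_definable[OF f]] dpred_list_eq[where n=m] dmap_dlist[OF f] dmap_dlist[OF g] dlist_map_vars)
  moreover have "(\<lambda>e. map e [0..<n] \<in> X \<and> (if map e [0..<n] \<in> X then f (map e [0..<n]) else replicate m 0) =
      (if map e [0..<n] \<in> X then g (map e [0..<n]) else replicate m 0)) =
      (\<lambda>e. map e [0..<n] \<in> {x \<in> X. f x = g x})" by auto
  ultimately show ?thesis
    unfolding definable_in_iff using definable_in_length[OF dmap_definable[OF f]] by auto
qed

lemma dmap_paste:
  assumes f: "dmap M n m C f" and g: "dmap M n m D g" and X: "X = C \<union> D"
    and C: "\<And>x. x \<in> X \<Longrightarrow> x \<notin> C \<Longrightarrow> \<exists>\<delta>>0. \<forall>y\<in>X. near \<delta> x y \<longrightarrow> y \<notin> C"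
    and D: "\<And>x. x \<in> X \<Longrightarrow> x \<notin> D \<Longrightarrow> \<exists>\<delta>>0. \<forall>y\<in>X. near \<delta> x y \<longrightarrow> y \<notin> D"
    and eq: "\<And>x. x \<in> C \<Longrightarrow> x \<in> D \<Longrightarrow> f x = g x"
  shows "dmap M n m X (\<lambda>x. if x \<in> C then f x else g x)"
proof -
  note dC = dmap_definable[OF f] and dD = dmap_definable[OF g]
  have "dpred M (\<lambda>e. map e [0..<n] \<in> C \<or> map e [0..<n] \<in> D)"
    by (intro dpred_disj dpred_mem[OF dC] dpred_mem[OF dD] dlist_map_vars)
  then have dX: "definable_in M n X"
    using X definable_in_length[OF dC] definable_in_length[OF dD] by (auto simp: definable_in_iff)
  have "dlist M m (\<lambda>e. if map e [0..<n] \<in> C then (if map e [0..<n] \<in> C then f (map e [0..<n]) else replicate m 0)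
      else (if map e [0..<n] \<in> D then g (map e [0..<n]) else replicate m 0))"
    by (intro dlist_if dpred_mem[OF dC] dlist_map_vars dmap_dlist[OF f] dmap_dlist[OF g])
  moreover have "(\<lambda>e. if map e [0..<n] \<in> C then (if map e [0..<n] \<in> C then f (map e [0..<n]) else replicate m 0)
      else (if map e [0..<n] \<in> D then g (map e [0..<n]) else replicate m 0)) =
     (\<lambda>e. if map e [0..<n] \<in> X then (if map e [0..<n] \<in> C then f (map e [0..<n]) else g (map e [0..<n])) else replicate m 0)"
    using X by auto
  moreover have "cont X (\<lambda>x. if x \<in> C then f x else g x)"
    by (rule cont_paste[OF _ C D])
      (use X eq cont_subset[OF dmap_cont[OF f]] cont_subset[OF dmap_cont[OF g]] in auto)
  ultimately show ?thesis
    using dX X dmap_length[OF f] dmap_length[OF g] by (auto simp: dmap_def)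
qed

section \<open>Products, and definable maps through their graphs\<close>

lemma mem_set_product:
  assumes "S \<subseteq> {x. length x = n}"
  shows "z \<in> S \<otimes> T \<longleftrightarrow> take n z \<in> S \<and> drop n z \<in> T"
proof
  assume "z \<in> S \<otimes> T"
  then show "take n z \<in> S \<and> drop n z \<in> T" using assms unfolding set_product_def by auto
next
  assume "take n z \<in> S \<and> drop n z \<in> T"
  then show "z \<in> S \<otimes> T" unfolding set_product_def
    by (metis (mono_tags, lifting) append_take_drop_id mem_Collect_eq)
qed

lemma set_product_iff:
  assumes "definable_in M n S" "length x = n"
  shows "x @ y \<in> S \<otimes> T \<longleftrightarrow> x \<in> S \<and> y \<in> T"
  using mem_set_product[of S n "x @ y" T] definable_in_length[OF assms(1)] assms(2) by auto

lemma set_productE: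
  assumes "z \<in> S \<otimes> T" obtains x y where "z = x @ y" "x \<in> S" "y \<in> T"
  using assms unfolding set_product_def by blast

lemma set_productI: "x \<in> S \<Longrightarrow> y \<in> T \<Longrightarrow> x @ y \<in> S \<otimes> T"
  unfolding set_product_def by blast

lemma definable_product:
  assumes S: "definable_in M n S" and T: "definable_in M m T" and k: "k = n + m"
  shows "definable_in M k (S \<otimes> T)"
  unfolding definable_in_iff
proof
  show "S \<otimes> T \<subseteq> {x. length x = k}"
    using definable_in_length[OF S] definable_in_length[OF T] k by (auto simp: set_product_def)
  have "dpred M (\<lambda>e. take n (map e [0..<k]) \<in> S \<and> drop n (map e [0..<k]) \<in> T)"
    using k by (intro dpred_conj dpred_mem[OF S] dpred_mem[OF T] dlist_take[where n=k] dlist_drop[where n=k] dlist_map_vars) auto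
  then show "dpred M (\<lambda>e. map e [0..<k] \<in> S \<otimes> T)"
    using mem_set_product[of S n _ T] definable_in_length[OF S] by (simp add: subset_iff)
qed

lemma unit_interval_iff: "x \<in> unit_interval \<longleftrightarrow> (\<exists>t. x = [t] \<and> 0 \<le> t \<and> t \<le> 1)"
  by (auto simp: unit_interval_def)

lemma definable_unit_interval: "definable_in M (Suc 0) unit_interval"
  unfolding definable_in_iff
proof
  have "dpred M (\<lambda>e. 0 \<le> e 0 \<and> e 0 \<le> 1)" by (intro dintros)
  then show "dpred M (\<lambda>e. map e [0..<Suc 0] \<in> unit_interval)" by (simp add: unit_interval_iff)
qed (auto simp: unit_interval_iff)

text \<open>From the graph, a coordinate of \<open>f x\<close> is obtained by quantifying over the
  whole value; conversely the graph is the equalizer of \<open>f\<close> after \<open>take n\<close>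
  with \<open>drop n\<close>.\<close>

lemma definable_map_iff_dmap:
  assumes X: "definable_in M n X" and Y: "definable_in M m Y"
  shows "definable_map M X Y f \<longleftrightarrow> dmap M n m X f \<and> f \<in> X \<rightarrow> Y"
proof
  assume f: "definable_map M X Y f"
  then have fXY: "f \<in> X \<rightarrow> Y" and c: "cont X f"
    unfolding definable_map_def continuous_map_space_of by blast+
  have len: "length (f x) = m" if "x \<in> X" for x using that fXY definable_in_length[OF Y] by blast
  define G where "G = {x @ f x |x. x \<in> X}"
  have "G \<subseteq> {z. length z = n + m}" using len definable_in_length[OF X] by (auto simp: G_def)
  then have G: "definable_in M (n + m) G"
    using f definable_iff[of M G "n + m"] unfolding definable_map_def G_def by blast
  have G_iff: "x @ y \<in> G \<longleftrightarrow> x \<in> X \<and> y = f x" if "length x = n" for x y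
  proof
    assume "x @ y \<in> G"
    then obtain x' where x': "x @ y = x' @ f x'" "x' \<in> X" unfolding G_def by (elim CollectE exE conjE)
    have "length x = length x'" using definable_in_length[OF X x'(2)] that by simp
    then show "x \<in> X \<and> y = f x" using x' by simp
  next
    assume "x \<in> X \<and> y = f x"
    then show "x @ y \<in> G" unfolding G_def by blast
  qed
  let ?F = "\<lambda>x. if x \<in> X then f x else replicate m 0"
  have "dfun M (\<lambda>e. ?F (map e [0..<n]) ! i)" if i: "i < m" for i
  proof -
    have "dpred M (\<lambda>e. \<exists>y. length y = m \<and> map (\<lambda>i. e (Suc i)) [0..<n] @ y \<in> G \<and> e 0 = y ! i)"
    proof (rule dpred_ex_list, rule dpred_conj)
      show "dpred M (\<lambda>e. map (\<lambda>i. e (m + Suc i)) [0..<n] @ map e [0..<m] \<in> G)"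
        by (rule dpred_mem[OF G], rule dlist_append[OF dlist_vars dlist_map_vars]) simp
      show "dpred M (\<lambda>e. e (m + 0) = map e [0..<m] ! i)" using i by (simp add: dpred_var_eq)
    qed
    moreover have "dpred M (\<lambda>e. map (\<lambda>i. e (Suc i)) [0..<n] \<notin> X \<and> e 0 = 0)"
      by (intro dpred_conj dpred_not dpred_mem[OF X] dlist_vars dintros)
    ultimately have "dpred M (\<lambda>e. (\<exists>y. length y = m \<and> map (\<lambda>i. e (Suc i)) [0..<n] @ y \<in> G \<and> e 0 = y ! i) \<or>
        (map (\<lambda>i. e (Suc i)) [0..<n] \<notin> X \<and> e 0 = 0))" by (rule dpred_disj)
    then show ?thesis unfolding dfun_def
      by (rule back_subst) (intro arg_cong[of _ _ "dpred M"] ext, use i in \<open>auto simp: G_iff len\<close>)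
  qed
  then have "dlist M m (\<lambda>e. ?F (map e [0..<n]))" using len by (auto simp: dlist_def)
  then show "dmap M n m X f \<and> f \<in> X \<rightarrow> Y" using X c len fXY by (simp add: dmap_def)
next
  assume f: "dmap M n m X f \<and> f \<in> X \<rightarrow> Y"
  define G where "G = {x @ f x |x. x \<in> X}"
  have G_eq: "G = {z \<in> X \<otimes> {y. length y = m}. f (take n z) = drop n z}"
  proof (intro subset_antisym subsetI)
    fix z assume "z \<in> G"
    then obtain x where x: "z = x @ f x" "x \<in> X" unfolding G_def by (elim CollectE exE conjE)
    then have "z \<in> X \<otimes> {y. length y = m}" using dmap_length[of M n m X f] f by (auto intro: set_productI)
    then show "z \<in> {z \<in> X \<otimes> {y. length y = m}. f (take n z) = drop n z}"
      using x definable_in_length[OF X x(2)] by simp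
  next
    fix z assume z: "z \<in> {z \<in> X \<otimes> {y. length y = m}. f (take n z) = drop n z}"
    then have "z \<in> X \<otimes> {y. length y = m}" by simp
    then obtain x y where xy: "z = x @ y" "x \<in> X" by (rule set_productE)
    then have "y = f x" using z definable_in_length[OF X xy(2)] by simp
    then show "z \<in> G" using xy unfolding G_def by blast
  qed
  have L: "definable_in M m {y. length y = m}"
    by (simp add: definable_in_iff dpred_const)
  have XL: "definable_in M (n + m) (X \<otimes> {y. length y = m})" by (rule definable_product[OF X L]) simp
  have "dmap M (n + m) m (X \<otimes> {y. length y = m}) (\<lambda>z. f (take n z))"
    by (rule dmap_compose[OF dmap_take[OF XL] conjunct1[OF f]])
      (use definable_in_length[OF X] in \<open>auto elim!: set_productE\<close>)
  then have "definable_in M (n + m) G"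
    unfolding G_eq by (rule definable_equalizer) (rule dmap_drop[OF XL], simp)
  then have "definable M G" using definable_iff by blast
  then show "definable_map M X Y f"
    unfolding definable_map_def continuous_map_space_of
    using f dmap_cont[of M n m X f] definable_iff[of M X n] definable_iff[of M Y m] X Y
    by (simp add: G_def)
qed

subsection \<open>Subdivision of homotopies\<close>

lemma is_lub_lub: "\<exists>s. is_lub s S \<Longrightarrow> is_lub (lub S) S"
  using lub_eq by auto

definition step_set :: "'a::linordered_field \<Rightarrow> ('a \<Rightarrow> 'a) \<Rightarrow> 'a \<Rightarrow> 'a set" where
  "step_set l D t = {s. s = t \<or> t \<le> s \<and> s \<le> 1 \<and> (\<forall>r. t \<le> r \<and> r \<le> s \<longrightarrow> l * (1 + s - t) \<le> 4 * D r)}"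

text \<open>
  The threshold rises from \<open>l / 4\<close> to at most \<open>l / 2\<close> as the step gets longer. This hysteresis makes
  the length of the step continuous in all data, while the step still cannot end at a point
  \<open>s < 1\<close> such that \<open>D \<ge> l\<close> on the interval from \<open>t\<close> to \<open>s\<close>.
\<close>

definition step :: "'a::linordered_field \<Rightarrow> ('a \<Rightarrow> 'a) \<Rightarrow> 'a \<Rightarrow> 'a" where
  "step l D t = lub (step_set l D t)"

text \<open>Shortening a step by \<open>\<epsilon> / 2\<close> lowers its threshold by
  \<open>l * \<epsilon> / 2\<close>, and this pays for the perturbation: \<open>8 * \<eta>\<close>
  from the four times weighted \<open>D\<close>, \<open>2 * \<eta>\<close> from \<open>l'\<close>
  (its factor is at most 2), and \<open>\<eta>\<close> from the shift of \<open>t\<close>.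
  Altogether \<open>11 * \<eta>\<close> has to be at most \<open>l * \<epsilon> / 2\<close>, hence
  the 22.\<close>

lemma step_lower:
  fixes l :: "'a::linordered_field"
  assumes s: "is_lub s (step_set l D t)" and s': "is_lub s' (step_set l' D' t')"
    and l: "0 < l" "l \<le> 1" "l' \<le> l + \<eta>" "0 \<le> l'" and t: "0 \<le> t" "t \<le> 1" "0 \<le> t'" "t' \<le> 1" "\<bar>t - t'\<bar> \<le> \<eta>"
    and D: "\<And>r r'. 0 \<le> r \<Longrightarrow> r \<le> 1 \<Longrightarrow> 0 \<le> r' \<Longrightarrow> r' \<le> 1 \<Longrightarrow> \<bar>r - r'\<bar> \<le> \<eta> \<Longrightarrow> D r \<le> D' r' + 2 * \<eta>"
    and \<eta>: "0 < \<eta>" "22 * \<eta> \<le> l * \<epsilon>"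
  shows "s - \<epsilon> \<le> s'"
proof (rule ccontr)
  assume *: "\<not> s - \<epsilon> \<le> s'"
  have "t' \<le> s'" using is_lub_upper[OF s'] by (simp add: step_set_def)
  with * have st: "t' < s - \<epsilon>" by simp
  have \<epsilon>: "\<epsilon> > 0" using \<eta> l(1) by (metis mult_pos_pos not_le_imp_less zero_less_mult_pos order_less_le_trans zero_less_numeral)
  have "l * \<epsilon> \<le> 1 * \<epsilon>" using l(2) \<epsilon> by (intro mult_right_mono) auto
  then have \<eta>\<epsilon>: "22 * \<eta> \<le> \<epsilon>" using \<eta>(2) by simp
  have "s - \<epsilon> / 2 < s" using \<epsilon> by simp
  \<comment> \<open>The supremum \<open>s\<close> need not be attained, so half of
    \<open>\<epsilon>\<close> is spent on reaching an admissible end \<open>s1\<close>; the other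
    half is the gain described above.\<close>
  then obtain s1 where s1: "s1 \<in> step_set l D t" "s - \<epsilon> / 2 < s1" using is_lub_less[OF s] by blast
  have half: "\<epsilon> / 2 + \<epsilon> / 2 = \<epsilon>" by simp
  have "s1 \<noteq> t"
  proof
    assume "s1 = t"
    then show False using s1(2) st t(5) \<eta>\<epsilon> half \<eta>(1) unfolding abs_le_iff by linarith
  qed
  then have s1': "t \<le> s1" "s1 \<le> 1" "\<And>r. t \<le> r \<Longrightarrow> r \<le> s1 \<Longrightarrow> l * (1 + s1 - t) \<le> 4 * D r"
    using s1(1) by (auto simp: step_set_def)
  have "s1 \<le> s" using is_lub_upper[OF s s1(1)] .
  have less: "s - \<epsilon> < s1 - \<epsilon> / 2" using s1(2) half by linarith
  have "s - \<epsilon> \<in> step_set l' D' t'"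
    unfolding step_set_def
  proof (intro CollectI disjI2 conjI allI impI)
    show "t' \<le> s - \<epsilon>" using st by simp
    show "s - \<epsilon> \<le> 1" using less s1'(2) \<epsilon> half by linarith
    fix r' assume r': "t' \<le> r' \<and> r' \<le> s - \<epsilon>"
    \<comment> \<open>If \<open>t' < t\<close>, the point \<open>r'\<close> may lie before
      \<open>t\<close>. Clipping it to \<open>t\<close> moves it by at most \<open>\<eta>\<close>
      and brings it into the range where \<open>s1\<close> controls \<open>D\<close>.\<close>
    have a1: "t \<le> max r' t" by simp
    have a2: "max r' t \<le> s1" using r' less s1'(1) \<epsilon> half by (simp add: max_def)
    have "\<bar>max r' t - r'\<bar> \<le> \<eta>" using r' t(5) \<eta>(1) by (auto simp: max_def abs_le_iff)
    moreover have "0 \<le> r'" "r' \<le> 1" using r' t(3) less s1'(2) \<epsilon> half by linarith+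
    ultimately have "D (max r' t) \<le> D' r' + 2 * \<eta>"
      using D[of "max r' t" r'] a1 a2 s1'(2) t(1) by auto
    then have 1: "l * (1 + s1 - t) - 8 * \<eta> \<le> 4 * D' r'" using s1'(3)[OF a1 a2] by linarith
    define x where "x = 1 + (s - \<epsilon>) - t'"
    have x: "0 \<le> x" "x \<le> 2" using st t(3) less s1'(2) \<epsilon> half by (auto simp: x_def)
    have x': "x \<le> 1 + s1 - t - \<epsilon> / 2 + \<eta>" using less t(5) by (simp add: x_def abs_le_iff)
    have "l' * x \<le> (l + \<eta>) * x" using l(3) x by (intro mult_right_mono) auto
    also have "\<dots> = l * x + \<eta> * x" by (simp add: distrib_right)
    also have "\<eta> * x \<le> \<eta> * 2" using x(2) \<eta>(1) by (intro mult_left_mono) auto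
    also have "l * x \<le> l * (1 + s1 - t - \<epsilon> / 2 + \<eta>)" using x' l(1) by (intro mult_left_mono) auto
    also have "\<dots> = l * (1 + s1 - t) - l * \<epsilon> / 2 + l * \<eta>" by (simp add: algebra_simps)
    also have "l * \<eta> \<le> 1 * \<eta>" using l(2) \<eta>(1) by (intro mult_right_mono) auto
    finally have "l' * x \<le> l * (1 + s1 - t) - l * \<epsilon> / 2 + 1 * \<eta> + \<eta> * 2" by simp
    moreover have "l * \<epsilon> / 2 + l * \<epsilon> / 2 = l * \<epsilon>" by simp
    ultimately have "l' * x \<le> l * (1 + s1 - t) - 8 * \<eta>" using \<eta>(2) by linarith
    with 1 show "l' * (1 + (s - \<epsilon>) - t') \<le> 4 * D' r'" unfolding x_def by linarith
  qed
  then have "s - \<epsilon> \<le> s'" by (rule is_lub_upper[OF s'])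
  with * show False by blast
qed

lemma step_bounds:
  assumes "is_lub s (step_set l D t)" "t \<le> 1" shows "t \<le> s" "s \<le> 1"
proof -
  show "t \<le> s" by (rule is_lub_upper[OF assms(1)]) (simp add: step_set_def)
  show "s \<le> 1" by (rule is_lub_least[OF assms(1)]) (use assms(2) in \<open>auto simp: step_set_def\<close>)
qed

text \<open>The threshold of a step never falls below \<open>l\<close>, so the bound is immediate at
  points covered by an admissible end. The end \<open>s\<close> itself may not be admissible, and
  there the Lipschitz bound on \<open>D\<close> carries the inequality over.\<close>

lemma step_inside:
  fixes l :: "'a::linordered_field"
  assumes s: "is_lub s (step_set l D t)" and l: "0 < l" and t: "0 \<le> t" "t \<le> 1"
    and D: "\<And>r r'. 0 \<le> r \<Longrightarrow> r \<le> 1 \<Longrightarrow> 0 \<le> r' \<Longrightarrow> r' \<le> 1 \<Longrightarrow> r \<noteq> r' \<Longrightarrow> D r \<le> D r' + \<bar>r - r'\<bar> * 2"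
    and r: "t \<le> r" "r \<le> s" "t < s"
  shows "l \<le> 4 * D r"
proof -
  have above': "l \<le> 4 * D p" if q: "q \<in> step_set l D t" "q \<noteq> t" "t \<le> p" "p \<le> q" for p q
  proof -
    have "l * 1 \<le> l * (1 + q - t)" using q l by (intro mult_left_mono) (auto simp: step_set_def)
    also have "\<dots> \<le> 4 * D p" using q by (auto simp: step_set_def)
    finally show ?thesis by simp
  qed
  note b = step_bounds[OF s t(2)]
  show ?thesis
  proof (rule ccontr)
    assume n: "\<not> l \<le> 4 * D r"
    \<comment> \<open>An eighth of the deficit: over a distance below \<open>g\<close> the value
      \<open>D\<close> changes by less than \<open>2 * g\<close>, hence \<open>4 * D\<close> by less
      than the whole deficit \<open>8 * g\<close>.\<close>
    define g where "g = (l - 4 * D r) / 8"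
    have g: "g > 0" "8 * g = l - 4 * D r" using n by (auto simp: g_def)
    obtain q where q: "q \<in> step_set l D t" "max t (r - g) < q"
      using is_lub_less[OF s, of "max t (r - g)"] r g(1) by auto
    have qs: "q \<le> s" "q \<noteq> t" using is_lub_upper[OF s q(1)] q(2) by auto
    have "\<not> r \<le> q" using above'[OF q(1) qs(2) r(1)] n by blast
    then have qr: "q < r" by simp
    have "l \<le> 4 * D q" by (rule above'[OF q(1) qs(2)]) (use q(2) in auto)
    moreover have "D q \<le> D r + \<bar>q - r\<bar> * 2"
      by (rule D) (use q(2) t qr r b in auto)
    moreover have "\<bar>q - r\<bar> * 2 < g * 2" using q(2) qr by (simp add: abs_less_iff)
    ultimately have "l \<le> 4 * D q" "D q < D r + g * 2" by simp_all
    then have "l < 4 * (D r + g * 2)" by simp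
    then show False using g(2) by (simp add: algebra_simps)
  qed
qed

text \<open>If \<open>D\<close> were at least \<open>l\<close> up to \<open>s\<close>, then on a
  further piece of length at most \<open>l / 4\<close> it would drop by at most
  \<open>l / 2\<close>. So \<open>4 * D\<close> would still be at least \<open>2 * l\<close>, which
  bounds every threshold, and the step could have been longer.\<close>

lemma step_progress:
  fixes l :: "'a::linordered_field"
  assumes s: "is_lub s (step_set l D t)" and l: "0 < l" and t: "0 \<le> t" "t \<le> 1" and "s < 1"
    and D: "\<And>r r'. 0 \<le> r \<Longrightarrow> r \<le> 1 \<Longrightarrow> 0 \<le> r' \<Longrightarrow> r' \<le> 1 \<Longrightarrow> r \<noteq> r' \<Longrightarrow> D r \<le> D r' + \<bar>r - r'\<bar> * 2"
  shows "\<exists>r. t \<le> r \<and> r \<le> s \<and> D r < l"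
proof (rule ccontr)
  assume "\<not> (\<exists>r. t \<le> r \<and> r \<le> s \<and> D r < l)"
  then have above: "l \<le> D r" if "t \<le> r" "r \<le> s" for r using that by force
  note b = step_bounds[OF s t(2)]
  define g where "g = min (l / 4) (1 - s)"
  have g: "g > 0" "g \<le> l / 4" "g \<le> 1 - s"
    unfolding g_def by (simp add: l assms(5), rule min.cobounded1, rule min.cobounded2)
  have "s + g \<in> step_set l D t"
    unfolding step_set_def
  proof (intro CollectI disjI2 conjI allI impI)
    show "t \<le> s + g" "s + g \<le> 1" using b g by auto
    fix r assume r: "t \<le> r \<and> r \<le> s + g"
    have "2 * l \<le> 4 * D r"
    proof (cases "r \<le> s")
      case True
      then show ?thesis using above[of r] r l by simp
    next
      case False
      have "D s \<le> D r + \<bar>s - r\<bar> * 2" by (rule D) (use False r b g t in auto)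
      moreover have "\<bar>s - r\<bar> \<le> l / 4" using False r g by auto
      moreover have "l \<le> D s" using above b by simp
      ultimately show ?thesis by (simp add: field_simps)
    qed
    moreover have "l * (1 + (s + g) - t) \<le> l * 2" using l g b t by (intro mult_left_mono) auto
    ultimately show "l * (1 + (s + g) - t) \<le> 4 * D r" by simp
  qed
  then show False using is_lub_upper[OF s, of "s + g"] g(1) by simp
qed

section \<open>The distance to the complement of an open definable set\<close>

lemma dpred_near:
  assumes "dfun M r" "dlist M n v" "dlist M m w"
  shows "dpred M (\<lambda>e. near (r e) (v e) (w e))"
proof (cases "n = m")
  case True
  have "dpred M (\<lambda>e. \<forall>i<n. \<bar>v e ! i - w e ! i\<bar> < r e)"
    using assms True by (intro dpred_ball_lessThan dintros dfun_nth[where n=n]) auto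
  then show ?thesis using assms(2,3) True by (simp add: near_def dlist_def)
next
  case False
  then show ?thesis using assms(2,3) by (simp add: near_def dlist_def dpred_const)
qed

text \<open>The distance from \<open>z\<close> to the complement of \<open>W\<close> in
  \<open>Z\<close>, cut off at 1 because that complement may be empty. It is the source of definable
  Lipschitz functions that are positive on \<open>W\<close>.\<close>

definition radius :: "'a::linordered_field list set \<Rightarrow> 'a list set \<Rightarrow> 'a list \<Rightarrow> 'a" where
  "radius Z W z = lub {\<rho>. \<rho> = 0 \<or> 0 < \<rho> \<and> \<rho> \<le> 1 \<and> (\<forall>w\<in>Z. near \<rho> z w \<longrightarrow> w \<in> W)}"

lemma radius:
  assumes "o_minimal M" "definable_in M n Z" "definable_in M n W"
  shows "is_lub (radius Z W z) {\<rho>. \<rho> = 0 \<or> 0 < \<rho> \<and> \<rho> \<le> 1 \<and> (\<forall>w\<in>Z. near \<rho> z w \<longrightarrow> w \<in> W)}"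
proof -
  have "\<exists>s. is_lub s {\<rho>. \<rho> = 0 \<or> 0 < \<rho> \<and> \<rho> \<le> 1 \<and> (\<forall>w\<in>Z. near \<rho> z w \<longrightarrow> w \<in> W)}"
  proof (rule is_lub_exists[OF assms(1), where u=1])
    show "dset M {\<rho>. \<rho> = 0 \<or> 0 < \<rho> \<and> \<rho> \<le> 1 \<and> (\<forall>w\<in>Z. near \<rho> z w \<longrightarrow> w \<in> W)}"
      unfolding dset_def mem_Collect_eq
      by (intro dintros dpred_ball[OF assms(2)] dpred_near[where n="length z" and m=n] dpred_mem[OF assms(3)] dlist_const) simp
  qed auto
  then show ?thesis unfolding radius_def by (rule is_lub_lub)
qed

lemma dfun_radius:
  assumes "o_minimal M" "definable_in M n Z" "definable_in M n W" "dlist M k v"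
  shows "dfun M (\<lambda>e. radius Z W (v e))"
proof (rule dfun_subst_list[where g="radius Z W", OF _ assms(4)])
  show "dfun M (\<lambda>e. radius Z W (map e [0..<k]))"
    unfolding radius_def
  proof (rule dfun_lub[where Q="\<lambda>\<rho> e. \<rho> = 0 \<or> 0 < \<rho> \<and> \<rho> \<le> 1 \<and> (\<forall>w\<in>Z. near \<rho> (map e [0..<k]) w \<longrightarrow> w \<in> W)"])
    show "dpred M (\<lambda>e. e 0 = 0 \<or> 0 < e 0 \<and> e 0 \<le> 1 \<and> (\<forall>w\<in>Z. near (e 0) (map (\<lambda>i. e (Suc i)) [0..<k]) w \<longrightarrow> w \<in> W))"
      by (intro dintros dpred_ball[OF assms(2)] dpred_near[where n=k and m=n] dpred_mem[OF assms(3)])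
  qed (use radius[OF assms(1-3)] in blast)
qed

lemma radius_bounds:
  assumes "o_minimal M" "definable_in M n Z" "definable_in M n W"
  shows "0 \<le> radius Z W z" "radius Z W z \<le> 1"
proof -
  show "0 \<le> radius Z W z" by (rule is_lub_upper[OF radius[OF assms]]) simp
  show "radius Z W z \<le> 1" by (rule is_lub_least[OF radius[OF assms]]) auto
qed

lemma radius_lipschitz:
  assumes "o_minimal M" "definable_in M n Z" "definable_in M n W" "near \<eta> z z'" "\<eta> > 0"
  shows "radius Z W z \<le> radius Z W z' + \<eta>"
proof (rule is_lub_least[OF radius[OF assms(1-3)]])
  fix \<rho> assume \<rho>: "\<rho> \<in> {\<rho>. \<rho> = 0 \<or> 0 < \<rho> \<and> \<rho> \<le> 1 \<and> (\<forall>w\<in>Z. near \<rho> z w \<longrightarrow> w \<in> W)}"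
  show "\<rho> \<le> radius Z W z' + \<eta>"
  proof (cases "\<rho> \<le> \<eta>")
    case True
    then show ?thesis using radius_bounds(1)[OF assms(1-3), of z'] by simp
  next
    case False
    then have "\<rho> \<noteq> 0" using assms(5) by auto
    have "w \<in> W" if "w \<in> Z" "near (\<rho> - \<eta>) z' w" for w
      using near_trans[OF assms(4) that(2)] \<rho> \<open>\<rho> \<noteq> 0\<close> that(1) by auto
    then have "\<rho> - \<eta> \<in> {\<rho>. \<rho> = 0 \<or> 0 < \<rho> \<and> \<rho> \<le> 1 \<and> (\<forall>w\<in>Z. near \<rho> z' w \<longrightarrow> w \<in> W)}"
      using False \<rho> assms(5) by auto
    from is_lub_upper[OF radius[OF assms(1-3)] this] show ?thesis by simp
  qed
qed

lemma radius_pos: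
  fixes W :: "'a::real_closed_field list set"
  assumes "o_minimal M" "definable_in M n Z" "definable_in M n W" "openin (space_of Z) W" "z \<in> W"
  shows "0 < radius Z W z"
proof -
  obtain \<delta> where \<delta>: "\<delta> > 0" "\<And>w. w \<in> Z \<Longrightarrow> near \<delta> z w \<Longrightarrow> w \<in> W"
    using assms(4,5) unfolding openin_space_of by blast
  have "min \<delta> 1 \<in> {\<rho>. \<rho> = 0 \<or> 0 < \<rho> \<and> \<rho> \<le> 1 \<and> (\<forall>w\<in>Z. near \<rho> z w \<longrightarrow> w \<in> W)}"
    using \<delta>(1) by (auto intro: \<delta>(2)[OF _ near_mono[OF _ min.cobounded1]])
  from is_lub_upper[OF radius[OF assms(1-3)] this] show ?thesis
    using \<delta>(1) by (meson less_le_trans min_less_iff_conj zero_less_one)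
qed

lemma radius_pos_mem:
  assumes "o_minimal M" "definable_in M n Z" "definable_in M n W" "0 < radius Z W z" "z \<in> Z"
  shows "z \<in> W"
  using is_lub_less[OF radius[OF assms(1-3)] assms(4)] near_refl assms(5) by auto

lemma dmap_scalar:
  assumes "definable_in M n X" "\<And>v. dlist M n v \<Longrightarrow> dfun M (\<lambda>e. s (v e))"
    and "\<And>x \<epsilon>. x \<in> X \<Longrightarrow> \<epsilon> > 0 \<Longrightarrow> \<exists>\<delta>>0. \<forall>y\<in>X. near \<delta> x y \<longrightarrow> \<bar>s x - s y\<bar> < \<epsilon>"
  shows "dmap M n (Suc 0) X (\<lambda>x. [s x])"
proof (rule dmapI[OF assms(1)])
  show "dlist M (Suc 0) (\<lambda>e. [s (map e [0..<n])])" by (intro dlist_singleton assms(2) dlist_map_vars)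
  show "cont X (\<lambda>x. [s x])" unfolding cont_def near_singleton using assms(3) by blast
qed

text \<open>\<open>Us\<close> will be the preimages of the charts under a homotopy. It is a list
  rather than a set because the steps go through the charts in a fixed order.\<close>

locale subdivision =
  fixes M :: "('f, 'r, 'a::real_closed_field) expansion" and n :: nat and Y :: "'a list set"
    and Us :: "'a list set list"
  assumes om: "o_minimal M" and Y: "definable_in M n Y"
    and Us: "\<And>W. W \<in> set Us \<Longrightarrow> definable_in M (Suc n) W \<and> openin (space_of (Y \<otimes> unit_interval)) W"
    and cover: "Y \<otimes> unit_interval \<subseteq> \<Union>(set Us)"
begin

abbreviation r :: "'a list set \<Rightarrow> 'a list \<Rightarrow> 'a" where
  "r W \<equiv> radius (Y \<otimes> unit_interval) W"

lemma Z: "definable_in M (Suc n) (Y \<otimes> unit_interval)"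
  by (rule definable_product[OF Y definable_unit_interval]) simp

lemma Z_iff: "y \<in> Y \<Longrightarrow> y @ [t] \<in> Y \<otimes> unit_interval \<longleftrightarrow> 0 \<le> t \<and> t \<le> 1"
  using set_product_iff[OF Y, of y] definable_in_length[OF Y] by (simp add: unit_interval_iff)

lemma r_lipschitz: "W \<in> set Us \<Longrightarrow> near \<eta> z z' \<Longrightarrow> \<eta> > 0 \<Longrightarrow> r W z \<le> r W z' + \<eta>"
  using radius_lipschitz[OF om Z] Us by blast

lemma r_dfun: "W \<in> set Us \<Longrightarrow> dlist M k v \<Longrightarrow> dfun M (\<lambda>e. r W (v e))"
  using dfun_radius[OF om Z] Us by blast

lemma r_pos_mem: "W \<in> set Us \<Longrightarrow> 0 < r W z \<Longrightarrow> z \<in> Y \<otimes> unit_interval \<Longrightarrow> z \<in> W"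
  using radius_pos_mem[OF om Z] Us by blast

text \<open>\<open>near\<close> is strict, so the distance \<open>\<bar>q - q'\<bar>\<close> itself
  is not an admissible radius; doubling it is, provided that it is positive.\<close>

lemma r_line:
  assumes "W \<in> set Us" "q \<noteq> q'" shows "r W (y @ [q]) \<le> r W (y @ [q']) + \<bar>q - q'\<bar> * 2"
proof -
  have "near (\<bar>q - q'\<bar> * 2) (y @ [q]) (y @ [q'])"
    using assms(2) by (simp add: near_append near_singleton near_refl)
  then show ?thesis using r_lipschitz[OF assms(1)] assms(2) by simp
qed

text \<open>A Lebesgue number, capped at \<open>1\<close>, of the cover along the segment over \<open>y\<close>.\<close>

definition lam :: "'a list \<Rightarrow> 'a" where
  "lam y = lub {\<rho>. \<rho> = 0 \<or> 0 < \<rho> \<and> \<rho> \<le> 1 \<and> (\<forall>t. 0 \<le> t \<and> t \<le> 1 \<longrightarrow> (\<exists>W\<in>set Us. \<rho> \<le> r W (y @ [t])))}"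

lemma lam: "is_lub (lam y)
    {\<rho>. \<rho> = 0 \<or> 0 < \<rho> \<and> \<rho> \<le> 1 \<and> (\<forall>t. 0 \<le> t \<and> t \<le> 1 \<longrightarrow> (\<exists>W\<in>set Us. \<rho> \<le> r W (y @ [t])))}"
proof -
  have "\<exists>s. is_lub s {\<rho>. \<rho> = 0 \<or> 0 < \<rho> \<and> \<rho> \<le> 1 \<and> (\<forall>t. 0 \<le> t \<and> t \<le> 1 \<longrightarrow> (\<exists>W\<in>set Us. \<rho> \<le> r W (y @ [t])))}"
  proof (rule is_lub_exists[OF om, where u=1])
    show "dset M {\<rho>. \<rho> = 0 \<or> 0 < \<rho> \<and> \<rho> \<le> 1 \<and> (\<forall>t. 0 \<le> t \<and> t \<le> 1 \<longrightarrow> (\<exists>W\<in>set Us. \<rho> \<le> r W (y @ [t])))}"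
      unfolding dset_def mem_Collect_eq
      by (intro dintros dpred_bex_finite r_dfun[where k="Suc (length y)"] dlist_const) auto
  qed auto
  then show ?thesis unfolding lam_def by (rule is_lub_lub)
qed

lemma lam_dfun: "dlist M k v \<Longrightarrow> dfun M (\<lambda>e. lam (v e))"
proof (rule dfun_subst_list[where g=lam])
  show "dfun M (\<lambda>e. lam (map e [0..<k]))"
    unfolding lam_def
  proof (rule dfun_lub[where Q="\<lambda>\<rho> e. \<rho> = 0 \<or> 0 < \<rho> \<and> \<rho> \<le> 1 \<and>
        (\<forall>t. 0 \<le> t \<and> t \<le> 1 \<longrightarrow> (\<exists>W\<in>set Us. \<rho> \<le> r W (map e [0..<k] @ [t])))"])
    show "dpred M (\<lambda>e. e 0 = 0 \<or> 0 < e 0 \<and> e 0 \<le> 1 \<and>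
        (\<forall>t. 0 \<le> t \<and> t \<le> 1 \<longrightarrow> (\<exists>W\<in>set Us. e 0 \<le> r W (map (\<lambda>i. e (Suc i)) [0..<k] @ [t]))))"
      by (intro dintros dpred_bex_finite r_dfun[where k="Suc k"]) auto
  qed (use lam in blast)
qed

lemma lam_bounds: "0 \<le> lam y" "lam y \<le> 1"
proof -
  show "0 \<le> lam y" by (rule is_lub_upper[OF lam]) simp
  show "lam y \<le> 1" by (rule is_lub_least[OF lam]) auto
qed

lemma lam_lipschitz:
  assumes "near \<eta> y y'" "\<eta> > 0" shows "lam y \<le> lam y' + \<eta>"
proof (rule is_lub_least[OF lam])
  fix \<rho> assume \<rho>: "\<rho> \<in> {\<rho>. \<rho> = 0 \<or> 0 < \<rho> \<and> \<rho> \<le> 1 \<and>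
      (\<forall>t. 0 \<le> t \<and> t \<le> 1 \<longrightarrow> (\<exists>W\<in>set Us. \<rho> \<le> r W (y @ [t])))}"
  show "\<rho> \<le> lam y' + \<eta>"
  proof (cases "\<rho> \<le> \<eta>")
    case True
    then show ?thesis using lam_bounds(1)[of y'] by simp
  next
    case False
    then have "\<rho> \<noteq> 0" using assms(2) by auto
    have "\<exists>W\<in>set Us. \<rho> - \<eta> \<le> r W (y' @ [t])" if t: "0 \<le> t \<and> t \<le> 1" for t
    proof -
      have "\<forall>t. 0 \<le> t \<and> t \<le> 1 \<longrightarrow> (\<exists>W\<in>set Us. \<rho> \<le> r W (y @ [t]))" using \<rho> \<open>\<rho> \<noteq> 0\<close> by blast
      then obtain W where W: "W \<in> set Us" "\<rho> \<le> r W (y @ [t])" using t by blast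
      have "near \<eta> (y @ [t]) (y' @ [t])"
        using assms by (simp add: near_append near_refl near_length)
      from r_lipschitz[OF W(1) this assms(2)] W(2) have "\<rho> - \<eta> \<le> r W (y' @ [t])" by simp
      then show ?thesis using W(1) by blast
    qed
    then have "\<rho> - \<eta> \<in> {\<rho>. \<rho> = 0 \<or> 0 < \<rho> \<and> \<rho> \<le> 1 \<and>
        (\<forall>t. 0 \<le> t \<and> t \<le> 1 \<longrightarrow> (\<exists>W\<in>set Us. \<rho> \<le> r W (y' @ [t])))}"
      using False \<rho> assms(2) by auto
    from is_lub_upper[OF lam this] show ?thesis by simp
  qed
qed

text \<open>\<open>lam y\<close> is only a supremum, but at a given \<open>t\<close> finitely many
  radii compete, so if all of them were smaller they would be smaller by a common positive
  amount.\<close>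

lemma ex_r_ge_lam:
  assumes "0 \<le> t" "t \<le> 1" "lam y > 0" shows "\<exists>W\<in>set Us. lam y \<le> r W (y @ [t])"
proof (rule ccontr)
  assume "\<not> (\<exists>W\<in>set Us. lam y \<le> r W (y @ [t]))"
  then have "0 < lam y - r W (y @ [t])" if "W \<in> set Us" for W using that by (simp add: not_le)
  then obtain \<delta> where \<delta>: "\<delta> > 0" "\<forall>W\<in>set Us. \<delta> \<le> lam y - r W (y @ [t])"
    using finite_min_pos[of "set Us" "\<lambda>W. lam y - r W (y @ [t])"] by auto
  obtain \<rho> where \<rho>: "max 0 (lam y - \<delta>) < \<rho>"
    "\<rho> \<in> {\<rho>. \<rho> = 0 \<or> 0 < \<rho> \<and> \<rho> \<le> 1 \<and> (\<forall>t. 0 \<le> t \<and> t \<le> 1 \<longrightarrow> (\<exists>W\<in>set Us. \<rho> \<le> r W (y @ [t])))}"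
  proof -
    have "max 0 (lam y - \<delta>) < lam y" using \<delta>(1) assms(3) by simp
    from is_lub_less[OF lam this] show ?thesis using that by blast
  qed
  have "\<rho> \<noteq> 0" using \<rho>(1) by auto
  with \<rho>(2) have "\<forall>t. 0 \<le> t \<and> t \<le> 1 \<longrightarrow> (\<exists>W\<in>set Us. \<rho> \<le> r W (y @ [t]))" by blast
  then obtain W where W: "W \<in> set Us" "\<rho> \<le> r W (y @ [t])" using assms(1,2) by blast
  then have "\<delta> \<le> lam y - r W (y @ [t])" using \<delta>(2) by blast
  then show False using W(2) \<rho>(1) by simp
qed

text \<open>Instead of compactness of the segment: the parameters \<open>s\<close> up to which some
  positive number works for the cover form a definable set. A chart around its supremum extends the
  range, so the supremum is 1 and is covered as well.\<close>

lemma lam_pos: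
  assumes y: "y \<in> Y" shows "0 < lam y"
proof -
  define S where "S = {s. 0 \<le> s \<and> s \<le> 1 \<and> (\<exists>\<rho>>0. \<forall>t. 0 \<le> t \<and> t \<le> s \<longrightarrow> (\<exists>W\<in>set Us. \<rho> \<le> r W (y @ [t])))}"
  have loc: "\<exists>W\<in>set Us. 0 < r W (y @ [t])" if t: "0 \<le> t" "t \<le> 1" for t
  proof -
    have "y @ [t] \<in> Y \<otimes> unit_interval" using Z_iff[OF y] t by simp
    then obtain W where W: "W \<in> set Us" "y @ [t] \<in> W" using cover by blast
    then have "0 < r W (y @ [t])" using Us[OF W(1)] by (intro radius_pos[OF om Z]) auto
    then show ?thesis using W(1) by blast
  qed
  have "0 \<in> S"
  proof -
    obtain W where W: "W \<in> set Us" "0 < r W (y @ [0])" using loc[of 0] by auto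
    have "\<exists>W'\<in>set Us. r W (y @ [0]) \<le> r W' (y @ [t])" if "0 \<le> t \<and> t \<le> 0" for t
    proof -
      have "t = 0" using that by (intro antisym) auto
      then show ?thesis using W(1) by blast
    qed
    then show ?thesis unfolding S_def mem_Collect_eq using W(2) by (intro conjI exI[of _ "r W (y @ [0])"]) simp_all
  qed
  have S1: "x \<le> 1" if "x \<in> S" for x using that by (simp add: S_def)
  have "dset M S"
  proof -
    show ?thesis unfolding dset_def S_def mem_Collect_eq
      by (intro dintros dpred_bex_finite r_dfun[where k="Suc (length y)"] dlist_const) auto
  qed
  then obtain s where s: "is_lub s S"
    using is_lub_exists[OF om, of S 1] \<open>0 \<in> S\<close> S1 by blast
  have s01: "0 \<le> s" "s \<le> 1" using is_lub_upper[OF s \<open>0 \<in> S\<close>] is_lub_least[OF s S1] by auto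
  obtain W where W: "W \<in> set Us" "0 < r W (y @ [s])" using loc[OF s01] by blast
  \<comment> \<open>Within distance \<open>\<kappa>\<close> of \<open>s\<close> the radius drops by
    less than \<open>2 * \<kappa>\<close> out of \<open>4 * \<kappa>\<close>.\<close>
  define \<kappa> where "\<kappa> = r W (y @ [s]) / 4"
  have \<kappa>: "\<kappa> > 0" "r W (y @ [s]) = 4 * \<kappa>" using W by (auto simp: \<kappa>_def)
  have nearby: "\<kappa> \<le> r W (y @ [t])" if "\<bar>s - t\<bar> < \<kappa>" for t
    using r_line[OF W(1), of s t y] \<kappa> that by (cases "s = t") auto
  obtain s' where s': "s' \<in> S" "s - \<kappa> < s'" using is_lub_less[OF s, of "s - \<kappa>"] \<kappa>(1) by auto
  then obtain \<rho> where \<rho>: "\<rho> > 0" "\<forall>t. 0 \<le> t \<and> t \<le> s' \<longrightarrow> (\<exists>W\<in>set Us. \<rho> \<le> r W (y @ [t]))"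
    unfolding S_def by blast
  have ext: "\<exists>W\<in>set Us. min \<rho> \<kappa> \<le> r W (y @ [t])" if t: "0 \<le> t" "t < s + \<kappa>" for t
  proof (cases "t \<le> s'")
    case True
    then obtain W' where "W' \<in> set Us" "\<rho> \<le> r W' (y @ [t])" using \<rho>(2) t(1) by blast
    then show ?thesis by (intro bexI[of _ W']) auto
  next
    case False
    then have "\<bar>s - t\<bar> < \<kappa>" using s'(2) t(2) by (simp add: abs_less_iff algebra_simps)
    then have "\<kappa> \<le> r W (y @ [t])" by (rule nearby)
    then show ?thesis using W(1) by (intro bexI[of _ W]) auto
  qed
  have "s = 1"
  proof (rule ccontr)
    assume "s \<noteq> 1"
    then have *: "s < min 1 (s + \<kappa> / 2)" using s01 \<kappa>(1) by simp
    have "\<kappa> / 2 < \<kappa>" using \<kappa>(1) by simp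
    have "\<exists>W\<in>set Us. min \<rho> \<kappa> \<le> r W (y @ [t])" if "0 \<le> t \<and> t \<le> min 1 (s + \<kappa> / 2)" for t
      by (rule ext) (use that \<open>\<kappa> / 2 < \<kappa>\<close> in auto)
    then have "min 1 (s + \<kappa> / 2) \<in> S"
      unfolding S_def mem_Collect_eq using s01 \<kappa>(1) \<rho>(1) by (intro conjI exI[of _ "min \<rho> \<kappa>"]) simp_all
    from is_lub_upper[OF s this] * show False by simp
  qed
  have "\<exists>W\<in>set Us. min 1 (min \<rho> \<kappa>) \<le> r W (y @ [t])" if t: "0 \<le> t \<and> t \<le> 1" for t
  proof -
    have "t < s + \<kappa>" using t \<open>s = 1\<close> \<kappa>(1) by (simp add: add_strict_increasing2 le_less_trans)
    then obtain W' where "W' \<in> set Us" "min \<rho> \<kappa> \<le> r W' (y @ [t])" using ext[of t] t by blast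
    then show ?thesis by (intro bexI[of _ W']) auto
  qed
  then have "min 1 (min \<rho> \<kappa>) \<in> {\<rho>. \<rho> = 0 \<or> 0 < \<rho> \<and> \<rho> \<le> 1 \<and>
      (\<forall>t. 0 \<le> t \<and> t \<le> 1 \<longrightarrow> (\<exists>W\<in>set Us. \<rho> \<le> r W (y @ [t])))}"
    using \<rho>(1) \<kappa>(1) by simp
  from is_lub_upper[OF lam this] show ?thesis using \<rho>(1) \<kappa>(1) by (meson less_le_trans min_less_iff_conj zero_less_one)
qed

definition st :: "'a list set \<Rightarrow> 'a list \<Rightarrow> 'a \<Rightarrow> 'a" where
  "st W y t = step (lam y) (\<lambda>q. r W (y @ [q])) t"

lemma st_lub:
  assumes "W \<in> set Us" shows "is_lub (st W y t) (step_set (lam y) (\<lambda>q. r W (y @ [q])) t)"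
proof -
  have "\<exists>s. is_lub s (step_set (lam y) (\<lambda>q. r W (y @ [q])) t)"
  proof (rule is_lub_exists[OF om, where u="max t 1"])
    show "dset M (step_set (lam y) (\<lambda>q. r W (y @ [q])) t)"
      unfolding dset_def step_set_def mem_Collect_eq
      by (intro dintros r_dfun[where k="Suc (length y)"] dlist_const assms) auto
  qed (auto simp: step_set_def)
  then show ?thesis unfolding st_def step_def by (rule is_lub_lub)
qed

lemma st_dfun:
  assumes W: "W \<in> set Us" and v: "dlist M k v" and f: "dfun M f"
  shows "dfun M (\<lambda>e. st W (v e) (f e))"
proof -
  have "dfun M (\<lambda>e. st W (take k (map e [0..<Suc k])) (map e [0..<Suc k] ! k))"
  proof -
    have "dfun M (\<lambda>e. st W (map e [0..<k]) (e k))"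
      unfolding st_def step_def step_set_def
    proof (rule dfun_lub[where Q="\<lambda>s e. s = e k \<or> e k \<le> s \<and> s \<le> 1 \<and> (\<forall>q. e k \<le> q \<and> q \<le> s \<longrightarrow>
          lam (map e [0..<k]) * (1 + s - e k) \<le> 4 * r W (map e [0..<k] @ [q]))"])
      show "dpred M (\<lambda>e. e 0 = e (Suc k) \<or> e (Suc k) \<le> e 0 \<and> e 0 \<le> 1 \<and> (\<forall>q. e (Suc k) \<le> q \<and> q \<le> e 0 \<longrightarrow>
          lam (map (\<lambda>i. e (Suc i)) [0..<k]) * (1 + e 0 - e (Suc k)) \<le> 4 * r W (map (\<lambda>i. e (Suc i)) [0..<k] @ [q])))"
        by (intro dintros r_dfun[where k="Suc k"] lam_dfun[where k=k] W)
      show "\<exists>s. is_lub s {s. s = e k \<or> e k \<le> s \<and> s \<le> 1 \<and> (\<forall>q. e k \<le> q \<and> q \<le> s \<longrightarrow>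
          lam (map e [0..<k]) * (1 + s - e k) \<le> 4 * r W (map e [0..<k] @ [q]))}" for e
        using st_lub[OF W, of "map e [0..<k]" "e k"] unfolding step_set_def by blast
    qed
    then show ?thesis by (simp add: nth_append)
  qed
  from dfun_subst_list[where g="\<lambda>z. st W (take k z) (z ! k)", OF this, of "\<lambda>e. v e @ [f e]"]
  have "dfun M (\<lambda>e. st W (take k (v e @ [f e])) ((v e @ [f e]) ! k))"
    by (simp add: dlist_append[OF v dlist_singleton[OF f]])
  moreover have "length (v e) = k" for e using v by (simp add: dlist_def)
  ultimately show ?thesis by (simp add: nth_append)
qed

lemma st_bounds:
  assumes "W \<in> set Us" "t \<le> 1" shows "t \<le> st W y t" "st W y t \<le> 1"
  using step_bounds[OF st_lub[OF assms(1)] assms(2)] by auto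

lemma st_inside:
  assumes "W \<in> set Us" "y \<in> Y" "0 \<le> t" "t \<le> 1" "t \<le> q" "q \<le> st W y t" "t < st W y t"
  shows "lam y \<le> 4 * r W (y @ [q])"
  by (rule step_inside[OF st_lub[OF assms(1)] lam_pos[OF assms(2)] assms(3,4) _ assms(5-7)])
    (rule r_line[OF assms(1)])

lemma st_progress:
  assumes "W \<in> set Us" "y \<in> Y" "0 \<le> t" "t \<le> 1" "st W y t < 1"
  shows "\<exists>q. t \<le> q \<and> q \<le> st W y t \<and> r W (y @ [q]) < lam y"
  by (rule step_progress[OF st_lub[OF assms(1)] lam_pos[OF assms(2)] assms(3-5)])
    (rule r_line[OF assms(1)])

text \<open>\<open>step_lower\<close> is one half of continuity; it is applied once from
  \<open>(y, t)\<close> to \<open>(y', t')\<close> and once in the opposite direction.\<close>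

lemma st_cont:
  assumes W: "W \<in> set Us" and y: "y \<in> Y" and t: "0 \<le> t" "t \<le> 1" and \<epsilon>: "\<epsilon> > 0"
  shows "\<exists>\<eta>>0. \<forall>y'\<in>Y. \<forall>t'. near \<eta> y y' \<and> \<bar>t - t'\<bar> < \<eta> \<and> 0 \<le> t' \<and> t' \<le> 1 \<longrightarrow> \<bar>st W y t - st W y' t'\<bar> < \<epsilon>"
proof -
  \<comment> \<open>Since \<open>\<epsilon>'\<close> is at most 1, the \<open>\<eta>\<close> chosen
    next is at most \<open>lam y / 44\<close>, and this makes \<open>lam y\<close> at most twice
    \<open>lam y'\<close>. The opposite direction has \<open>lam y'\<close> in place of
    \<open>lam y\<close>, which explains \<open>44 = 2 * 22\<close>.\<close>
  define \<epsilon>' where "\<epsilon>' = min (\<epsilon> / 2) 1"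
  have \<epsilon>': "0 < \<epsilon>'" "\<epsilon>' < \<epsilon>" "\<epsilon>' \<le> 1" using \<epsilon> by (auto simp: \<epsilon>'_def min_def field_simps)
  define \<eta> where "\<eta> = lam y * \<epsilon>' / 44"
  have l: "0 < lam y" "lam y \<le> 1" using lam_pos[OF y] lam_bounds by auto
  have \<eta>: "0 < \<eta>" "44 * \<eta> = lam y * \<epsilon>'" using l \<epsilon>' by (auto simp: \<eta>_def)
  have "lam y * \<epsilon>' \<le> lam y * 1" using l \<epsilon>' by (intro mult_left_mono) auto
  then have \<eta>l: "44 * \<eta> \<le> lam y" using \<eta> by simp
  show ?thesis
  proof (rule exI[of _ \<eta>], intro conjI ballI allI impI)
    show "0 < \<eta>" by fact
    fix y' t' assume y': "y' \<in> Y" and "near \<eta> y y' \<and> \<bar>t - t'\<bar> < \<eta> \<and> 0 \<le> t' \<and> t' \<le> 1"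
    then have n: "near \<eta> y y'" "near \<eta> y' y" and t': "\<bar>t - t'\<bar> \<le> \<eta>" "\<bar>t' - t\<bar> \<le> \<eta>" "0 \<le> t'" "t' \<le> 1"
      using near_sym[of \<eta> y y'] by (auto simp: abs_minus_commute)
    have l1: "lam y \<le> lam y' + \<eta>" "lam y' \<le> lam y + \<eta>" using lam_lipschitz n \<eta>(1) by auto
    have l': "0 < lam y'" "lam y' \<le> 1" using lam_pos[OF y'] lam_bounds by auto
    have D: "r W (u @ [q]) \<le> r W (u' @ [q']) + 2 * \<eta>" if "\<bar>q - q'\<bar> \<le> \<eta>" "near \<eta> u u'" for u u' q q'
    proof (rule r_lipschitz[OF W])
      have "near (2 * \<eta>) u u'" by (rule near_mono[OF that(2)]) (use \<eta>(1) in simp)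
      then show "near (2 * \<eta>) (u @ [q]) (u' @ [q'])"
        using that(1) \<eta>(1) by (simp add: near_append near_length near_singleton)
    qed (use \<eta>(1) in simp)
    have "st W y t - \<epsilon>' \<le> st W y' t'"
    proof (rule step_lower[OF st_lub[OF W] st_lub[OF W] l l1(2) _ t t'(3,4,1)])
      show "22 * \<eta> \<le> lam y * \<epsilon>'" using \<eta> by simp
    qed (use l' D n \<eta> in auto)
    moreover have "st W y' t' - \<epsilon>' \<le> st W y t"
    proof (rule step_lower[OF st_lub[OF W] st_lub[OF W] l' l1(1) _ t'(3,4) t t'(2)])
      have "lam y \<le> 2 * lam y'" using l1(1) \<eta>l \<eta>(1) by linarith
      then have "lam y * \<epsilon>' \<le> 2 * lam y' * \<epsilon>'" using \<epsilon>' by (intro mult_right_mono) auto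
      then show "22 * \<eta> \<le> lam y' * \<epsilon>'" using \<eta> by simp
    qed (use l D n \<eta> in auto)
    ultimately show "\<bar>st W y t - st W y' t'\<bar> < \<epsilon>" using \<epsilon>'(2) by (simp add: abs_less_iff)
  qed
qed

section \<open>Iterated steps and their number\<close>

definition run :: "'a list set list \<Rightarrow> 'a list \<Rightarrow> 'a \<Rightarrow> 'a" where
  "run Ws y t = foldl (\<lambda>t W. st W y t) t Ws"

lemma run_simps: "run [] y t = t" "run (Ws @ [W]) y t = st W y (run Ws y t)"
  by (simp_all add: run_def)

lemma run_append: "run (As @ Bs) y t = run Bs y (run As y t)"
  by (simp add: run_def)

lemma run_bounds:
  assumes "set Ws \<subseteq> set Us" "t \<le> 1" shows "t \<le> run Ws y t \<and> run Ws y t \<le> 1"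
  using assms(1)
proof (induction Ws rule: rev_induct)
  case Nil
  then show ?case using assms(2) by (simp add: run_simps)
next
  case (snoc W Ws)
  then show ?case using st_bounds[of W "run Ws y t" y] by (auto simp: run_simps)
qed

lemma run_dmap:
  assumes "set Ws \<subseteq> set Us" shows "dmap M n (Suc 0) Y (\<lambda>y. [run Ws y 0])"
proof (rule dmap_scalar[OF Y])
  show "dfun M (\<lambda>e. run Ws (v e) 0)" if "dlist M n v" for v
    using assms by (induction Ws rule: rev_induct) (auto simp: run_simps intro!: dfun_const st_dfun that)
next
  fix y and \<epsilon> :: 'a assume y: "y \<in> Y" and "\<epsilon> > 0"
  then show "\<exists>\<delta>>0. \<forall>y'\<in>Y. near \<delta> y y' \<longrightarrow> \<bar>run Ws y 0 - run Ws y' 0\<bar> < \<epsilon>"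
    using assms
  proof (induction Ws arbitrary: \<epsilon> rule: rev_induct)
    case Nil
    then show ?case by (auto simp: run_simps intro: exI[of _ 1])
  next
    case (snoc W Ws)
    then have W: "W \<in> set Us" "set Ws \<subseteq> set Us" by auto
    have b: "0 \<le> run Ws x 0" "run Ws x 0 \<le> 1" for x using run_bounds[OF W(2), of 0] by auto
    obtain \<eta> where \<eta>: "\<eta> > 0" "\<And>y' t'. y' \<in> Y \<Longrightarrow> near \<eta> y y' \<Longrightarrow> \<bar>run Ws y 0 - t'\<bar> < \<eta> \<Longrightarrow> 0 \<le> t' \<Longrightarrow> t' \<le> 1 \<Longrightarrow>
        \<bar>st W y (run Ws y 0) - st W y' t'\<bar> < \<epsilon>"
      using st_cont[OF W(1) y b snoc.prems(2)] by blast
    obtain \<delta> where \<delta>: "\<delta> > 0" "\<And>y'. y' \<in> Y \<Longrightarrow> near \<delta> y y' \<Longrightarrow> \<bar>run Ws y 0 - run Ws y' 0\<bar> < \<eta>"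
      using snoc.IH[OF y \<eta>(1) W(2)] by blast
    have "\<bar>st W y (run Ws y 0) - st W y' (run Ws y' 0)\<bar> < \<epsilon>" if "y' \<in> Y" "near (min \<delta> \<eta>) y y'" for y'
      using \<eta>(2)[OF that(1) near_mono[OF that(2)] \<delta>(2)[OF that(1) near_mono[OF that(2)]]] b by auto
    then show ?case using \<delta>(1) \<eta>(1) by (intro exI[of _ "min \<delta> \<eta>"]) (auto simp: run_simps)
  qed
qed

text \<open>
  In each cycle through the charts some step starts at a point where its radius is at least \<open>lam\<close>.
  Unless it reaches \<open>1\<close> it passes an exit point, so the number of exit points bounds the number of
  cycles needed.
\<close>

definition exit_point :: "'a list \<Rightarrow> 'a \<Rightarrow> bool" where
  "exit_point y z \<longleftrightarrow> (\<exists>W\<in>set Us. lam y \<le> r W (y @ [z]) \<and>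
     (\<forall>\<epsilon>>0. \<exists>q. z < q \<and> q < z + \<epsilon> \<and> r W (y @ [q]) < lam y))"

lemma r_line_dset: "W \<in> set Us \<Longrightarrow> dfun M (\<lambda>e. r W (y @ [e k]))"
  by (intro r_dfun[where k="Suc (length y)"] dlist_snoc dlist_const dfun_var) auto

text \<open>Infinitely many exit points of one chart would fill an interval. Right after one of its
  points the radius is somewhere below \<open>lam y\<close>, yet every point of the interval has
  radius at least \<open>lam y\<close>.\<close>

lemma finite_exit_points: "finite {z. exit_point y z}"
proof -
  let ?A = "\<lambda>W. {z. lam y \<le> r W (y @ [z]) \<and> (\<forall>\<epsilon>>0. \<exists>q. z < q \<and> q < z + \<epsilon> \<and> r W (y @ [q]) < lam y)}"
  have "finite (?A W)" if W: "W \<in> set Us" for W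
  proof (rule ccontr)
    assume inf: "infinite (?A W)"
    have d: "dset M (?A W)" unfolding dset_def mem_Collect_eq by (intro dintros r_line_dset[OF W])
    obtain a b where ab: "a < b" "{a<..<b} \<subseteq> ?A W" by (rule infinite_contains_interval[OF om d inf])
    obtain c where c: "a < c" "c < b" using dense ab(1) by blast
    then have "c \<in> ?A W" using ab(2) by (meson greaterThanLessThan_iff subsetD)
    then have "\<forall>\<epsilon>>0. \<exists>q. c < q \<and> q < c + \<epsilon> \<and> r W (y @ [q]) < lam y" by simp
    from this[rule_format, of "b - c"] have "\<exists>q. c < q \<and> q < c + (b - c) \<and> r W (y @ [q]) < lam y"
      using c(2) by simp
    then obtain q where q: "c < q" "q < c + (b - c)" "r W (y @ [q]) < lam y" by blast
    then have "q \<in> {a<..<b}" using c by simp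
    then have "q \<in> ?A W" using ab(2) by (rule subsetD[rotated])
    then show False using q(3) by simp
  qed
  moreover have "{z. exit_point y z} = (\<Union>W\<in>set Us. ?A W)" by (auto simp: exit_point_def)
  ultimately show ?thesis by simp
qed

text \<open>The application of uniform finiteness: finitely many exit points for each
  \<open>y\<close> would not do, since one list of charts has to serve all \<open>y\<close>.\<close>

lemma exit_points_bounded: "\<exists>N. \<forall>y\<in>Y. card {z. 0 \<le> z \<and> z \<le> 1 \<and> exit_point y z} \<le> N"
proof -
  define A where "A = {y @ [z] |y z. y \<in> Y \<and> 0 \<le> z \<and> z \<le> 1 \<and> exit_point y z}"
  have A_iff: "y @ [z] \<in> A \<longleftrightarrow> y \<in> Y \<and> 0 \<le> z \<and> z \<le> 1 \<and> exit_point y z" for y z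
    by (auto simp: A_def)
  have "definable_in M (Suc n) A"
    unfolding definable_in_iff
  proof
    show "A \<subseteq> {x. length x = Suc n}" using definable_in_length[OF Y] by (auto simp: A_def)
    have "dpred M (\<lambda>e. map e [0..<n] \<in> Y \<and> 0 \<le> e n \<and> e n \<le> 1 \<and> exit_point (map e [0..<n]) (e n))"
      unfolding exit_point_def
      by (intro dpred_conj dpred_all dpred_imp dpred_ex dpred_less dpred_le dfun_var dfun_const dfun_add
          dpred_mem[OF Y] dpred_bex_finite r_dfun[where k="Suc n"] lam_dfun[where k=n] dlist_vars dlist_map_vars dlist_snoc) auto
    then show "dpred M (\<lambda>e. map e [0..<Suc n] \<in> A)" by (simp add: A_iff)
  qed
  moreover have "finite {t. x @ [t] \<in> A}" for x
    by (rule finite_subset[OF _ finite_exit_points[of x]]) (auto simp: A_iff)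
  ultimately obtain N where N: "\<And>x. card {t. x @ [t] \<in> A} \<le> N"
    using uniform_finiteness[OF om, of n A] by (auto simp: A_iff)
  have "card {z. 0 \<le> z \<and> z \<le> 1 \<and> exit_point y z} \<le> N" if "y \<in> Y" for y
    using N[of y] that by (simp add: A_iff)
  then show ?thesis by blast
qed

text \<open>\<open>z\<close> ends the longest initial piece of the segment from \<open>t\<close> to
  \<open>q\<close> on which the radius is at least \<open>lam y\<close>. The Lipschitz bound keeps
  the inequality at \<open>z\<close> itself, and maximality puts smaller radii immediately to its
  right.\<close>

lemma exit_point_between:
  assumes W: "W \<in> set Us" and t: "lam y \<le> r W (y @ [t])" and q: "t \<le> q" "r W (y @ [q]) < lam y"
  shows "\<exists>z. t \<le> z \<and> z < q \<and> exit_point y z"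
proof -
  define S where "S = {s. t \<le> s \<and> s \<le> q \<and> (\<forall>p. t \<le> p \<and> p \<le> s \<longrightarrow> lam y \<le> r W (y @ [p]))}"
  have "dset M S" unfolding dset_def S_def mem_Collect_eq by (intro dintros r_line_dset[OF W])
  moreover have tS: "t \<in> S"
  proof -
    have "lam y \<le> r W (y @ [p])" if "t \<le> p \<and> p \<le> t" for p
    proof -
      have "p = t" using that by (intro antisym) auto
      then show ?thesis using t by simp
    qed
    then show ?thesis using q(1) by (simp add: S_def)
  qed
  moreover have Sq: "x \<le> q" if "x \<in> S" for x using that by (simp add: S_def)
  ultimately obtain z where z: "is_lub z S" using is_lub_exists[OF om, of S q] by blast
  have tz: "t \<le> z" "z \<le> q" using is_lub_upper[OF z tS] is_lub_least[OF z Sq] by auto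
  have below: "lam y \<le> r W (y @ [p])" if p: "t \<le> p" "p < z" for p
  proof -
    obtain s where "s \<in> S" "p < s" using is_lub_less[OF z p(2)] by blast
    then show ?thesis using p(1) by (simp add: S_def)
  qed
  have rz: "lam y \<le> r W (y @ [z])"
  proof (rule ccontr)
    assume n: "\<not> lam y \<le> r W (y @ [z])"
    then have "t < z" using t tz(1) by (cases "t = z") auto
    define g where "g = (lam y - r W (y @ [z])) / 2"
    have g: "0 < g" "2 * g = lam y - r W (y @ [z])" using n by (auto simp: g_def)
    obtain p where p: "max t (z - g) < p" "p < z" using dense[of "max t (z - g)" z] \<open>t < z\<close> g(1) by auto
    have "r W (y @ [p]) \<le> r W (y @ [z]) + \<bar>p - z\<bar> * 2" by (rule r_line[OF W]) (use p in auto)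
    moreover have "\<bar>p - z\<bar> * 2 < 2 * g" using p by (simp add: abs_less_iff)
    ultimately have "r W (y @ [p]) < lam y" using g(2) by simp
    moreover have "lam y \<le> r W (y @ [p])" by (rule below) (use p in auto)
    ultimately show False by simp
  qed
  have "z \<noteq> q" using rz q(2) by auto
  then have "z < q" using tz(2) by simp
  have "\<exists>p. z < p \<and> p < z + \<epsilon> \<and> r W (y @ [p]) < lam y" if \<epsilon>: "\<epsilon> > 0" for \<epsilon>
  proof (rule ccontr)
    assume n: "\<not> (\<exists>p. z < p \<and> p < z + \<epsilon> \<and> r W (y @ [p]) < lam y)"
    obtain s where s: "z < s" "s < min q (z + \<epsilon>)" using dense[of z "min q (z + \<epsilon>)"] \<open>z < q\<close> \<epsilon> by auto
    have "lam y \<le> r W (y @ [p])" if "t \<le> p" "p \<le> s" for p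
    proof (cases p z rule: linorder_cases)
      case greater
      moreover have "p < z + \<epsilon>" using s(2) that(2) by simp
      ultimately show ?thesis using n by (meson not_le)
    next
      case less
      then show ?thesis using below that(1) by blast
    qed (use rz in simp)
    then have "s \<in> S" using s tz by (simp add: S_def)
    from is_lub_upper[OF z this] s(1) show False by simp
  qed
  then have "exit_point y z" using W rz unfolding exit_point_def by blast
  with tz(1) \<open>z < q\<close> show ?thesis by blast
qed

text \<open>The chart \<open>W\<close> is good at the start \<open>t\<close> of the cycle, although
  its turn only comes at a later parameter \<open>?t1\<close>. This does no harm: its step still
  meets a radius below \<open>lam y\<close>, and the exit point is looked for from \<open>t\<close>
  onwards.\<close>

lemma cycle_progress:
  assumes y: "y \<in> Y" and t: "0 \<le> t" "t \<le> 1" and "run Us y t < 1"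
  shows "\<exists>z. t \<le> z \<and> z < run Us y t \<and> exit_point y z"
proof -
  obtain W where W: "W \<in> set Us" "lam y \<le> r W (y @ [t])"
    using ex_r_ge_lam[OF t lam_pos[OF y]] by blast
  obtain As Bs where AB: "Us = As @ W # Bs" using W(1) split_list by metis
  let ?t1 = "run As y t" let ?t2 = "st W y ?t1"
  have t1: "t \<le> ?t1" "?t1 \<le> 1" using run_bounds[of As t y] AB t(2) by auto
  have t2: "?t2 \<le> 1" using st_bounds[OF W(1) t1(2)] by auto
  have "run Us y t = run (As @ W # Bs) y t" using AB by (rule arg_cong)
  then have "run Us y t = run Bs y ?t2" by (simp add: run_def)
  then have "?t2 \<le> run Us y t" using run_bounds[of Bs ?t2 y] AB t2 by auto
  then have "?t2 < 1" "0 \<le> ?t1" using assms(4) t1(1) t(1) by auto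
  then obtain q where q: "?t1 \<le> q" "q \<le> ?t2" "r W (y @ [q]) < lam y"
    using st_progress[OF W(1) y _ t1(2)] by blast
  obtain z where "t \<le> z" "z < q" "exit_point y z"
    using exit_point_between[OF W _ q(3)] q(1) t1(1) by auto
  moreover have "q \<le> run Us y t" using q(2) \<open>?t2 \<le> run Us y t\<close> by simp
  ultimately show ?thesis using less_le_trans by blast
qed

text \<open>The exit point found in a cycle lies at or after its start and strictly before its end,
  so different cycles contribute different exit points. A run that is still below 1 after
  \<open>Suc N\<close> cycles would have passed more than \<open>N\<close> of them.\<close>

lemma run_complete: "\<exists>Ws. set Ws \<subseteq> set Us \<and> (\<forall>y\<in>Y. run Ws y 0 = 1)"
proof -
  obtain N where N: "\<And>y. y \<in> Y \<Longrightarrow> card {z. 0 \<le> z \<and> z \<le> 1 \<and> exit_point y z} \<le> N"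
    using exit_points_bounded by blast
  define C where "C k = concat (replicate k Us)" for k :: nat
  have C: "set (C k) \<subseteq> set Us" for k by (induction k) (auto simp: C_def)
  have C_Suc: "C (Suc k) = C k @ Us" for k
    unfolding C_def by (induction k) auto
  have "k \<le> card {z. 0 \<le> z \<and> z < run (C k) y 0 \<and> exit_point y z}"
    if y: "y \<in> Y" and k: "run (C k) y 0 < 1" for y k
    using k
  proof (induction k)
    case (Suc k)
    let ?t = "run (C k) y 0"
    have t: "0 \<le> ?t" "?t \<le> 1" using run_bounds[OF C, of 0] by auto
    have eq: "run (C (Suc k)) y 0 = run Us y ?t" by (simp add: C_Suc run_append)
    have le: "?t \<le> run Us y ?t" using run_bounds[of Us ?t y] t by auto
    obtain z where z: "?t \<le> z" "z < run Us y ?t" "exit_point y z"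
      using cycle_progress[OF y t] Suc.prems eq by auto
    have "Suc k \<le> Suc (card {z. 0 \<le> z \<and> z < ?t \<and> exit_point y z})"
      using Suc.IH Suc.prems eq le by simp
    also have "\<dots> = card (insert z {z. 0 \<le> z \<and> z < ?t \<and> exit_point y z})"
      using z(1) finite_subset[OF _ finite_exit_points[of y], of "{z. 0 \<le> z \<and> z < ?t \<and> exit_point y z}"] by (subst card_insert_disjoint) auto
    also have "\<dots> \<le> card {z. 0 \<le> z \<and> z < run (C (Suc k)) y 0 \<and> exit_point y z}"
      by (rule card_mono[OF finite_subset[OF _ finite_exit_points[of y]]]) (use z t le eq in auto)
    finally show ?case .
  qed simp
  then have *: "Suc N \<le> card {z. 0 \<le> z \<and> z < run (C (Suc N)) y 0 \<and> exit_point y z}"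
    if "y \<in> Y" "run (C (Suc N)) y 0 < 1" for y using that by blast
  have "run (C (Suc N)) y 0 = 1" if y: "y \<in> Y" for y
  proof (rule ccontr)
    have b: "run (C (Suc N)) y 0 \<le> 1" using run_bounds[OF C, of 0] by auto
    assume "run (C (Suc N)) y 0 \<noteq> 1"
    then have "Suc N \<le> card {z. 0 \<le> z \<and> z < run (C (Suc N)) y 0 \<and> exit_point y z}" using * y b by force
    also have "\<dots> \<le> card {z. 0 \<le> z \<and> z \<le> 1 \<and> exit_point y z}"
      by (rule card_mono[OF finite_subset[OF _ finite_exit_points[of y]]]) (use b in auto)
    also have "\<dots> \<le> N" by (rule N[OF y])
    finally show False by simp
  qed
  then show ?thesis using C by blast
qed

lemma lam_dmap: "dmap M n (Suc 0) Y (\<lambda>y. [lam y])"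
proof (rule dmap_scalar[OF Y lam_dfun])
  fix y and \<epsilon> :: 'a assume "\<epsilon> > 0"
  have "\<bar>lam y - lam y'\<bar> < \<epsilon>" if "near (\<epsilon> / 2) y y'" for y'
    using lam_lipschitz[OF that] lam_lipschitz[OF near_sym[OF that]] \<open>\<epsilon> > 0\<close> by (simp add: abs_less_iff field_simps)
  then show "\<exists>\<delta>>0. \<forall>y'\<in>Y. near \<delta> y y' \<longrightarrow> \<bar>lam y - lam y'\<bar> < \<epsilon>"
    using half_gt_zero[OF \<open>\<epsilon> > 0\<close>] by blast
qed

lemma r_dmap:
  assumes W: "W \<in> set Us" shows "dmap M (Suc n) (Suc 0) (Y \<otimes> unit_interval) (\<lambda>z. [r W z])"
proof (rule dmap_scalar[OF Z r_dfun[OF W]])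
  fix y and \<epsilon> :: 'a assume "\<epsilon> > 0"
  have "\<bar>r W y - r W y'\<bar> < \<epsilon>" if "near (\<epsilon> / 2) y y'" for y'
    using r_lipschitz[OF W that] r_lipschitz[OF W near_sym[OF that]] \<open>\<epsilon> > 0\<close> by (simp add: abs_less_iff field_simps)
  then show "\<exists>\<delta>>0. \<forall>y'\<in>Y \<otimes> unit_interval. near \<delta> y y' \<longrightarrow> \<bar>r W y - r W y'\<bar> < \<epsilon>"
    using half_gt_zero[OF \<open>\<epsilon> > 0\<close>] by blast
qed

end

subsection \<open>Parallel transport\<close>

text \<open>Meant for Lipschitz operations on scalars such as \<open>min\<close>, constant multiples
  and reparametrizations of the interval; \<open>\<epsilon> / K\<close> serves as radius at every
  point.\<close>

lemma dmap_binop: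
  fixes M :: "('f, 'r, 'a::real_closed_field) expansion"
  assumes s: "dmap M n (Suc 0) X (\<lambda>x. [s x])" and u: "dmap M n (Suc 0) X (\<lambda>x. [u x])"
    and F: "dfun M (\<lambda>e. F (e 0) (e 1))" and "K > 0"
    and lip: "\<And>a b a' b' \<delta>. \<delta> > 0 \<Longrightarrow> \<bar>a - a'\<bar> < \<delta> \<Longrightarrow> \<bar>b - b'\<bar> < \<delta> \<Longrightarrow> \<bar>F a b - F a' b'\<bar> < K * \<delta>"
  shows "dmap M n (Suc 0) X (\<lambda>x. [F (s x) (u x)])"
proof -
  let ?L = "{x. length x = Suc (Suc 0)} :: 'a list set"
  have L: "definable_in M (Suc (Suc 0)) ?L" by (simp add: definable_in_iff dpred_const)
  have 1: "dmap M (Suc (Suc 0)) (Suc 0) ?L (\<lambda>x. [F (x ! 0) (x ! 1)])"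
  proof (rule dmap_scalar[OF L])
    show "dfun M (\<lambda>e. F (v e ! 0) (v e ! 1))" if "dlist M (Suc (Suc 0)) v" for v
      by (rule dfun_subst2[where F=F, OF F]) (rule dfun_nth[OF that], simp)+
    fix x and \<epsilon> :: 'a assume x: "x \<in> ?L" and "\<epsilon> > 0"
    then have \<epsilon>: "\<epsilon> / K > 0" "K * (\<epsilon> / K) = \<epsilon>" using \<open>K > 0\<close> by auto
    have "\<bar>F (x ! 0) (x ! 1) - F (y ! 0) (y ! 1)\<bar> < K * \<delta>" if "near \<delta> x y" "\<delta> > 0" for y \<delta>
    proof (rule lip[OF that(2)])
      have "\<bar>x ! i - y ! i\<bar> < \<delta>" if "i < Suc (Suc 0)" for i
        using \<open>near \<delta> x y\<close> x that by (simp add: near_def)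
      then show "\<bar>x ! 0 - y ! 0\<bar> < \<delta>" "\<bar>x ! 1 - y ! 1\<bar> < \<delta>" by simp_all
    qed
    note close = this
    have "\<bar>F (x ! 0) (x ! 1) - F (y ! 0) (y ! 1)\<bar> < \<epsilon>" if "near (\<epsilon> / K) x y" for y
      using close[OF that \<epsilon>(1)] \<epsilon>(2) by simp
    then show "\<exists>\<delta>>0. \<forall>y\<in>?L. near \<delta> x y \<longrightarrow> \<bar>F (x ! 0) (x ! 1) - F (y ! 0) (y ! 1)\<bar> < \<epsilon>"
      using \<epsilon>(1) by (intro exI[of _ "\<epsilon> / K"]) simp
  qed
  have 2: "dmap M n (Suc (Suc 0)) X (\<lambda>x. [s x] @ [u x])" by (rule dmap_append[OF s u]) simp
  have "dmap M n (Suc 0) X (\<lambda>x. [F (([s x] @ [u x]) ! 0) (([s x] @ [u x]) ! 1)])"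
    by (rule dmap_compose[OF 2 1]) simp
  then show ?thesis by simp
qed

text \<open>Provides both properties that \<open>dmap_paste\<close> needs of a piece: it is
  definable and relatively closed.\<close>

lemma closed_le:
  fixes M :: "('f, 'r, 'a::real_closed_field) expansion" and s :: "'a::real_closed_field list \<Rightarrow> 'a"
  assumes s: "dmap M n (Suc 0) X (\<lambda>x. [s x])" and u: "dmap M n (Suc 0) X (\<lambda>x. [u x])"
  shows "definable_in M n {x \<in> X. s x \<le> u x}"
    and "x \<in> X \<Longrightarrow> \<not> s x \<le> u x \<Longrightarrow> \<exists>\<delta>>0. \<forall>y\<in>X. near \<delta> x y \<longrightarrow> \<not> s y \<le> u y"
proof -
  let ?L = "{x. length x = Suc (Suc 0) \<and> x ! 0 \<le> x ! 1} :: 'a list set"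
  have "dpred M (\<lambda>e. e 0 \<le> e 1)" by (intro dintros)
  then have L: "definable_in M (Suc (Suc 0)) ?L"
    by (auto simp: definable_in_iff)
  have "dmap M n (Suc (Suc 0)) X (\<lambda>x. [s x] @ [u x])" by (rule dmap_append[OF s u]) simp
  from definable_preimage[OF this L] show "definable_in M n {x \<in> X. s x \<le> u x}" by simp
next
  assume x: "x \<in> X" "\<not> s x \<le> u x"
  define \<epsilon> where "\<epsilon> = (s x - u x) / 2"
  have \<epsilon>: "\<epsilon> > 0" "2 * \<epsilon> = s x - u x" using x(2) by (auto simp: \<epsilon>_def)
  obtain d1 where d1: "d1 > 0" "\<And>y. y \<in> X \<Longrightarrow> near d1 x y \<Longrightarrow> near \<epsilon> [s x] [s y]"
    using contD[OF dmap_cont[OF s] x(1) \<epsilon>(1)] by blast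
  obtain d2 where d2: "d2 > 0" "\<And>y. y \<in> X \<Longrightarrow> near d2 x y \<Longrightarrow> near \<epsilon> [u x] [u y]"
    using contD[OF dmap_cont[OF u] x(1) \<epsilon>(1)] by blast
  have "\<not> s y \<le> u y" if "y \<in> X" "near (min d1 d2) x y" for y
  proof -
    have "\<bar>s x - s y\<bar> < \<epsilon>" "\<bar>u x - u y\<bar> < \<epsilon>"
      using d1(2)[OF that(1) near_mono[OF that(2)]] d2(2)[OF that(1) near_mono[OF that(2)]]
      by (auto simp: near_singleton)
    then show ?thesis using \<epsilon>(2) unfolding abs_less_iff by linarith
  qed
  then show "\<exists>\<delta>>0. \<forall>y\<in>X. near \<delta> x y \<longrightarrow> \<not> s y \<le> u y"
    using d1(1) d2(1) by (intro exI[of _ "min d1 d2"]) simp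
qed

lemma homeomorphic_map_space_ofI:
  fixes f g :: "'a::real_closed_field list \<Rightarrow> 'a list"
  assumes "f \<in> X \<rightarrow> Y" "g \<in> Y \<rightarrow> X" "cont X f" "cont Y g"
    and "\<And>x. x \<in> X \<Longrightarrow> g (f x) = x" "\<And>y. y \<in> Y \<Longrightarrow> f (g y) = y"
  shows "homeomorphic_map (space_of X) (space_of Y) f"
proof -
  have "homeomorphic_maps (space_of X) (space_of Y) f g"
    unfolding homeomorphic_maps_def continuous_map_space_of topspace_space_of using assms by blast
  then show ?thesis using homeomorphic_map_maps by blast
qed

text \<open>A homeomorphism has a continuous inverse; that this inverse is definable follows from
  its graph being the graph of \<open>f\<close> with the factors exchanged.\<close>

lemma definable_homeomorphism_inverse:
  assumes f: "definable_homeomorphism M X Y f" and X: "definable_in M n X" and Y: "definable_in M m Y"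
  obtains g where "dmap M m n Y g" "g \<in> Y \<rightarrow> X" "\<And>x. x \<in> X \<Longrightarrow> g (f x) = x" "\<And>y. y \<in> Y \<Longrightarrow> f (g y) = y"
proof -
  have fd: "dmap M n m X f" "f \<in> X \<rightarrow> Y"
    using f definable_map_iff_dmap[OF X Y] by (auto simp: definable_homeomorphism_def)
  obtain g where "homeomorphic_maps (space_of X) (space_of Y) f g"
    using f unfolding definable_homeomorphism_def homeomorphic_map_maps by blast
  then have g: "continuous_map (space_of Y) (space_of X) g" "g \<in> Y \<rightarrow> X"
    "\<And>x. x \<in> X \<Longrightarrow> g (f x) = x" "\<And>y. y \<in> Y \<Longrightarrow> f (g y) = y"
    unfolding homeomorphic_maps_def topspace_space_of continuous_map_space_of by blast+
  define G where "G = {y @ g y |y. y \<in> Y}"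
  have YX: "definable_in M (m + n) (Y \<otimes> X)" by (rule definable_product[OF Y X]) simp
  have G_eq: "G = {z \<in> Y \<otimes> X. f (drop m z) = take m z}"
  proof (intro subset_antisym subsetI)
    fix z assume "z \<in> G"
    then obtain y where y: "z = y @ g y" "y \<in> Y" unfolding G_def by (elim CollectE exE conjE)
    then show "z \<in> {z \<in> Y \<otimes> X. f (drop m z) = take m z}"
      using g(2,4) definable_in_length[OF Y y(2)] by (auto intro: set_productI)
  next
    fix z assume z: "z \<in> {z \<in> Y \<otimes> X. f (drop m z) = take m z}"
    then have "z \<in> Y \<otimes> X" by simp
    then obtain y x where yx: "z = y @ x" "y \<in> Y" "x \<in> X" by (rule set_productE)
    then have "y = f x" using z definable_in_length[OF Y yx(2)] by simp
    then have "z = y @ g y" using yx(1) g(3)[OF yx(3)] by simp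
    then show "z \<in> G" using yx(2) unfolding G_def by blast
  qed
  have "definable_in M (m + n) G"
    unfolding G_eq
  proof (rule definable_equalizer)
    show "dmap M (m + n) m (Y \<otimes> X) (\<lambda>z. f (drop m z))"
      by (rule dmap_compose[OF dmap_drop[OF YX] fd(1)])
        (use definable_in_length[OF Y] in \<open>auto elim!: set_productE\<close>)
    show "dmap M (m + n) m (Y \<otimes> X) (take m)" by (rule dmap_take[OF YX]) simp
  qed
  then have "definable M G" using definable_iff by blast
  then have "definable_map M Y X g"
    unfolding definable_map_def using g(1,2) definable_iff X Y unfolding G_def by blast
  then have "dmap M m n Y g" using definable_map_iff_dmap[OF Y X] by blast
  with g that show ?thesis by blast
qed

text \<open>\<open>\<kappa>\<close> is the fibre component of the inverse chart. The base component
  needs no name, because it is \<open>p\<close>.\<close>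

lemma chart_coordinate:
  fixes M :: "('f, 'r, 'a::real_closed_field) expansion"
  assumes B: "definable_in M b B" and U: "definable_in M m U" and F: "definable_in M k F"
    and p: "dmap M b m B p"
    and \<phi>: "definable_homeomorphism M (U \<otimes> F) {c \<in> B. p c \<in> U} \<phi>"
    and p\<phi>: "\<And>x y. x \<in> U \<Longrightarrow> y \<in> F \<Longrightarrow> p (\<phi> (x @ y)) = x"
  obtains \<kappa> where "dmap M b k {c \<in> B. p c \<in> U} \<kappa>"
    "dmap M (m + k) b (U \<otimes> F) \<phi>" "\<phi> \<in> U \<otimes> F \<rightarrow> {c \<in> B. p c \<in> U}"
    "\<And>c. c \<in> B \<Longrightarrow> p c \<in> U \<Longrightarrow> \<kappa> c \<in> F \<and> \<phi> (p c @ \<kappa> c) = c"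
    "\<And>x y. x \<in> U \<Longrightarrow> y \<in> F \<Longrightarrow> \<kappa> (\<phi> (x @ y)) = y"
proof -
  let ?P = "{c \<in> B. p c \<in> U}"
  have P: "definable_in M b ?P" by (rule definable_preimage[OF p U])
  have UF: "definable_in M (m + k) (U \<otimes> F)" by (rule definable_product[OF U F]) simp
  have \<phi>d: "dmap M (m + k) b (U \<otimes> F) \<phi>" "\<phi> \<in> U \<otimes> F \<rightarrow> ?P"
    using \<phi> definable_map_iff_dmap[OF UF P] by (auto simp: definable_homeomorphism_def)
  obtain \<psi> where \<psi>: "dmap M b (m + k) ?P \<psi>" "\<psi> \<in> ?P \<rightarrow> U \<otimes> F"
    "\<And>z. z \<in> U \<otimes> F \<Longrightarrow> \<psi> (\<phi> z) = z" "\<And>c. c \<in> ?P \<Longrightarrow> \<phi> (\<psi> c) = c"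
    by (rule definable_homeomorphism_inverse[OF \<phi> UF P], rule that)
  show ?thesis
  proof (rule that[of "\<lambda>c. drop m (\<psi> c)", OF dmap_compose[OF \<psi>(1) dmap_drop[OF UF] \<psi>(2)] \<phi>d])
    fix c assume c: "c \<in> B" "p c \<in> U"
    then have "\<psi> c \<in> U \<otimes> F" using \<psi>(2) by blast
    then obtain x y where xy: "\<psi> c = x @ y" "x \<in> U" "y \<in> F" by (rule set_productE)
    then have "p c = x" using p\<phi>[OF xy(2,3)] \<psi>(4)[of c] c by simp
    then show "drop m (\<psi> c) \<in> F \<and> \<phi> (p c @ drop m (\<psi> c)) = c"
      using xy definable_in_length[OF U xy(2)] \<psi>(4)[of c] c by auto
  next
    fix x y assume "x \<in> U" "y \<in> F"
    then show "drop m (\<psi> (\<phi> (x @ y))) = y"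
      using \<psi>(3)[OF set_productI] definable_in_length[OF U] by simp
  qed simp
qed

text \<open>
  Parallel transport inside a chart, \<open>c \<mapsto> T (c @ x)\<close>, moves the fibre through \<open>c\<close> to the fibre
  over \<open>x\<close> keeping the fibre coordinate fixed.
\<close>

lemma chart_transport:
  fixes M :: "('f, 'r, 'a::real_closed_field) expansion"
  assumes B: "definable_in M b B" and U: "definable_in M m U" and F: "definable_in M k F"
    and p: "dmap M b m B p"
    and \<phi>: "definable_homeomorphism M (U \<otimes> F) {c \<in> B. p c \<in> U} \<phi>"
    and p\<phi>: "\<And>x y. x \<in> U \<Longrightarrow> y \<in> F \<Longrightarrow> p (\<phi> (x @ y)) = x"
  obtains T where "dmap M (b + m) b ({c \<in> B. p c \<in> U} \<otimes> U) T"
    "\<And>c x. c \<in> B \<Longrightarrow> p c \<in> U \<Longrightarrow> x \<in> U \<Longrightarrow> T (c @ x) \<in> B \<and> p (T (c @ x)) = x"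
    "\<And>c. c \<in> B \<Longrightarrow> p c \<in> U \<Longrightarrow> T (c @ p c) = c"
    "\<And>x x'. x \<in> U \<Longrightarrow> x' \<in> U \<Longrightarrow>
       homeomorphic_map (space_of {c \<in> B. p c = x}) (space_of {c \<in> B. p c = x'}) (\<lambda>c. T (c @ x'))"
proof -
  let ?P = "{c \<in> B. p c \<in> U}"
  obtain \<kappa> where \<kappa>: "dmap M b k ?P \<kappa>" "dmap M (m + k) b (U \<otimes> F) \<phi>" "\<phi> \<in> U \<otimes> F \<rightarrow> ?P"
    "\<And>c. c \<in> B \<Longrightarrow> p c \<in> U \<Longrightarrow> \<kappa> c \<in> F \<and> \<phi> (p c @ \<kappa> c) = c"
    "\<And>x y. x \<in> U \<Longrightarrow> y \<in> F \<Longrightarrow> \<kappa> (\<phi> (x @ y)) = y"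
    by (rule chart_coordinate[OF B U F p \<phi>], rule p\<phi>, assumption+, rule that)
  have P: "definable_in M b ?P" by (rule definable_preimage[OF p U])
  have PU: "definable_in M (b + m) (?P \<otimes> U)" by (rule definable_product[OF P U]) simp
  define T where "T z = \<phi> (drop b z @ \<kappa> (take b z))" for z
  have T: "T (c @ x) = \<phi> (x @ \<kappa> c)" if "c \<in> B" for c x
    using definable_in_length[OF B that] by (simp add: T_def)
  have T1: "T (c @ x) \<in> B \<and> p (T (c @ x)) = x" if "c \<in> B" "p c \<in> U" "x \<in> U" for c x
  proof -
    have "\<kappa> c \<in> F" using \<kappa>(4) that by blast
    then show ?thesis using Pi_mem[OF \<kappa>(3) set_productI[OF that(3)]] p\<phi>[OF that(3)] T[OF that(1)] by auto
  qed
  have T2: "T (c @ p c) = c" if "c \<in> B" "p c \<in> U" for c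
    using T \<kappa>(4) that by simp
  \<comment> \<open>Transport inside one chart depends on its target only, so moving on to
    \<open>x\<close> first makes no difference. This supplies the inverses of the maps between
    fibres.\<close>
  have TT: "T (T (c @ x) @ x') = T (c @ x')" if "c \<in> B" "p c \<in> U" "x \<in> U" "x' \<in> U" for c x x'
    using T[OF conjunct1[OF T1[OF that(1-3)]]] T[OF that(1)] \<kappa>(5)[OF that(3)] \<kappa>(4)[OF that(1,2)] by simp
  have dT: "dmap M (b + m) b (?P \<otimes> U) T"
    unfolding T_def
  proof (rule dmap_compose[OF dmap_append[OF dmap_drop[OF PU] dmap_compose[OF dmap_take[OF PU] \<kappa>(1)]] \<kappa>(2)])
    show "take b \<in> ?P \<otimes> U \<rightarrow> ?P"
      using definable_in_length[OF B] by (auto elim!: set_productE)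
    show "(\<lambda>z. drop b z @ \<kappa> (take b z)) \<in> ?P \<otimes> U \<rightarrow> U \<otimes> F"
    proof
      fix z assume "z \<in> ?P \<otimes> U"
      then obtain c x where z: "z = c @ x" "c \<in> ?P" "x \<in> U" by (rule set_productE)
      then have "length c = b" using definable_in_length[OF B, of c] by simp
      then show "drop b z @ \<kappa> (take b z) \<in> U \<otimes> F"
        using z \<kappa>(4)[of c] by (simp add: set_productI)
    qed
  qed simp_all
  have cont: "cont {c \<in> B. p c = x} (\<lambda>c. T (c @ x'))" if "x \<in> U" "x' \<in> U" for x x'
  proof (rule cont_compose[OF _ dmap_cont[OF dT]])
    show "cont {c \<in> B. p c = x} (\<lambda>c. c @ x')"
      by (rule cont_append[OF cont_contraction cont_const])
    show "(\<lambda>c. c @ x') \<in> {c \<in> B. p c = x} \<rightarrow> ?P \<otimes> U" using that by (auto intro: set_productI)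
  qed
  show ?thesis
  proof (rule that[OF dT T1 T2])
    fix x x' assume x: "x \<in> U" "x' \<in> U"
    show "homeomorphic_map (space_of {c \<in> B. p c = x}) (space_of {c \<in> B. p c = x'}) (\<lambda>c. T (c @ x'))"
    proof (rule homeomorphic_map_space_ofI[where g="\<lambda>c. T (c @ x)"])
      show "T (T (c @ x') @ x) = c" if "c \<in> {c \<in> B. p c = x}" for c
        using TT[of c x' x] T2[of c] that x by auto
      show "T (T (c @ x) @ x') = c" if "c \<in> {c \<in> B. p c = x'}" for c
        using TT[of c x x'] T2[of c] that x by auto
    qed (use T1 x cont in auto)
  qed
qed

text \<open>Besides the total space of the induced bundle this is the domain of transport along a
  homotopy \<open>H\<close>: a parameter \<open>y\<close> together with a point of the fibre over
  \<open>H (y, 0)\<close>.\<close>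

definition pullback :: "('a list \<Rightarrow> 'a list) \<Rightarrow> 'a list set \<Rightarrow> 'a list set \<Rightarrow> ('a list \<Rightarrow> 'a list) \<Rightarrow> 'a list set" where
  "pullback f X B p = {c @ x |c x. c \<in> B \<and> x \<in> X \<and> p c = f x}"

lemma pullbackI: "c \<in> B \<Longrightarrow> x \<in> X \<Longrightarrow> p c = f x \<Longrightarrow> c @ x \<in> pullback f X B p"
  unfolding pullback_def by blast

lemma pullbackE:
  assumes "z \<in> pullback f X B p"
  obtains c x where "z = c @ x" "c \<in> B" "x \<in> X" "p c = f x"
  using assms unfolding pullback_def by blast

lemma definable_pullback:
  assumes B: "definable_in M b B" and X: "definable_in M n X"
    and p: "dmap M b m B p" and f: "dmap M n m X f" and k: "k = b + n"
  shows "definable_in M k (pullback f X B p)"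
proof -
  have BX: "definable_in M k (B \<otimes> X)" by (rule definable_product[OF B X k])
  have "pullback f X B p = {z \<in> B \<otimes> X. p (take b z) = f (drop b z)}"
  proof (intro subset_antisym subsetI)
    fix z assume "z \<in> pullback f X B p"
    then obtain c x where z: "z = c @ x" "c \<in> B" "x \<in> X" "p c = f x" by (rule pullbackE)
    then show "z \<in> {z \<in> B \<otimes> X. p (take b z) = f (drop b z)}"
      using definable_in_length[OF B z(2)] by (simp add: set_productI)
  next
    fix z assume z: "z \<in> {z \<in> B \<otimes> X. p (take b z) = f (drop b z)}"
    then have "z \<in> B \<otimes> X" by simp
    then obtain c x where cx: "z = c @ x" "c \<in> B" "x \<in> X" by (rule set_productE)
    then show "z \<in> pullback f X B p"
      using z definable_in_length[OF B cx(2)] by (simp add: pullbackI)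
  qed
  moreover have "dmap M k m (B \<otimes> X) (\<lambda>z. p (take b z))"
    by (rule dmap_compose[OF dmap_take[OF BX] p]) (use definable_in_length[OF B] k in \<open>auto elim!: set_productE\<close>)
  moreover have "dmap M k m (B \<otimes> X) (\<lambda>z. f (drop b z))"
    by (rule dmap_compose[OF dmap_drop[OF BX] f]) (use definable_in_length[OF B] k in \<open>auto elim!: set_productE\<close>)
  ultimately show ?thesis by (simp add: definable_equalizer)
qed

lemma definable_Int:
  assumes "definable_in M n S" "definable_in M n T" shows "definable_in M n (S \<inter> T)"
  using dpred_conj[of M "\<lambda>e. map e [0..<n] \<in> S" "\<lambda>e. map e [0..<n] \<in> T"] assms
  by (auto simp: definable_in_iff)

lemma dmap_mult_const:
  assumes s: "dmap M n (Suc 0) X (\<lambda>x. [s x])" and "0 < c"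
  shows "dmap M n (Suc 0) X (\<lambda>x. [c * s x])"
proof (rule dmap_binop[where F="\<lambda>a _. c * a", OF s s _ assms(2)])
  show "dfun M (\<lambda>e. c * e 0)" by (intro dintros)
  show "\<bar>c * a - c * a'\<bar> < c * \<delta>" if "\<bar>a - a'\<bar> < \<delta>" for a a' \<delta>
  proof -
    have "\<bar>c * a - c * a'\<bar> = c * \<bar>a - a'\<bar>" using assms(2) by (simp add: abs_mult right_diff_distrib[symmetric])
    then show ?thesis using that assms(2) by simp
  qed
qed

lemma dmap_min:
  fixes M :: "('f, 'r, 'a::real_closed_field) expansion"
  assumes s: "dmap M n (Suc 0) X (\<lambda>x. [s x])" and u: "dmap M n (Suc 0) X (\<lambda>x. [u x])"
  shows "dmap M n (Suc 0) X (\<lambda>x. [min (s x) (u x)])"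
proof (rule dmap_binop[where F=min and K=1, OF s u])
  show "dfun M (\<lambda>e. min (e 0) (e 1))" by (intro dintros)
  show "\<bar>min a b - min a' b'\<bar> < 1 * \<delta>" if "\<bar>a - a'\<bar> < \<delta>" "\<bar>b - b'\<bar> < \<delta>" for a a' b b' \<delta> :: 'a
    using that by (auto simp: min_def abs_less_iff)
qed simp

text \<open>Induction over a list of steps that reaches 1 for all \<open>y\<close>. After a part of
  the list, the path over \<open>y\<close> is followed only up to the parameter
  \<open>run Ws y 0\<close> and the point rests there for later \<open>t\<close>. So every stage is
  defined on the whole domain, and at the end the truncation disappears.\<close>

theorem transport:
  fixes M :: "('f, 'r, 'a::real_closed_field) expansion"
  assumes om: "o_minimal M" and bun: "definable_fibre_bundle M (B, X, p, F)"
    and B: "definable_in M b B" and X: "definable_in M m X" and Y: "definable_in M n Y"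
    and H: "dmap M (Suc n) m (Y \<otimes> unit_interval) H" and HX: "H \<in> Y \<otimes> unit_interval \<rightarrow> X"
  obtains \<Theta> where
    "dmap M (Suc (b + n)) b (pullback (\<lambda>y. H (y @ [0])) Y B p \<otimes> unit_interval) \<Theta>"
    "\<And>c y t. c \<in> B \<Longrightarrow> y \<in> Y \<Longrightarrow> p c = H (y @ [0]) \<Longrightarrow> 0 \<le> t \<Longrightarrow> t \<le> 1 \<Longrightarrow>
       \<Theta> (c @ y @ [t]) \<in> B \<and> p (\<Theta> (c @ y @ [t])) = H (y @ [t])"
    "\<And>c y. c \<in> B \<Longrightarrow> y \<in> Y \<Longrightarrow> p c = H (y @ [0]) \<Longrightarrow> \<Theta> (c @ y @ [0]) = c"
    "\<And>c y t. c \<in> B \<Longrightarrow> y \<in> Y \<Longrightarrow> p c = H (y @ [0]) \<Longrightarrow> 0 \<le> t \<Longrightarrow> t \<le> 1 \<Longrightarrow>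
       \<forall>q. 0 \<le> q \<and> q \<le> 1 \<longrightarrow> H (y @ [q]) = H (y @ [0]) \<Longrightarrow> \<Theta> (c @ y @ [t]) = c"
    "\<And>y t. y \<in> Y \<Longrightarrow> 0 \<le> t \<Longrightarrow> t \<le> 1 \<Longrightarrow>
       homeomorphic_map (space_of {c \<in> B. p c = H (y @ [0])}) (space_of {c \<in> B. p c = H (y @ [t])})
         (\<lambda>c. \<Theta> (c @ y @ [t]))"
proof -
  let ?Z = "Y \<otimes> unit_interval"
  let ?E = "pullback (\<lambda>y. H (y @ [0])) Y B p"
  let ?ZE = "?E \<otimes> unit_interval"
  have "definable M F" "definable_map M B X p" and "\<exists>\<U>. finite \<U> \<and> \<Union>\<U> = X \<and>
        (\<forall>U\<in>\<U>. definable M U \<and> openin (space_of X) U \<and>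
           (\<exists>\<phi>. definable_homeomorphism M (U \<otimes> F) {b \<in> B. p b \<in> U} \<phi> \<and>
              (\<forall>x\<in>U. \<forall>y\<in>F. p (\<phi> (x @ y)) = x)))"
    using bun by auto
  then obtain \<U> where fin: "finite \<U>" and cover: "\<Union>\<U> = X" and
    charts: "\<And>U. U \<in> \<U> \<Longrightarrow> definable M U \<and> openin (space_of X) U \<and>
           (\<exists>\<phi>. definable_homeomorphism M (U \<otimes> F) {b \<in> B. p b \<in> U} \<phi> \<and>
              (\<forall>x\<in>U. \<forall>y\<in>F. p (\<phi> (x @ y)) = x))"
    by blast
  obtain k where F: "definable_in M k F" using \<open>definable M F\<close> by (auto simp: definable_def)
  have p: "dmap M b m B p" "p \<in> B \<rightarrow> X"
    using \<open>definable_map M B X p\<close> definable_map_iff_dmap[OF B X] by auto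
  have U: "definable_in M m U" if "U \<in> \<U>" for U
    using charts[OF that] definable_iff[of M U m] that cover definable_in_length[OF X] by blast
  obtain xs where xs: "set xs = \<U>" using finite_list[OF fin] by blast
  \<comment> \<open>Pulling the charts back along \<open>H\<close> gives the open cover of the
    cylinder that is to be subdivided.\<close>
  define W where "W U = {z \<in> ?Z. H z \<in> U}" for U
  have contH: "continuous_map (space_of ?Z) (space_of X) H"
    unfolding continuous_map_space_of using HX dmap_cont[OF H] by blast
  interpret subdivision M n Y "map W xs"
  proof
    show "o_minimal M" "definable_in M n Y" by fact+
    fix V assume "V \<in> set (map W xs)"
    then obtain U' where U': "V = W U'" "U' \<in> \<U>" using xs by auto
    have "openin (space_of ?Z) {z \<in> topspace (space_of ?Z). H z \<in> U'}"
      by (rule openin_continuous_map_preimage[OF contH]) (use charts[OF U'(2)] in blast)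
    then show "definable_in M (Suc n) V \<and> openin (space_of ?Z) V"
      unfolding U'(1) W_def topspace_space_of using definable_preimage[OF H U[OF U'(2)]] by blast
  next
    show "?Z \<subseteq> \<Union>(set (map W xs))"
    proof
      fix z assume z: "z \<in> ?Z"
      then have "H z \<in> \<Union>\<U>" using HX cover by blast
      then show "z \<in> \<Union>(set (map W xs))" using z xs by (auto simp: W_def)
    qed
  qed
  have H0: "dmap M n m Y (\<lambda>y. H (y @ [0]))"
    by (rule dmap_compose[OF dmap_append[OF dmap_id[OF Y] dmap_const[OF Y, of "[0]" "Suc 0"]] H])
      (auto simp: Z_iff)
  have E: "definable_in M (b + n) ?E" by (rule definable_pullback[OF B Y p(1) H0]) simp
  have ZE: "definable_in M (Suc (b + n)) ?ZE" by (rule definable_product[OF E definable_unit_interval]) simp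
  have ZE_I: "c @ y @ [t] \<in> ?ZE" if "c \<in> B" "y \<in> Y" "p c = H (y @ [0])" "0 \<le> t" "t \<le> 1" for c y t
    using set_productI[OF pullbackI[where p=p and f="\<lambda>y. H (y @ [0])", OF that(1-3)], of "[t]" unit_interval] that(4,5) by (simp add: unit_interval_iff)
  have ZE_E: "\<exists>c y t. z = c @ y @ [t] \<and> c \<in> B \<and> y \<in> Y \<and> p c = H (y @ [0]) \<and> 0 \<le> t \<and> t \<le> 1"
    if z: "z \<in> ?ZE" for z
  proof -
    obtain x i where x: "z = x @ i" "x \<in> ?E" "i \<in> unit_interval" by (rule set_productE[OF z])
    obtain c y where "x = c @ y" "c \<in> B" "y \<in> Y" "p c = H (y @ [0])" by (rule pullbackE[OF x(2)])
    then show ?thesis using x(1,3) by (auto simp: unit_interval_iff)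
  qed
  have lens: "length c = b" "length y = n" if "c \<in> B" "y \<in> Y" for c y
    using definable_in_length[OF B] definable_in_length[OF Y] that by auto
  define py where "py z = take n (drop b z)" for z :: "'a list"
  define pt where "pt z = z ! (b + n)" for z :: "'a list"
  have coords: "py (c @ y @ [t]) = y" "pt (c @ y @ [t]) = t" "take b (c @ y @ [t]) = c" if "c \<in> B" "y \<in> Y" for c y t
    using lens[OF that] by (simp_all add: py_def pt_def nth_append)
  have py_d: "dmap M (Suc (b + n)) n ?ZE py"
  proof -
    have "dmap M (Suc (b + n)) (Suc n) ?ZE (drop b)" by (rule dmap_drop[OF ZE]) simp
    moreover have "definable_in M (Suc n) {x. length x = Suc n}" by (simp add: definable_in_iff dpred_const)
    then have "dmap M (Suc n) n {x. length x = Suc n} (take n)" by (rule dmap_take) simp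
    ultimately have "dmap M (Suc (b + n)) n ?ZE (\<lambda>z. take n (drop b z))"
      by (rule dmap_compose) (use definable_in_length[OF ZE] in auto)
    then show ?thesis by (simp add: py_def[abs_def])
  qed
  have py_Y: "py \<in> ?ZE \<rightarrow> Y" using ZE_E coords by fastforce
  have pt_d: "dmap M (Suc (b + n)) (Suc 0) ?ZE (\<lambda>z. [pt z])"
  proof (rule dmap_cong[where f="drop (b + n)"])
    show "dmap M (Suc (b + n)) (Suc 0) ?ZE (drop (b + n))" by (rule dmap_drop[OF ZE]) simp
    show "drop (b + n) z = [pt z]" if "z \<in> ?ZE" for z
      using definable_in_length[OF ZE that] by (simp add: pt_def Cons_nth_drop_Suc[symmetric])
  qed
  \<comment> \<open>The invariant of the induction: \<open>\<Theta>\<close> transports along the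
    path stopped at \<open>\<tau> y\<close>. The clause on constant paths is carried along because
    the trivial ends of later homotopies depend on it.\<close>
  define good where "good \<tau> \<Theta> \<longleftrightarrow> dmap M (Suc (b + n)) b ?ZE \<Theta> \<and>
    (\<forall>c\<in>B. \<forall>y\<in>Y. p c = H (y @ [0]) \<longrightarrow> \<Theta> (c @ y @ [0]) = c \<and>
       (\<forall>t. 0 \<le> t \<and> t \<le> 1 \<longrightarrow> \<Theta> (c @ y @ [t]) \<in> B \<and> p (\<Theta> (c @ y @ [t])) = H (y @ [min t (\<tau> y)]) \<and>
          ((\<forall>q. 0 \<le> q \<and> q \<le> 1 \<longrightarrow> H (y @ [q]) = H (y @ [0])) \<longrightarrow> \<Theta> (c @ y @ [t]) = c))) \<and>
    (\<forall>y\<in>Y. \<forall>t. 0 \<le> t \<and> t \<le> 1 \<longrightarrow> homeomorphic_map (space_of {c \<in> B. p c = H (y @ [0])})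
       (space_of {c \<in> B. p c = H (y @ [min t (\<tau> y)])}) (\<lambda>c. \<Theta> (c @ y @ [t])))"
    for \<tau> :: "'a list \<Rightarrow> 'a" and \<Theta> :: "'a list \<Rightarrow> 'a list"
  have "\<exists>\<Theta>. good (\<lambda>y. run Ws y 0) \<Theta>" if "set Ws \<subseteq> set (map W xs)" for Ws
    using that
  proof (induction Ws rule: rev_induct)
    case Nil
    have "homeomorphic_map (space_of {c \<in> B. p c = H (y @ [0])}) (space_of {c \<in> B. p c = H (y @ [0])})
        (\<lambda>c. take b (c @ y @ [t]))" if "y \<in> Y" for y t
      by (rule homeomorphic_map_eq[OF homeomorphic_map_id[THEN iffD2, OF refl]])
        (use lens that in \<open>auto simp: topspace_space_of\<close>)
    moreover have "dmap M (Suc (b + n)) b ?ZE (take b)" by (rule dmap_take[OF ZE]) simp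
    ultimately have "good (\<lambda>y. run [] y 0) (take b)"
      unfolding good_def run_simps using coords by (simp add: min_def)
    then show ?case by blast
  next
    case (snoc V Ws)
    then obtain \<Theta> where "good (\<lambda>y. run Ws y 0) \<Theta>" and V: "V \<in> set (map W xs)" and Ws: "set Ws \<subseteq> set (map W xs)"
      by auto
    define \<tau> where "\<tau> y = run Ws y 0" for y
    define \<tau>' where "\<tau>' y = run (Ws @ [V]) y 0" for y
    have "good \<tau> \<Theta>" using \<open>good (\<lambda>y. run Ws y 0) \<Theta>\<close> unfolding \<tau>_def .
    note G = this[unfolded good_def]
    note G2 = G[THEN conjunct2, THEN conjunct1, rule_format]
    note Gt = G2[THEN conjunct2, rule_format, OF _ _ _ conjI]
    note \<Theta>d = G[THEN conjunct1] and \<Theta>0 = G2[THEN conjunct1] and \<Theta>B = Gt[THEN conjunct1]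
      and \<Theta>p = Gt[THEN conjunct2, THEN conjunct1] and \<Theta>c = Gt[THEN conjunct2, THEN conjunct2, THEN mp]
      and \<Theta>h = G[THEN conjunct2, THEN conjunct2, rule_format, OF _ conjI]
    obtain U0 where U0: "V = W U0" "U0 \<in> \<U>" using V xs by auto
    obtain \<phi> where \<phi>: "definable_homeomorphism M (U0 \<otimes> F) {c \<in> B. p c \<in> U0} \<phi>"
      "\<And>x y. x \<in> U0 \<Longrightarrow> y \<in> F \<Longrightarrow> p (\<phi> (x @ y)) = x" using charts[OF U0(2)] by blast
    obtain T where Td: "dmap M (b + m) b ({c \<in> B. p c \<in> U0} \<otimes> U0) T"
      and T1: "\<And>c x. c \<in> B \<Longrightarrow> p c \<in> U0 \<Longrightarrow> x \<in> U0 \<Longrightarrow> T (c @ x) \<in> B \<and> p (T (c @ x)) = x"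
      and T2: "\<And>c. c \<in> B \<Longrightarrow> p c \<in> U0 \<Longrightarrow> T (c @ p c) = c"
      and Th: "\<And>x x'. x \<in> U0 \<Longrightarrow> x' \<in> U0 \<Longrightarrow>
        homeomorphic_map (space_of {c \<in> B. p c = x}) (space_of {c \<in> B. p c = x'}) (\<lambda>c. T (c @ x'))"
      by (rule chart_transport[OF B U[OF U0(2)] F p(1) \<phi>(1)], rule \<phi>(2), assumption+, rule that)
    have \<tau>: "0 \<le> \<tau> y" "\<tau> y \<le> \<tau>' y" "\<tau>' y \<le> 1" for y
      using run_bounds[OF Ws, of 0 y] st_bounds[OF V, of "run Ws y 0" y] by (auto simp: \<tau>_def \<tau>'_def run_simps)
    have \<tau>_d: "dmap M n (Suc 0) Y (\<lambda>y. [\<tau> y])" "dmap M n (Suc 0) Y (\<lambda>y. [\<tau>' y])"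
      unfolding \<tau>_def \<tau>'_def using V Ws by (intro run_dmap; simp)+
    \<comment> \<open>Both ends of the step, stopped at time \<open>t\<close>, lie well inside the
      chart. A lower bound on the radii is used rather than membership in the open set
      \<open>V\<close>, so that the condition describes a relatively closed set; as
      \<open>lam y\<close> is positive, it implies membership.\<close>
    define cond where "cond y t \<longleftrightarrow> lam y \<le> 4 * r V (y @ [min t (\<tau> y)]) \<and> lam y \<le> 4 * r V (y @ [min t (\<tau>' y)])" for y t
    \<comment> \<open>A stopped step of positive length has both ends between
      \<open>\<tau> y\<close> and \<open>\<tau>' y\<close>, where \<open>st_inside\<close> gives the
      bound. So where the condition fails there is nothing to transport.\<close>
    have not_cond: "min t (\<tau>' y) = min t (\<tau> y)" if y: "y \<in> Y" and n: "\<not> cond y t" for y t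
    proof (rule ccontr)
      assume ne: "min t (\<tau>' y) \<noteq> min t (\<tau> y)"
      have lt: "\<tau> y < t" "\<tau> y < \<tau>' y"
        using ne \<tau>(2)[of y] by (auto simp: min_def split: if_splits)
      have "lam y \<le> 4 * r V (y @ [q])" if "\<tau> y \<le> q" "q \<le> \<tau>' y" for q
        using st_inside[OF V y, of "run Ws y 0" q] \<tau>[of y] lt that by (simp add: \<tau>_def \<tau>'_def run_simps)
      then have "cond y t" using lt unfolding cond_def by (auto simp: min_def)
      with n show False by blast
    qed
    have cond_U: "H (y @ [min t (\<tau> y)]) \<in> U0" "H (y @ [min t (\<tau>' y)]) \<in> U0"
      if y: "y \<in> Y" and t: "0 \<le> t" "t \<le> 1" and c: "cond y t" for y t
    proof -
      have "0 < 4 * r V (y @ [min t (\<tau> y)])" "0 < 4 * r V (y @ [min t (\<tau>' y)])"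
        using c lam_pos[OF y] unfolding cond_def by auto
      moreover have "y @ [min t (\<tau> y)] \<in> ?Z" "y @ [min t (\<tau>' y)] \<in> ?Z"
        using Z_iff[OF y] t \<tau>[of y] by (auto simp: min_def)
      ultimately have "y @ [min t (\<tau> y)] \<in> V" "y @ [min t (\<tau>' y)] \<in> V"
        using r_pos_mem[OF V] by simp_all
      then show "H (y @ [min t (\<tau> y)]) \<in> U0" "H (y @ [min t (\<tau>' y)]) \<in> U0" by (auto simp: U0(1) W_def)
    qed
    define s where "s z = min (pt z) (\<tau> (py z))" for z
    define s' where "s' z = min (pt z) (\<tau>' (py z))" for z
    have s_coords: "s (c @ y @ [t]) = min t (\<tau> y)" "s' (c @ y @ [t]) = min t (\<tau>' y)" if "c \<in> B" "y \<in> Y" for c y t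
      using coords[OF that] by (simp_all add: s_def s'_def)
    have s_d: "dmap M (Suc (b + n)) (Suc 0) ?ZE (\<lambda>z. [s z])" "dmap M (Suc (b + n)) (Suc 0) ?ZE (\<lambda>z. [s' z])"
      unfolding s_def s'_def
      by (rule dmap_min[OF pt_d dmap_compose[OF py_d \<tau>_d(1) py_Y]])
        (rule dmap_min[OF pt_d dmap_compose[OF py_d \<tau>_d(2) py_Y]])
    have a_d: "dmap M (Suc (b + n)) (Suc n) ?ZE (\<lambda>z. py z @ [s z])" "dmap M (Suc (b + n)) (Suc n) ?ZE (\<lambda>z. py z @ [s' z])"
      by (rule dmap_append[OF py_d s_d(1)], simp) (rule dmap_append[OF py_d s_d(2)], simp)
    have a_Z: "(\<lambda>z. py z @ [s z]) \<in> ?ZE \<rightarrow> ?Z" "(\<lambda>z. py z @ [s' z]) \<in> ?ZE \<rightarrow> ?Z"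
    proof -
      have "py z @ [s z] \<in> ?Z \<and> py z @ [s' z] \<in> ?Z" if z: "z \<in> ?ZE" for z
      proof -
        obtain c y t where "z = c @ y @ [t]" "c \<in> B" "y \<in> Y" "0 \<le> t" "t \<le> 1" using ZE_E[OF z] by blast
        then show ?thesis using coords[of c y t] s_coords[of c y t] Z_iff[of y] \<tau>[of y] by (auto simp: min_def)
      qed
      then show "(\<lambda>z. py z @ [s z]) \<in> ?ZE \<rightarrow> ?Z" "(\<lambda>z. py z @ [s' z]) \<in> ?ZE \<rightarrow> ?Z" by auto
    qed
    note lam_d = dmap_compose[OF py_d lam_dmap py_Y]
    note r_d = dmap_mult_const[where c=4, OF dmap_compose[OF a_d(1) r_dmap[OF V] a_Z(1)]]
      dmap_mult_const[where c=4, OF dmap_compose[OF a_d(2) r_dmap[OF V] a_Z(2)]]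
    define C1 where "C1 = {z \<in> ?ZE. lam (py z) \<le> 4 * r V (py z @ [s z])}"
    define C2 where "C2 = {z \<in> ?ZE. lam (py z) \<le> 4 * r V (py z @ [s' z])}"
    define C where "C = C1 \<inter> C2"
    \<comment> \<open>The closed set where the stopped step has length zero; together with
      \<open>C\<close> it covers the domain by \<open>not_cond\<close>.\<close>
    define D where "D = {z \<in> ?ZE. s' z \<le> s z}"
    have dC: "definable_in M (Suc (b + n)) C1" "definable_in M (Suc (b + n)) C2"
      unfolding C1_def C2_def by (rule closed_le(1)[OF lam_d r_d(1)], simp) (rule closed_le(1)[OF lam_d r_d(2)], simp)
    have C: "definable_in M (Suc (b + n)) C" unfolding C_def by (rule definable_Int[OF dC])
    have D: "definable_in M (Suc (b + n)) D" unfolding D_def by (rule closed_le(1)[OF s_d(2,1)])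
    have sub: "C \<subseteq> ?ZE" "D \<subseteq> ?ZE" by (auto simp: C_def C1_def D_def)
    have C_iff: "c @ y @ [t] \<in> C \<longleftrightarrow> cond y t"
      if "c \<in> B" "y \<in> Y" "p c = H (y @ [0])" "0 \<le> t" "t \<le> 1" for c y t
      using ZE_I[OF that] coords[OF that(1,2), of t] s_coords[OF that(1,2), of t]
      by (simp add: C_def C1_def C2_def cond_def)
    define g where "g z = T (\<Theta> z @ H (py z @ [s' z]))" for z
    define \<Theta>' where "\<Theta>' z = (if z \<in> C then g z else \<Theta> z)" for z
    have \<Theta>'_C: "\<Theta>' (c @ y @ [t]) = T (\<Theta> (c @ y @ [t]) @ H (y @ [min t (\<tau>' y)]))"
      if "c \<in> B" "y \<in> Y" "p c = H (y @ [0])" "0 \<le> t" "t \<le> 1" "cond y t" for c y t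
      using C_iff[OF that(1-5)] that coords(1)[OF that(1,2), of t] s_coords[OF that(1,2), of t] by (simp add: \<Theta>'_def g_def)
    have \<Theta>'_D: "\<Theta>' (c @ y @ [t]) = \<Theta> (c @ y @ [t])"
      if "c \<in> B" "y \<in> Y" "p c = H (y @ [0])" "0 \<le> t" "t \<le> 1" "\<not> cond y t" for c y t
      using C_iff[OF that(1-5)] that(6) by (simp add: \<Theta>'_def)
    have g_d: "dmap M (Suc (b + n)) b C g"
      unfolding g_def
    proof (rule dmap_compose[OF _ Td])
      show "dmap M (Suc (b + n)) (b + m) C (\<lambda>z. \<Theta> z @ H (py z @ [s' z]))"
        by (rule dmap_append[OF dmap_subset[OF \<Theta>d C sub(1)]
              dmap_subset[OF dmap_compose[OF a_d(2) H a_Z(2)] C sub(1)]]) simp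
      show "(\<lambda>z. \<Theta> z @ H (py z @ [s' z])) \<in> C \<rightarrow> {c \<in> B. p c \<in> U0} \<otimes> U0"
      proof
        fix z assume z: "z \<in> C"
        then have "z \<in> ?ZE" using sub(1) by blast
        then obtain c y t where cyt: "z = c @ y @ [t]" "c \<in> B" "y \<in> Y" "p c = H (y @ [0])" "0 \<le> t" "t \<le> 1"
          using ZE_E by blast
        then have "cond y t" using C_iff z by blast
        note u = cond_U[OF cyt(3,5,6) this]
        have "\<Theta> z \<in> {c \<in> B. p c \<in> U0}"
          using \<Theta>B[OF cyt(2-6)] \<Theta>p[OF cyt(2-6)] u(1) cyt(1) by simp
        moreover have "H (py z @ [s' z]) \<in> U0"
          using u(2) coords(1)[OF cyt(2,3), of t] s_coords[OF cyt(2,3), of t] cyt(1) by simp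
        ultimately show "\<Theta> z @ H (py z @ [s' z]) \<in> {c \<in> B. p c \<in> U0} \<otimes> U0" by (rule set_productI)
      qed
    qed
    have \<Theta>'_d: "dmap M (Suc (b + n)) b ?ZE \<Theta>'"
      unfolding \<Theta>'_def
    proof (rule dmap_paste[OF g_d dmap_subset[OF \<Theta>d D sub(2)]])
      show "?ZE = C \<union> D"
      proof (intro subset_antisym subsetI)
        fix z assume z: "z \<in> ?ZE"
        then obtain c y t where cyt: "z = c @ y @ [t]" "c \<in> B" "y \<in> Y" "p c = H (y @ [0])" "0 \<le> t" "t \<le> 1"
          using ZE_E by blast
        show "z \<in> C \<union> D"
        proof (cases "cond y t")
          case True
          then show ?thesis using C_iff[OF cyt(2-6)] cyt(1) by simp
        next
          case False
          then have "s' z \<le> s z" using not_cond[OF cyt(3)] s_coords[OF cyt(2,3), of t] cyt(1) by simp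
          then show ?thesis using z by (simp add: D_def)
        qed
      qed (use sub in auto)
      show "\<exists>\<delta>>0. \<forall>y\<in>?ZE. near \<delta> x y \<longrightarrow> y \<notin> C" if x: "x \<in> ?ZE" "x \<notin> C" for x
      proof -
        have "\<not> lam (py x) \<le> 4 * r V (py x @ [s x]) \<or> \<not> lam (py x) \<le> 4 * r V (py x @ [s' x])"
          using x by (auto simp: C_def C1_def C2_def)
        then show ?thesis
        proof
          assume "\<not> lam (py x) \<le> 4 * r V (py x @ [s x])"
          then obtain \<delta> where "\<delta> > 0" "\<forall>y\<in>?ZE. near \<delta> x y \<longrightarrow> \<not> lam (py y) \<le> 4 * r V (py y @ [s y])"
            using closed_le(2)[OF lam_d r_d(1) x(1)] by auto
          then show ?thesis by (intro exI[of _ \<delta>]) (simp add: C_def C1_def)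
        next
          assume "\<not> lam (py x) \<le> 4 * r V (py x @ [s' x])"
          then obtain \<delta> where "\<delta> > 0" "\<forall>y\<in>?ZE. near \<delta> x y \<longrightarrow> \<not> lam (py y) \<le> 4 * r V (py y @ [s' y])"
            using closed_le(2)[OF lam_d r_d(2) x(1)] by auto
          then show ?thesis by (intro exI[of _ \<delta>]) (simp add: C_def C2_def)
        qed
      qed
      show "\<exists>\<delta>>0. \<forall>y\<in>?ZE. near \<delta> x y \<longrightarrow> y \<notin> D" if x: "x \<in> ?ZE" "x \<notin> D" for x
      proof -
        have "\<not> s' x \<le> s x" using x by (simp add: D_def)
        then obtain \<delta> where "\<delta> > 0" "\<forall>y\<in>?ZE. near \<delta> x y \<longrightarrow> \<not> s' y \<le> s y"
          using closed_le(2)[OF s_d(2,1) x(1)] by auto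
        then show ?thesis by (intro exI[of _ \<delta>]) (simp add: D_def)
      qed
      \<comment> \<open>On the overlap the target of the chart transport is the base point over
        which \<open>\<Theta> z\<close> already lies, so the transport is the identity
        there.\<close>
      show "g z = \<Theta> z" if z: "z \<in> C" "z \<in> D" for z
      proof -
        obtain c y t where cyt: "z = c @ y @ [t]" "c \<in> B" "y \<in> Y" "p c = H (y @ [0])" "0 \<le> t" "t \<le> 1"
          using ZE_E z(1) sub(1) by blast
        then have co: "cond y t" using C_iff z by blast
        have "s' z \<le> s z" using z(2) by (simp add: D_def)
        then have eq: "min t (\<tau>' y) = min t (\<tau> y)"
          using s_coords[OF cyt(2,3), of t] cyt(1) \<tau>(2)[of y] by (auto simp: min_def split: if_splits)
        have "H (py z @ [s' z]) = p (\<Theta> z)"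
          using \<Theta>p[OF cyt(2-6)] eq coords(1)[OF cyt(2,3), of t] s_coords[OF cyt(2,3), of t] cyt(1) by simp
        moreover have "p (\<Theta> z) \<in> U0" using \<Theta>p[OF cyt(2-6)] cond_U(1)[OF cyt(3,5,6) co] cyt(1) by simp
        ultimately show ?thesis using T2[of "\<Theta> z"] \<Theta>B[OF cyt(2-6)] cyt(1) by (simp add: g_def)
      qed
    qed
    have pc_U: "p c \<in> U0" if "y \<in> Y" "0 \<le> t" "t \<le> 1" "cond y t" "p c = H (y @ [0])"
      "H (y @ [min t (\<tau> y)]) = H (y @ [0])" for c y t
      using cond_U(1)[OF that(1-4)] that(5,6) by simp
    have "good \<tau>' \<Theta>'"
      unfolding good_def
    proof (intro conjI ballI allI impI)
      show "dmap M (Suc (b + n)) b ?ZE \<Theta>'" by fact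
    next
      fix c y assume c: "c \<in> B" "y \<in> Y" "p c = H (y @ [0])"
      have m0: "min 0 (\<tau> y) = 0" "min 0 (\<tau>' y) = 0" using \<tau>[of y] by auto
      have z1: "(0::'a) \<le> 1" "(0::'a) \<le> 0" by auto
      show "\<Theta>' (c @ y @ [0]) = c"
      proof (cases "cond y 0")
        case True
        then have "p c \<in> U0" using pc_U[OF c(2) z1(2,1) True c(3)] m0 by simp
        then show ?thesis using \<Theta>'_C[OF c z1(2,1) True] \<Theta>0[OF c] m0(2) T2[OF c(1)] c(3) by simp
      next
        case False
        then show ?thesis using \<Theta>'_D[OF c z1(2,1)] \<Theta>0[OF c] by simp
      qed
      fix t :: 'a assume "0 \<le> t \<and> t \<le> 1"
      then have t: "0 \<le> t" "t \<le> 1" by auto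
      note \<Theta>U = cond_U[OF c(2) t]
      have *: "\<Theta>' (c @ y @ [t]) \<in> B \<and> p (\<Theta>' (c @ y @ [t])) = H (y @ [min t (\<tau>' y)])"
      proof (cases "cond y t")
        case True
        then show ?thesis
          using \<Theta>'_C[OF c t True] T1[OF \<Theta>B[OF c t] _ \<Theta>U(2)[OF True]] \<Theta>p[OF c t] \<Theta>U(1)[OF True] by simp
      next
        case False
        then show ?thesis using \<Theta>'_D[OF c t False] \<Theta>B[OF c t] \<Theta>p[OF c t] not_cond[OF c(2) False] by simp
      qed
      then show "\<Theta>' (c @ y @ [t]) \<in> B" "p (\<Theta>' (c @ y @ [t])) = H (y @ [min t (\<tau>' y)])" by auto
      assume const: "\<forall>q. 0 \<le> q \<and> q \<le> 1 \<longrightarrow> H (y @ [q]) = H (y @ [0])"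
      have mm: "0 \<le> min t (\<tau> y) \<and> min t (\<tau> y) \<le> 1" "0 \<le> min t (\<tau>' y) \<and> min t (\<tau>' y) \<le> 1"
        using t \<tau>[of y] by (auto simp: min_def)
      show "\<Theta>' (c @ y @ [t]) = c"
      proof (cases "cond y t")
        case True
        then have "p c \<in> U0" using pc_U[OF c(2) t True c(3)] const mm by blast
        then show ?thesis
          using \<Theta>'_C[OF c t True] \<Theta>c[OF c t const] const[rule_format, OF mm(2)] T2[OF c(1)] c(3) by simp
      next
        case False
        then show ?thesis using \<Theta>'_D[OF c t False] \<Theta>c[OF c t const] by simp
      qed
    next
      fix y and t :: 'a assume y: "y \<in> Y" and "0 \<le> t \<and> t \<le> 1"
      then have t: "0 \<le> t" "t \<le> 1" by auto
      show "homeomorphic_map (space_of {c \<in> B. p c = H (y @ [0])})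
          (space_of {c \<in> B. p c = H (y @ [min t (\<tau>' y)])}) (\<lambda>c. \<Theta>' (c @ y @ [t]))"
      proof (cases "cond y t")
        case True
        note u = cond_U[OF y t True]
        show ?thesis
          by (rule homeomorphic_map_eq[OF homeomorphic_map_compose[OF \<Theta>h[OF y t] Th[OF u]]])
            (use \<Theta>'_C[OF _ y _ t True] in \<open>simp add: topspace_space_of\<close>)
      next
        case False
        show ?thesis
          unfolding not_cond[OF y False]
          by (rule homeomorphic_map_eq[OF \<Theta>h[OF y t]]) (use \<Theta>'_D[OF _ y _ t False] in \<open>simp add: topspace_space_of\<close>)
      qed
    qed
    then show ?case unfolding \<tau>'_def by blast
  qed
  moreover obtain Ws where Ws: "set Ws \<subseteq> set (map W xs)" "\<And>y. y \<in> Y \<Longrightarrow> run Ws y 0 = 1"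
    using run_complete by blast
  ultimately obtain \<Theta> where \<Theta>: "good (\<lambda>y. run Ws y 0) \<Theta>" by blast
  have min1: "min t (run Ws y 0) = t" if "y \<in> Y" "t \<le> 1" for y t
    using Ws(2)[OF that(1)] that(2) by simp
  note G = \<Theta>[unfolded good_def]
  note G2 = G[THEN conjunct2, THEN conjunct1, rule_format]
  note Gt = G2[THEN conjunct2, rule_format, OF _ _ _ conjI]
  note \<Theta>d = G[THEN conjunct1] and \<Theta>0 = G2[THEN conjunct1] and \<Theta>B = Gt[THEN conjunct1]
    and \<Theta>p = Gt[THEN conjunct2, THEN conjunct1] and \<Theta>c = Gt[THEN conjunct2, THEN conjunct2, THEN mp]
    and \<Theta>h = G[THEN conjunct2, THEN conjunct2, rule_format, OF _ conjI]
  show ?thesis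
  proof (rule that[of \<Theta>])
    show "dmap M (Suc (b + n)) b ?ZE \<Theta>" by (rule \<Theta>d)
    show "\<Theta> (c @ y @ [t]) \<in> B \<and> p (\<Theta> (c @ y @ [t])) = H (y @ [t])"
      if "c \<in> B" "y \<in> Y" "p c = H (y @ [0])" "0 \<le> t" "t \<le> 1" for c y t
      using \<Theta>B[OF that] \<Theta>p[OF that] min1[OF that(2,5)] by simp
    show "\<Theta> (c @ y @ [0]) = c" if "c \<in> B" "y \<in> Y" "p c = H (y @ [0])" for c y
      by (rule \<Theta>0[OF that])
    show "\<Theta> (c @ y @ [t]) = c"
      if "c \<in> B" "y \<in> Y" "p c = H (y @ [0])" "0 \<le> t" "t \<le> 1"
        "\<forall>q. 0 \<le> q \<and> q \<le> 1 \<longrightarrow> H (y @ [q]) = H (y @ [0])" for c y t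
      by (rule \<Theta>c[OF that])
    show "homeomorphic_map (space_of {c \<in> B. p c = H (y @ [0])}) (space_of {c \<in> B. p c = H (y @ [t])})
         (\<lambda>c. \<Theta> (c @ y @ [t]))" if "y \<in> Y" "0 \<le> t" "t \<le> 1" for y t
      using \<Theta>h[OF that] unfolding min1[OF that(1,3)] .
  qed
qed

subsection \<open>Homotopies of bundle maps\<close>

lemma definable_homeomorphismI:
  fixes M :: "('f, 'r, 'a::real_closed_field) expansion"
  assumes f: "dmap M n m X f" "f \<in> X \<rightarrow> Y" and g: "dmap M m n Y g" "g \<in> Y \<rightarrow> X"
    and "\<And>x. x \<in> X \<Longrightarrow> g (f x) = x" "\<And>y. y \<in> Y \<Longrightarrow> f (g y) = y"
  shows "definable_homeomorphism M X Y f"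
  unfolding definable_homeomorphism_def
  using definable_map_iff_dmap[OF dmap_definable[OF f(1)] dmap_definable[OF g(1)]] f
    homeomorphic_map_space_ofI[OF f(2) g(2) dmap_cont[OF f(1)] dmap_cont[OF g(1)] assms(5,6)] by blast

lemma definable_map_compose:
  fixes M :: "('f, 'r, 'a::real_closed_field) expansion"
  assumes "definable_map M X Y f" "definable_map M Y Z g"
  shows "definable_map M X Z (g \<circ> f)"
proof -
  obtain n m k where d: "definable_in M n X" "definable_in M m Y" "definable_in M k Z"
    using assms unfolding definable_map_def definable_def by blast
  then show ?thesis
    using assms dmap_compose[of M n m X f k Y g]
    unfolding definable_map_iff_dmap[OF d(1,2)] definable_map_iff_dmap[OF d(2,3)] definable_map_iff_dmap[OF d(1,3)]
    by (auto simp: comp_def)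
qed

lemma definable_map_cong:
  fixes M :: "('f, 'r, 'a::real_closed_field) expansion"
  assumes "definable_map M X Y f" "\<And>x. x \<in> X \<Longrightarrow> f x = g x"
  shows "definable_map M X Y g"
proof -
  obtain n m where d: "definable_in M n X" "definable_in M m Y"
    using assms(1) unfolding definable_map_def definable_def by blast
  have f: "dmap M n m X f" "f \<in> X \<rightarrow> Y" using assms(1) unfolding definable_map_iff_dmap[OF d] by auto
  have "g \<in> X \<rightarrow> Y"
  proof
    fix x assume "x \<in> X"
    then show "g x \<in> Y" using Pi_mem[OF f(2)] assms(2) by metis
  qed
  then show ?thesis
    unfolding definable_map_iff_dmap[OF d] using dmap_cong[OF assms(2) f(1)] by blast
qed

lemma dmap_last: "definable_in M n A \<Longrightarrow> dmap M (Suc n) (Suc 0) (A \<otimes> unit_interval) (\<lambda>z. [z ! n])"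
proof (rule dmap_cong[where f="drop n"])
  assume A: "definable_in M n A"
  then have Z: "definable_in M (Suc n) (A \<otimes> unit_interval)"
    by (rule definable_product[OF _ definable_unit_interval]) simp
  then show "dmap M (Suc n) (Suc 0) (A \<otimes> unit_interval) (drop n)" by (rule dmap_drop) simp
  show "drop n z = [z ! n]" if "z \<in> A \<otimes> unit_interval" for z
    using definable_in_length[OF Z that] by (simp add: Cons_nth_drop_Suc[symmetric])
qed

lemma product_unit_intervalE:
  assumes "z \<in> A \<otimes> unit_interval" obtains c t where "z = c @ [t]" "c \<in> A" "0 \<le> t" "t \<le> 1"
  using assms by (auto simp: unit_interval_iff elim!: set_productE)

lemma product_unit_intervalI: "c \<in> A \<Longrightarrow> 0 \<le> t \<Longrightarrow> t \<le> 1 \<Longrightarrow> c @ [t] \<in> A \<otimes> unit_interval"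
  by (rule set_productI) (simp_all add: unit_interval_iff)

lemma reparametrization:
  fixes M :: "('f, 'r, 'a::real_closed_field) expansion"
  assumes A: "definable_in M n A" and \<sigma>: "dfun M (\<lambda>e. \<sigma> (e 0))" "K > 0"
    and lip: "\<And>s t \<delta>. \<delta> > 0 \<Longrightarrow> \<bar>s - t\<bar> < \<delta> \<Longrightarrow> \<bar>\<sigma> s - \<sigma> t\<bar> < K * \<delta>"
    and \<sigma>01: "\<And>t. 0 \<le> t \<Longrightarrow> t \<le> 1 \<Longrightarrow> 0 \<le> \<sigma> t \<and> \<sigma> t \<le> 1"
    and h: "dmap M (Suc n) m (A \<otimes> unit_interval) h"
  shows "dmap M (Suc n) m (A \<otimes> unit_interval) (\<lambda>z. h (take n z @ [\<sigma> (z ! n)]))"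
proof (rule dmap_compose[OF dmap_append[OF dmap_take] h])
  show Z: "definable_in M (Suc n) (A \<otimes> unit_interval)"
    by (rule definable_product[OF A definable_unit_interval]) simp
  show "dmap M (Suc n) (Suc 0) (A \<otimes> unit_interval) (\<lambda>z. [\<sigma> (z ! n)])"
    by (rule dmap_binop[where F="\<lambda>a _. \<sigma> a", OF dmap_last[OF A] dmap_last[OF A] \<sigma> lip])
  show "(\<lambda>z. take n z @ [\<sigma> (z ! n)]) \<in> A \<otimes> unit_interval \<rightarrow> A \<otimes> unit_interval"
  proof
    fix z assume "z \<in> A \<otimes> unit_interval"
    then obtain c t where z: "z = c @ [t]" "c \<in> A" "0 \<le> t" "t \<le> 1" by (rule product_unit_intervalE)
    then show "take n z @ [\<sigma> (z ! n)] \<in> A \<otimes> unit_interval"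
      using definable_in_length[OF A z(2)] \<sigma>01[OF z(3,4)] by (simp add: product_unit_intervalI nth_append)
  qed
qed simp_all

lemma dmap_slice:
  assumes "dmap M (Suc n) m (A \<otimes> unit_interval) h" "definable_in M n A" "0 \<le> t" "t \<le> 1"
  shows "dmap M n m A (\<lambda>c. h (c @ [t]))"
  by (rule dmap_compose[OF dmap_append[OF dmap_id[OF assms(2)] dmap_const[OF assms(2), of "[t]" "Suc 0"]] assms(1)])
    (use assms in \<open>auto intro: product_unit_intervalI\<close>)

lemma definable_bundle_mapI:
  assumes "dmap M a b A u" "u \<in> A \<rightarrow> B" "dmap M n m X v" "v \<in> X \<rightarrow> Y"
    and B: "definable_in M b B" and Y: "definable_in M m Y"
    and "\<And>c. c \<in> A \<Longrightarrow> q (u c) = v (p c)"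
    and "\<And>x. x \<in> X \<Longrightarrow> homeomorphic_map (space_of {c \<in> A. p c = x}) (space_of {c \<in> B. q c = v x}) u"
  shows "definable_bundle_map M (A, X, p, F) (B, Y, q, F) u"
  using definable_map_iff_dmap[OF dmap_definable[OF assms(1)] B, of u]
    definable_map_iff_dmap[OF dmap_definable[OF assms(3)] Y, of v] assms by auto

lemma definable_bundle_map_cong:
  fixes M :: "('f, 'r, 'a::real_closed_field) expansion"
  assumes "definable_bundle_map M (A, X, p, F) (B, Y, q, G) u" and eq: "\<And>c. c \<in> A \<Longrightarrow> u c = w c"
  shows "definable_bundle_map M (A, X, p, F) (B, Y, q, G) w"
proof -
  obtain v where v: "F = G" "definable_map M A B u" "definable_map M X Y v" "\<forall>b\<in>A. q (u b) = v (p b)"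
    "\<forall>x\<in>X. homeomorphic_map (space_of {b \<in> A. p b = x}) (space_of {b \<in> B. q b = v x}) u"
    using assms(1) by auto
  have "homeomorphic_map (space_of {b \<in> A. p b = x}) (space_of {b \<in> B. q b = v x}) w" if "x \<in> X" for x
    by (rule homeomorphic_map_eq[OF v(5)[rule_format, OF that]]) (use eq in \<open>simp add: topspace_space_of\<close>)
  then show ?thesis using v eq definable_map_cong[OF v(2) eq] by auto
qed

lemma definable_bundle_map_compose:
  fixes M :: "('f, 'r, 'a::real_closed_field) expansion"
  assumes u: "definable_bundle_map M (A, X, p, F) (B, Y, q, G) u"
    and w: "definable_bundle_map M (B, Y, q, G) (C, Z, r, H) w"
    and p: "p \<in> A \<rightarrow> X"
  shows "definable_bundle_map M (A, X, p, F) (C, Z, r, H) (w \<circ> u)"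
proof -
  obtain v where v: "F = G" "definable_map M A B u" "definable_map M X Y v" "\<forall>b\<in>A. q (u b) = v (p b)"
    "\<forall>x\<in>X. homeomorphic_map (space_of {b \<in> A. p b = x}) (space_of {b \<in> B. q b = v x}) u"
    using u by auto
  obtain v' where v': "G = H" "definable_map M B C w" "definable_map M Y Z v'" "\<forall>b\<in>B. r (w b) = v' (q b)"
    "\<forall>x\<in>Y. homeomorphic_map (space_of {b \<in> B. q b = x}) (space_of {b \<in> C. r b = v' x}) w"
    using w by auto
  have "v \<in> X \<rightarrow> Y" "u \<in> A \<rightarrow> B" using v(2,3) by (auto simp: definable_map_def)
  have "homeomorphic_map (space_of {b \<in> A. p b = x}) (space_of {b \<in> C. r b = (v' \<circ> v) x}) (w \<circ> u)"
    if x: "x \<in> X" for x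
  proof -
    have "v x \<in> Y" using \<open>v \<in> X \<rightarrow> Y\<close> x by blast
    then show ?thesis using homeomorphic_map_compose[OF v(5)[rule_format, OF x] v'(5)[rule_format]] by simp
  qed
  moreover have "r ((w \<circ> u) c) = (v' \<circ> v) (p c)" if "c \<in> A" for c
    using v(4) v'(4)[rule_format, OF Pi_mem[OF \<open>u \<in> A \<rightarrow> B\<close> that]] that by simp
  moreover have "definable_map M A C (w \<circ> u)" "definable_map M X Z (v' \<circ> v)"
    using definable_map_compose[OF v(2) v'(2)] definable_map_compose[OF v(3) v'(3)] by auto
  ultimately show ?thesis unfolding definable_bundle_map.simps using v(1) v'(1) by blast
qed

lemma definable_map_product_unit_interval:
  fixes M :: "('f, 'r, 'a::real_closed_field) expansion"
  assumes "definable_map M (A \<otimes> unit_interval) B h" and A: "definable_in M a A"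
  obtains b where "definable_in M b B" "dmap M (Suc a) b (A \<otimes> unit_interval) h" "h \<in> A \<otimes> unit_interval \<rightarrow> B"
proof -
  have Z: "definable_in M (Suc a) (A \<otimes> unit_interval)"
    by (rule definable_product[OF A definable_unit_interval]) simp
  obtain b where b: "definable_in M b B" using assms(1) unfolding definable_map_def definable_def by blast
  then show ?thesis using that definable_map_iff_dmap[OF Z b] assms(1) by blast
qed

lemma definable_map_product_iff:
  fixes M :: "('f, 'r, 'a::real_closed_field) expansion"
  assumes A: "definable_in M a A" and B: "definable_in M b B"
  shows "definable_map M (A \<otimes> unit_interval) B h \<longleftrightarrow>
    dmap M (Suc a) b (A \<otimes> unit_interval) h \<and> h \<in> A \<otimes> unit_interval \<rightarrow> B"
  by (rule definable_map_iff_dmap[OF definable_product[OF A definable_unit_interval] B]) simp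

text \<open>\<open>k\<close> is a homotopy of base maps covered by \<open>h\<close>. A homotopy of
  bundle maps asks for a base map at each \<open>t\<close> separately, and the slices of
  \<open>k\<close> provide them.\<close>

lemma bundle_map_homotopicI:
  assumes A: "definable_in M a A" and X: "definable_in M n X" and B: "definable_in M b B" and Y: "definable_in M m Y"
    and h: "dmap M (Suc a) b (A \<otimes> unit_interval) h" and k: "dmap M (Suc n) m (X \<otimes> unit_interval) k"
    and hB: "\<And>c t. c \<in> A \<Longrightarrow> 0 \<le> t \<Longrightarrow> t \<le> 1 \<Longrightarrow> h (c @ [t]) \<in> B \<and> q (h (c @ [t])) = k (p c @ [t])"
    and kY: "\<And>x t. x \<in> X \<Longrightarrow> 0 \<le> t \<Longrightarrow> t \<le> 1 \<Longrightarrow> k (x @ [t]) \<in> Y"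
    and hom: "\<And>x t. x \<in> X \<Longrightarrow> 0 \<le> t \<Longrightarrow> t \<le> 1 \<Longrightarrow>
      homeomorphic_map (space_of {c \<in> A. p c = x}) (space_of {c \<in> B. q c = k (x @ [t])}) (\<lambda>c. h (c @ [t]))"
    and ends: "\<And>c. c \<in> A \<Longrightarrow> h (c @ [0]) = u0 c \<and> h (c @ [1]) = u1 c"
  shows "bundle_map_homotopic M (A, X, p, F) (B, Y, q, F) u0 u1"
proof -
  have "definable_bundle_map M (A, X, p, F) (B, Y, q, F) (\<lambda>c. h (c @ [t]))" if t: "0 \<le> t" "t \<le> 1" for t
    by (rule definable_bundle_mapI[where v="\<lambda>x. k (x @ [t])", OF dmap_slice[OF h A t] _ dmap_slice[OF k X t] _ B Y])
      (use hB kY hom t in auto)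
  moreover have "definable_map M (A \<otimes> unit_interval) B h"
    unfolding definable_map_product_iff[OF A B] using h hB by (auto elim!: product_unit_intervalE)
  ultimately show ?thesis using ends unfolding bundle_map_homotopic.simps by blast
qed

lemma bundle_map_homotopic_sym:
  fixes M :: "('f, 'r, 'a::real_closed_field) expansion"
  assumes "bundle_map_homotopic M (A, X, p, F) (B, Y, q, G) u0 u1"
  shows "bundle_map_homotopic M (A, X, p, F) (B, Y, q, G) u1 u0"
proof -
  obtain h where h: "definable_map M (A \<otimes> unit_interval) B h"
    "\<And>t. 0 \<le> t \<Longrightarrow> t \<le> 1 \<Longrightarrow> definable_bundle_map M (A, X, p, F) (B, Y, q, G) (\<lambda>b. h (b @ [t]))"
    "\<And>b. b \<in> A \<Longrightarrow> h (b @ [0]) = u0 b \<and> h (b @ [1]) = u1 b"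
    using assms by auto
  have "definable M A" using h(2)[of 0] by (auto simp: definable_map_def)
  then obtain a where A: "definable_in M a A" by (auto simp: definable_def)
  obtain b where b: "definable_in M b B" "dmap M (Suc a) b (A \<otimes> unit_interval) h" "h \<in> A \<otimes> unit_interval \<rightarrow> B"
    by (rule definable_map_product_unit_interval[OF h(1) A])
  define k where "k z = h (take a z @ [1 - z ! a])" for z
  have k: "k (c @ [t]) = h (c @ [1 - t])" if "c \<in> A" for c t
    using definable_in_length[OF A that] by (simp add: k_def nth_append)
  have kd: "dmap M (Suc a) b (A \<otimes> unit_interval) k"
    unfolding k_def[abs_def]
  proof (rule reparametrization[where K=1 and \<sigma>="\<lambda>t. 1 - t", OF A _ _ _ _ b(2)])
    show "dfun M (\<lambda>e. 1 - e 0)" by (intro dintros)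
  qed (auto simp: abs_minus_commute)
  have "definable_map M (A \<otimes> unit_interval) B k"
    unfolding definable_map_product_iff[OF A b(1)]
    using kd b(3) k by (auto elim!: product_unit_intervalE intro!: product_unit_intervalI Pi_mem[OF b(3)])
  moreover have "definable_bundle_map M (A, X, p, F) (B, Y, q, G) (\<lambda>b. k (b @ [t]))" if "0 \<le> t" "t \<le> 1" for t
    by (rule definable_bundle_map_cong[OF h(2)[of "1 - t"]]) (use that k in auto)
  moreover have "k (c @ [0]) = u1 c \<and> k (c @ [1]) = u0 c" if "c \<in> A" for c
    using k[OF that] h(3)[OF that] by simp
  ultimately show ?thesis unfolding bundle_map_homotopic.simps by blast
qed

lemma bundle_map_homotopic_trans:
  fixes M :: "('f, 'r, 'a::real_closed_field) expansion"
  assumes "bundle_map_homotopic M (A, X, p, F) (B, Y, q, G) u0 u1"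
    and "bundle_map_homotopic M (A, X, p, F) (B, Y, q, G) u1 u2"
  shows "bundle_map_homotopic M (A, X, p, F) (B, Y, q, G) u0 u2"
proof -
  obtain h where h: "definable_map M (A \<otimes> unit_interval) B h"
    "\<And>t. 0 \<le> t \<Longrightarrow> t \<le> 1 \<Longrightarrow> definable_bundle_map M (A, X, p, F) (B, Y, q, G) (\<lambda>b. h (b @ [t]))"
    "\<And>b. b \<in> A \<Longrightarrow> h (b @ [0]) = u0 b \<and> h (b @ [1]) = u1 b"
    using assms(1) by auto
  obtain k where k: "definable_map M (A \<otimes> unit_interval) B k"
    "\<And>t. 0 \<le> t \<Longrightarrow> t \<le> 1 \<Longrightarrow> definable_bundle_map M (A, X, p, F) (B, Y, q, G) (\<lambda>b. k (b @ [t]))"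
    "\<And>b. b \<in> A \<Longrightarrow> k (b @ [0]) = u1 b \<and> k (b @ [1]) = u2 b"
    using assms(2) by auto
  have "definable M A" using h(2)[of 0] by (auto simp: definable_map_def)
  then obtain a where A: "definable_in M a A" by (auto simp: definable_def)
  have "definable M B" using h(1) by (auto simp: definable_map_def)
  then obtain b where B: "definable_in M b B" by (auto simp: definable_def)
  have hd: "dmap M (Suc a) b (A \<otimes> unit_interval) h" "h \<in> A \<otimes> unit_interval \<rightarrow> B"
    and kd: "dmap M (Suc a) b (A \<otimes> unit_interval) k" "k \<in> A \<otimes> unit_interval \<rightarrow> B"
    using h(1) k(1) unfolding definable_map_product_iff[OF A B] by auto
  have Z: "definable_in M (Suc a) (A \<otimes> unit_interval)"
    by (rule definable_product[OF A definable_unit_interval]) simp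
  \<comment> \<open>The speed is doubled, and the parameters are clamped to the unit interval so
    that \<open>h'\<close> and \<open>k'\<close> are definable maps on the whole cylinder; they are
    then restricted to the halves \<open>C\<close> and \<open>D\<close> and pasted.\<close>
  define h' where "h' z = h (take a z @ [min 1 (2 * z ! a)])" for z
  define k' where "k' z = k (take a z @ [max 0 (2 * z ! a - 1)])" for z
  have h'd: "dmap M (Suc a) b (A \<otimes> unit_interval) h'"
    unfolding h'_def[abs_def]
  proof (rule reparametrization[where K=2 and \<sigma>="\<lambda>t. min 1 (2 * t)", OF A _ _ _ _ hd(1)])
    show "dfun M (\<lambda>e. min 1 (2 * e 0))" by (intro dintros)
  qed (auto simp: min_def abs_less_iff)
  have k'd: "dmap M (Suc a) b (A \<otimes> unit_interval) k'"
    unfolding k'_def[abs_def]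
  proof (rule reparametrization[where K=2 and \<sigma>="\<lambda>t. max 0 (2 * t - 1)", OF A _ _ _ _ kd(1)])
    show "dfun M (\<lambda>e. max 0 (2 * e 0 - 1))" by (intro dintros)
  qed (auto simp: max_def abs_less_iff)
  define C where "C = {z \<in> A \<otimes> unit_interval. z ! a \<le> 1 / 2}"
  define D where "D = {z \<in> A \<otimes> unit_interval. 1 / 2 \<le> z ! a}"
  have half: "dmap M (Suc a) (Suc 0) (A \<otimes> unit_interval) (\<lambda>z. [1 / 2])" by (rule dmap_const[OF Z]) simp
  have CD: "definable_in M (Suc a) C" "definable_in M (Suc a) D"
    unfolding C_def D_def by (rule closed_le(1)[OF dmap_last[OF A] half], rule closed_le(1)[OF half dmap_last[OF A]])
  define l where "l z = (if z \<in> C then h' z else k' z)" for z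
  have nth_a: "(c @ [t]) ! a = t" "take a (c @ [t]) = c" if "c \<in> A" for c t
    using definable_in_length[OF A that] by (simp_all add: nth_append)
  have l1: "l (c @ [t]) = h (c @ [2 * t])" if "c \<in> A" "0 \<le> t" "t \<le> 1" "t \<le> 1 / 2" for c t
  proof -
    have "min 1 (2 * t) = 2 * t" using that(4) by (intro min.absorb2) simp
    then show ?thesis
      using nth_a[OF that(1), of t] product_unit_intervalI[OF that(1-3)] that(4) by (simp add: l_def C_def h'_def)
  qed
  have l2: "l (c @ [t]) = k (c @ [2 * t - 1])" if "c \<in> A" "0 \<le> t" "t \<le> 1" "\<not> t \<le> 1 / 2" for c t
  proof -
    have "max 0 (2 * t - 1) = 2 * t - 1" using that(4) by (intro max.absorb2) simp
    then show ?thesis using nth_a[OF that(1), of t] that(4) by (simp add: l_def C_def k'_def)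
  qed
  have ld: "dmap M (Suc a) b (A \<otimes> unit_interval) l"
    unfolding l_def[abs_def]
  proof (rule dmap_paste[OF dmap_subset[OF h'd CD(1)] dmap_subset[OF k'd CD(2)]])
    show "C \<subseteq> A \<otimes> unit_interval" "D \<subseteq> A \<otimes> unit_interval" "A \<otimes> unit_interval = C \<union> D"
      by (auto simp: C_def D_def)
    show "\<exists>\<delta>>0. \<forall>y\<in>A \<otimes> unit_interval. near \<delta> x y \<longrightarrow> y \<notin> C" if x: "x \<in> A \<otimes> unit_interval" "x \<notin> C" for x
    proof -
      have "\<not> x ! a \<le> 1 / 2" using x by (simp add: C_def)
      from closed_le(2)[OF dmap_last[OF A] half x(1) this] show ?thesis unfolding C_def by blast
    qed
    show "\<exists>\<delta>>0. \<forall>y\<in>A \<otimes> unit_interval. near \<delta> x y \<longrightarrow> y \<notin> D" if x: "x \<in> A \<otimes> unit_interval" "x \<notin> D" for x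
    proof -
      have "\<not> 1 / 2 \<le> x ! a" using x by (simp add: D_def)
      from closed_le(2)[OF half dmap_last[OF A] x(1) this] show ?thesis unfolding D_def by blast
    qed
    show "h' z = k' z" if z: "z \<in> C" "z \<in> D" for z
    proof -
      have "z \<in> A \<otimes> unit_interval" using z by (simp add: C_def)
      then obtain c t where ct: "z = c @ [t]" "c \<in> A" by (rule product_unit_intervalE)
      have "t = 1 / 2" using z nth_a[OF ct(2), of t] ct(1) by (auto simp: C_def D_def)
      then show ?thesis using ct nth_a[OF ct(2), of t] h(3)[OF ct(2)] k(3)[OF ct(2)] by (simp add: h'_def k'_def)
    qed
  qed
  have "l (c @ [t]) \<in> B" if "c \<in> A" "0 \<le> t" "t \<le> 1" for c t
  proof (cases "t \<le> 1 / 2")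
    case True
    then have "c @ [2 * t] \<in> A \<otimes> unit_interval" using that by (intro product_unit_intervalI) auto
    then show ?thesis using l1[OF that True] hd(2) by auto
  next
    case False
    then have "c @ [2 * t - 1] \<in> A \<otimes> unit_interval" using that by (intro product_unit_intervalI) auto
    then show ?thesis using l2[OF that False] kd(2) by auto
  qed
  then have "definable_map M (A \<otimes> unit_interval) B l"
    unfolding definable_map_product_iff[OF A B] using ld by (auto elim!: product_unit_intervalE)
  moreover have "definable_bundle_map M (A, X, p, F) (B, Y, q, G) (\<lambda>c. l (c @ [t]))" if t: "0 \<le> t" "t \<le> 1" for t
  proof (cases "t \<le> 1 / 2")
    case True
    then show ?thesis
      by (intro definable_bundle_map_cong[OF h(2)[of "2 * t"]]) (use t l1[OF _ t True] in auto)
  next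
    case False
    then show ?thesis
      by (intro definable_bundle_map_cong[OF k(2)[of "2 * t - 1"]]) (use t l2[OF _ t False] in auto)
  qed
  moreover have "l (c @ [0]) = u0 c \<and> l (c @ [1]) = u2 c" if "c \<in> A" for c
    using l1[OF that, of 0] l2[OF that, of 1] h(3)[OF that] k(3)[OF that] by simp
  ultimately show ?thesis unfolding bundle_map_homotopic.simps by blast
qed

lemma bundle_map_homotopic_post:
  fixes M :: "('f, 'r, 'a::real_closed_field) expansion"
  assumes "bundle_map_homotopic M (A, X, p, F) (B, Y, q, G) u0 u1"
    and w: "definable_bundle_map M (B, Y, q, G) (C, Z, r, H) w" and p: "p \<in> A \<rightarrow> X"
  shows "bundle_map_homotopic M (A, X, p, F) (C, Z, r, H) (w \<circ> u0) (w \<circ> u1)"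
proof -
  obtain h where h: "definable_map M (A \<otimes> unit_interval) B h"
    "\<And>t. 0 \<le> t \<Longrightarrow> t \<le> 1 \<Longrightarrow> definable_bundle_map M (A, X, p, F) (B, Y, q, G) (\<lambda>b. h (b @ [t]))"
    "\<And>b. b \<in> A \<Longrightarrow> h (b @ [0]) = u0 b \<and> h (b @ [1]) = u1 b"
    using assms(1) by auto
  have "definable_map M B C w" using w by auto
  then have "definable_map M (A \<otimes> unit_interval) C (w \<circ> h)" by (rule definable_map_compose[OF h(1)])
  moreover have "definable_bundle_map M (A, X, p, F) (C, Z, r, H) (\<lambda>b. (w \<circ> h) (b @ [t]))" if "0 \<le> t" "t \<le> 1" for t
    using definable_bundle_map_compose[OF h(2)[OF that] w p] by (simp add: comp_def)
  moreover have "(w \<circ> h) (c @ [0]) = (w \<circ> u0) c \<and> (w \<circ> h) (c @ [1]) = (w \<circ> u1) c" if "c \<in> A" for c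
    using h(3)[OF that] by simp
  ultimately show ?thesis unfolding bundle_map_homotopic.simps by blast
qed

lemma bundle_map_homotopic_pre:
  fixes M :: "('f, 'r, 'a::real_closed_field) expansion"
  assumes u: "definable_bundle_map M (A, X, p, F) (B, Y, q, G) u"
    and "bundle_map_homotopic M (B, Y, q, G) (C, Z, r, H) w0 w1" and p: "p \<in> A \<rightarrow> X"
  shows "bundle_map_homotopic M (A, X, p, F) (C, Z, r, H) (w0 \<circ> u) (w1 \<circ> u)"
proof -
  obtain h where h: "definable_map M (B \<otimes> unit_interval) C h"
    "\<And>t. 0 \<le> t \<Longrightarrow> t \<le> 1 \<Longrightarrow> definable_bundle_map M (B, Y, q, G) (C, Z, r, H) (\<lambda>b. h (b @ [t]))"
    "\<And>b. b \<in> B \<Longrightarrow> h (b @ [0]) = w0 b \<and> h (b @ [1]) = w1 b"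
    using assms(2) by auto
  have uAB: "definable_map M A B u" using u by auto
  then have uB: "u c \<in> B" if "c \<in> A" for c using that by (auto simp: definable_map_def)
  obtain a b where A: "definable_in M a A" and B: "definable_in M b B"
    using uAB unfolding definable_map_def definable_def by blast
  obtain k where k: "definable_in M k C" "dmap M (Suc b) k (B \<otimes> unit_interval) h" "h \<in> B \<otimes> unit_interval \<rightarrow> C"
    by (rule definable_map_product_unit_interval[OF h(1) B])
  have Z: "definable_in M (Suc a) (A \<otimes> unit_interval)"
    by (rule definable_product[OF A definable_unit_interval]) simp
  define h' where "h' z = h (u (take a z) @ [z ! a])" for z
  have h': "h' (c @ [t]) = h (u c @ [t])" if "c \<in> A" for c t
    using definable_in_length[OF A that] by (simp add: h'_def nth_append)
  have ud: "dmap M a b A u" using uAB definable_map_iff_dmap[OF A B] by blast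
  have "dmap M (Suc a) k (A \<otimes> unit_interval) h'"
    unfolding h'_def[abs_def]
  proof (rule dmap_compose[OF dmap_append[OF dmap_compose[OF dmap_take[OF Z] ud] dmap_last[OF A]] k(2)])
    show "take a \<in> A \<otimes> unit_interval \<rightarrow> A"
      using definable_in_length[OF A] by (auto elim!: product_unit_intervalE)
    show "(\<lambda>z. u (take a z) @ [z ! a]) \<in> A \<otimes> unit_interval \<rightarrow> B \<otimes> unit_interval"
      using definable_in_length[OF A] uB by (auto elim!: product_unit_intervalE intro!: product_unit_intervalI simp: nth_append)
  qed simp_all
  moreover have "h' \<in> A \<otimes> unit_interval \<rightarrow> C"
    using h' uB by (auto elim!: product_unit_intervalE intro!: product_unit_intervalI Pi_mem[OF k(3)])
  ultimately have "definable_map M (A \<otimes> unit_interval) C h'"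
    unfolding definable_map_product_iff[OF A k(1)] by blast
  moreover have "definable_bundle_map M (A, X, p, F) (C, Z, r, H) (\<lambda>b. h' (b @ [t]))" if "0 \<le> t" "t \<le> 1" for t
    by (rule definable_bundle_map_cong[OF definable_bundle_map_compose[OF u h(2)[OF that] p]]) (simp add: h')
  moreover have "h' (c @ [0]) = (w0 \<circ> u) c \<and> h' (c @ [1]) = (w1 \<circ> u) c" if "c \<in> A" for c
    using h'[OF that] h(3)[OF uB[OF that]] by simp
  ultimately show ?thesis unfolding bundle_map_homotopic.simps by blast
qed

subsection \<open>Induced bundles\<close>

lemma product_snd_pullback:
  assumes "definable_in M b B" "c @ x \<in> pullback f X B p" "length c = b"
  shows "product_snd B X (c @ x) = x"
proof -
  obtain c' x' where *: "c @ x = c' @ x'" "c' \<in> B" "x' \<in> X" using assms(2) by (rule pullbackE)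
  then have "x = x'" using definable_in_length[OF assms(1) *(2)] assms(3) by simp
  then show ?thesis
    using product_snd_append[of M B c' x' X] * assms(1) definable_iff[of M B b] by simp
qed

text \<open>\<open>product_snd\<close> is a definite description; on the pullback it agrees with
  \<open>drop b\<close>, from which definability and continuity are read off.\<close>

lemma product_snd_dmap:
  assumes B: "definable_in M b B" and X: "definable_in M n X" and A: "definable_in M (b + n) (pullback f X B p)"
  shows "dmap M (b + n) n (pullback f X B p) (product_snd B X)"
proof (rule dmap_cong[where f="drop b"])
  show "dmap M (b + n) n (pullback f X B p) (drop b)" by (rule dmap_drop[OF A]) simp
  show "drop b z = product_snd B X z" if z: "z \<in> pullback f X B p" for z
  proof -
    obtain c x where cx: "z = c @ x" "c \<in> B" using z by (rule pullbackE)
    then show ?thesis using product_snd_pullback[OF B] z definable_in_length[OF B cx(2)] by simp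
  qed
qed

lemma pullback_fibre:
  assumes B: "definable_in M b B" and "x \<in> X"
  shows "{a \<in> pullback f X B p. product_snd B X a = x} = {c @ x |c. c \<in> B \<and> p c = f x}"
proof (intro subset_antisym subsetI)
  fix a assume a: "a \<in> {a \<in> pullback f X B p. product_snd B X a = x}"
  then have "a \<in> pullback f X B p" by simp
  then obtain c x' where cx: "a = c @ x'" "c \<in> B" "x' \<in> X" "p c = f x'" by (rule pullbackE)
  then have "x' = x" using product_snd_pullback[OF B, of c x' f X p] a definable_in_length[OF B cx(2)] by simp
  then show "a \<in> {c @ x |c. c \<in> B \<and> p c = f x}" using cx by blast
next
  fix a assume "a \<in> {c @ x |c. c \<in> B \<and> p c = f x}"
  then obtain c where c: "a = c @ x" "c \<in> B" "p c = f x" by blast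
  then have "c @ x \<in> pullback f X B p" using assms(2) by (intro pullbackI)
  then show "a \<in> {a \<in> pullback f X B p. product_snd B X a = x}"
    using product_snd_pullback[OF B] definable_in_length[OF B c(2)] c(1) by simp
qed

lemma homeomorphic_map_pullback_fibre:
  fixes B X :: "'a::real_closed_field list set"
  assumes B: "definable_in M b B" and x: "x \<in> X"
  shows "homeomorphic_map (space_of {c \<in> B. p c = f x})
           (space_of {a \<in> pullback f X B p. product_snd B X a = x}) (\<lambda>c. c @ x)"
    and "homeomorphic_map (space_of {a \<in> pullback f X B p. product_snd B X a = x})
           (space_of {c \<in> B. p c = f x}) (take b)"
proof -
  have app: "cont {c \<in> B. p c = f x} (\<lambda>c. c @ x)" by (rule cont_append[OF cont_contraction cont_const])
  have tak: "cont Z (take b)" for Z :: "'a list set" by (rule cont_contraction) (rule near_take)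
  have len: "length c = b" if "c \<in> B" for c using definable_in_length[OF B that] .
  show "homeomorphic_map (space_of {c \<in> B. p c = f x})
           (space_of {a \<in> pullback f X B p. product_snd B X a = x}) (\<lambda>c. c @ x)"
    unfolding pullback_fibre[OF B x]
    by (rule homeomorphic_map_space_ofI[OF _ _ app tak]) (use len in auto)
  show "homeomorphic_map (space_of {a \<in> pullback f X B p. product_snd B X a = x})
           (space_of {c \<in> B. p c = f x}) (take b)"
    unfolding pullback_fibre[OF B x]
    by (rule homeomorphic_map_space_ofI[OF _ _ tak app]) (use len in auto)
qed

text \<open>Charts pull back: over the preimage \<open>V\<close> of a chart domain \<open>U\<close>,
  the pair of \<open>x\<close> and \<open>y\<close> goes to the point
  \<open>\<phi> (f x @ y)\<close> together with \<open>x\<close>. The inverse keeps \<open>x\<close>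
  and applies the fibre coordinate \<open>\<kappa>\<close>.\<close>

lemma definable_fibre_bundle_pullback:
  fixes M :: "('f, 'r, 'a::real_closed_field) expansion"
  assumes bun: "definable_fibre_bundle M (B, X', p, F)"
    and B: "definable_in M b B" and X': "definable_in M m X'" and X: "definable_in M n X"
    and f: "dmap M n m X f" "f \<in> X \<rightarrow> X'"
  shows "definable_fibre_bundle M (pullback f X B p, X, product_snd B X, F)"
proof -
  let ?A = "pullback f X B p" and ?q = "product_snd B X"
  note b = bun[unfolded definable_fibre_bundle.simps]
  note bun' = b[THEN conjunct2, THEN conjunct2, THEN conjunct1]
    b[THEN conjunct2, THEN conjunct2, THEN conjunct2, THEN conjunct1]
    b[THEN conjunct2, THEN conjunct2, THEN conjunct2, THEN conjunct2, THEN conjunct1]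
    b[THEN conjunct2, THEN conjunct2, THEN conjunct2, THEN conjunct2, THEN conjunct2]
  from bun'(4) obtain \<U> where fin: "finite \<U>" and cover: "\<Union>\<U> = X'" and
    charts': "\<forall>U\<in>\<U>. definable M U \<and> openin (space_of X') U \<and>
           (\<exists>\<phi>. definable_homeomorphism M (U \<otimes> F) {b \<in> B. p b \<in> U} \<phi> \<and>
              (\<forall>x\<in>U. \<forall>y\<in>F. p (\<phi> (x @ y)) = x))"
    by (elim exE conjE)
  note charts = charts'[THEN bspec]
  obtain k where F: "definable_in M k F" using bun'(1) by (auto simp: definable_def)
  have p: "dmap M b m B p"
    using bun'(2) definable_map_iff_dmap[OF B X'] by auto
  have A: "definable_in M (b + n) ?A" by (rule definable_pullback[OF B X p f(1)]) simp
  have q: "dmap M (b + n) n ?A ?q" by (rule product_snd_dmap[OF B X A])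
  have qA: "?q (c @ x) = x" if "c \<in> B" "x \<in> X" "p c = f x" for c x
    using product_snd_pullback[OF B pullbackI[where p=p and f=f, OF that]] definable_in_length[OF B that(1)] by simp
  have contf: "continuous_map (space_of X) (space_of X') f"
    unfolding continuous_map_space_of using f dmap_cont by blast
  have q_into: "?q \<in> ?A \<rightarrow> X" using qA by (auto elim!: pullbackE)
  moreover have "?q ` ?A = X"
  proof
    show "?q ` ?A \<subseteq> X" by (rule funcset_image[OF q_into])
    show "X \<subseteq> ?q ` ?A"
    proof
      fix x assume x: "x \<in> X"
      then have "f x \<in> p ` B" using Pi_mem[OF f(2)] bun'(3) by simp
      then obtain c where c: "c \<in> B" "p c = f x" by (metis imageE)
      show "x \<in> ?q ` ?A"
        by (rule image_eqI[where f="?q", OF qA[OF c(1) x c(2), symmetric] pullbackI[where p=p and f=f, OF c(1) x c(2)]])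
    qed
  qed
  moreover have "\<exists>\<V>. finite \<V> \<and> \<Union>\<V> = X \<and> (\<forall>V\<in>\<V>. definable M V \<and> openin (space_of X) V \<and>
      (\<exists>\<phi>. definable_homeomorphism M (V \<otimes> F) {a \<in> ?A. ?q a \<in> V} \<phi> \<and> (\<forall>x\<in>V. \<forall>y\<in>F. ?q (\<phi> (x @ y)) = x)))"
  proof (rule exI[of _ "(\<lambda>U. {x \<in> X. f x \<in> U}) ` \<U>"], intro conjI ballI)
    show "finite ((\<lambda>U. {x \<in> X. f x \<in> U}) ` \<U>)" using fin by simp
    show "\<Union>((\<lambda>U. {x \<in> X. f x \<in> U}) ` \<U>) = X" using cover f(2) by auto
  next
    fix V assume "V \<in> (\<lambda>U. {x \<in> X. f x \<in> U}) ` \<U>"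
    then obtain U where V: "V = {x \<in> X. f x \<in> U}" and U0: "U \<in> \<U>" by blast
    have U: "definable_in M m U"
      using charts[OF U0] definable_iff[of M U m] U0 cover definable_in_length[OF X'] by blast
    have Vd: "definable_in M n V" unfolding V by (rule definable_preimage[OF f(1) U])
    then show "definable M V" using definable_iff by blast
    show "openin (space_of X) V"
      using openin_continuous_map_preimage[OF contf, of U] charts[OF U0]
      unfolding V topspace_space_of by blast
    obtain \<phi> where \<phi>: "definable_homeomorphism M (U \<otimes> F) {c \<in> B. p c \<in> U} \<phi>"
      "\<And>x y. x \<in> U \<Longrightarrow> y \<in> F \<Longrightarrow> p (\<phi> (x @ y)) = x" using charts[OF U0] by blast
    obtain \<kappa> where \<kappa>: "dmap M b k {c \<in> B. p c \<in> U} \<kappa>" "dmap M (m + k) b (U \<otimes> F) \<phi>" "\<phi> \<in> U \<otimes> F \<rightarrow> {c \<in> B. p c \<in> U}"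
      "\<And>c. c \<in> B \<Longrightarrow> p c \<in> U \<Longrightarrow> \<kappa> c \<in> F \<and> \<phi> (p c @ \<kappa> c) = c"
      "\<And>x y. x \<in> U \<Longrightarrow> y \<in> F \<Longrightarrow> \<kappa> (\<phi> (x @ y)) = y"
      by (rule chart_coordinate[OF B U F p \<phi>(1)], rule \<phi>(2), assumption+, rule that)
    have VF: "definable_in M (n + k) (V \<otimes> F)" by (rule definable_product[OF Vd F]) simp
    have AV: "definable_in M (b + n) {a \<in> ?A. ?q a \<in> V}" by (rule definable_preimage[OF q Vd])
    have lenV: "length x = n" if "x \<in> V" for x using definable_in_length[OF Vd that] .
    define \<phi>' where "\<phi>' z = \<phi> (f (take n z) @ drop n z) @ take n z" for z
    define \<psi>' where "\<psi>' z = drop b z @ \<kappa> (take b z)" for z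
    have \<phi>': "\<phi>' (x @ y) = \<phi> (f x @ y) @ x" if "x \<in> V" for x y using lenV[OF that] by (simp add: \<phi>'_def)
    have \<psi>': "\<psi>' (c @ x) = x @ \<kappa> c" if "c \<in> B" for c x using definable_in_length[OF B that] by (simp add: \<psi>'_def)
    have \<phi>B: "\<phi> (f x @ y) \<in> B" "p (\<phi> (f x @ y)) = f x" "f x \<in> U" "x \<in> X" if "x \<in> V" "y \<in> F" for x y
      using Pi_mem[OF \<kappa>(3) set_productI[of "f x" U y F]] \<phi>(2)[of "f x" y] that by (auto simp: V)
    have AVE: "\<exists>c x. a = c @ x \<and> c \<in> B \<and> x \<in> V \<and> p c = f x" if "a \<in> {a \<in> ?A. ?q a \<in> V}" for a
    proof -
      have "a \<in> ?A" using that by simp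
      then obtain c x where cx: "a = c @ x" "c \<in> B" "x \<in> X" "p c = f x" by (rule pullbackE)
      then show ?thesis using qA[OF cx(2-4)] that by auto
    qed
    have AVI: "c @ x \<in> {a \<in> ?A. ?q a \<in> V}" if "c \<in> B" "x \<in> V" "p c = f x" for c x
      using pullbackI[of c B x X p f] qA[of c x] that by (auto simp: V)
    have "definable_homeomorphism M (V \<otimes> F) {a \<in> ?A. ?q a \<in> V} \<phi>'"
    proof (rule definable_homeomorphismI[where g=\<psi>'])
      have tV: "take n \<in> V \<otimes> F \<rightarrow> X" using lenV by (auto elim!: set_productE simp: V)
      show "dmap M (n + k) (b + n) (V \<otimes> F) \<phi>'"
        unfolding \<phi>'_def[abs_def]
      proof (rule dmap_append[OF dmap_compose[OF dmap_append[OF dmap_compose[OF dmap_take[OF VF] f(1) tV] dmap_drop[OF VF]] \<kappa>(2)] dmap_take[OF VF]])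
        show "(\<lambda>z. f (take n z) @ drop n z) \<in> V \<otimes> F \<rightarrow> U \<otimes> F"
          using lenV by (auto elim!: set_productE intro!: set_productI simp: V)
      qed simp_all
      show "\<phi>' \<in> V \<otimes> F \<rightarrow> {a \<in> ?A. ?q a \<in> V}"
      proof
        fix z assume "z \<in> V \<otimes> F"
        then obtain x y where z: "z = x @ y" "x \<in> V" "y \<in> F" by (rule set_productE)
        then show "\<phi>' z \<in> {a \<in> ?A. ?q a \<in> V}" using AVI[OF \<phi>B(1)[OF z(2,3)] z(2) \<phi>B(2)[OF z(2,3)]] \<phi>'[OF z(2)] by simp
      qed
      show "dmap M (b + n) (n + k) {a \<in> ?A. ?q a \<in> V} \<psi>'"
        unfolding \<psi>'_def[abs_def]
      proof (rule dmap_append[OF dmap_drop[OF AV] dmap_compose[OF dmap_take[OF AV] \<kappa>(1)]])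
        show "take b \<in> {a \<in> ?A. ?q a \<in> V} \<rightarrow> {c \<in> B. p c \<in> U}"
        proof
          fix a assume "a \<in> {a \<in> ?A. ?q a \<in> V}"
          then obtain c x where "a = c @ x" "c \<in> B" "x \<in> V" "p c = f x" using AVE by blast
          then show "take b a \<in> {c \<in> B. p c \<in> U}" using definable_in_length[OF B] by (simp add: V)
        qed
      qed simp_all
      show "\<psi>' \<in> {a \<in> ?A. ?q a \<in> V} \<rightarrow> V \<otimes> F"
      proof
        fix a assume "a \<in> {a \<in> ?A. ?q a \<in> V}"
        then obtain c x where a: "a = c @ x" "c \<in> B" "x \<in> V" "p c = f x" using AVE by blast
        then show "\<psi>' a \<in> V \<otimes> F" using \<psi>'[OF a(2)] \<kappa>(4)[OF a(2)] by (auto simp: V intro!: set_productI)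
      qed
      show "\<psi>' (\<phi>' z) = z" if z: "z \<in> V \<otimes> F" for z
      proof -
        obtain x y where z: "z = x @ y" "x \<in> V" "y \<in> F" using z by (rule set_productE)
        then show ?thesis using \<phi>'[OF z(2)] \<psi>'[OF \<phi>B(1)[OF z(2,3)]] \<kappa>(5)[OF \<phi>B(3)[OF z(2,3)] z(3)] by simp
      qed
      show "\<phi>' (\<psi>' a) = a" if a: "a \<in> {a \<in> ?A. ?q a \<in> V}" for a
      proof -
        obtain c x where a: "a = c @ x" "c \<in> B" "x \<in> V" "p c = f x" using AVE[OF a] by blast
        then show ?thesis using \<psi>'[OF a(2)] \<phi>'[OF a(3)] \<kappa>(4)[OF a(2)] by (auto simp: V)
      qed
    qed
    moreover have "?q (\<phi>' (x @ y)) = x" if "x \<in> V" "y \<in> F" for x y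
      using \<phi>'[OF that(1)] qA[OF \<phi>B(1,4,2)[OF that]] by simp
    ultimately show "\<exists>\<phi>. definable_homeomorphism M (V \<otimes> F) {a \<in> ?A. ?q a \<in> V} \<phi> \<and>
        (\<forall>x\<in>V. \<forall>y\<in>F. ?q (\<phi> (x @ y)) = x)" by blast
  qed
  moreover have "definable M ?A" "definable M X" using A X definable_iff by blast+
  moreover have "definable_map M ?A X ?q" using definable_map_iff_dmap[OF A X] q \<open>?q \<in> ?A \<rightarrow> X\<close> by blast
  ultimately show ?thesis using bun'(1) by simp
qed

lemma pullback_cong: "(\<And>x. x \<in> X \<Longrightarrow> f x = f' x) \<Longrightarrow> pullback f X B p = pullback f' X B p"
  by (auto elim!: pullbackE intro!: pullbackI)

theorem theorem2p18:
  fixes M :: "('f, 'r, 'a::real_closed_field) expansion"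
    and X X' B' F :: "'a list set"
    and f p :: "'a list \<Rightarrow> 'a list"
  assumes "o_minimal M"
    and "definable M X" and "definable M X'"
    and "definable_homotopy_equivalence M X X' f"
    and "definable_fibre_bundle M (B', X', p, F)"
    and "locally_definably_compact M F"
  shows "bundle_homotopy_equivalent M (induced_bundle f X (B', X', p, F)) (B', X', p, F)"
proof -
  note om = assms(1) and bun = assms(5)
  obtain n where X: "definable_in M n X" using assms(2) by (auto simp: definable_def)
  obtain m where X': "definable_in M m X'" using assms(3) by (auto simp: definable_def)
  have "definable M B'" "definable_map M B' X' p" using bun by auto
  then obtain b where B: "definable_in M b B'" by (auto simp: definable_def)
  have p: "dmap M b m B' p" "p \<in> B' \<rightarrow> X'"
    using \<open>definable_map M B' X' p\<close> definable_map_iff_dmap[OF B X'] by auto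
  obtain g K L where "definable_map M X X' f" "definable_map M X' X g"
    and "definable_map M (X \<otimes> unit_interval) X K" "\<forall>x\<in>X. K (x @ [0]) = (g \<circ> f) x \<and> K (x @ [1]) = id x"
    and "definable_map M (X' \<otimes> unit_interval) X' L" "\<forall>x\<in>X'. L (x @ [0]) = (f \<circ> g) x \<and> L (x @ [1]) = id x"
    using assms(4) unfolding definable_homotopy_equivalence_def definably_homotopic_def by blast
  then have f: "dmap M n m X f" "\<And>x. x \<in> X \<Longrightarrow> f x \<in> X'" and g: "dmap M m n X' g" "\<And>y. y \<in> X' \<Longrightarrow> g y \<in> X"
    and K: "dmap M (Suc n) n (X \<otimes> unit_interval) K" "K \<in> X \<otimes> unit_interval \<rightarrow> X"
    and K01: "\<And>x. x \<in> X \<Longrightarrow> K (x @ [0]) = g (f x)" "\<And>x. x \<in> X \<Longrightarrow> K (x @ [1]) = x"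
    and L: "dmap M (Suc m) m (X' \<otimes> unit_interval) L" "L \<in> X' \<otimes> unit_interval \<rightarrow> X'"
    and L01: "\<And>y. y \<in> X' \<Longrightarrow> L (y @ [0]) = f (g y)" "\<And>y. y \<in> X' \<Longrightarrow> L (y @ [1]) = y"
    using definable_map_iff_dmap[OF X X'] definable_map_iff_dmap[OF X' X]
      definable_map_product_iff[OF X X] definable_map_product_iff[OF X' X'] by auto
  have fXX': "f \<in> X \<rightarrow> X'" and gX'X: "g \<in> X' \<rightarrow> X" using f(2) g(2) by auto
  have KX: "K (x @ [t]) \<in> X" if "x \<in> X" "0 \<le> t" "t \<le> 1" for x t
    using Pi_mem[OF K(2) product_unit_intervalI[OF that]] .
  have LX': "L (y @ [t]) \<in> X'" if "y \<in> X'" "0 \<le> t" "t \<le> 1" for y t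
    using Pi_mem[OF L(2) product_unit_intervalI[OF that]] .
  have pX': "p c \<in> X'" if "c \<in> B'" for c using Pi_mem[OF p(2) that] .
  have lenX: "length x = n" if "x \<in> X" for x using definable_in_length[OF X that] .
  have lenX': "length y = m" if "y \<in> X'" for y using definable_in_length[OF X' that] .
  have lenB: "length c = b" if "c \<in> B'" for c using definable_in_length[OF B that] .
  define A where "A = pullback f X B' p"
  define q where "q = product_snd B' X"
  have A: "definable_in M (b + n) A" unfolding A_def by (rule definable_pullback[OF B X p(1) f(1)]) simp
  have qd: "dmap M (b + n) n A q" unfolding A_def q_def by (rule product_snd_dmap[OF B X A[unfolded A_def]])
  have AI: "c @ x \<in> A" if "c \<in> B'" "x \<in> X" "p c = f x" for c x
    unfolding A_def using that by (rule pullbackI)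
  have AE: "\<exists>c x. a = c @ x \<and> c \<in> B' \<and> x \<in> X \<and> p c = f x" if "a \<in> A" for a
    using that unfolding A_def by (rule pullbackE) blast
  have q: "q (c @ x) = x" if "c \<in> B'" "x \<in> X" "p c = f x" for c x
    unfolding q_def using product_snd_pullback[OF B AI[OF that, unfolded A_def] lenB[OF that(1)]] .
  have qX: "q \<in> A \<rightarrow> X" using AE q by fastforce
  note fibre = homeomorphic_map_pullback_fibre[OF B, where p=p and f=f and X=X, folded A_def q_def]

  \<comment> \<open>The paths in the base: \<open>J\<close> from \<open>f x\<close> back to
    \<open>f (g (f x))\<close>, and the retractions \<open>G\<close> of initial pieces of
    \<open>L\<close>\<close>
  define J where "J z = f (K (take n z @ [1 - z ! n]))" for z
  have Kr: "dmap M (Suc n) n (X \<otimes> unit_interval) (\<lambda>z. K (take n z @ [1 - z ! n]))"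
  proof (rule reparametrization[where K=1 and \<sigma>="\<lambda>t. 1 - t", OF X _ _ _ _ K(1)])
    show "dfun M (\<lambda>e. 1 - e 0)" by (intro dintros)
  qed (auto simp: abs_minus_commute)
  have Kr_eq: "K (take n (x @ [t]) @ [1 - (x @ [t]) ! n]) = K (x @ [1 - t])" if "x \<in> X" for x t
    using lenX[OF that] by (simp add: nth_append)
  have KrX: "(\<lambda>z. K (take n z @ [1 - z ! n])) \<in> X \<otimes> unit_interval \<rightarrow> X"
    using Kr_eq KX by (auto elim!: product_unit_intervalE)
  have J: "dmap M (Suc n) m (X \<otimes> unit_interval) J" "J \<in> X \<otimes> unit_interval \<rightarrow> X'"
    unfolding J_def[abs_def] using dmap_compose[OF Kr f(1) KrX] KrX f(2) by auto
  have J_eq: "J (x @ [t]) = f (K (x @ [1 - t]))" if "x \<in> X" for x t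
    unfolding J_def Kr_eq[OF that] ..
  have J0: "J (x @ [0]) = f x" "J (x @ [1]) = f (g (f x))" if "x \<in> X" for x
    using J_eq[OF that] K01 that by auto

  let ?I2 = "(X' \<otimes> unit_interval) \<otimes> unit_interval"
  \<comment> \<open>\<open>G\<close> retracts the path \<open>L (y, -)\<close> from the parameter \<open>s\<close> to \<open>0\<close>. It is constant for \<open>s = 0\<close>, where
    transport along it is the identity; this is what deforms \<open>v \<circ> u'\<close> to \<open>v''\<close> below.\<close>
  define G where "G z = L (take m z @ [max (z ! m - z ! Suc m) 0])" for z
  have XI: "definable_in M (Suc m) (X' \<otimes> unit_interval)"
    by (rule definable_product[OF X' definable_unit_interval]) simp
  have XII: "definable_in M (Suc (Suc m)) ?I2"
    by (rule definable_product[OF XI definable_unit_interval]) simp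
  have G_eq: "G (y @ [s, t]) = L (y @ [max (s - t) 0])" if "y \<in> X'" for y s t
    using lenX'[OF that] by (simp add: G_def nth_append)
  have I2E: "\<exists>y s t. z = y @ [s, t] \<and> y \<in> X' \<and> 0 \<le> s \<and> s \<le> 1 \<and> 0 \<le> t \<and> t \<le> 1" if z: "z \<in> ?I2" for z
  proof -
    obtain y' t where y': "z = y' @ [t]" "y' \<in> X' \<otimes> unit_interval" "0 \<le> t" "t \<le> 1"
      using z by (rule product_unit_intervalE)
    obtain y s where "y' = y @ [s]" "y \<in> X'" "0 \<le> s" "s \<le> 1" using y'(2) by (rule product_unit_intervalE)
    then show ?thesis using y' by simp
  qed
  have G: "dmap M (Suc (Suc m)) m ?I2 G" "G \<in> ?I2 \<rightarrow> X'"
  proof -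
    have s: "dmap M (Suc (Suc m)) (Suc 0) ?I2 (\<lambda>z. [z ! m])"
    proof (rule dmap_cong[OF _ dmap_compose[OF dmap_take[OF XII] dmap_last[OF X']]])
      show "[take (Suc m) z ! m] = [z ! m]" if "z \<in> ?I2" for z by simp
      show "take (Suc m) \<in> ?I2 \<rightarrow> X' \<otimes> unit_interval"
        using definable_in_length[OF XI] by (auto elim!: product_unit_intervalE[where A="X' \<otimes> unit_interval"])
    qed simp
    have "dmap M (Suc (Suc m)) (Suc 0) ?I2 (\<lambda>z. [max (z ! m - z ! Suc m) 0])"
    proof (rule dmap_binop[where F="\<lambda>s t. max (s - t) 0" and K=2, OF s dmap_last[OF XI]])
      show "dfun M (\<lambda>e. max (e 0 - e 1) 0)" by (intro dintros)
    qed (auto simp: max_def abs_less_iff)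
    then have "dmap M (Suc (Suc m)) (Suc m) ?I2 (\<lambda>z. take m z @ [max (z ! m - z ! Suc m) 0])"
      by (intro dmap_append[OF dmap_take[OF XII]]) auto
    then show "dmap M (Suc (Suc m)) m ?I2 G"
      unfolding G_def[abs_def]
    proof (rule dmap_compose[OF _ L(1)])
      show "(\<lambda>z. take m z @ [max (z ! m - z ! Suc m) 0]) \<in> ?I2 \<rightarrow> X' \<otimes> unit_interval"
      proof
        fix z assume "z \<in> ?I2"
        then obtain y s t where z: "z = y @ [s, t]" "y \<in> X'" "0 \<le> s" "s \<le> 1" "0 \<le> t" "t \<le> 1" using I2E by blast
        then show "take m z @ [max (z ! m - z ! Suc m) 0] \<in> X' \<otimes> unit_interval"
          using lenX'[OF z(2)] by (auto simp: nth_append intro!: product_unit_intervalI)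
      qed
    qed
    show "G \<in> ?I2 \<rightarrow> X'"
    proof
      fix z assume "z \<in> ?I2"
      then obtain y s t where z: "z = y @ [s, t]" "y \<in> X'" "0 \<le> s" "s \<le> 1" "0 \<le> t" "t \<le> 1" using I2E by blast
      then show "G z \<in> X'" using G_eq[OF z(2)] by (auto intro!: LX')
    qed
  qed

  \<comment> \<open>Transports: \<open>T1\<close> along \<open>L\<close>, \<open>T2\<close> along
    \<open>G\<close>, \<open>T3\<close> along \<open>J\<close>\<close>
  obtain T1 where
    T1d: "dmap M (Suc (b + m)) b (pullback (\<lambda>y. L (y @ [0])) X' B' p \<otimes> unit_interval) T1" and
    T1B: "\<And>c y t. c \<in> B' \<Longrightarrow> y \<in> X' \<Longrightarrow> p c = L (y @ [0]) \<Longrightarrow> 0 \<le> t \<Longrightarrow> t \<le> 1 \<Longrightarrow>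
       T1 (c @ y @ [t]) \<in> B' \<and> p (T1 (c @ y @ [t])) = L (y @ [t])" and
    T1_0: "\<And>c y. c \<in> B' \<Longrightarrow> y \<in> X' \<Longrightarrow> p c = L (y @ [0]) \<Longrightarrow> T1 (c @ y @ [0]) = c" and
    T1h: "\<And>y t. y \<in> X' \<Longrightarrow> 0 \<le> t \<Longrightarrow> t \<le> 1 \<Longrightarrow>
       homeomorphic_map (space_of {c \<in> B'. p c = L (y @ [0])}) (space_of {c \<in> B'. p c = L (y @ [t])})
         (\<lambda>c. T1 (c @ y @ [t]))"
    by (rule transport[OF om bun B X' X' L], rule that)
  obtain T2 where
    T2d: "dmap M (Suc (b + Suc m)) b (pullback (\<lambda>y. G (y @ [0])) (X' \<otimes> unit_interval) B' p \<otimes> unit_interval) T2" and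
    T2B': "\<And>c y t. c \<in> B' \<Longrightarrow> y \<in> X' \<otimes> unit_interval \<Longrightarrow> p c = G (y @ [0]) \<Longrightarrow> 0 \<le> t \<Longrightarrow> t \<le> 1 \<Longrightarrow>
       T2 (c @ y @ [t]) \<in> B' \<and> p (T2 (c @ y @ [t])) = G (y @ [t])" and
    T2_0': "\<And>c y. c \<in> B' \<Longrightarrow> y \<in> X' \<otimes> unit_interval \<Longrightarrow> p c = G (y @ [0]) \<Longrightarrow> T2 (c @ y @ [0]) = c" and
    T2c': "\<And>c y t. c \<in> B' \<Longrightarrow> y \<in> X' \<otimes> unit_interval \<Longrightarrow> p c = G (y @ [0]) \<Longrightarrow> 0 \<le> t \<Longrightarrow> t \<le> 1 \<Longrightarrow>
       \<forall>q. 0 \<le> q \<and> q \<le> 1 \<longrightarrow> G (y @ [q]) = G (y @ [0]) \<Longrightarrow> T2 (c @ y @ [t]) = c" and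
    T2h': "\<And>y t. y \<in> X' \<otimes> unit_interval \<Longrightarrow> 0 \<le> t \<Longrightarrow> t \<le> 1 \<Longrightarrow>
       homeomorphic_map (space_of {c \<in> B'. p c = G (y @ [0])}) (space_of {c \<in> B'. p c = G (y @ [t])})
         (\<lambda>c. T2 (c @ y @ [t]))"
    by (rule transport[OF om bun B X' XI G], rule that)
  obtain T3 where
    T3d': "dmap M (Suc (b + n)) b (pullback (\<lambda>y. J (y @ [0])) X B' p \<otimes> unit_interval) T3" and
    T3B': "\<And>c y t. c \<in> B' \<Longrightarrow> y \<in> X \<Longrightarrow> p c = J (y @ [0]) \<Longrightarrow> 0 \<le> t \<Longrightarrow> t \<le> 1 \<Longrightarrow>
       T3 (c @ y @ [t]) \<in> B' \<and> p (T3 (c @ y @ [t])) = J (y @ [t])" and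
    T3_0': "\<And>c y. c \<in> B' \<Longrightarrow> y \<in> X \<Longrightarrow> p c = J (y @ [0]) \<Longrightarrow> T3 (c @ y @ [0]) = c" and
    T3h': "\<And>y t. y \<in> X \<Longrightarrow> 0 \<le> t \<Longrightarrow> t \<le> 1 \<Longrightarrow>
       homeomorphic_map (space_of {c \<in> B'. p c = J (y @ [0])}) (space_of {c \<in> B'. p c = J (y @ [t])})
         (\<lambda>c. T3 (c @ y @ [t]))"
    by (rule transport[OF om bun B X' X J], rule that)

  have G0: "G (y @ [s, 0]) = L (y @ [s])" if "y \<in> X'" "0 \<le> s" for y s
    using G_eq[OF that(1)] that(2) by (simp add: max_def)
  have T2B: "T2 (c @ y @ [s, t]) \<in> B'" "p (T2 (c @ y @ [s, t])) = L (y @ [max (s - t) 0])"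
    if "c \<in> B'" "y \<in> X'" "p c = L (y @ [s])" "0 \<le> s" "s \<le> 1" "0 \<le> t" "t \<le> 1" for c y s t
    using T2B'[OF that(1) product_unit_intervalI[OF that(2,4,5)] _ that(6,7)] G0[OF that(2,4)] G_eq[OF that(2)] that(3)
    by simp_all
  have T2_0: "T2 (c @ y @ [s, 0]) = c" if "c \<in> B'" "y \<in> X'" "p c = L (y @ [s])" "0 \<le> s" "s \<le> 1" for c y s
    using T2_0'[OF that(1) product_unit_intervalI[OF that(2,4,5)]] G0[OF that(2,4)] that(3) by simp
  have T2c: "T2 (c @ y @ [0, t]) = c" if "c \<in> B'" "y \<in> X'" "p c = L (y @ [0])" "0 \<le> t" "t \<le> 1" for c y t
  proof -
    have "\<forall>u. 0 \<le> u \<and> u \<le> 1 \<longrightarrow> G ((y @ [0]) @ [u]) = G ((y @ [0]) @ [0])"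
      using G_eq[OF that(2)] by (simp add: max_def)
    from T2c'[OF that(1) product_unit_intervalI[OF that(2), of 0] _ that(4,5) this]
    show ?thesis using G0[OF that(2), of 0] that(3) by simp
  qed
  have T2h: "homeomorphic_map (space_of {c \<in> B'. p c = L (y @ [s])}) (space_of {c \<in> B'. p c = L (y @ [max (s - t) 0])})
         (\<lambda>c. T2 (c @ y @ [s, t]))" if "y \<in> X'" "0 \<le> s" "s \<le> 1" "0 \<le> t" "t \<le> 1" for y s t
    using T2h'[OF product_unit_intervalI[OF that(1-3)] that(4,5)] G0[OF that(1,2)] G_eq[OF that(1)] by simp
  have "pullback (\<lambda>y. J (y @ [0])) X B' p = A" unfolding A_def by (rule pullback_cong) (rule J0(1))
  with T3d' have T3d: "dmap M (Suc (b + n)) b (A \<otimes> unit_interval) T3" by simp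
  have T3B: "T3 (c @ x @ [t]) \<in> B'" "p (T3 (c @ x @ [t])) = f (K (x @ [1 - t]))"
    if "c \<in> B'" "x \<in> X" "p c = f x" "0 \<le> t" "t \<le> 1" for c x t
    using T3B'[OF that(1,2) _ that(4,5)] J_eq[OF that(2)] J0(1)[OF that(2)] that(3) by simp_all
  have T3_0: "T3 (c @ x @ [0]) = c" if "c \<in> B'" "x \<in> X" "p c = f x" for c x
    using T3_0'[OF that(1,2)] J0(1)[OF that(2)] that(3) by simp
  have T3h: "homeomorphic_map (space_of {c \<in> B'. p c = f x}) (space_of {c \<in> B'. p c = f (K (x @ [1 - t]))})
         (\<lambda>c. T3 (c @ x @ [t]))" if "x \<in> X" "0 \<le> t" "t \<le> 1" for x t
    using T3h'[OF that] J_eq[OF that(1)] J0(1)[OF that(1)] by simp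
  have z1: "(0::'a) \<le> 0" "(0::'a) \<le> 1" "(1::'a) \<le> 1" by auto
  have T31: "T3 (c @ x @ [1]) \<in> B'" "p (T3 (c @ x @ [1])) = L (f x @ [0])"
    if "c \<in> B'" "x \<in> X" "p c = f x" for c x
    using T3B[OF that z1(2,3)] K01(1)[OF that(2)] L01(1)[OF f(2)[OF that(2)]] by simp_all
  have T13: "T1 (T3 (c @ x @ [1]) @ f x @ [s]) \<in> B'" "p (T1 (T3 (c @ x @ [1]) @ f x @ [s])) = L (f x @ [s])"
    if "c \<in> B'" "x \<in> X" "p c = f x" "0 \<le> s" "s \<le> 1" for c x s
    using T1B[OF T31(1)[OF that(1-3)] f(2)[OF that(2)] T31(2)[OF that(1-3)] that(4,5)] by simp_all

  define u where "u = (take b :: 'a list \<Rightarrow> 'a list)"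
  \<comment> \<open>With both parameters of \<open>T2\<close> equal to 1 the path
    \<open>L (p c, -)\<close> is retracted completely, from \<open>p c\<close> to
    \<open>f (g (p c))\<close>; hence the result pairs with \<open>g (p c)\<close> to a point of the
    induced bundle.\<close>
  define v where "v c = T2 (c @ p c @ [1, 1]) @ g (p c)" for c
  define u' where "u' a = T1 (T3 (a @ [1]) @ f (drop b a) @ [1])" for a
  \<comment> \<open>Retracts the path only up to the time \<open>z ! b\<close>: nothing has moved at
    time 0, and at time 1 this is \<open>u \<circ> v\<close>.\<close>
  define h0 where "h0 z = T2 (take b z @ p (take b z) @ [1, z ! b])" for z
  \<comment> \<open>After transport along \<open>J\<close>, it goes forth along
    \<open>L (f x, -)\<close> up to time \<open>t\<close> and back again. The base component is
    \<open>g (f x)\<close> throughout; at \<open>t = 1\<close> this is \<open>v \<circ> u'\<close>,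
    and at \<open>t = 0\<close> only the transport along \<open>J\<close> is left.\<close>
  define h1 where "h1 z = T2 (T1 (T3 (take (b + n) z @ [1]) @ f (drop b (take (b + n) z)) @ [z ! (b + n)]) @
      f (drop b (take (b + n) z)) @ [z ! (b + n), 1]) @ g (f (drop b (take (b + n) z)))" for z
  \<comment> \<open>\<open>T3\<close> moves the point of \<open>B'\<close> over
    \<open>f (K (x, 1 - t))\<close>, so pairing it with \<open>K (x, 1 - t)\<close> stays in the
    induced bundle: here the homotopy \<open>K\<close> is lifted to \<open>A\<close>.\<close>
  define h2 where "h2 z = T3 z @ K (take n (drop b z) @ [1 - drop b z ! n])" for z

  have u: "u (c @ x) = c" if "c \<in> B'" for c x using lenB[OF that] by (simp add: u_def)
  have u': "u' (c @ x) = T1 (T3 (c @ x @ [1]) @ f x @ [1])" if "c \<in> B'" for c x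
    using lenB[OF that] by (simp add: u'_def)
  have h0: "h0 (c @ [t]) = T2 (c @ p c @ [1, t])" if "c \<in> B'" for c t
    using lenB[OF that] by (simp add: h0_def nth_append)
  have h1: "h1 (c @ x @ [t]) = T2 (T1 (T3 (c @ x @ [1]) @ f x @ [t]) @ f x @ [t, 1]) @ g (f x)"
    if "c \<in> B'" "x \<in> X" for c x t
    using lenB[OF that(1)] lenX[OF that(2)] by (simp add: h1_def nth_append)
  have h2: "h2 (c @ x @ [t]) = T3 (c @ x @ [t]) @ K (x @ [1 - t])" if "c \<in> B'" "x \<in> X" for c x t
    using lenB[OF that(1)] lenX[OF that(2)] by (simp add: h2_def nth_append)

  have T1I: "c @ y @ [t] \<in> pullback (\<lambda>y. L (y @ [0])) X' B' p \<otimes> unit_interval"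
    if "c \<in> B'" "y \<in> X'" "p c = L (y @ [0])" "0 \<le> t" "t \<le> 1" for c y t
    using product_unit_intervalI[OF pullbackI[where f="\<lambda>y. L (y @ [0])" and p=p, OF that(1-3)] that(4,5)] by simp
  have T2I: "c @ y @ [s, t] \<in> pullback (\<lambda>y. G (y @ [0])) (X' \<otimes> unit_interval) B' p \<otimes> unit_interval"
    if "c \<in> B'" "y \<in> X'" "p c = L (y @ [s])" "0 \<le> s" "s \<le> 1" "0 \<le> t" "t \<le> 1" for c y s t
    using product_unit_intervalI[OF pullbackI[where f="\<lambda>y. G (y @ [0])" and p=p, OF that(1)
        product_unit_intervalI[OF that(2,4,5)]] that(6,7)] G0[OF that(2,4)] that(3) by simp
  \<comment> \<open>The form in which \<open>c\<close> enters \<open>T2\<close>: it lies over the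
    end \<open>s = 1\<close> of the path \<open>L (p c, -)\<close>.\<close>
  have pL: "p c = L (p c @ [1])" if "c \<in> B'" for c using L01(2)[OF pX'[OF that]] by simp
  have BI: "definable_in M (Suc b) (B' \<otimes> unit_interval)"
    by (rule definable_product[OF B definable_unit_interval]) simp
  have AId: "definable_in M (Suc (b + n)) (A \<otimes> unit_interval)"
    by (rule definable_product[OF A definable_unit_interval]) simp
  have AIE: "\<exists>c x t. z = c @ x @ [t] \<and> c \<in> B' \<and> x \<in> X \<and> p c = f x \<and> 0 \<le> t \<and> t \<le> 1"
    if z: "z \<in> A \<otimes> unit_interval" for z
  proof -
    obtain a t where a: "z = a @ [t]" "a \<in> A" "0 \<le> t" "t \<le> 1" using z by (rule product_unit_intervalE)
    then show ?thesis using AE[OF a(2)] by auto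
  qed

  \<comment> \<open>Definability and continuity of the maps and homotopies\<close>
  have h0d: "dmap M (Suc b) b (B' \<otimes> unit_interval) h0"
    unfolding h0_def[abs_def]
  proof (rule dmap_compose[OF _ T2d])
    have tB: "take b \<in> B' \<otimes> unit_interval \<rightarrow> B'" using lenB by (auto elim!: product_unit_intervalE)
    have t: "dmap M (Suc b) b (B' \<otimes> unit_interval) (take b)" by (rule dmap_take[OF BI]) simp
    have "dmap M (Suc b) (Suc (Suc 0)) (B' \<otimes> unit_interval) (\<lambda>z. [1] @ [z ! b])"
      by (rule dmap_append[OF dmap_const[OF BI, where m="Suc 0"] dmap_last[OF B]]) simp_all
    from dmap_append[OF t dmap_append[OF dmap_compose[OF t p(1) tB] this refl] refl]
    show "dmap M (Suc b) (Suc (b + Suc m)) (B' \<otimes> unit_interval) (\<lambda>z. take b z @ p (take b z) @ [1, z ! b])"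
      by simp
    show "(\<lambda>z. take b z @ p (take b z) @ [1, z ! b]) \<in> B' \<otimes> unit_interval \<rightarrow>
        pullback (\<lambda>y. G (y @ [0])) (X' \<otimes> unit_interval) B' p \<otimes> unit_interval"
    proof
      fix z assume "z \<in> B' \<otimes> unit_interval"
      then obtain c t where z: "z = c @ [t]" "c \<in> B'" "0 \<le> t" "t \<le> 1" by (rule product_unit_intervalE)
      then show "take b z @ p (take b z) @ [1, z ! b] \<in> pullback (\<lambda>y. G (y @ [0])) (X' \<otimes> unit_interval) B' p \<otimes> unit_interval"
        using T2I[OF z(2) pX'[OF z(2)] pL[OF z(2)] z1(2,3) z(3,4)] lenB[OF z(2)] by (simp add: nth_append)
    qed
  qed
  have vd: "dmap M b (b + n) B' v"
  proof (rule dmap_cong[OF _ dmap_append[OF dmap_slice[OF h0d B z1(2,3)] dmap_compose[OF p(1) g(1) p(2)]]])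
    show "h0 (c @ [1]) @ g (p c) = v c" if "c \<in> B'" for c using h0[OF that] by (simp add: v_def)
  qed simp
  have T31d: "dmap M (b + n) b A (\<lambda>a. T3 (a @ [1]))" by (rule dmap_slice[OF T3d A z1(2,3)])
  have dXA: "drop b \<in> A \<rightarrow> X" using AE lenB by fastforce
  have fdd: "dmap M (b + n) m A (\<lambda>a. f (drop b a))"
    by (rule dmap_compose[OF dmap_drop[OF A] f(1) dXA]) simp
  have tA: "take (b + n) \<in> A \<otimes> unit_interval \<rightarrow> A"
    using definable_in_length[OF A] by (auto elim!: product_unit_intervalE)
  have tAd: "dmap M (Suc (b + n)) (b + n) (A \<otimes> unit_interval) (take (b + n))" by (rule dmap_take[OF AId]) simp
  define w where "w z = T1 (T3 (take (b + n) z @ [1]) @ f (drop b (take (b + n) z)) @ [z ! (b + n)])" for z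
  have w: "w (c @ x @ [t]) = T1 (T3 (c @ x @ [1]) @ f x @ [t])" if "c \<in> B'" "x \<in> X" for c x t
    using lenB[OF that(1)] lenX[OF that(2)] by (simp add: w_def nth_append)
  have wd: "dmap M (Suc (b + n)) b (A \<otimes> unit_interval) w"
    unfolding w_def[abs_def]
  proof (rule dmap_compose[OF dmap_append[OF dmap_compose[OF tAd T31d tA]
          dmap_append[OF dmap_compose[OF tAd fdd tA] dmap_last[OF A] refl]] T1d])
    show "(\<lambda>z. T3 (take (b + n) z @ [1]) @ f (drop b (take (b + n) z)) @ [z ! (b + n)]) \<in> A \<otimes> unit_interval \<rightarrow>
        pullback (\<lambda>y. L (y @ [0])) X' B' p \<otimes> unit_interval"
    proof
      fix z assume "z \<in> A \<otimes> unit_interval"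
      then obtain c x t where z: "z = c @ x @ [t]" "c \<in> B'" "x \<in> X" "p c = f x" "0 \<le> t" "t \<le> 1" using AIE by blast
      then show "T3 (take (b + n) z @ [1]) @ f (drop b (take (b + n) z)) @ [z ! (b + n)] \<in>
          pullback (\<lambda>y. L (y @ [0])) X' B' p \<otimes> unit_interval"
        using T1I[OF T31(1)[OF z(2-4)] f(2)[OF z(3)] T31(2)[OF z(2-4)] z(5,6)] lenB[OF z(2)] lenX[OF z(3)]
        by (simp add: nth_append)
    qed
  qed simp
  have h1d: "dmap M (Suc (b + n)) (b + n) (A \<otimes> unit_interval) h1"
  proof -
    let ?fx = "\<lambda>z. f (drop b (take (b + n) z))"
    have fx: "dmap M (Suc (b + n)) m (A \<otimes> unit_interval) ?fx" by (rule dmap_compose[OF tAd fdd tA])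
    have fxX': "?fx \<in> A \<otimes> unit_interval \<rightarrow> X'"
    proof
      fix z assume "z \<in> A \<otimes> unit_interval"
      then have "take (b + n) z \<in> A" using tA by blast
      then show "?fx z \<in> X'" using dXA f(2) by blast
    qed
    have "dmap M (Suc (b + n)) (Suc (Suc 0)) (A \<otimes> unit_interval) (\<lambda>z. [z ! (b + n)] @ [1])"
      by (rule dmap_append[OF dmap_last[OF A] dmap_const[OF AId, where m="Suc 0"]]) simp_all
    from dmap_append[OF wd dmap_append[OF fx this refl] refl]
    have "dmap M (Suc (b + n)) (Suc (b + Suc m)) (A \<otimes> unit_interval) (\<lambda>z. w z @ ?fx z @ [z ! (b + n), 1])" by simp
    then have "dmap M (Suc (b + n)) b (A \<otimes> unit_interval) (\<lambda>z. T2 (w z @ ?fx z @ [z ! (b + n), 1]))"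
    proof (rule dmap_compose[OF _ T2d])
      show "(\<lambda>z. w z @ ?fx z @ [z ! (b + n), 1]) \<in> A \<otimes> unit_interval \<rightarrow>
          pullback (\<lambda>y. G (y @ [0])) (X' \<otimes> unit_interval) B' p \<otimes> unit_interval"
      proof
        fix z assume "z \<in> A \<otimes> unit_interval"
        then obtain c x t where z: "z = c @ x @ [t]" "c \<in> B'" "x \<in> X" "p c = f x" "0 \<le> t" "t \<le> 1" using AIE by blast
        then show "w z @ ?fx z @ [z ! (b + n), 1] \<in> pullback (\<lambda>y. G (y @ [0])) (X' \<otimes> unit_interval) B' p \<otimes> unit_interval"
          using T2I[OF T13(1)[OF z(2-6)] f(2)[OF z(3)] T13(2)[OF z(2-6)] z(5,6) z1(2,3)] w[OF z(2,3)] lenB[OF z(2)] lenX[OF z(3)]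
          by (simp add: nth_append)
      qed
    qed
    from dmap_append[OF this dmap_compose[OF fx g(1) fxX'] refl] show ?thesis
      unfolding h1_def[abs_def] w_def .
  qed
  have h2d: "dmap M (Suc (b + n)) (b + n) (A \<otimes> unit_interval) h2"
    unfolding h2_def[abs_def]
  proof (rule dmap_append[OF T3d dmap_compose[OF dmap_drop[OF AId] Kr]])
    show "drop b \<in> A \<otimes> unit_interval \<rightarrow> X \<otimes> unit_interval"
    proof
      fix z assume "z \<in> A \<otimes> unit_interval"
      then obtain c x t where z: "z = c @ x @ [t]" "c \<in> B'" "x \<in> X" "p c = f x" "0 \<le> t" "t \<le> 1" using AIE by blast
      then show "drop b z \<in> X \<otimes> unit_interval" using lenB[OF z(2)] by (simp add: product_unit_intervalI)
    qed
  qed simp_all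
  have ud: "dmap M (b + n) b A u" unfolding u_def by (rule dmap_take[OF A]) simp
  have u'd: "dmap M (b + n) b A u'"
  proof (rule dmap_cong[OF _ dmap_slice[OF wd A z1(2,3)]])
    fix a assume "a \<in> A"
    then obtain c x where "a = c @ x" "c \<in> B'" "x \<in> X" using AE by blast
    then show "w (a @ [1]) = u' a" using w[of c x 1] u'[of c x] by simp
  qed

  have vB: "v c \<in> A \<and> q (v c) = g (p c)" if c: "c \<in> B'" for c
  proof -
    note T = T2B[OF c pX'[OF c] pL[OF c] z1(2,3) z1(2,3)]
    have "p (T2 (c @ p c @ [1, 1])) = f (g (p c))" using T(2) L01(1)[OF pX'[OF c]] by simp
    then show ?thesis using AI[OF T(1)] q[OF T(1)] g(2)[OF pX'[OF c]] by (simp add: v_def)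
  qed

  \<comment> \<open>The bundle maps \<open>u\<close>, \<open>v\<close> and \<open>u'\<close>\<close>
  have bu: "definable_bundle_map M (A, X, q, F) (B', X', p, F) u"
  proof (rule definable_bundle_mapI[where v=f, OF ud _ f(1) fXX' B X'])
    show "u \<in> A \<rightarrow> B'" using AE u by fastforce
    show "p (u a) = f (q a)" if "a \<in> A" for a using AE[OF that] u q by auto
    show "homeomorphic_map (space_of {a \<in> A. q a = x}) (space_of {c \<in> B'. p c = f x}) u" if "x \<in> X" for x
      unfolding u_def by (rule fibre(2)[OF that])
  qed
  have bv: "definable_bundle_map M (B', X', p, F) (A, X, q, F) v"
  proof (rule definable_bundle_mapI[where v=g, OF vd _ g(1) gX'X A X])
    show "v \<in> B' \<rightarrow> A" using vB by blast
    show "q (v c) = g (p c)" if "c \<in> B'" for c using vB[OF that] by blast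
    fix y assume y: "y \<in> X'"
    have "homeomorphic_map (space_of {c \<in> B'. p c = y}) (space_of {c \<in> B'. p c = f (g y)}) (\<lambda>c. T2 (c @ y @ [1, 1]))"
      using T2h[OF y z1(2,3,2,3)] L01[OF y] by simp
    from homeomorphic_map_compose[OF this fibre(1)[OF g(2)[OF y]]]
    show "homeomorphic_map (space_of {c \<in> B'. p c = y}) (space_of {a \<in> A. q a = g y}) v"
      by (rule homeomorphic_map_eq) (auto simp: topspace_space_of v_def)
  qed
  have bu': "definable_bundle_map M (A, X, q, F) (B', X', p, F) u'"
  proof (rule definable_bundle_mapI[where v=f, OF u'd _ f(1) fXX' B X'])
    have *: "u' a \<in> B' \<and> p (u' a) = f (q a)" if a: "a \<in> A" for a
    proof -
      obtain c x where cx: "a = c @ x" "c \<in> B'" "x \<in> X" "p c = f x" using AE[OF a] by blast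
      then show ?thesis using T13[OF cx(2-4) z1(2,3)] L01(2)[OF f(2)[OF cx(3)]] u'[OF cx(2)] q[OF cx(2-4)] by simp
    qed
    show "u' \<in> A \<rightarrow> B'" using * by blast
    show "p (u' a) = f (q a)" if "a \<in> A" for a using * that by blast
    fix x assume x: "x \<in> X"
    have 1: "homeomorphic_map (space_of {c \<in> B'. p c = f x}) (space_of {c \<in> B'. p c = L (f x @ [0])}) (\<lambda>c. T3 (c @ x @ [1]))"
      using T3h[OF x z1(2,3)] K01(1)[OF x] L01(1)[OF f(2)[OF x]] by simp
    have 2: "homeomorphic_map (space_of {c \<in> B'. p c = L (f x @ [0])}) (space_of {c \<in> B'. p c = f x}) (\<lambda>c. T1 (c @ f x @ [1]))"
      using T1h[OF f(2)[OF x] z1(2,3)] L01(2)[OF f(2)[OF x]] by simp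
    show "homeomorphic_map (space_of {a \<in> A. q a = x}) (space_of {c \<in> B'. p c = f x}) u'"
    proof (rule homeomorphic_map_eq[OF homeomorphic_map_compose[OF fibre(2)[OF x] homeomorphic_map_compose[OF 1 2]]])
      fix a assume "a \<in> topspace (space_of {a \<in> A. q a = x})"
      then have a: "a \<in> A" "q a = x" by (auto simp: topspace_space_of)
      obtain c x' where cx: "a = c @ x'" "c \<in> B'" "x' \<in> X" "p c = f x'" using AE[OF a(1)] by blast
      then show "((\<lambda>c. T1 (c @ f x @ [1])) \<circ> (\<lambda>c. T3 (c @ x @ [1])) \<circ> take b) a = u' a"
        using a(2) q[OF cx(2-4)] u'[OF cx(2)] lenB[OF cx(2)] by simp
    qed
  qed

  \<comment> \<open>The homotopies of bundle maps\<close>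
  have bh0: "bundle_map_homotopic M (B', X', p, F) (B', X', p, F) id (u \<circ> v)"
  proof (rule bundle_map_homotopicI[where k="\<lambda>z. L (take m z @ [1 - z ! m])", OF B X' B X' h0d])
    show "dmap M (Suc m) m (X' \<otimes> unit_interval) (\<lambda>z. L (take m z @ [1 - z ! m]))"
    proof (rule reparametrization[where K=1 and \<sigma>="\<lambda>t. 1 - t", OF X' _ _ _ _ L(1)])
      show "dfun M (\<lambda>e. 1 - e 0)" by (intro dintros)
    qed (auto simp: abs_minus_commute)
    have eq: "L (take m (y @ [t]) @ [1 - (y @ [t]) ! m]) = L (y @ [1 - t])" if "y \<in> X'" for y t
      using lenX'[OF that] by (simp add: nth_append)
    have m: "max (1 - t) 0 = 1 - t" if "t \<le> 1" for t :: 'a using that by (intro max.absorb1) simp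
    show "h0 (c @ [t]) \<in> B' \<and> p (h0 (c @ [t])) = L (take m (p c @ [t]) @ [1 - (p c @ [t]) ! m])"
      if "c \<in> B'" "0 \<le> t" "t \<le> 1" for c t
      using T2B[OF that(1) pX'[OF that(1)] pL[OF that(1)] z1(2,3) that(2,3)] h0[OF that(1)] m[OF that(3)]
      unfolding eq[OF pX'[OF that(1)]] by simp
    show "L (take m (y @ [t]) @ [1 - (y @ [t]) ! m]) \<in> X'" if "y \<in> X'" "0 \<le> t" "t \<le> 1" for y t
      unfolding eq[OF that(1)] by (rule LX') (use that in auto)
    show "homeomorphic_map (space_of {c \<in> B'. p c = y})
        (space_of {c \<in> B'. p c = L (take m (y @ [t]) @ [1 - (y @ [t]) ! m])}) (\<lambda>c. h0 (c @ [t]))"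
      if y: "y \<in> X'" "0 \<le> t" "t \<le> 1" for y t
    proof -
      have "homeomorphic_map (space_of {c \<in> B'. p c = y}) (space_of {c \<in> B'. p c = L (y @ [1 - t])})
          (\<lambda>c. T2 (c @ y @ [1, t]))"
        using T2h[OF y(1) z1(2,3) y(2,3)] L01(2)[OF y(1)] m[OF y(3)] by simp
      then show ?thesis
        unfolding eq[OF y(1)] by (rule homeomorphic_map_eq) (auto simp: topspace_space_of h0)
    qed
    show "h0 (c @ [0]) = id c \<and> h0 (c @ [1]) = (u \<circ> v) c" if "c \<in> B'" for c
      using h0[OF that] T2_0[OF that pX'[OF that] pL[OF that] z1(2,3)]
        u[OF T2B(1)[OF that pX'[OF that] pL[OF that] z1(2,3,2,3)]] by (simp add: v_def)
  qed

  \<comment> \<open>The intermediate map between the identity and \<open>v \<circ> u'\<close>: the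
    end of the lift \<open>h2\<close> of \<open>K\<close>, and the start of \<open>h1\<close>, where
    the excursion along \<open>L\<close> is trivial.\<close>
  define v'' where "v'' a = T3 (a @ [1]) @ g (f (drop b a))" for a
  have v'': "v'' (c @ x) = T3 (c @ x @ [1]) @ g (f x)" if "c \<in> B'" for c x
    using lenB[OF that] by (simp add: v''_def)
  have bh1: "bundle_map_homotopic M (A, X, q, F) (A, X, q, F) v'' (v \<circ> u')"
  proof (rule bundle_map_homotopicI[where k="\<lambda>z. g (f (take n z))", OF A X A X h1d])
    have XId: "definable_in M (Suc n) (X \<otimes> unit_interval)"
      by (rule definable_product[OF X definable_unit_interval]) simp
    have "take n \<in> X \<otimes> unit_interval \<rightarrow> X" using lenX by (auto elim!: product_unit_intervalE)
    then have ft: "dmap M (Suc n) m (X \<otimes> unit_interval) (\<lambda>z. f (take n z))" "(\<lambda>z. f (take n z)) \<in> X \<otimes> unit_interval \<rightarrow> X'"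
      using dmap_compose[OF dmap_take[OF XId] f(1)] f(2) by auto
    show "dmap M (Suc n) n (X \<otimes> unit_interval) (\<lambda>z. g (f (take n z)))" by (rule dmap_compose[OF ft(1) g(1) ft(2)])
    have eq: "g (f (take n (x @ [t]))) = g (f x)" if "x \<in> X" for x t using lenX[OF that] by simp
    have m: "max (t - 1) 0 = 0" if "t \<le> 1" for t :: 'a using that by (intro max.absorb2) simp
    have T: "T2 (T1 (T3 (c @ x @ [1]) @ f x @ [t]) @ f x @ [t, 1]) \<in> B'"
      "p (T2 (T1 (T3 (c @ x @ [1]) @ f x @ [t]) @ f x @ [t, 1])) = f (g (f x))"
      if "c \<in> B'" "x \<in> X" "p c = f x" "0 \<le> t" "t \<le> 1" for c x t
      using T2B[OF T13(1)[OF that] f(2)[OF that(2)] T13(2)[OF that] that(4,5) z1(2,3)] m[OF that(5)]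
        L01(1)[OF f(2)[OF that(2)]] by simp_all
    show "h1 (a @ [t]) \<in> A \<and> q (h1 (a @ [t])) = g (f (take n (q a @ [t])))"
      if a: "a \<in> A" and t: "0 \<le> t" "t \<le> 1" for a t
    proof -
      obtain c x where cx: "a = c @ x" "c \<in> B'" "x \<in> X" "p c = f x" using AE[OF a] by blast
      have gx: "g (f x) \<in> X" using f(2) g(2) cx(3) by blast
      show ?thesis
        using AI[OF T(1)[OF cx(2-4) t] gx T(2)[OF cx(2-4) t]] q[OF T(1)[OF cx(2-4) t] gx T(2)[OF cx(2-4) t]]
          h1[OF cx(2,3)] q[OF cx(2-4)] cx(1) lenX[OF cx(3)] by simp
    qed
    show "g (f (take n (x @ [t]))) \<in> X" if "x \<in> X" for x t unfolding eq[OF that] using f(2) g(2) that by blast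
    show "homeomorphic_map (space_of {a \<in> A. q a = x}) (space_of {a \<in> A. q a = g (f (take n (x @ [t])))}) (\<lambda>a. h1 (a @ [t]))"
      if x: "x \<in> X" and t: "0 \<le> t" "t \<le> 1" for x t
    proof -
      have 1: "homeomorphic_map (space_of {c \<in> B'. p c = f x}) (space_of {c \<in> B'. p c = L (f x @ [0])}) (\<lambda>c. T3 (c @ x @ [1]))"
        using T3h[OF x z1(2,3)] K01(1)[OF x] L01(1)[OF f(2)[OF x]] by simp
      have 3: "homeomorphic_map (space_of {c \<in> B'. p c = L (f x @ [t])}) (space_of {c \<in> B'. p c = f (g (f x))}) (\<lambda>c. T2 (c @ f x @ [t, 1]))"
        using T2h[OF f(2)[OF x] t z1(2,3)] m[OF t(2)] L01(1)[OF f(2)[OF x]] by simp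
      have gx: "g (f x) \<in> X" using f(2) g(2) x by blast
      show ?thesis
        unfolding eq[OF x]
      proof (rule homeomorphic_map_eq[OF homeomorphic_map_compose[OF homeomorphic_map_compose[OF fibre(2)[OF x] 1]
              homeomorphic_map_compose[OF homeomorphic_map_compose[OF T1h[OF f(2)[OF x] t] 3] fibre(1)[OF gx]]]])
        fix a assume "a \<in> topspace (space_of {a \<in> A. q a = x})"
        then have a: "a \<in> A" "q a = x" by (auto simp: topspace_space_of)
        obtain c x' where cx: "a = c @ x'" "c \<in> B'" "x' \<in> X" "p c = f x'" using AE[OF a(1)] by blast
        then show "((\<lambda>c. c @ g (f x)) \<circ> ((\<lambda>c. T2 (c @ f x @ [t, 1])) \<circ> (\<lambda>c. T1 (c @ f x @ [t]))) \<circ>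
            ((\<lambda>c. T3 (c @ x @ [1])) \<circ> take b)) a = h1 (a @ [t])"
          using a(2) q[OF cx(2-4)] h1[OF cx(2,3)] lenB[OF cx(2)] by simp
      qed
    qed
    show "h1 (a @ [0]) = v'' a \<and> h1 (a @ [1]) = (v \<circ> u') a" if a: "a \<in> A" for a
    proof -
      obtain c x where cx: "a = c @ x" "c \<in> B'" "x \<in> X" "p c = f x" using AE[OF a] by blast
      have "T1 (T3 (c @ x @ [1]) @ f x @ [0]) = T3 (c @ x @ [1])"
        by (rule T1_0[OF T31(1)[OF cx(2-4)] f(2)[OF cx(3)] T31(2)[OF cx(2-4)]])
      moreover have "T2 (T3 (c @ x @ [1]) @ f x @ [0, 1]) = T3 (c @ x @ [1])"
        by (rule T2c[OF T31(1)[OF cx(2-4)] f(2)[OF cx(3)] T31(2)[OF cx(2-4)] z1(2,3)])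
      moreover have "p (T1 (T3 (c @ x @ [1]) @ f x @ [1])) = f x"
        using T13(2)[OF cx(2-4) z1(2,3)] L01(2)[OF f(2)[OF cx(3)]] by simp
      ultimately show ?thesis
        using h1[OF cx(2,3)] v''[OF cx(2)] u'[OF cx(2)] cx(1) by (simp add: v_def)
    qed
  qed

  have bh2: "bundle_map_homotopic M (A, X, q, F) (A, X, q, F) id v''"
  proof (rule bundle_map_homotopicI[OF A X A X h2d Kr])
    show "h2 (a @ [t]) \<in> A \<and> q (h2 (a @ [t])) = K (take n (q a @ [t]) @ [1 - (q a @ [t]) ! n])"
      if a: "a \<in> A" and t: "0 \<le> t" "t \<le> 1" for a t
    proof -
      obtain c x where cx: "a = c @ x" "c \<in> B'" "x \<in> X" "p c = f x" using AE[OF a] by blast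
      have kx: "K (x @ [1 - t]) \<in> X" by (rule KX[OF cx(3)]) (use t in auto)
      show ?thesis
        using AI[OF T3B(1)[OF cx(2-4) t] kx T3B(2)[OF cx(2-4) t]] q[OF T3B(1)[OF cx(2-4) t] kx T3B(2)[OF cx(2-4) t]]
          h2[OF cx(2,3)] q[OF cx(2-4)] cx(1) Kr_eq[OF cx(3)] by simp
    qed
    show "K (take n (x @ [t]) @ [1 - (x @ [t]) ! n]) \<in> X" if "x \<in> X" "0 \<le> t" "t \<le> 1" for x t
      unfolding Kr_eq[OF that(1)] by (rule KX[OF that(1)]) (use that in auto)
    show "homeomorphic_map (space_of {a \<in> A. q a = x})
        (space_of {a \<in> A. q a = K (take n (x @ [t]) @ [1 - (x @ [t]) ! n])}) (\<lambda>a. h2 (a @ [t]))"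
      if x: "x \<in> X" and t: "0 \<le> t" "t \<le> 1" for x t
    proof -
      have kx: "K (x @ [1 - t]) \<in> X" by (rule KX[OF x]) (use t in auto)
      show ?thesis
        unfolding Kr_eq[OF x]
      proof (rule homeomorphic_map_eq[OF homeomorphic_map_compose[OF fibre(2)[OF x]
              homeomorphic_map_compose[OF T3h[OF x t] fibre(1)[OF kx]]]])
        fix a assume "a \<in> topspace (space_of {a \<in> A. q a = x})"
        then have a: "a \<in> A" "q a = x" by (auto simp: topspace_space_of)
        obtain c x' where cx: "a = c @ x'" "c \<in> B'" "x' \<in> X" "p c = f x'" using AE[OF a(1)] by blast
        then show "((\<lambda>c. c @ K (x @ [1 - t])) \<circ> (\<lambda>c. T3 (c @ x @ [t])) \<circ> take b) a = h2 (a @ [t])"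
          using a(2) q[OF cx(2-4)] h2[OF cx(2,3)] lenB[OF cx(2)] by simp
      qed
    qed
    show "h2 (a @ [0]) = id a \<and> h2 (a @ [1]) = v'' a" if a: "a \<in> A" for a
    proof -
      obtain c x where cx: "a = c @ x" "c \<in> B'" "x \<in> X" "p c = f x" using AE[OF a] by blast
      then show ?thesis using h2[OF cx(2,3)] v''[OF cx(2)] T3_0[OF cx(2-4)] K01[OF cx(3)] by simp
    qed
  qed

  \<comment> \<open>Formal cancellation of the one-sided inverses\<close>
  note trans = bundle_map_homotopic_trans and sym = bundle_map_homotopic_sym
  have vu': "bundle_map_homotopic M (A, X, q, F) (A, X, q, F) id (v \<circ> u')" by (rule trans[OF bh2 bh1])
  have 1: "bundle_map_homotopic M (A, X, q, F) (A, X, q, F) (v \<circ> u) ((v \<circ> u) \<circ> (v \<circ> u'))"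
    using bundle_map_homotopic_post[OF vu' definable_bundle_map_compose[OF bu bv qX] qX] by simp
  have 2: "bundle_map_homotopic M (A, X, q, F) (A, X, q, F) ((v \<circ> u) \<circ> (v \<circ> u')) (v \<circ> u')"
    using bundle_map_homotopic_post[OF bundle_map_homotopic_pre[OF bu' sym[OF bh0] qX] bv qX] by (simp add: comp_assoc)
  have vu: "bundle_map_homotopic M (A, X, q, F) (A, X, q, F) (v \<circ> u) id"
    by (rule trans[OF trans[OF 1 2] sym[OF vu']])
  have "definable_fibre_bundle M (A, X, q, F)"
    unfolding A_def q_def by (rule definable_fibre_bundle_pullback[OF bun B X' X f(1) fXX'])
  moreover have "induced_bundle f X (B', X', p, F) = (A, X, q, F)"
    by (simp add: A_def q_def pullback_def)
  ultimately show ?thesis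
    unfolding bundle_homotopy_equivalent_def using bun bu bv sym[OF bh0] vu by (simp only:) blast
qed

end
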